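(* Let $X=(X_t,\mathbb P_x)$ and $\hat X=(\hat X_t,\hat{\mathbb P}_x)$ be Hunt processes with common state space $(S,\mathcal B(S))$, where $S$ is a locally compact separable metric space, and let $m$ be a Radon measure on $(S,\mathcal B(S))$ such that the resolvent kernels $R_\lambda(x,\cdot)$ of $X$ and $\hat R_\lambda(x,\cdot)$ of $\hat X$ are absolutely continuous with respect to $m$ for all $\lambda>0$, $x\in S$, and $\int_S f\,R_\lambda g\,dm=\int_S \hat R_\lambda f\,g\,dm$ for all $\lambda>0$ and all measurable $f,g:S\to[0,\infty]$. Let $r_\lambda$ be the $\lambda$-resolvent density, and let $a\in S$ be a point such that $r_1(a,a)<\infty$ and $x\mapsto r_1(x,a)$ is continuous at $x=a$. Let $\alpha\in(0,1)$ and $\hat{\alpha}=1-\alpha$. Let $\ell:(0,\infty)\to(0,\infty)$ be slowly varying at $\infty$, and suppose $\varepsilon:(0,\infty)\to(0,1)$ satisfies $\varepsilon(t)\to 0$ and $\varepsilon(t)t\to\infty$ as $t\to\infty$. Let $\tau$ be the inverse local time of $X$ at $a$, and $G(t)$ the last visit time of $X$ to $a$ up to time $t$. Then the following statements hold. (1) Assume $r_\lambda(a,a)\sim \lambda^{-\alpha}/\ell(1/\lambda)$ as $\lambda\to0+$. Then $$\mathbb{P}_a\bigg(\frac{G(t)}{t}\leq \varepsilon(t)\bigg)\sim\frac{\sin(\pi\alpha)}{\pi\alpha}\,\frac{\ell(t)}{\ell(\varepsilon(t)t)}\,\varepsilon(t)^\alpha,\qquad t\to\infty.$$ Suppose additionally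 that $\tau$ (under $\mathbb{P}_a$) is special. Then $$\mathbb{P}_a\bigg(\frac{G(t)}{t}\geq 1-\varepsilon(t)\bigg)\sim\frac{\sin(\pi\hat{\alpha})}{\pi\hat{\alpha}}\,\frac{\ell(\varepsilon(t)t)}{\ell(t)}\,\varepsilon(t)^{\hat{\alpha}},\qquad t\to\infty.$$ (2) Assume $r_\lambda(a,a)\asymp \lambda^{-\alpha}/\ell(1/\lambda)$ as $\lambda\to0+$. Then $$\mathbb{P}_a\bigg(\frac{G(t)}{t}\leq \varepsilon(t)\bigg)\asymp\frac{\ell(t)}{\ell(\varepsilon(t)t)}\,\varepsilon(t)^\alpha,\qquad t\to\infty.$$ Suppose additionally that $\tau$ (under $\mathbb{P}_a$) is special. Then $$\mathbb{P}_a\bigg(\frac{G(t)}{t}\geq 1-\varepsilon(t)\bigg)\asymp\frac{\ell(\varepsilon(t)t)}{\ell(t)}\,\varepsilon(t)^{\hat{\alpha}},\qquad t\to\infty.$$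
   Context: Asymptotic notation: $f\sim g$ as $x\to a$ means $f(x)/g(x)\to1$. For non-negative $f,g$, $f\asymp g$ as $x\to a$ means that there are constants $0<C_1\le C_2<\infty$ with $C_1f\le g\le C_2f$ on some neighborhood of $a$. A positive measurable $\ell$ is slowly varying at $\infty$ if $\ell(\lambda x)/\ell(x)\to1$ as $x\to\infty$ for every $\lambda>0$. Setting: $S$ is a locally compact separable metric space with Borel $\sigma$-field $\mathcal B(S)$; $\partial$ is a cemetery point adjoined to $S$ (the point at infinity if $S$ is non-compact, an isolated point if $S$ is compact). $\mathcal B(S)_+$ is the set of measurable $f:S\to[0,\infty]$, with convention $f(\partial)=0$. (A1) $X=(X_t,\mathbb P_x)$ and $\hat X=(\hat X_t,\hat{\mathbb P}_x)$ are Hunt processes with common state space $(S,\mathcal B(S))$. Write $P_tf(x)=\mathbb E_xf(X_t)$, $\hat P_tf(x)=\hat{\mathbb E}_xf(\hat X_t)$, $R_\lambda f=\int_0^\infty e^{-\lambda t}P_tf\,dt$, $\hat R_\lambda f=\int_0^\infty e^{-\lambda t}\hat P_tf\,dt$ for $\lambda>0$, $f\in\mathcal B(S)_+$, and $P_t(x,\cdot)$, $R_\lambda(x,\cdot)$, etc. for the corresponding kernels. (A2) $m$ is a Radon measure on $(S,\mathcal B(S))$; the measures $R_\lambda(x,\cdot)$ and $\hat R_\lambda(x,\cdot)$ are absolutely continuous with respect to $m$ for all $\lambda>0$, $x\in S$; and $\int_S f\,R_\lambda g\,dm=\int_S \hat R_\lambda f\,g\,dm$ for all $\lambda>0$, $f,g\in\mathcal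 B(S)_+$. A function $f\in\mathcal B(S)_+$ is $\lambda$-excessive (resp. $\lambda$-coexcessive) if $\mu R_{\lambda+\mu}f\le f$ for all $\mu>0$ and $\mu R_{\lambda+\mu}f\uparrow f$ as $\mu\to\infty$ (resp. the same with $\hat R$). Under (A1), (A2) there is for each $\lambda>0$ a unique measurable $r_\lambda:S\times S\to[0,\infty]$, the $\lambda$-resolvent density, such that $x\mapsto r_\lambda(x,y)$ is $\lambda$-excessive for every $y$, $y\mapsto r_\lambda(x,y)$ is $\lambda$-coexcessive for every $x$, and $R_\lambda(x,dy)=r_\lambda(x,y)\,m(dy)$, $\hat R_\lambda(y,dx)=r_\lambda(x,y)\,m(dx)$. (A3) (for the point $a\in S$) $r_1(a,a)<\infty$ and $x\mapsto r_1(x,a)$ is continuous at $x=a$. Under (A1)–(A3) there is a local time $L=(L(t))_{t\ge0}$ of $X$ at $a$, i.e. a perfect positive continuous additive functional of $X$ with support $\operatorname{Supp}L=\{a\}$ (where $\operatorname{Supp}L=\{x:\mathbb P_x(\inf\{t:L(t)>0\}=0)=1\}$), unique up to a multiplicative constant; it is normalized so that $\mathbb E_x\int_0^\infty e^{-\lambda t}\,dL(t)=r_\lambda(x,a)$ for all $\lambda>0$, $x\in S$. The inverse local time is $\tau(s)=\inf\{t>0:L(t)>s\}$, $s\ge0$, with $\tau(s)=\infty$ if $s\ge L(\infty):=\lim_{t\to\infty}L(t)$. Under $\mathbb P_a$, $\tau$ is a (killed) subordinator; its Laplace exponent $\Phi$ is given by $\mathbb E_a e^{-\lambda\tau(s)}=e^{-\Phi(\lambda)s}$.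 The last visit time is $$G(t)=\sup\{\tau(s):s\ge0,\ \tau(s)\le t\}=\sup\{0\le s\le t: X_s=a\},\quad t\ge0,\ \mathbb P_a\text{-a.s.}$$ Special: a Bernstein function is an infinitely differentiable $\Phi:(0,\infty)\to[0,\infty)$ with $(-d/d\lambda)^n\Phi(\lambda)\le0$ for all integers $n\ge1$, $\lambda>0$; a Bernstein function $\Phi\neq0$ is special if $\lambda/\Phi(\lambda)$ is also a Bernstein function; a subordinator is special if its Laplace exponent is. *)

theory Defs
  imports "HOL-Probability.Probability" "HOL-Library.Landau_Symbols"
begin

section \<open>Hunt processes\<close>

text \<open>The state space is the type \<open>'s\<close>, and \<open>'s option\<close> is the state space with the cemetery
  \<^term>\<open>None\<close> adjoined.  \<^const>\<open>Alexandroff_compactification\<close> makes \<^term>\<open>None\<close> the point at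
  infinity if \<open>'s\<close> is non-compact and an isolated point if \<open>'s\<close> is compact.\<close>

abbreviation ext_top :: "'s::metric_space option topology" where
  "ext_top \<equiv> Alexandroff_compactification euclidean"

definition ext_borel :: "'s::metric_space option measure" where
  "ext_borel = sigma UNIV {U. openin ext_top U}"

text \<open>Of \<open>sample\<close> only the sample space and its \<open>\<sigma>\<close>-field matter.  Time runs through \<open>[0,\<infinity>]\<close>;
  at time \<open>\<infinity>\<close> the process sits in the cemetery.\<close>

record ('w, 's) process =
  sample :: "'w measure"
  coord :: "ennreal \<Rightarrow> 'w \<Rightarrow> 's option"
  shift :: "ennreal \<Rightarrow> 'w \<Rightarrow> 'w"
  law :: "'s option \<Rightarrow> 'w measure"

abbreviation Omega :: "('w, 's) process \<Rightarrow> 'w set" where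
  "Omega X \<equiv> space (sample X)"

definition lifetime :: "('w, 's) process \<Rightarrow> 'w \<Rightarrow> ennreal" where
  "lifetime X \<omega> = Inf {t. coord X t \<omega> = None}"

definition raw_filtration :: "('w, 's::metric_space) process \<Rightarrow> ennreal \<Rightarrow> 'w measure" where
  "raw_filtration X t =
     sigma (Omega X) {coord X s -` E \<inter> Omega X | s E. s \<le> t \<and> E \<in> sets ext_borel}"

text \<open>The completion of \<open>\<P>\<^sub>\<mu> = \<integral> \<P>\<^sub>x(\<cdot>) \<mu>(dx)\<close> on \<open>\<sigma>(X\<^sub>s : s \<ge> 0)\<close>.\<close>

definition init_law :: "('w, 's::metric_space) process \<Rightarrow> 's option measure \<Rightarrow> 'w measure" where
  "init_law X \<mu> = completion (measure_of (Omega X) (sets (raw_filtration X \<infinity>))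
     (\<lambda>A. \<integral>\<^sup>+ x. emeasure (law X x) A \<partial>\<mu>))"

definition pt_law :: "('w, 's::metric_space) process \<Rightarrow> 's \<Rightarrow> 'w measure" where
  "pt_law X x = init_law X (return ext_borel (Some x))"

text \<open>The minimal completed admissible filtration: \<open>\<F>\<^sub>t\<close> is the intersection over all initial
  laws \<open>\<mu>\<close> of the \<open>\<sigma>\<close>-fields generated by \<open>\<sigma>(X\<^sub>s : s \<le> t)\<close> and the \<open>\<P>\<^sub>\<mu>\<close>-null sets.\<close>

definition aug_filtration :: "('w, 's::metric_space) process \<Rightarrow> ennreal \<Rightarrow> 'w measure" where
  "aug_filtration X t = sigma (Omega X)
     (\<Inter>\<mu>\<in>space (prob_algebra ext_borel).
        sigma_sets (Omega X) (sets (raw_filtration X t) \<union> null_sets (init_law X \<mu>)))"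

text \<open>The simple Markov property is the case of a constant stopping time in \<open>strong_markov\<close>.\<close>

definition strong_markov :: "('w, 's::metric_space) process \<Rightarrow> bool" where
  "strong_markov X \<longleftrightarrow>
     (\<forall>\<mu>\<in>space (prob_algebra ext_borel). \<forall>\<sigma>. stopping_time (aug_filtration X) \<sigma> \<longrightarrow>
       (\<forall>s. \<forall>E\<in>sets ext_borel. AE \<omega> in init_law X \<mu>.
          real_cond_exp (init_law X \<mu>) (filtration.pre_sigma (Omega X) (aug_filtration X) \<sigma>)
            (indicator {\<omega>' \<in> Omega X. coord X (\<sigma> \<omega>' + s) \<omega>' \<in> E}) \<omega>
          = measure (law X (coord X (\<sigma> \<omega>) \<omega>)) {\<omega>' \<in> Omega X. coord X s \<omega>' \<in> E}))"

definition quasi_left_continuous :: "('w, 's::metric_space) process \<Rightarrow> bool" where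
  "quasi_left_continuous X \<longleftrightarrow>
     (\<forall>\<mu>\<in>space (prob_algebra ext_borel). \<forall>\<sigma> :: nat \<Rightarrow> 'w \<Rightarrow> ennreal.
       (\<forall>n. stopping_time (aug_filtration X) (\<sigma> n)) \<longrightarrow>
       (\<forall>\<omega>\<in>Omega X. incseq (\<lambda>n. \<sigma> n \<omega>)) \<longrightarrow>
       (AE \<omega> in init_law X \<mu>. (SUP n. \<sigma> n \<omega>) < \<infinity> \<longrightarrow>
          limitin ext_top (\<lambda>n. coord X (\<sigma> n \<omega>) \<omega>) (coord X (SUP n. \<sigma> n \<omega>) \<omega>) sequentially))"

definition hunt_process :: "('w, 's::metric_space) process \<Rightarrow> bool" where
  "hunt_process X \<longleftrightarrow>
     (\<forall>x. prob_space (law X x) \<and> sets (law X x) = sets (sample X)) \<and>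
     (\<forall>t. coord X t \<in> measurable (sample X) ext_borel) \<and>
     (\<forall>t. \<forall>E\<in>sets ext_borel.
        (\<lambda>x. emeasure (law X x) {\<omega> \<in> Omega X. coord X t \<omega> \<in> E}) \<in> borel_measurable ext_borel) \<and>
     (\<forall>x. AE \<omega> in law X x. coord X 0 \<omega> = x) \<and>
     (\<forall>t. AE \<omega> in law X None. coord X t \<omega> = None) \<and>
     (\<forall>\<omega>\<in>Omega X.
        coord X \<infinity> \<omega> = None \<and>
        (\<forall>t\<ge>lifetime X \<omega>. coord X t \<omega> = None) \<and>
        (\<forall>t<\<infinity>. shift X t \<omega> \<in> Omega X \<and> (\<forall>s. coord X s (shift X t \<omega>) = coord X (s + t) \<omega>)) \<and>
        (\<forall>t<\<infinity>. limitin ext_top (\<lambda>s. coord X s \<omega>) (coord X t \<omega>) (at_right t)) \<and>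
        (\<forall>t. 0 < t \<and> t < \<infinity> \<longrightarrow> (\<exists>y. limitin ext_top (\<lambda>s. coord X s \<omega>) y (at_left t)))) \<and>
     (\<forall>t<\<infinity>. sets (aug_filtration X t) = (\<Inter>s\<in>{t<..}. sets (aug_filtration X s))) \<and>
     strong_markov X \<and> quasi_left_continuous X"


section \<open>Resolvents and duality\<close>

definition semigroup_op ::
    "('w, 's::metric_space) process \<Rightarrow> real \<Rightarrow> ('s \<Rightarrow> ennreal) \<Rightarrow> 's \<Rightarrow> ennreal" where
  "semigroup_op X t f x = (\<integral>\<^sup>+ \<omega>. case_option 0 f (coord X (ennreal t) \<omega>) \<partial>law X (Some x))"

definition resolvent ::
    "('w, 's::metric_space) process \<Rightarrow> real \<Rightarrow> ('s \<Rightarrow> ennreal) \<Rightarrow> 's \<Rightarrow> ennreal" where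
  "resolvent X l f x = (\<integral>\<^sup>+ t\<in>{0..}. ennreal (exp (- l * t)) * semigroup_op X t f x \<partial>lborel)"

definition resolvent_kernel ::
    "('w, 's::metric_space) process \<Rightarrow> real \<Rightarrow> 's \<Rightarrow> 's measure" where
  "resolvent_kernel X l x = measure_of UNIV (sets borel) (\<lambda>A. resolvent X l (indicator A) x)"

definition radon_measure :: "'s::topological_space measure \<Rightarrow> bool" where
  "radon_measure m \<longleftrightarrow> sets m = sets borel \<and> (\<forall>K. compact K \<longrightarrow> emeasure m K < \<infinity>) \<and>
     (\<forall>A\<in>sets borel. emeasure m A = (SUP K\<in>{K. compact K \<and> K \<subseteq> A}. emeasure m K))"

definition dual_processes ::
    "('w, 's::metric_space) process \<Rightarrow> ('v, 's) process \<Rightarrow> 's measure \<Rightarrow> bool" where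
  "dual_processes X Xh m \<longleftrightarrow>
     (\<forall>l>0. \<forall>x. absolutely_continuous m (resolvent_kernel X l x) \<and>
                 absolutely_continuous m (resolvent_kernel Xh l x)) \<and>
     (\<forall>l>0. \<forall>f\<in>borel_measurable borel. \<forall>g\<in>borel_measurable borel.
        (\<integral>\<^sup>+ x. f x * resolvent X l g x \<partial>m) = (\<integral>\<^sup>+ x. resolvent Xh l f x * g x \<partial>m))"

text \<open>Coexcessive for \<open>X\<close> means excessive for the dual process.\<close>

definition excessive :: "('w, 's::metric_space) process \<Rightarrow> real \<Rightarrow> ('s \<Rightarrow> ennreal) \<Rightarrow> bool" where
  "excessive X l f \<longleftrightarrow> f \<in> borel_measurable borel \<and>
     (\<forall>x. (\<forall>u>0. ennreal u * resolvent X (l + u) f x \<le> f x) \<and>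
          mono_on {0<..} (\<lambda>u. ennreal u * resolvent X (l + u) f x) \<and>
          ((\<lambda>u. ennreal u * resolvent X (l + u) f x) \<longlongrightarrow> f x) at_top)"

definition resolvent_density :: "('w, 's::metric_space) process \<Rightarrow> ('v, 's) process \<Rightarrow>
    's measure \<Rightarrow> real \<Rightarrow> ('s \<Rightarrow> 's \<Rightarrow> ennreal) \<Rightarrow> bool" where
  "resolvent_density X Xh m l q \<longleftrightarrow>
     (\<lambda>(x, y). q x y) \<in> borel_measurable (borel \<Otimes>\<^sub>M borel) \<and>
     (\<forall>y. excessive X l (\<lambda>x. q x y)) \<and>
     (\<forall>x. excessive Xh l (\<lambda>y. q x y)) \<and>
     (\<forall>x. resolvent_kernel X l x = density m (\<lambda>y. q x y)) \<and>
     (\<forall>y. resolvent_kernel Xh l y = density m (\<lambda>x. q x y))"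


section \<open>Local time\<close>

text \<open>In a perfect additive functional the exceptional set does not depend on the two times in
  the additivity relation.\<close>

definition perfect_pcaf :: "('w, 's::metric_space) process \<Rightarrow> (real \<Rightarrow> 'w \<Rightarrow> real) \<Rightarrow> bool" where
  "perfect_pcaf X L \<longleftrightarrow>
     (\<forall>t\<ge>0. L t \<in> borel_measurable (aug_filtration X (ennreal t))) \<and>
     (\<exists>\<Lambda>\<in>sets (aug_filtration X \<infinity>). (\<forall>x. emeasure (pt_law X x) \<Lambda> = 1) \<and>
       (\<forall>\<omega>\<in>\<Lambda>. L 0 \<omega> = 0 \<and> mono_on {0..} (\<lambda>t. L t \<omega>) \<and> continuous_on {0..} (\<lambda>t. L t \<omega>) \<and>
         (\<forall>s t. lifetime X \<omega> \<le> ennreal s \<and> 0 \<le> s \<and> s \<le> t \<longrightarrow> L t \<omega> = L s \<omega>) \<and>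
         (\<forall>s\<ge>0. \<forall>t\<ge>0. L (t + s) \<omega> = L t \<omega> + L s (shift X (ennreal t) \<omega>))))"

definition af_support :: "('w, 's::metric_space) process \<Rightarrow> (real \<Rightarrow> 'w \<Rightarrow> real) \<Rightarrow> 's set" where
  "af_support X L = {x. AE \<omega> in pt_law X x. Inf (ennreal ` {t. 0 \<le> t \<and> L t \<omega> > 0}) = 0}"

text \<open>Here \<open>r\<close> is the family of resolvent densities.  Extending \<open>L\<close> to negative times by \<open>L(0)\<close>
  makes \<^const>\<open>interval_measure\<close> the Stieltjes measure \<open>dL\<close> on \<open>[0,\<infinity>)\<close>.\<close>

definition local_time :: "('w, 's::metric_space) process \<Rightarrow> (real \<Rightarrow> 's \<Rightarrow> 's \<Rightarrow> ennreal) \<Rightarrow>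
    's \<Rightarrow> (real \<Rightarrow> 'w \<Rightarrow> real) \<Rightarrow> bool" where
  "local_time X r a L \<longleftrightarrow> perfect_pcaf X L \<and> af_support X L = {a} \<and>
     (\<forall>l>0. \<forall>x. (\<integral>\<^sup>+ \<omega>. (\<integral>\<^sup>+ t\<in>{0..}. ennreal (exp (- l * t))
                     \<partial>interval_measure (\<lambda>t. L (max 0 t) \<omega>)) \<partial>pt_law X x) = r l x a)"

text \<open>The infimum of the empty set is \<open>\<infinity>\<close>, which covers \<open>s \<ge> L(\<infinity>)\<close>.\<close>

definition inv_local_time :: "(real \<Rightarrow> 'w \<Rightarrow> real) \<Rightarrow> real \<Rightarrow> 'w \<Rightarrow> ennreal" where
  "inv_local_time L s \<omega> = Inf (ennreal ` {t. 0 < t \<and> L t \<omega> > s})"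

definition last_visit :: "(real \<Rightarrow> 'w \<Rightarrow> real) \<Rightarrow> real \<Rightarrow> 'w \<Rightarrow> real" where
  "last_visit L t \<omega> =
     enn2real (Sup {inv_local_time L s \<omega> | s. 0 \<le> s \<and> inv_local_time L s \<omega> \<le> ennreal t})"


section \<open>Special subordinators\<close>

definition bernstein :: "(real \<Rightarrow> real) \<Rightarrow> bool" where
  "bernstein \<Phi> \<longleftrightarrow> (\<forall>l>0. \<Phi> l \<ge> 0) \<and>
     (\<forall>n. \<forall>l>0. ((deriv ^^ n) \<Phi>) field_differentiable (at l)) \<and>
     (\<forall>n\<ge>1. \<forall>l>0. (- 1) ^ n * (deriv ^^ n) \<Phi> l \<le> 0)"

definition special_bernstein :: "(real \<Rightarrow> real) \<Rightarrow> bool" where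
  "special_bernstein \<Phi> \<longleftrightarrow> bernstein \<Phi> \<and> (\<exists>l>0. \<Phi> l \<noteq> 0) \<and> bernstein (\<lambda>l. l / \<Phi> l)"

text \<open>With the convention \<open>exp (- \<infinity>) = 0\<close>, i.e. the subordinator may be killed.\<close>

definition laplace_exponent ::
    "'w measure \<Rightarrow> (real \<Rightarrow> 'w \<Rightarrow> ennreal) \<Rightarrow> (real \<Rightarrow> real) \<Rightarrow> bool" where
  "laplace_exponent P \<tau> \<Phi> \<longleftrightarrow> (\<forall>l>0. \<forall>s\<ge>0.
     (\<integral>\<omega>. (if \<tau> s \<omega> = \<infinity> then 0 else exp (- l * enn2real (\<tau> s \<omega>))) \<partial>P) = exp (- \<Phi> l * s))"

definition special_subordinator :: "'w measure \<Rightarrow> (real \<Rightarrow> 'w \<Rightarrow> ennreal) \<Rightarrow> bool" where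
  "special_subordinator P \<tau> \<longleftrightarrow> (\<exists>\<Phi>. laplace_exponent P \<tau> \<Phi> \<and> special_bernstein \<Phi>)"


section \<open>Slow variation\<close>

text \<open>Only the values on \<open>(0,\<infinity>)\<close> matter.\<close>

definition slowly_varying :: "(real \<Rightarrow> real) \<Rightarrow> bool" where
  "slowly_varying ell \<longleftrightarrow> (\<forall>x>0. ell x > 0) \<and> ell \<in> borel_measurable (restrict_space borel {0<..}) \<and>
     (\<forall>c>0. ((\<lambda>x. ell (c * x) / ell x) \<longlongrightarrow> 1) at_top)"

end

theory Submission
  imports Defs "HOL-Real_Asymp.Real_Asymp"
begin

text \<open>Let \<open>L\<close> be the local time at \<open>a\<close>, let \<open>U t\<close> be the expectation of \<open>L(t)\<close> under \<open>P\<^sub>a\<close>, and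
  let \<open>D u\<close> be the first time after \<open>u\<close> at which \<open>L\<close> increases; almost surely this is the first
  visit to \<open>a\<close> after \<open>u\<close>. Up to null events, the last visit before \<open>t\<close> occurs at or before \<open>u\<close> iff
  \<open>D u > t\<close> (\<open>prob_last_visit_le\<close>), and at or after \<open>u\<close> iff \<open>D u \<le> t\<close> (\<open>prob_last_visit_ge\<close>). The
  theorem is therefore a statement on the distribution function \<open>H u t\<close> of \<open>D u\<close>, with \<open>u\<close> a small
  fraction of \<open>t\<close> in the first half of each part and \<open>t - u\<close> a small fraction of \<open>t\<close> in the second
  half.

  The process enters through a single identity (\<open>first_passage\<close>). The path restarts from \<open>a\<close> at
  time \<open>D u\<close>, and \<open>L\<close> does not grow between \<open>u\<close> and \<open>D u\<close>; the strong Markov property therefore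
  gives \<open>laplace (\<lambda>s. U s - U (min s u)) l = l * laplace (H u) l * laplace U l\<close>. Since
  \<open>R l = l * laplace U l\<close> is the resolvent density at \<open>(a, a)\<close>, this can be read in two ways:
  \<open>R l\<close> times the transform of the survival function \<open>1 - H u t\<close> is the transform of the truncated
  function \<open>U (min s u)\<close> (\<open>survival_laplace\<close>), and \<open>R l\<close> times the transform of \<open>H v (v + s)\<close> is
  the transform of the increment \<open>U (v + s) - U v\<close> (\<open>increment_laplace\<close>).

  In the first half, \<open>u = \<epsilon> T * T\<close> and \<open>l = c / T\<close>. Then \<open>l * u\<close> is negligible, and the transform
  of the truncated function is \<open>U u / l\<close> up to a factor tending to 1. So
  \<open>laplace (\<lambda>t. 1 - H u t) (c / T)\<close> is known asymptotically for every \<open>c\<close>, and the tail at time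
  \<open>T\<close> follows because it is monotone in time (\<open>monotone_tauberian\<close>); the same theorem evaluates
  \<open>U u\<close>. The two Gamma values combine to the constant by the reflection formula.

  In the second half, \<open>v = (1 - \<epsilon> T) * T\<close> and \<open>l = c / (\<epsilon> T * T)\<close>, and the growth of \<open>U\<close> on a
  window much shorter than \<open>T\<close> is required, which regular variation of \<open>U\<close> does not control. If
  the inverse local time is special with exponent \<open>\<Phi>\<close>, then \<open>l / \<Phi> l = l\<^sup>2 * laplace U l\<close> is a
  Bernstein function. Up to sign and positive factors, its higher derivatives at \<open>l = n / t\<close> are
  the second derivatives in \<open>t\<close> of the Post-Widder approximants of \<open>U\<close>; hence the approximants,
  and in the limit \<open>U\<close>, have decreasing slopes (\<open>U_slopes\<close>). A slope of \<open>U\<close> near \<open>T\<close> is thus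
  squeezed between slopes over intervals of length proportional to \<open>T\<close>, which are known from
  regular variation.

  For the statements on orders of magnitude the limits are replaced by two-sided bounds, and
  \<open>monotone_tauberian\<close> by \<open>monotone_tauberian_bounds\<close>, which compares a monotone function with
  explicit functions instead of passing to a limit.\<close>

section \<open>Laplace transforms and monotone functions\<close>

abbreviation laplace :: "(real \<Rightarrow> real) \<Rightarrow> real \<Rightarrow> real" where
  "laplace f c \<equiv> LBINT x:{0..}. exp (- c * x) * f x"

abbreviation laplace_integrable :: "(real \<Rightarrow> real) \<Rightarrow> real \<Rightarrow> bool" where
  "laplace_integrable f c \<equiv> set_integrable lborel {0..} (\<lambda>x. exp (- c * x) * f x)"

text \<open>Read from right to left, this writes an exponential as an integral over \<open>{t..}\<close>; with Fubini
  it turns distribution functions into Laplace transforms.\<close>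
lemma exp_tail:
  fixes l t :: real assumes "0 < l"
  shows "(\<integral>\<^sup>+ s. ennreal (l * exp (- l * s)) * indicator {t..} s \<partial>lborel) = ennreal (exp (- l * t))"
proof -
  have "(\<integral>\<^sup>+ s. ennreal (l * exp (- l * s)) * indicator {t..} s \<partial>lborel) = ennreal (0 - (- exp (- l * t)))"
  proof (rule nn_integral_FTC_atLeast)
    show "DERIV (\<lambda>s. - exp (- l * s)) x :> l * exp (- l * x)" for x
      by (auto intro!: derivative_eq_intros)
    have "((\<lambda>s. - exp (- (l * s))) \<longlongrightarrow> - 0) at_top"
      by (intro tendsto_minus filterlim_compose[OF exp_at_bot] filterlim_compose[OF filterlim_uminus_at_bot_at_top]
          filterlim_tendsto_pos_mult_at_top[OF tendsto_const assms] filterlim_ident)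
    then show "((\<lambda>s. - exp (- l * s)) \<longlongrightarrow> 0) at_top" by simp
  qed (use assms in auto)
  then show ?thesis by simp
qed

text \<open>Transforms of nonnegative functions are computed with Fubini in the extended nonnegative
  reals; this is the way back to real Laplace integrals.\<close>
lemma laplace_nn:
  assumes [measurable]: "f \<in> borel_measurable borel" and f: "\<And>x. 0 \<le> x \<Longrightarrow> 0 \<le> f x"
    and fin: "(\<integral>\<^sup>+ x. ennreal (exp (- c * x) * f x) * indicator {0..} x \<partial>lborel) = ennreal y" and y: "0 \<le> y"
  shows "laplace_integrable f c" "laplace f c = y"
proof -
  have "has_bochner_integral lborel (\<lambda>x. indicat_real {0..} x *\<^sub>R (exp (- c * x) * f x)) y"
  proof (rule has_bochner_integral_nn_integral)
    have "ennreal (indicat_real {0..} x *\<^sub>R (exp (- c * x) * f x)) =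
      ennreal (exp (- c * x) * f x) * indicator {0..} x" for x
      by (auto simp: indicator_def)
    then show "(\<integral>\<^sup>+ x. ennreal (indicat_real {0..} x *\<^sub>R (exp (- c * x) * f x)) \<partial>lborel) = ennreal y"
      using fin by simp
  qed (use y f in \<open>auto simp: indicator_def\<close>)
  then show "laplace_integrable f c" "laplace f c = y"
    by (auto simp: set_integrable_def set_lebesgue_integral_def has_bochner_integral_iff)
qed

lemma laplace_nonneg: "(\<And>x. 0 \<le> x \<Longrightarrow> 0 \<le> f x) \<Longrightarrow> 0 \<le> laplace f c"
  unfolding set_lebesgue_integral_def by (intro integral_nonneg_AE AE_I2) (auto simp: indicator_def)

lemma laplace_one:
  assumes "0 < c" shows "laplace_integrable (\<lambda>_. 1) c" "laplace (\<lambda>_. 1) c = 1 / c"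
proof -
  have "(\<integral>\<^sup>+ x. ennreal (exp (- c * x) * 1) * indicator {0..} x \<partial>lborel) =
    (\<integral>\<^sup>+ x. ennreal (1 / c) * (ennreal (c * exp (- c * x)) * indicator {0..} x) \<partial>lborel)"
    using assms by (intro nn_integral_cong) (simp add: mult.assoc[symmetric] ennreal_mult'[symmetric])
  also have "\<dots> = ennreal (1 / c)"
    by (subst nn_integral_cmult, measurable, subst exp_tail[OF assms]) simp
  finally have *: "(\<integral>\<^sup>+ x. ennreal (exp (- c * x) * 1) * indicator {0..} x \<partial>lborel) = ennreal (1 / c)" .
  show "laplace_integrable (\<lambda>_. 1) c" "laplace (\<lambda>_. 1) c = 1 / c"
    by (rule laplace_nn[OF _ _ *]; use assms in simp)+
qed

lemma laplace_powr:
  fixes \<rho> c :: real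
  assumes \<rho>: "0 < \<rho>" and c: "0 < c"
  shows "laplace_integrable (\<lambda>x. x powr (\<rho> - 1)) c" "laplace (\<lambda>x. x powr (\<rho> - 1)) c = Gamma \<rho> * c powr (- \<rho>)"
proof -
  let ?g = "\<lambda>t :: real. ennreal (indicator {0..} t * t powr (\<rho> - 1) / exp t)"
  let ?J = "\<integral>\<^sup>+ x. ennreal (exp (- c * x) * x powr (\<rho> - 1)) * indicator {0..} x \<partial>lborel"
  have "ennreal (Gamma \<rho>) = (\<integral>\<^sup>+ t. ?g t \<partial>lborel)" using Gamma_conv_nn_integral_real[OF \<rho>] by simp
  also have "\<dots> = ennreal \<bar>c\<bar> * (\<integral>\<^sup>+ x. ?g (0 + c * x) \<partial>lborel)"
    using c by (intro nn_integral_real_affine) auto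
  also have "(\<integral>\<^sup>+ x. ?g (0 + c * x) \<partial>lborel) =
    (\<integral>\<^sup>+ x. ennreal (c powr (\<rho> - 1)) * (ennreal (exp (- c * x) * x powr (\<rho> - 1)) * indicator {0..} x) \<partial>lborel)"
  proof (rule nn_integral_cong)
    fix x :: real
    show "?g (0 + c * x) = ennreal (c powr (\<rho> - 1)) * (ennreal (exp (- c * x) * x powr (\<rho> - 1)) * indicator {0..} x)"
      using c by (cases "0 \<le> x")
        (auto simp: indicator_def powr_mult exp_minus divide_inverse ennreal_mult'[symmetric] mult_ac zero_le_mult_iff)
  qed
  also have "\<dots> = ennreal (c powr (\<rho> - 1)) * ?J" by (rule nn_integral_cmult) measurable
  also have "ennreal \<bar>c\<bar> * (ennreal (c powr (\<rho> - 1)) * ?J) = ennreal (c powr \<rho>) * ?J"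
    using c by (simp add: mult.assoc[symmetric] ennreal_mult'[symmetric] powr_mult_base)
  finally have "ennreal (c powr (- \<rho>)) * ennreal (Gamma \<rho>) = ennreal (c powr (- \<rho>)) * (ennreal (c powr \<rho>) * ?J)"
    by simp
  also have "\<dots> = ?J"
    using c by (simp add: mult.assoc[symmetric] ennreal_mult'[symmetric] powr_add[symmetric])
  finally have e: "ennreal (c powr (- \<rho>)) * ennreal (Gamma \<rho>) = ?J" .
  have *: "?J = ennreal (Gamma \<rho> * c powr (- \<rho>))"
    unfolding e[symmetric] using Gamma_real_pos[OF \<rho>] by (simp add: ennreal_mult'[symmetric] mult.commute)
  show "laplace_integrable (\<lambda>x. x powr (\<rho> - 1)) c" "laplace (\<lambda>x. x powr (\<rho> - 1)) c = Gamma \<rho> * c powr (- \<rho>)"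
    by (rule laplace_nn[OF _ _ *]; use \<rho> Gamma_real_pos[OF \<rho>] in simp)+
qed

lemma laplace_integrable_weight:
  assumes f: "laplace_integrable f 1" and h: "continuous_on UNIV h" 
  shows "set_integrable lborel {0..} (\<lambda>x. exp (- x) * h (exp (- x)) * f x)"
proof -
  have "compact (h ` {0..1::real})"
    using h by (intro compact_continuous_image) (auto intro: continuous_on_subset)
  then obtain B where B: "\<And>y. y \<in> {0..1} \<Longrightarrow> \<bar>h y\<bar> \<le> B"
  proof -
    have "bounded (h ` {0..1})" using \<open>compact (h ` {0..1})\<close> by (rule compact_imp_bounded)
    then obtain C where "\<forall>y\<in>{0..1}. \<bar>h y\<bar> \<le> C" by (auto simp: bounded_iff)
    then show ?thesis by (intro that[of C]) auto
  qed
  have "0 \<le> B" using B[of 0] by auto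
  have hm [measurable]: "h \<in> borel_measurable borel" using h by (rule borel_measurable_continuous_onI)
  have fm: "set_borel_measurable lborel {0..} (\<lambda>x. exp (- x) * f x)"
    using f by (simp add: set_integrable_def set_borel_measurable_def borel_measurable_integrable)
  have m: "set_borel_measurable lborel {0..} (\<lambda>x. exp (- x) * h (exp (- x)) * f x)"
  proof -
    have "(\<lambda>x. h (exp (- x)) * (indicator {0..} x *\<^sub>R (exp (- x) * f x))) \<in> borel_measurable lborel"
      using fm unfolding set_borel_measurable_def by measurable
    moreover have "(\<lambda>x. h (exp (- x)) * (indicator {0..} x *\<^sub>R (exp (- x) * f x))) =
       (\<lambda>x. indicator {0..} x *\<^sub>R (exp (- x) * h (exp (- x)) * f x))" by (auto simp: mult_ac)
    ultimately show ?thesis unfolding set_borel_measurable_def by simp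
  qed
  have "set_integrable lborel {0..} (\<lambda>x. B * (exp (- x) * f x))"
    using f by (intro set_integrable_mult_right) simp
  then show ?thesis
  proof (rule set_integrable_bound[OF _ m], intro AE_I2 impI)
    fix x :: real assume "x \<in> {0..}"
    then have "\<bar>h (exp (- x))\<bar> \<le> B" by (intro B) auto
    then have "\<bar>h (exp (- x))\<bar> * (exp (- x) * \<bar>f x\<bar>) \<le> B * (exp (- x) * \<bar>f x\<bar>)" by (intro mult_right_mono) auto
    then show "norm (exp (- x) * h (exp (- x)) * f x) \<le> norm (B * (exp (- x) * f x))"
      using \<open>0 \<le> B\<close> by (simp add: abs_mult mult_ac)
  qed
qed

lemma laplace_weight_bound:
  assumes f: "laplace_integrable f 1" "\<And>x. 0 \<le> x \<Longrightarrow> 0 \<le> f x"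
    and g: "continuous_on UNIV g" "\<And>y. y \<in> {0..1} \<Longrightarrow> \<bar>g y\<bar> \<le> \<eta>"
  shows "\<bar>LBINT x:{0..}. exp (- x) * g (exp (- x)) * f x\<bar> \<le> \<eta> * laplace f 1"
proof -
  have "\<bar>LBINT x:{0..}. exp (- x) * g (exp (- x)) * f x\<bar> \<le> (LBINT x:{0..}. \<bar>exp (- x) * g (exp (- x)) * f x\<bar>)"
    unfolding set_lebesgue_integral_def by (rule order_trans[OF integral_abs_bound]) (simp add: abs_mult)
  also have "\<dots> \<le> (LBINT x:{0..}. \<eta> * (exp (- 1 * x) * f x))"
  proof (rule set_integral_mono)
    show "set_integrable lborel {0..} (\<lambda>x. \<bar>exp (- x) * g (exp (- x)) * f x\<bar>)"
      using laplace_integrable_weight[OF f(1) g(1)] by (rule set_integrable_abs)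
    show "set_integrable lborel {0..} (\<lambda>x. \<eta> * (exp (- 1 * x) * f x))"
      using f(1) by (intro set_integrable_mult_right) simp
    fix x :: real assume x: "x \<in> {0..}"
    then have "\<bar>g (exp (- x))\<bar> \<le> \<eta>" by (intro g(2)) auto
    then have "\<bar>g (exp (- x))\<bar> * (exp (- x) * f x) \<le> \<eta> * (exp (- x) * f x)"
      using f(2) x by (intro mult_right_mono) auto
    then show "\<bar>exp (- x) * g (exp (- x)) * f x\<bar> \<le> \<eta> * (exp (- 1 * x) * f x)"
      using f(2)[of x] x by (simp add: abs_mult mult_ac)
  qed
  also have "\<dots> = \<eta> * laplace f 1" by simp
  finally show ?thesis .
qed

lemma laplace_polynomial:
  assumes "\<And>c. c > 0 \<Longrightarrow> laplace_integrable f c"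
  shows "(LBINT x:{0..}. exp (- x) * (\<Sum>i\<le>n. a i * exp (- x) ^ i) * f x) = (\<Sum>i\<le>n. a i * laplace f (real i + 1))"
proof -
  have "(LBINT x:{0..}. exp (- x) * (\<Sum>i\<le>n. a i * exp (- x) ^ i) * f x) =
    (LBINT x:{0..}. (\<Sum>i\<le>n. a i * (exp (- (real i + 1) * x) * f x)))"
  proof -
    have "exp (- x) * exp (- x) ^ i = exp (- (real i + 1) * x)" for x :: real and i
      by (simp add: exp_of_nat_mult[symmetric] exp_add[symmetric] algebra_simps)
    then have "exp (- x) * (\<Sum>i\<le>n. a i * exp (- x) ^ i) * f x = (\<Sum>i\<le>n. a i * (exp (- (real i + 1) * x) * f x))" for x
      by (simp add: sum_distrib_left sum_distrib_right mult_ac)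
    then show ?thesis by simp
  qed
  also have "\<dots> = (\<Sum>i\<le>n. LBINT x:{0..}. a i * (exp (- (real i + 1) * x) * f x))"
    unfolding set_lebesgue_integral_def scaleR_sum_right
  proof (rule Bochner_Integration.integral_sum)
    fix i
    have "set_integrable lborel {0..} (\<lambda>x. a i * (exp (- (real i + 1) * x) * f x))"
      by (intro set_integrable_mult_right assms impI) simp
    then show "integrable lborel (\<lambda>x. indicat_real {0..} x *\<^sub>R (a i * (exp (- (real i + 1) * x) * f x)))"
      by (simp add: set_integrable_def)
  qed
  also have "\<dots> = (\<Sum>i\<le>n. a i * laplace f (real i + 1))" by simp
  finally show ?thesis .
qed

text \<open>In the variable \<open>y = exp (- x)\<close> the half line becomes the unit interval, where a continuous
  weight is uniformly close to a polynomial. The integral against \<open>exp (- x)\<close> times a polynomial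
  in \<open>exp (- x)\<close> is a linear combination of the values of the transform at \<open>1, 2, 3, \<dots>\<close>, and the
  error is controlled by the transform at \<open>1\<close>.\<close>
theorem laplace_continuity:
  fixes f :: "'a \<Rightarrow> real \<Rightarrow> real" and w h :: "real \<Rightarrow> real"
  assumes f: "\<forall>\<^sub>F T in F. (\<forall>x\<ge>0. 0 \<le> f T x) \<and> (\<forall>c>0. laplace_integrable (f T) c)"
    and w: "\<And>x. 0 \<le> x \<Longrightarrow> 0 \<le> w x" "\<And>c. c > 0 \<Longrightarrow> laplace_integrable w c"
    and lim: "\<And>c. c > 0 \<Longrightarrow> ((\<lambda>T. laplace (f T) c) \<longlongrightarrow> laplace w c) F"
    and h: "continuous_on UNIV h"
  shows "((\<lambda>T. LBINT x:{0..}. exp (- x) * h (exp (- x)) * f T x) \<longlongrightarrow>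
     (LBINT x:{0..}. exp (- x) * h (exp (- x)) * w x)) F"
proof (rule tendstoI)
  fix e :: real assume e: "e > 0"
  define M where "M = laplace w 1"
  have M: "0 \<le> M" unfolding M_def by (rule laplace_nonneg) (rule w(1))
  \<comment> \<open>The approximation error costs at most \<open>\<eta> * (M + 1) = e / 4\<close> for \<open>f T\<close> and for \<open>w\<close> each; the
    polynomial part contributes \<open>e / 2\<close>.\<close>
  define \<eta> where "\<eta> = e / (4 * (M + 1))"
  have \<eta>: "\<eta> > 0" using e M by (simp add: \<eta>_def)
  have "\<exists>g. real_polynomial_function g \<and> (\<forall>x\<in>{0..1}. \<bar>h x - g x\<bar> < \<eta>)"
  proof -
    obtain g where "real_polynomial_function g" "\<And>x. x \<in> {0..1} \<Longrightarrow> \<bar>h x - g x\<bar> < \<eta>"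
      using Stone_Weierstrass_real_polynomial_function[of "{0..1::real}" h \<eta>] h \<eta>
      by (auto intro: continuous_on_subset)
    then show ?thesis by blast
  qed
  then obtain a n where "\<forall>y\<in>{0..1}. \<bar>h y - (\<Sum>i\<le>n. a i * y ^ i)\<bar> < \<eta>"
    by (auto simp: real_polynomial_function_iff_sum)
  then have an: "\<And>y. y \<in> {0..1} \<Longrightarrow> \<bar>h y - (\<Sum>i\<le>n. a i * y ^ i)\<bar> \<le> \<eta>"
    by (auto intro: less_imp_le)
  let ?p = "\<lambda>y::real. \<Sum>i\<le>n. a i * y ^ i" and ?g = "\<lambda>y. h y - (\<Sum>i\<le>n. a i * y ^ i)"
  have pc: "continuous_on UNIV ?p" by (intro continuous_intros)
  have gc: "continuous_on UNIV ?g" using h by (intro continuous_intros) auto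
  have split: "(LBINT x:{0..}. exp (- x) * h (exp (- x)) * v x) =
    (LBINT x:{0..}. exp (- x) * ?g (exp (- x)) * v x) + (\<Sum>i\<le>n. a i * laplace v (real i + 1))"
    if v: "\<And>c. c > 0 \<Longrightarrow> laplace_integrable v c" for v
  proof -
    note i = laplace_integrable_weight[OF v[of 1]]
    have "(LBINT x:{0..}. exp (- x) * h (exp (- x)) * v x) =
      (LBINT x:{0..}. exp (- x) * ?g (exp (- x)) * v x + exp (- x) * ?p (exp (- x)) * v x)"
      by (simp add: algebra_simps)
    also have "\<dots> = (LBINT x:{0..}. exp (- x) * ?g (exp (- x)) * v x) + (LBINT x:{0..}. exp (- x) * ?p (exp (- x)) * v x)"
      by (rule set_integral_add(2)[OF i[OF _ gc] i[OF _ pc]]) auto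
    finally show ?thesis using laplace_polynomial[OF v] by simp
  qed
  have lim_p: "((\<lambda>T. \<Sum>i\<le>n. a i * laplace (f T) (real i + 1)) \<longlongrightarrow> (\<Sum>i\<le>n. a i * laplace w (real i + 1))) F"
    by (intro tendsto_sum tendsto_mult tendsto_const lim) simp
  have e1: "\<forall>\<^sub>F T in F. dist (\<Sum>i\<le>n. a i * laplace (f T) (real i + 1)) (\<Sum>i\<le>n. a i * laplace w (real i + 1)) < e / 2"
    using lim_p e by (intro tendstoD) auto
  have e2: "\<forall>\<^sub>F T in F. laplace (f T) 1 < M + 1"
    using lim[of 1] by (intro order_tendstoD) (auto simp: M_def)
  show "\<forall>\<^sub>F T in F. dist (LBINT x:{0..}. exp (- x) * h (exp (- x)) * f T x) (LBINT x:{0..}. exp (- x) * h (exp (- x)) * w x) < e"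
    using e1 e2 f
  proof eventually_elim
    case (elim T)
    have 1: "\<bar>LBINT x:{0..}. exp (- x) * ?g (exp (- x)) * f T x\<bar> \<le> \<eta> * laplace (f T) 1"
    proof (rule laplace_weight_bound[OF _ _ gc an])
      show "laplace_integrable (f T) 1" using elim(3) zero_less_one by blast
    qed (use elim in auto)
    have 2: "\<bar>LBINT x:{0..}. exp (- x) * ?g (exp (- x)) * w x\<bar> \<le> \<eta> * M"
      unfolding M_def by (rule laplace_weight_bound[OF w(2)[OF zero_less_one] w(1) gc an])
    have 3: "\<eta> * laplace (f T) 1 < \<eta> * (M + 1)" using elim \<eta> by simp
    have 4: "\<eta> * M \<le> \<eta> * (M + 1)" using \<eta> by simp
    have 5: "\<eta> * (M + 1) = e / 4" using M by (simp add: \<eta>_def field_simps)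
    have s1: "(LBINT x:{0..}. exp (- x) * h (exp (- x)) * f T x) =
      (LBINT x:{0..}. exp (- x) * ?g (exp (- x)) * f T x) + (\<Sum>i\<le>n. a i * laplace (f T) (real i + 1))"
      using elim(3) by (intro split) blast
    have s2: "(LBINT x:{0..}. exp (- x) * h (exp (- x)) * w x) =
      (LBINT x:{0..}. exp (- x) * ?g (exp (- x)) * w x) + (\<Sum>i\<le>n. a i * laplace w (real i + 1))"
      by (rule split[OF w(2)])
    show ?case unfolding s1 s2 dist_real_def using 1 2 3 4 5 elim(1) unfolding dist_real_def by linarith
  qed
qed

text \<open>A continuous nonnegative weight in \<open>exp (- x)\<close> that lives on \<open>{u..v}\<close> and has positive mass:
  \<open>laplace_continuity\<close>, applied to it, sees only the values of \<open>f T\<close> on this window.\<close>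
lemma laplace_window:
  assumes uv: "0 \<le> u" "u < v"
  obtains k :: "real \<Rightarrow> real" where "continuous_on UNIV k" "\<And>y. 0 \<le> k y"
    "\<And>x. x \<notin> {u..v} \<Longrightarrow> k (exp (- x)) = 0"
    "set_integrable lborel {0..} (\<lambda>x. exp (- x) * k (exp (- x)))"
    "0 < (LBINT x:{0..}. exp (- x) * k (exp (- x)))"
proof
  let ?k = "\<lambda>y. max 0 (min (y - exp (- v)) (exp (- u) - y))"
  show kc: "continuous_on UNIV ?k" by (intro continuous_intros)
  show "0 \<le> ?k y" for y by simp
  show "?k (exp (- x)) = 0" if x: "x \<notin> {u..v}" for x
  proof (cases "x < u")
    case True
    then show ?thesis by (intro max_absorb1 min.coboundedI2) simp
  next
    case False
    then have "v < x" using x by auto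
    then show ?thesis by (intro max_absorb1 min.coboundedI1) simp
  qed
  have one: "laplace_integrable (\<lambda>_. 1) 1"
    by (rule laplace_one) simp
  show int: "set_integrable lborel {0..} (\<lambda>x. exp (- x) * ?k (exp (- x)))"
    using laplace_integrable_weight[OF one kc] by simp
  \<comment> \<open>On the middle third of the window the weight is bounded below by a positive constant.\<close>
  define s where "s = (2 * u + v) / 3" define t where "t = (u + 2 * v) / 3"
  have st: "u < s" "s < t" "t < v" using uv by (auto simp: s_def t_def field_simps)
  define b where "b = exp (- t) * min (exp (- t) - exp (- v)) (exp (- u) - exp (- s))"
  have b: "0 < b" unfolding b_def using st by (intro mult_pos_pos) auto
  have "0 < b * (t - s)" using b st by simp
  also have "\<dots> = (LBINT x:{0..}. indicator {s..t} x * b)"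
  proof -
    have "(\<lambda>x. indicat_real {0..} x *\<^sub>R (indicator {s..t} x * b)) = (\<lambda>x. b * indicator {s..t} x)"
      using st uv by (auto simp: indicator_def)
    then show ?thesis unfolding set_lebesgue_integral_def using st by simp
  qed
  also have "\<dots> \<le> (LBINT x:{0..}. exp (- x) * ?k (exp (- x)))"
  proof (rule set_integral_mono[OF _ int])
    have "(\<lambda>x. indicat_real {0..} x *\<^sub>R (indicator {s..t} x * b)) = (\<lambda>x. b * indicator {s..t} x)"
      using st uv by (auto simp: indicator_def)
    then show "set_integrable lborel {0..} (\<lambda>x. indicator {s..t} x * b)"
      unfolding set_integrable_def using st by (simp add: integrable_real_indicator)
    fix x :: real
    show "indicator {s..t} x * b \<le> exp (- x) * ?k (exp (- x))"
    proof (cases "x \<in> {s..t}")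
      case True
      then have "min (exp (- t) - exp (- v)) (exp (- u) - exp (- s)) \<le> ?k (exp (- x))"
        by (intro max.coboundedI2 min.mono diff_mono) auto
      then have "b \<le> exp (- x) * ?k (exp (- x))" unfolding b_def using True st by (intro mult_mono) auto
      then show ?thesis using True by simp
    qed simp
  qed
  finally show "0 < (LBINT x:{0..}. exp (- x) * ?k (exp (- x)))" .
qed

lemma laplace_window_average:
  assumes v: "laplace_integrable v 1" and k: "continuous_on UNIV k" "\<And>y. 0 \<le> k y"
    "\<And>x. x \<notin> {p..q} \<Longrightarrow> k (exp (- x)) = 0"
    "set_integrable lborel {0..} (\<lambda>x. exp (- x) * k (exp (- x)))"
  shows "(\<And>x. x \<in> {p..q} \<Longrightarrow> 0 \<le> x \<Longrightarrow> v x \<le> A) \<Longrightarrow>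
      (LBINT x:{0..}. exp (- x) * k (exp (- x)) * v x) \<le> A * (LBINT x:{0..}. exp (- x) * k (exp (- x)))"
    and "(\<And>x. x \<in> {p..q} \<Longrightarrow> 0 \<le> x \<Longrightarrow> A \<le> v x) \<Longrightarrow>
      A * (LBINT x:{0..}. exp (- x) * k (exp (- x))) \<le> (LBINT x:{0..}. exp (- x) * k (exp (- x)) * v x)"
proof -
  have i: "set_integrable lborel {0..} (\<lambda>x. exp (- x) * k (exp (- x)) * v x)"
    by (rule laplace_integrable_weight[OF v k(1)])
  have i': "set_integrable lborel {0..} (\<lambda>x. A * (exp (- x) * k (exp (- x))))"
    using k(4) by (intro set_integrable_mult_right) simp
  have eq: "A * (LBINT x:{0..}. exp (- x) * k (exp (- x))) = (LBINT x:{0..}. A * (exp (- x) * k (exp (- x))))" by simp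
  show "(LBINT x:{0..}. exp (- x) * k (exp (- x)) * v x) \<le> A * (LBINT x:{0..}. exp (- x) * k (exp (- x)))"
    if "\<And>x. x \<in> {p..q} \<Longrightarrow> 0 \<le> x \<Longrightarrow> v x \<le> A"
    unfolding eq
  proof (rule set_integral_mono[OF i i'])
    fix x :: real assume x: "x \<in> {0..}"
    show "exp (- x) * k (exp (- x)) * v x \<le> A * (exp (- x) * k (exp (- x)))"
    proof (cases "x \<in> {p..q}")
      case True
      then have "(exp (- x) * k (exp (- x))) * v x \<le> (exp (- x) * k (exp (- x))) * A"
        using that x k(2) by (intro mult_left_mono) auto
      then show ?thesis by (simp add: mult_ac)
    qed (simp add: k(3))
  qed
  show "A * (LBINT x:{0..}. exp (- x) * k (exp (- x))) \<le> (LBINT x:{0..}. exp (- x) * k (exp (- x)) * v x)"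
    if "\<And>x. x \<in> {p..q} \<Longrightarrow> 0 \<le> x \<Longrightarrow> A \<le> v x"
    unfolding eq
  proof (rule set_integral_mono[OF i' i])
    fix x :: real assume x: "x \<in> {0..}"
    show "A * (exp (- x) * k (exp (- x))) \<le> exp (- x) * k (exp (- x)) * v x"
    proof (cases "x \<in> {p..q}")
      case True
      then have "(exp (- x) * k (exp (- x))) * A \<le> (exp (- x) * k (exp (- x))) * v x"
        using that x k(2) by (intro mult_left_mono) auto
      then show ?thesis by (simp add: mult_ac)
    qed (simp add: k(3))
  qed
qed

text \<open>The weighted averages over the window converge. A number below all values of \<open>f T\<close> on the
  window is below their average, hence eventually smaller than any bound strictly above \<open>w\<close>; and
  dually. In the applications \<open>g T\<close> is a single value of a monotone \<open>f T\<close>, with the window on the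
  appropriate side.\<close>
lemma laplace_window_bounds:
  fixes f :: "'a \<Rightarrow> real \<Rightarrow> real" and w :: "real \<Rightarrow> real"
  assumes f: "\<forall>\<^sub>F T in F. (\<forall>x\<ge>0. 0 \<le> f T x) \<and> (\<forall>c>0. laplace_integrable (f T) c)"
    and w: "\<And>x. 0 \<le> x \<Longrightarrow> 0 \<le> w x" "\<And>c. c > 0 \<Longrightarrow> laplace_integrable w c"
    and lim: "\<And>c. c > 0 \<Longrightarrow> ((\<lambda>T. laplace (f T) c) \<longlongrightarrow> laplace w c) F"
    and pq: "0 \<le> p" "p < q"
  shows "(\<And>x. x \<in> {p..q} \<Longrightarrow> w x \<le> A) \<Longrightarrow> A < A' \<Longrightarrow>
      \<forall>\<^sub>F T in F. (\<forall>x\<in>{p..q}. g T \<le> f T x) \<longrightarrow> g T < A'"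
    and "(\<And>x. x \<in> {p..q} \<Longrightarrow> A \<le> w x) \<Longrightarrow> A' < A \<Longrightarrow>
      \<forall>\<^sub>F T in F. (\<forall>x\<in>{p..q}. f T x \<le> g T) \<longrightarrow> A' < g T"
proof -
  obtain k where k: "continuous_on UNIV k" "\<And>y. 0 \<le> k y" "\<And>x. x \<notin> {p..q} \<Longrightarrow> k (exp (- x)) = 0"
    "set_integrable lborel {0..} (\<lambda>x. exp (- x) * k (exp (- x)))"
    and pos: "0 < (LBINT x:{0..}. exp (- x) * k (exp (- x)))"
    using laplace_window[OF pq] by blast
  let ?B = "LBINT x:{0..}. exp (- x) * k (exp (- x))"
  have lim': "((\<lambda>T. LBINT x:{0..}. exp (- x) * k (exp (- x)) * f T x) \<longlongrightarrow>
     (LBINT x:{0..}. exp (- x) * k (exp (- x)) * w x)) F"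
    by (rule laplace_continuity[OF f w lim k(1)])
  show "\<forall>\<^sub>F T in F. (\<forall>x\<in>{p..q}. g T \<le> f T x) \<longrightarrow> g T < A'"
    if A: "\<And>x. x \<in> {p..q} \<Longrightarrow> w x \<le> A" "A < A'"
  proof -
    have "(LBINT x:{0..}. exp (- x) * k (exp (- x)) * w x) \<le> A * ?B"
      using w(2)[of 1] by (intro laplace_window_average(1)[OF _ k] A) auto
    also have "\<dots> < A' * ?B" using A(2) pos by simp
    finally have "\<forall>\<^sub>F T in F. (LBINT x:{0..}. exp (- x) * k (exp (- x)) * f T x) < A' * ?B"
      by (rule order_tendstoD(2)[OF lim'])
    then show ?thesis using f
    proof eventually_elim
      case (elim T)
      show ?case
      proof
        assume g: "\<forall>x\<in>{p..q}. g T \<le> f T x"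
        have "g T * ?B \<le> (LBINT x:{0..}. exp (- x) * k (exp (- x)) * f T x)"
        proof (rule laplace_window_average(2)[OF _ k])
          show "laplace_integrable (f T) 1" using elim(2) zero_less_one by blast
        qed (use g in auto)
        then have "g T * ?B < A' * ?B" using elim(1) by simp
        then show "g T < A'" using pos by simp
      qed
    qed
  qed
  show "\<forall>\<^sub>F T in F. (\<forall>x\<in>{p..q}. f T x \<le> g T) \<longrightarrow> A' < g T"
    if A: "\<And>x. x \<in> {p..q} \<Longrightarrow> A \<le> w x" "A' < A"
  proof -
    have "A' * ?B < A * ?B" using A(2) pos by simp
    also have "A * ?B \<le> (LBINT x:{0..}. exp (- x) * k (exp (- x)) * w x)"
      using w(2)[of 1] by (intro laplace_window_average(2)[OF _ k] A) auto
    finally have "\<forall>\<^sub>F T in F. A' * ?B < (LBINT x:{0..}. exp (- x) * k (exp (- x)) * f T x)"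
      by (rule order_tendstoD(1)[OF lim'])
    then show ?thesis using f
    proof eventually_elim
      case (elim T)
      show ?case
      proof
        assume g: "\<forall>x\<in>{p..q}. f T x \<le> g T"
        have "(LBINT x:{0..}. exp (- x) * k (exp (- x)) * f T x) \<le> g T * ?B"
        proof (rule laplace_window_average(1)[OF _ k])
          show "laplace_integrable (f T) 1" using elim(2) zero_less_one by blast
        qed (use g in auto)
        then have "A' * ?B < g T * ?B" using elim(1) by simp
        then show "A' < g T" using pos by simp
      qed
    qed
  qed
qed

text \<open>The transforms converge to that of \<open>C / Gamma \<rho> * x powr (\<rho> - 1)\<close>, a function continuous at
  1. By monotonicity \<open>f T 1\<close> bounds \<open>f T\<close> from above on a short window at one side of 1 and from
  below on one at the other side, so that \<open>laplace_window_bounds\<close> applies to both.\<close>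
theorem monotone_tauberian:
  fixes f :: "'a \<Rightarrow> real \<Rightarrow> real" and \<rho> :: real
  assumes \<rho>: "0 < \<rho>"
    and f: "\<forall>\<^sub>F T in F. (\<forall>x\<ge>0. 0 \<le> f T x) \<and> (\<forall>c>0. laplace_integrable (f T) c)"
    and mono: "(\<forall>\<^sub>F T in F. mono_on {0..} (f T)) \<or> (\<forall>\<^sub>F T in F. antimono_on {0..} (f T))"
    and lim: "\<And>c. c > 0 \<Longrightarrow> ((\<lambda>T. laplace (f T) c) \<longlongrightarrow> C * c powr (- \<rho>)) F" and C: "0 \<le> C"
  shows "((\<lambda>T. f T 1) \<longlongrightarrow> C / Gamma \<rho>) F"
proof -
  define w where "w x = C / Gamma \<rho> * x powr (\<rho> - 1)" for x
  have G: "0 < Gamma \<rho>" using \<rho> by (rule Gamma_real_pos)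
  have w0: "0 \<le> w x" for x using C G by (simp add: w_def)
  have wi: "laplace_integrable w c" if "0 < c" for c
    using set_integrable_mult_right[of "C / Gamma \<rho>" lborel "{0..}"] laplace_powr(1)[OF \<rho> that]
    by (simp add: w_def mult.left_commute)
  have wl: "laplace w c = C * c powr (- \<rho>)" if "0 < c" for c
    using laplace_powr(2)[OF \<rho> that] G by (simp add: w_def mult.left_commute)
  have lim': "((\<lambda>T. laplace (f T) c) \<longlongrightarrow> laplace w c) F" if "0 < c" for c
    using lim[OF that] wl[OF that] by simp
  note bounds = laplace_window_bounds[OF f w0 wi lim']
  have wc: "isCont w 1" unfolding w_def by (intro continuous_intros) auto
  have w1: "w 1 = C / Gamma \<rho>" by (simp add: w_def)
  show ?thesis
  proof (rule order_tendstoI)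
    fix y assume y: "y < C / Gamma \<rho>"
    obtain z where z: "y < z" "z < w 1" using y w1 dense[of y "w 1"] by auto
    have "eventually (\<lambda>x. z < w x) (at 1)"
      using wc z(2) by (simp add: isCont_def order_tendstoD)
    then obtain d where d: "d > 0" "\<And>x. x \<noteq> 1 \<Longrightarrow> dist x 1 < d \<Longrightarrow> z < w x" unfolding eventually_at by auto
    define e where "e = min (d / 2) (1 / 2)"
    have e: "0 < e" "e < d" "e < 1" using d(1) by (auto simp: e_def)
    have zw: "z \<le> w x" if "\<bar>x - 1\<bar> \<le> e" for x
      using d(2)[of x] that e z by (cases "x = 1") (auto simp: dist_real_def less_imp_le)
    have 1: "\<forall>\<^sub>F T in F. (\<forall>x\<in>{1 - e..1}. f T x \<le> f T 1) \<longrightarrow> y < f T 1"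
      using e by (intro bounds(2)[where A = z] zw z) auto
    have 2: "\<forall>\<^sub>F T in F. (\<forall>x\<in>{1..1 + e}. f T x \<le> f T 1) \<longrightarrow> y < f T 1"
      using e by (intro bounds(2)[where A = z] zw z) auto
    from mono show "\<forall>\<^sub>F T in F. y < f T 1"
    proof
      assume "\<forall>\<^sub>F T in F. mono_on {0..} (f T)"
      with 1 show ?thesis by eventually_elim (use e in \<open>auto simp: monotone_on_def\<close>)
    next
      assume "\<forall>\<^sub>F T in F. antimono_on {0..} (f T)"
      with 2 show ?thesis by eventually_elim (use e in \<open>auto simp: monotone_on_def\<close>)
    qed
  next
    fix y assume y: "C / Gamma \<rho> < y"
    obtain z where z: "z < y" "w 1 < z" using y w1 dense[of "w 1" y] by auto
    have "eventually (\<lambda>x. w x < z) (at 1)"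
      using wc z(2) by (simp add: isCont_def order_tendstoD)
    then obtain d where d: "d > 0" "\<And>x. x \<noteq> 1 \<Longrightarrow> dist x 1 < d \<Longrightarrow> w x < z" unfolding eventually_at by auto
    define e where "e = min (d / 2) (1 / 2)"
    have e: "0 < e" "e < d" "e < 1" using d(1) by (auto simp: e_def)
    have zw: "w x \<le> z" if "\<bar>x - 1\<bar> \<le> e" for x
      using d(2)[of x] that e z by (cases "x = 1") (auto simp: dist_real_def less_imp_le)
    have 1: "\<forall>\<^sub>F T in F. (\<forall>x\<in>{1 - e..1}. f T 1 \<le> f T x) \<longrightarrow> f T 1 < y"
      using e by (intro bounds(1)[where A = z] zw z) auto
    have 2: "\<forall>\<^sub>F T in F. (\<forall>x\<in>{1..1 + e}. f T 1 \<le> f T x) \<longrightarrow> f T 1 < y"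
      using e by (intro bounds(1)[where A = z] zw z) auto
    from mono show "\<forall>\<^sub>F T in F. f T 1 < y"
    proof
      assume "\<forall>\<^sub>F T in F. mono_on {0..} (f T)"
      with 2 show ?thesis by eventually_elim (use e in \<open>auto simp: monotone_on_def\<close>)
    next
      assume "\<forall>\<^sub>F T in F. antimono_on {0..} (f T)"
      with 1 show ?thesis by eventually_elim (use e in \<open>auto simp: monotone_on_def\<close>)
    qed
  qed
qed

lemma laplace_mono:
  assumes "laplace_integrable f c" "laplace_integrable g c" "\<And>x. 0 \<le> x \<Longrightarrow> f x \<le> g x"
  shows "laplace f c \<le> laplace g c"
  using assms by (intro set_integral_mono) auto

lemma laplace_integrable_add: "laplace_integrable f c \<Longrightarrow> laplace_integrable g c \<Longrightarrow> laplace_integrable (\<lambda>x. f x + g x) c"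
  using set_integral_add(1)[of lborel "{0..}" "\<lambda>x. exp (- c * x) * f x" "\<lambda>x. exp (- c * x) * g x"]
  by (simp add: distrib_left)

lemma laplace_add:
  "laplace_integrable f c \<Longrightarrow> laplace_integrable g c \<Longrightarrow> laplace (\<lambda>x. f x + g x) c = laplace f c + laplace g c"
  using set_integral_add(2)[of lborel "{0..}" "\<lambda>x. exp (- c * x) * f x" "\<lambda>x. exp (- c * x) * g x"]
  by (simp add: distrib_left)

lemma laplace_integrable_diff: "laplace_integrable f c \<Longrightarrow> laplace_integrable g c \<Longrightarrow> laplace_integrable (\<lambda>x. f x - g x) c"
  using set_integral_diff(1)[of lborel "{0..}" "\<lambda>x. exp (- c * x) * f x" "\<lambda>x. exp (- c * x) * g x"]
  by (simp add: right_diff_distrib)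

lemma laplace_diff:
  "laplace_integrable f c \<Longrightarrow> laplace_integrable g c \<Longrightarrow> laplace (\<lambda>x. f x - g x) c = laplace f c - laplace g c"
  using set_integral_diff(2)[of lborel "{0..}" "\<lambda>x. exp (- c * x) * f x" "\<lambda>x. exp (- c * x) * g x"]
  by (simp add: right_diff_distrib)

lemma laplace_integrable_cmult: "laplace_integrable f c \<Longrightarrow> laplace_integrable (\<lambda>x. k * f x) c"
  using set_integrable_mult_right[of k lborel "{0..}" "\<lambda>x. exp (- c * x) * f x"]
  by (simp add: mult.left_commute)

lemma laplace_cmult: "laplace (\<lambda>x. k * f x) c = k * laplace f c"
  using set_integral_mult_right[of lborel "{0..}" k "\<lambda>x. exp (- c * x) * f x"]
  by (simp add: mult.left_commute)

lemma laplace_exp_mult: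
  "laplace_integrable (\<lambda>x. exp (- b * x) * f x) c = laplace_integrable f (c + b)"
  "laplace (\<lambda>x. exp (- b * x) * f x) c = laplace f (c + b)"
proof -
  have "(\<lambda>x. exp (- c * x) * (exp (- b * x) * f x)) = (\<lambda>x. exp (- (c + b) * x) * f x)"
  proof
    fix x :: real
    have e: "- (c + b) * x = - c * x + - b * x" by (simp add: algebra_simps)
    show "exp (- c * x) * (exp (- b * x) * f x) = exp (- (c + b) * x) * f x"
      unfolding e exp_add by (simp only: mult.assoc)
  qed
  then show "laplace_integrable (\<lambda>x. exp (- b * x) * f x) c = laplace_integrable f (c + b)"
    "laplace (\<lambda>x. exp (- b * x) * f x) c = laplace f (c + b)" by simp_all
qed

lemma laplace_integrable_bound:
  assumes g: "laplace_integrable g c" and f: "f \<in> borel_measurable borel" "\<And>x. 0 \<le> x \<Longrightarrow> \<bar>f x\<bar> \<le> g x"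
  shows "laplace_integrable f c"
  using g
proof (rule set_integrable_bound)
  show "set_borel_measurable lborel {0..} (\<lambda>x. exp (- c * x) * f x)"
    using f(1) unfolding set_borel_measurable_def by measurable
  show "AE x in lborel. x \<in> {0..} \<longrightarrow> norm (exp (- c * x) * f x) \<le> norm (exp (- c * x) * g x)"
    using f(2) by (intro AE_I2) (auto simp: abs_mult intro!: mult_left_mono order_trans[OF f(2) abs_ge_self])
qed

lemma laplace_scale:
  assumes T: "0 < T"
  shows "laplace_integrable f (c / T) \<Longrightarrow> laplace_integrable (\<lambda>x. f (T * x)) c"
    and "laplace (\<lambda>x. f (T * x)) c = laplace f (c / T) / T"
proof -
  let ?g = "\<lambda>x. indicat_real {0..} x *\<^sub>R (exp (- (c / T) * x) * f x)"
  have eq: "?g (0 + T * x) = indicat_real {0..} x *\<^sub>R (exp (- c * x) * f (T * x))" for x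
    using T by (auto simp: indicator_def zero_le_mult_iff)
  show "laplace_integrable (\<lambda>x. f (T * x)) c" if "laplace_integrable f (c / T)"
    using lborel_integrable_real_affine[of ?g T 0] that T unfolding set_integrable_def eq by simp
  have "integral\<^sup>L lborel ?g = \<bar>T\<bar> *\<^sub>R (\<integral>x. ?g (0 + T * x) \<partial>lborel)"
    using T by (intro lborel_integral_real_affine) simp
  then show "laplace (\<lambda>x. f (T * x)) c = laplace f (c / T) / T"
    unfolding set_lebesgue_integral_def eq using T by (simp add: field_simps)
qed

lemma laplace_shift:
  assumes v: "0 \<le> v" and f: "\<And>x. 0 \<le> x \<Longrightarrow> x < v \<Longrightarrow> f x = 0"
  shows "laplace_integrable f l \<Longrightarrow> laplace_integrable (\<lambda>x. f (v + x)) l"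
    and "laplace f l = exp (- l * v) * laplace (\<lambda>x. f (v + x)) l"
proof -
  let ?g = "\<lambda>x. indicat_real {0..} x *\<^sub>R (exp (- l * x) * f x)"
  have eq: "?g (v + 1 * x) = exp (- l * v) * (indicat_real {0..} x *\<^sub>R (exp (- l * x) * f (v + x)))" for x
  proof (cases "0 \<le> x")
    case True
    then show ?thesis using v by (simp add: mult.assoc[symmetric] exp_add[symmetric] distrib_left)
  next
    case False
    then show ?thesis using f[of "v + x"] by (auto simp: indicator_def)
  qed
  show "laplace_integrable (\<lambda>x. f (v + x)) l" if "laplace_integrable f l"
    using lborel_integrable_real_affine[of ?g 1 v] that unfolding set_integrable_def eq by simp
  have "integral\<^sup>L lborel ?g = \<bar>1\<bar> *\<^sub>R (\<integral>x. ?g (v + 1 * x) \<partial>lborel)"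
    by (intro lborel_integral_real_affine) simp
  then show "laplace f l = exp (- l * v) * laplace (\<lambda>x. f (v + x)) l"
    unfolding set_lebesgue_integral_def eq by simp
qed

lemma powr_neg_large:
  fixes \<rho> B :: real assumes "0 < \<rho>"
  obtains l where "0 < l" "l \<le> 1" "B \<le> l powr (- \<rho>)"
proof -
  have "filterlim (\<lambda>l::real. l powr (- \<rho>)) at_top (at_right 0)" using assms by real_asymp
  then have "eventually (\<lambda>l. B \<le> l powr (- \<rho>)) (at_right 0)" by (simp add: filterlim_at_top)
  moreover have "eventually (\<lambda>l::real. 0 < l \<and> l \<le> 1) (at_right 0)"
    by (auto simp: eventually_at_right_field intro!: exI[of _ 1])
  ultimately have "eventually (\<lambda>l. 0 < l \<and> l \<le> 1 \<and> B \<le> l powr (- \<rho>)) (at_right (0::real))"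
    by eventually_elim auto
  then show ?thesis using that eventually_happens'[of "at_right (0::real)"] by auto
qed

text \<open>Without limits, \<open>f T 1\<close> is bounded by comparing \<open>f T\<close> with functions whose transforms are
  explicit. One bound uses a multiple of \<open>f T 1\<close> that lies below \<open>f T\<close>. For the other one, \<open>f T\<close>
  is at most \<open>f T 1\<close> on one side of 1, and on the other side it is dominated by an exponential
  multiple of itself whose transform is negligible against that of \<open>f T\<close>: for increasing functions
  in the limit of large \<open>l\<close>, for decreasing functions in the limit of small \<open>l\<close>.\<close>
theorem monotone_tauberian_bounds:
  fixes f :: "'a \<Rightarrow> real \<Rightarrow> real" and \<rho> c C :: real
  assumes \<rho>: "0 < \<rho>" and c: "0 < c" and C: "0 < C"
    and f: "\<forall>\<^sub>F T in F. (\<forall>x\<ge>0. 0 \<le> f T x) \<and> (\<forall>l>0. laplace_integrable (f T) l)"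
    and mono: "(\<forall>\<^sub>F T in F. mono_on {0..} (f T)) \<or> (\<forall>\<^sub>F T in F. antimono_on {0..} (f T))"
    and lim: "\<And>l. l > 0 \<Longrightarrow> \<forall>\<^sub>F T in F. c * l powr (- \<rho>) \<le> laplace (f T) l \<and> laplace (f T) l \<le> C * l powr (- \<rho>)"
  shows "\<exists>k>0. \<exists>K>0. \<forall>\<^sub>F T in F. k \<le> f T 1 \<and> f T 1 \<le> K"
  using mono
proof
  have quarter: "(0::real) < 1 / 4" by simp
  assume m: "\<forall>\<^sub>F T in F. mono_on {0..} (f T)"
  \<comment> \<open>For \<open>x > 1\<close> the factor \<open>exp (- l * x)\<close> is at most \<open>exp (- l / 2) * exp (- l / 2 * x)\<close>. So the
    part of the transform beyond 1 is at most \<open>exp (- l / 2)\<close> times the transform at \<open>l / 2\<close>, and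
    for this \<open>l\<close> it is at most half of the lower bound on the transform at \<open>l\<close>.\<close>
  have "((\<lambda>l::real. exp (- l / 2) * (C * 2 powr \<rho>)) \<longlongrightarrow> 0) at_top" by real_asymp
  then have "\<forall>\<^sub>F l in at_top. exp (- l / 2) * (C * 2 powr \<rho>) < c / 2" using c by (intro order_tendstoD) auto
  then have "\<forall>\<^sub>F l in at_top. 0 < l \<and> exp (- l / 2) * (C * 2 powr \<rho>) < c / 2"
    using eventually_gt_at_top[of "0::real"] by eventually_elim auto
  then obtain l :: real where l: "0 < l" "exp (- l / 2) * (C * 2 powr \<rho>) < c / 2"
    using eventually_happens'[OF trivial_limit_at_top_linorder] by blast
  have "\<forall>\<^sub>F T in F. c / 2 * l powr (1 - \<rho>) \<le> f T 1 \<and> f T 1 \<le> C * (1 / 4) powr (- \<rho>)"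
    using m f lim[OF l(1)] lim[OF half_gt_zero[OF l(1)]] lim[OF quarter]
  proof eventually_elim
    case (elim T)
    have fi: "laplace_integrable (f T) b" if "0 < b" for b using elim(2) that by blast
    have mono: "f T x \<le> f T y" if "0 \<le> x" "x \<le> y" for x y
      using elim(1) that by (auto simp: monotone_on_def)
    have f1: "0 \<le> f T 1" using elim(2) by simp
    have l2: "l + - l / 2 = l / 2" by simp
    have hi: "laplace_integrable (\<lambda>x. f T 1 * 1) l" by (rule laplace_integrable_cmult[OF laplace_one(1)[OF l(1)]])
    have hi': "laplace_integrable (\<lambda>x. exp (- l / 2) * (exp (- (- l / 2) * x) * f T x)) l"
      by (rule laplace_integrable_cmult) (unfold laplace_exp_mult l2, use fi[of "l / 2"] l(1) in simp)
    have "laplace (f T) l \<le> laplace (\<lambda>x. f T 1 * 1 + exp (- l / 2) * (exp (- (- l / 2) * x) * f T x)) l"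
    proof (rule laplace_mono[OF fi[OF l(1)] laplace_integrable_add[OF hi hi']])
      fix x :: real assume x: "0 \<le> x"
      have fx: "0 \<le> f T x" using elim(2) x by simp
      show "f T x \<le> f T 1 * 1 + exp (- l / 2) * (exp (- (- l / 2) * x) * f T x)"
      proof (cases "x \<le> 1")
        case True
        then have "f T x \<le> f T 1" using mono x by simp
        then show ?thesis using fx by (simp add: add_increasing2)
      next
        case False
        then have "1 \<le> exp (- l / 2) * exp (- (- l / 2) * x)"
          using l(1) by (simp add: exp_add[symmetric] one_le_exp_iff)
        then have "1 * f T x \<le> (exp (- l / 2) * exp (- (- l / 2) * x)) * f T x" using fx by (rule mult_right_mono)
        then show ?thesis using f1 by (simp add: mult.assoc)
      qed
    qed
    also have "\<dots> = f T 1 * (1 / l) + exp (- l / 2) * laplace (f T) (l / 2)"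
      unfolding laplace_add[OF hi hi'] laplace_cmult laplace_exp_mult laplace_one(2)[OF l(1)] l2 ..
    also have "\<dots> \<le> f T 1 * (1 / l) + exp (- l / 2) * (C * (l / 2) powr (- \<rho>))"
      using elim by (intro add_left_mono mult_left_mono) auto
    also have "(l / 2) powr (- \<rho>) = 2 powr \<rho> * l powr (- \<rho>)"
      using l(1) by (simp add: powr_divide powr_minus field_simps)
    also have "exp (- l / 2) * (C * (2 powr \<rho> * l powr (- \<rho>))) \<le> c / 2 * l powr (- \<rho>)"
      using mult_right_mono[OF less_imp_le[OF l(2)], of "l powr (- \<rho>)"] by (simp add: mult.assoc)
    finally have "c * l powr (- \<rho>) \<le> f T 1 * (1 / l) + c / 2 * l powr (- \<rho>)" using elim(3) by linarith
    moreover have "c * l powr (- \<rho>) = c / 2 * l powr (- \<rho>) + c / 2 * l powr (- \<rho>)" by simp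
    ultimately have "c / 2 * l powr (- \<rho>) \<le> f T 1 * (1 / l)" by linarith
    then have "c / 2 * l powr (- \<rho>) \<le> f T 1 / l" by simp
    then have "c / 2 * (l powr (- \<rho>) * l) \<le> f T 1" using l(1) by (simp add: field_simps)
    then have lower: "c / 2 * l powr (1 - \<rho>) \<le> f T 1" using l(1) by (simp add: powr_diff powr_minus field_simps)
    \<comment> \<open>The function \<open>1 - exp (1 - x)\<close> is at most the indicator of \<open>{1..}\<close>; its transform at
      \<open>1 / 4\<close> is \<open>4 - exp 1 * 4 / 5\<close>, which exceeds 1.\<close>
    let ?g = "\<lambda>x::real. f T 1 * 1 - f T 1 * exp 1 * (exp (- 1 * x) * 1)"
    have gi: "laplace_integrable (\<lambda>x. f T 1 * 1) (1 / 4)" "laplace_integrable (\<lambda>x. f T 1 * exp 1 * (exp (- 1 * x) * 1)) (1 / 4)"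
      by (intro laplace_integrable_cmult laplace_one; simp)
         (rule laplace_integrable_cmult, subst laplace_exp_mult, rule laplace_one, simp)
    have "f T 1 * 1 \<le> f T 1 * (4 - exp 1 * (4 / 5))" using exp_le f1 by (intro mult_left_mono) auto
    also have "\<dots> = laplace ?g (1 / 4)"
      unfolding laplace_diff[OF gi] laplace_cmult laplace_exp_mult
      by (subst laplace_one, simp, subst laplace_one, simp) (simp add: algebra_simps)
    also have "\<dots> \<le> laplace (f T) (1 / 4)"
    proof (rule laplace_mono[OF laplace_integrable_diff[OF gi] fi])
      fix x :: real assume x: "0 \<le> x"
      show "?g x \<le> f T x"
      proof (cases "x \<le> 1")
        case True
        then have "1 \<le> exp 1 * exp (- 1 * x)" by (simp add: exp_add[symmetric] one_le_exp_iff)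
        then have "f T 1 * 1 \<le> f T 1 * (exp 1 * exp (- 1 * x))" using f1 by (rule mult_left_mono)
        then have "?g x \<le> 0" by (simp add: mult.assoc)
        also have "0 \<le> f T x" using elim(2) x by simp
        finally show ?thesis .
      next
        case False
        then have "f T 1 \<le> f T x" using mono by simp
        moreover have "0 \<le> f T 1 * exp 1 * (exp (- 1 * x) * 1)" using f1 by simp
        ultimately show ?thesis by linarith
      qed
    qed simp
    also have "\<dots> \<le> C * (1 / 4) powr (- \<rho>)" using elim by simp
    finally have "f T 1 \<le> C * (1 / 4) powr (- \<rho>)" by simp
    with lower show ?case by simp
  qed
  then show ?thesis using l c C by (intro exI[of _ "c / 2 * l powr (1 - \<rho>)"] exI[of _ "C * (1 / 4) powr (- \<rho>)"] conjI) auto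
next
  assume m: "\<forall>\<^sub>F T in F. antimono_on {0..} (f T)"
  \<comment> \<open>For \<open>x \<le> 1\<close> the factor \<open>exp (- l * x)\<close> is at most \<open>exp 1 * exp (- x)\<close>. So the part of the
    transform before 1 is at most \<open>exp 1\<close> times the transform at 1, which stays bounded while the
    transform at \<open>l\<close> grows as \<open>l\<close> tends to 0.\<close>
  obtain l where l: "0 < l" "l \<le> 1" "2 * exp 1 * C / c \<le> l powr (- \<rho>)" using powr_neg_large[OF \<rho>] by blast
  have "\<forall>\<^sub>F T in F. exp 1 * C * l \<le> f T 1 \<and> f T 1 \<le> 12 * C * 4 powr (- \<rho>)"
    using m f lim[OF l(1)] lim[OF zero_less_numeral[of "num.Bit0 (num.Bit0 num.One)"]] lim[OF zero_less_one]
  proof eventually_elim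
    case (elim T)
    have fi: "laplace_integrable (f T) b" if "0 < b" for b using elim(2) that by blast
    have mono: "f T y \<le> f T x" if "0 \<le> x" "x \<le> y" for x y
      using elim(1) that by (auto simp: monotone_on_def)
    have f1: "0 \<le> f T 1" using elim(2) by simp
    have l2: "l + (1 - l) = 1" by simp
    have hi: "laplace_integrable (\<lambda>x. f T 1 * 1) l" by (rule laplace_integrable_cmult[OF laplace_one(1)[OF l(1)]])
    have hi': "laplace_integrable (\<lambda>x. exp 1 * (exp (- (1 - l) * x) * f T x)) l"
      by (rule laplace_integrable_cmult) (unfold laplace_exp_mult l2, rule fi, simp)
    have "laplace (f T) l \<le> laplace (\<lambda>x. f T 1 * 1 + exp 1 * (exp (- (1 - l) * x) * f T x)) l"
    proof (rule laplace_mono[OF fi[OF l(1)] laplace_integrable_add[OF hi hi']])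
      fix x :: real assume x: "0 \<le> x"
      have fx: "0 \<le> f T x" using elim(2) x by simp
      show "f T x \<le> f T 1 * 1 + exp 1 * (exp (- (1 - l) * x) * f T x)"
      proof (cases "x \<le> 1")
        case True
        have "(1 - l) * x \<le> 1 * 1" using l True x by (intro mult_mono) auto
        then have "1 \<le> exp 1 * exp (- (1 - l) * x)" by (simp add: exp_add[symmetric] one_le_exp_iff algebra_simps)
        then have "1 * f T x \<le> (exp 1 * exp (- (1 - l) * x)) * f T x" using fx by (rule mult_right_mono)
        then show ?thesis using f1 by (simp add: mult.assoc)
      next
        case False
        then have "f T x \<le> f T 1" using mono by simp
        then show ?thesis using fx by (simp add: add_increasing2)
      qed
    qed
    also have "\<dots> = f T 1 * (1 / l) + exp 1 * laplace (f T) 1"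
      unfolding laplace_add[OF hi hi'] laplace_cmult laplace_exp_mult laplace_one(2)[OF l(1)] l2 ..
    also have "\<dots> \<le> f T 1 * (1 / l) + exp 1 * C" using elim by simp
    finally have *: "c * l powr (- \<rho>) \<le> f T 1 * (1 / l) + exp 1 * C" using elim by simp
    have "2 * exp 1 * C \<le> c * l powr (- \<rho>)" using l(3) c by (simp add: field_simps)
    then have "exp 1 * C \<le> f T 1 / l" using * by simp
    then have lower: "exp 1 * C * l \<le> f T 1" using l(1) by (simp add: field_simps)
    \<comment> \<open>The function \<open>1 - exp (x - 1)\<close> is at most the indicator of \<open>{..1}\<close>; its transform at 4 is
      \<open>1 / 4 - exp (- 1) / 3\<close>, at least \<open>1 / 12\<close>.\<close>
    let ?g = "\<lambda>x::real. f T 1 * 1 - f T 1 * exp (- 1) * (exp (- (- 1) * x) * 1)"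
    have gi: "laplace_integrable (\<lambda>x. f T 1 * 1) 4" "laplace_integrable (\<lambda>x. f T 1 * exp (- 1) * (exp (- (- 1) * x) * 1)) 4"
      by (intro laplace_integrable_cmult laplace_one; simp)
         (rule laplace_integrable_cmult, subst laplace_exp_mult, rule laplace_one, simp)
    have "exp (- 1) \<le> (1 / 2 :: real)" using exp_ge_add_one_self[of "1::real"] by (simp add: exp_minus field_simps)
    then have "f T 1 * (1 / 12) \<le> f T 1 * (1 / 4 - exp (- 1) * (1 / 3))" using f1 by (intro mult_left_mono) auto
    also have "\<dots> = laplace ?g 4"
      unfolding laplace_diff[OF gi] laplace_cmult laplace_exp_mult
      by (subst laplace_one, simp, subst laplace_one, simp) (simp add: algebra_simps)
    also have "\<dots> \<le> laplace (f T) 4"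
    proof (rule laplace_mono[OF laplace_integrable_diff[OF gi] fi])
      fix x :: real assume x: "0 \<le> x"
      show "?g x \<le> f T x"
      proof (cases "x \<le> 1")
        case False
        then have "1 \<le> exp (- 1) * exp (- (- 1) * x)" by (simp add: exp_add[symmetric] one_le_exp_iff)
        then have "f T 1 * 1 \<le> f T 1 * (exp (- 1) * exp (- (- 1) * x))" using f1 by (rule mult_left_mono)
        then have "?g x \<le> 0" by (simp add: mult.assoc)
        also have "0 \<le> f T x" using elim(2) x by simp
        finally show ?thesis .
      next
        case True
        then have "f T 1 \<le> f T x" using mono x by simp
        moreover have "0 \<le> f T 1 * exp (- 1) * (exp (- (- 1) * x) * 1)" using f1 by simp
        ultimately show ?thesis by linarith
      qed
    qed simp
    also have "\<dots> \<le> C * 4 powr (- \<rho>)" using elim by simp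
    finally have "f T 1 \<le> 12 * C * 4 powr (- \<rho>)" by simp
    with lower show ?case by simp
  qed
  then show ?thesis using l c C
    by (intro exI[of _ "exp 1 * C * l"] exI[of _ "12 * C * 4 powr (- \<rho>)"] conjI) auto
qed

section \<open>First passage in terms of the potential function\<close>

text \<open>The analytic content of the problem without the process: \<open>U t\<close> is the expected local time up
  to \<open>t\<close>, and \<open>H u t\<close> is the probability that the first increase of the local time after \<open>u\<close>
  occurs by time \<open>t\<close>. The last assumption is the strong Markov property at this first increase; it
  determines \<open>H\<close> from \<open>U\<close>.\<close>
locale passage_problem =
  fixes U :: "real \<Rightarrow> real" and H :: "real \<Rightarrow> real \<Rightarrow> real"
  assumes U_mono: "s \<le> t \<Longrightarrow> U s \<le> U t" and U_nonpos: "t \<le> 0 \<Longrightarrow> U t = 0"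
    and U_laplace: "0 < l \<Longrightarrow> laplace_integrable U l" and U_laplace_pos: "0 < l \<Longrightarrow> 0 < laplace U l"
    and H_bounds: "0 \<le> H u t" "H u t \<le> 1" and H_mono: "0 \<le> u \<Longrightarrow> s \<le> t \<Longrightarrow> H u s \<le> H u t"
    and H_before: "0 \<le> t \<Longrightarrow> t < u \<Longrightarrow> H u t = 0"
    and H_laplace: "0 \<le> u \<Longrightarrow> 0 < l \<Longrightarrow> laplace (\<lambda>s. U s - U (min s u)) l = l * laplace (H u) l * laplace U l"
begin

definition R :: "real \<Rightarrow> real" where "R l = l * laplace U l"

lemma R_pos: "0 < l \<Longrightarrow> 0 < R l"
  unfolding R_def by (intro mult_pos_pos U_laplace_pos)

lemma U_nonneg: "0 \<le> U t"
  using U_mono[of "min t 0" t] U_nonpos[of "min t 0"] by simp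

lemma U_measurable [measurable]: "U \<in> borel_measurable borel"
  by (intro borel_measurable_mono) (simp add: mono_def U_mono)

lemma U_min_integrable: "0 < l \<Longrightarrow> laplace_integrable (\<lambda>s. U (min s u)) l"
  by (rule laplace_integrable_bound[OF U_laplace]) (auto simp: U_nonneg intro: U_mono)

lemma H_integrable:
  assumes "0 \<le> u" "0 < l" shows "laplace_integrable (H u) l"
proof (rule laplace_integrable_bound[OF laplace_one(1)[OF assms(2)]])
  show "H u \<in> borel_measurable borel" using assms by (intro borel_measurable_mono) (simp add: mono_def H_mono)
qed (auto simp: H_bounds)

lemma survival_laplace:
  assumes "0 \<le> u" "0 < l"
  shows "laplace_integrable (\<lambda>t. 1 - H u t) l"
    and "R l * laplace (\<lambda>t. 1 - H u t) l = laplace (\<lambda>s. U (min s u)) l"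
proof -
  note i = laplace_one(1)[OF assms(2)] H_integrable[OF assms]
  show "laplace_integrable (\<lambda>t. 1 - H u t) l" by (rule laplace_integrable_diff[OF i])
  have "laplace U l - laplace (\<lambda>s. U (min s u)) l = l * laplace (H u) l * laplace U l"
    using H_laplace[OF assms] laplace_diff[OF U_laplace[OF assms(2)] U_min_integrable[OF assms(2)], of u] by simp
  then show "R l * laplace (\<lambda>t. 1 - H u t) l = laplace (\<lambda>s. U (min s u)) l"
    unfolding laplace_diff[OF i] laplace_one(2)[OF assms(2)] R_def using assms(2) by (simp add: algebra_simps)
qed

text \<open>The integrand is at most \<open>U u\<close>, with equality from \<open>u\<close> on. Thus both sides agree up to the
  factor \<open>exp (- l * u)\<close>, which is close to 1 when \<open>u\<close> is short on the time scale \<open>1 / l\<close>.\<close>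
lemma U_min_laplace_bounds:
  assumes u: "0 \<le> u" and l: "0 < l"
  shows "l * laplace (\<lambda>s. U (min s u)) l \<le> U u"
    and "exp (- l * u) * U u \<le> l * laplace (\<lambda>s. U (min s u)) l"
proof -
  have c: "laplace_integrable (\<lambda>s. U u * 1) l" by (rule laplace_integrable_cmult[OF laplace_one(1)[OF l]])
  have "laplace (\<lambda>s. U (min s u)) l \<le> laplace (\<lambda>s. U u * 1) l"
    by (rule laplace_mono[OF U_min_integrable[OF l] c]) (simp add: U_mono)
  also have "\<dots> = U u / l" unfolding laplace_cmult laplace_one(2)[OF l] by simp
  finally show "l * laplace (\<lambda>s. U (min s u)) l \<le> U u" using l by (simp add: field_simps)
  let ?f = "\<lambda>s. if s < u then 0 else U u"
  have fi: "laplace_integrable ?f l" by (rule laplace_integrable_bound[OF c]) (auto simp: U_nonneg)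
  have "laplace ?f l = exp (- l * u) * laplace (\<lambda>x. ?f (u + x)) l"
    by (rule laplace_shift(2)[OF u]) simp
  also have "laplace (\<lambda>x. ?f (u + x)) l = laplace (\<lambda>x. U u * 1) l"
    by (intro set_lebesgue_integral_cong) auto
  also have "\<dots> = U u / l" unfolding laplace_cmult laplace_one(2)[OF l] by simp
  finally have "exp (- l * u) * (U u / l) = laplace ?f l" ..
  also have "\<dots> \<le> laplace (\<lambda>s. U (min s u)) l"
    by (rule laplace_mono[OF fi U_min_integrable[OF l]]) (auto simp: U_nonneg min_def)
  finally show "exp (- l * u) * U u \<le> l * laplace (\<lambda>s. U (min s u)) l" using l by (simp add: field_simps)
qed

text \<open>Both sides of the passage identity vanish before \<open>v\<close>; shifting them by \<open>v\<close> removes the same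
  factor \<open>exp (- l * v)\<close>.\<close>
lemma increment_laplace:
  assumes v: "0 \<le> v" and l: "0 < l"
  shows "laplace_integrable (\<lambda>s. H v (v + s)) l" "laplace_integrable (\<lambda>s. U (v + s) - U v) l"
    "R l * laplace (\<lambda>s. H v (v + s)) l = laplace (\<lambda>s. U (v + s) - U v) l"
proof -
  show "laplace_integrable (\<lambda>s. H v (v + s)) l"
    by (rule laplace_shift(1)[OF v _ H_integrable[OF v l]]) (simp add: H_before)
  let ?d = "\<lambda>s. U s - U (min s v)"
  have d: "laplace_integrable ?d l" by (rule laplace_integrable_diff[OF U_laplace[OF l] U_min_integrable[OF l]])
  have eq: "laplace (\<lambda>s. ?d (v + s)) l = laplace (\<lambda>s. U (v + s) - U v) l"
    by (intro set_lebesgue_integral_cong) auto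
  have "laplace_integrable (\<lambda>s. ?d (v + s)) l" by (rule laplace_shift(1)[OF v _ d]) simp
  also have "?this \<longleftrightarrow> laplace_integrable (\<lambda>s. U (v + s) - U v) l"
    by (intro set_integrable_cong) auto
  finally show "laplace_integrable (\<lambda>s. U (v + s) - U v) l" .
  have 1: "laplace ?d l = exp (- l * v) * laplace (\<lambda>s. ?d (v + s)) l" by (rule laplace_shift(2)[OF v]) simp
  have 2: "laplace (H v) l = exp (- l * v) * laplace (\<lambda>s. H v (v + s)) l"
    by (rule laplace_shift(2)[OF v]) (simp add: H_before)
  have "exp (- l * v) * (R l * laplace (\<lambda>s. H v (v + s)) l) = exp (- l * v) * laplace (\<lambda>s. U (v + s) - U v) l"
    using H_laplace[OF v l] unfolding 1 2 eq R_def by (simp add: mult_ac)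
  then show "R l * laplace (\<lambda>s. H v (v + s)) l = laplace (\<lambda>s. U (v + s) - U v) l" by simp
qed

end

section \<open>Scaled transforms\<close>

locale regular_passage = passage_problem U H
  for U :: "real \<Rightarrow> real" and H :: "real \<Rightarrow> real \<Rightarrow> real" +
  fixes \<alpha> :: real and ell \<epsilon> :: "real \<Rightarrow> real"
  assumes \<alpha>: "0 < \<alpha>" "\<alpha> < 1"
    and ell_pos: "0 < x \<Longrightarrow> 0 < ell x" and ell_slow: "0 < c \<Longrightarrow> ((\<lambda>x. ell (c * x) / ell x) \<longlongrightarrow> 1) at_top"
    and \<epsilon>: "0 < t \<Longrightarrow> 0 < \<epsilon> t" "0 < t \<Longrightarrow> \<epsilon> t < 1" and \<epsilon>0: "(\<epsilon> \<longlongrightarrow> 0) at_top"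
    and \<epsilon>_inf: "filterlim (\<lambda>t. \<epsilon> t * t) at_top at_top"
begin

text \<open>For slowly varying \<open>ell\<close>, regular variation of \<open>R\<close> at 0, in the form
  \<open>R l \<sim> l powr (- \<alpha>) / ell (1 / l)\<close>, says that \<open>A c T\<close> tends to \<open>c powr (- \<alpha>)\<close> for every \<open>c\<close>.\<close>
definition A :: "real \<Rightarrow> real \<Rightarrow> real" where "A c T = R (c / T) * ell T * T powr (- \<alpha>)"

text \<open>The regular variation of \<open>U\<close> that corresponds to that of \<open>R\<close> says that \<open>Y\<close> converges.\<close>
definition Y :: "real \<Rightarrow> real" where "Y T = U T * ell T * T powr (- \<alpha>)"

lemma A_pos: "0 < c \<Longrightarrow> 0 < T \<Longrightarrow> 0 < A c T"
  by (simp add: A_def R_pos ell_pos)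

definition scaled_U :: "real \<Rightarrow> real \<Rightarrow> real" where "scaled_U T x = ell T * T powr (- \<alpha>) * U (T * x)"

lemma scaled_U_laplace:
  assumes "0 < T" "0 < c"
  shows "laplace_integrable (scaled_U T) c" "laplace (scaled_U T) c = A c T / c"
proof -
  show "laplace_integrable (scaled_U T) c"
    unfolding scaled_U_def[abs_def] using assms by (intro laplace_integrable_cmult laplace_scale(1) U_laplace) auto
  have "laplace (scaled_U T) c = ell T * T powr (- \<alpha>) * (laplace U (c / T) / T)"
    unfolding scaled_U_def[abs_def] laplace_cmult laplace_scale(2)[OF assms(1), where f = U] ..
  then show "laplace (scaled_U T) c = A c T / c" using assms by (simp add: A_def R_def field_simps)
qed

lemma scaled_U_ok:
  "\<forall>\<^sub>F T in at_top. (\<forall>x\<ge>0. 0 \<le> scaled_U T x) \<and> (\<forall>c>0. laplace_integrable (scaled_U T) c)"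
  "\<forall>\<^sub>F T in at_top. mono_on {0..} (scaled_U T)"
proof -
  show "\<forall>\<^sub>F T in at_top. (\<forall>x\<ge>0. 0 \<le> scaled_U T x) \<and> (\<forall>c>0. laplace_integrable (scaled_U T) c)"
    by (rule eventually_mono[OF eventually_gt_at_top[of 0]], intro conjI allI impI scaled_U_laplace(1))
       (auto simp: scaled_U_def U_nonneg ell_pos less_imp_le)
  show "\<forall>\<^sub>F T in at_top. mono_on {0..} (scaled_U T)"
    by (rule eventually_mono[OF eventually_gt_at_top[of 0]])
       (auto simp: scaled_U_def ell_pos less_imp_le monotone_on_def intro!: mult_left_mono U_mono)
qed

text \<open>The probability that the passage after \<open>\<epsilon> T * T\<close> has not occurred at time \<open>T * x\<close>, divided
  by its expected order of magnitude \<open>U (\<epsilon> T * T) / R (1 / T)\<close>.\<close>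
definition scaled_survival :: "real \<Rightarrow> real \<Rightarrow> real" where
  "scaled_survival T x = (1 - H (\<epsilon> T * T) (T * x)) / (U (\<epsilon> T * T) * ell T * T powr (- \<alpha>))"

text \<open>By \<open>survival_laplace\<close> the transform of \<open>scaled_survival\<close> is a multiple of \<open>\<theta>\<close>, and
  \<open>U_min_laplace_bounds\<close> shows that \<open>\<theta>\<close> is close to 1.\<close>
definition \<theta> :: "real \<Rightarrow> real \<Rightarrow> real" where
  "\<theta> c T = c / T * laplace (\<lambda>s. U (min s (\<epsilon> T * T))) (c / T) / U (\<epsilon> T * T)"

lemma scaled_survival_laplace:
  assumes T: "0 < T" and c: "0 < c" 
  shows "laplace_integrable (scaled_survival T) c" and "0 < U (\<epsilon> T * T) \<Longrightarrow> laplace (scaled_survival T) c = \<theta> c T / (A c T * c)"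
proof -
  let ?u = "\<epsilon> T * T" and ?n = "1 / (U (\<epsilon> T * T) * ell T * T powr (- \<alpha>))"
  have u: "0 \<le> ?u" using \<epsilon>(1)[OF T] T by simp
  have cT: "0 < c / T" using assms by simp
  have f: "scaled_survival T = (\<lambda>x. ?n * (\<lambda>t. 1 - H ?u t) (T * x))" by (rule ext) (simp add: scaled_survival_def)
  show "laplace_integrable (scaled_survival T) c"
    unfolding f by (intro laplace_integrable_cmult laplace_scale(1)[OF T] survival_laplace(1)[OF u cT])
  assume U: "0 < U ?u"
  have s: "laplace (\<lambda>t. 1 - H ?u t) (c / T) = laplace (\<lambda>s. U (min s ?u)) (c / T) / R (c / T)"
    using survival_laplace(2)[OF u cT] R_pos[OF cT] by (simp add: field_simps)
  have "laplace (scaled_survival T) c = ?n * (laplace (\<lambda>t. 1 - H ?u t) (c / T) / T)"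
    unfolding f laplace_cmult laplace_scale(2)[OF T, where f = "\<lambda>t. 1 - H ?u t"] ..
  also have "\<dots> = \<theta> c T / (A c T * c)"
    unfolding s \<theta>_def A_def using U T c R_pos[OF cT] ell_pos[OF T] by (simp add: field_simps)
  finally show "laplace (scaled_survival T) c = \<theta> c T / (A c T * c)" .
qed

lemma \<theta>_limit:
  assumes U: "\<forall>\<^sub>F T in at_top. 0 < U (\<epsilon> T * T)" and c: "0 < c"
  shows "((\<lambda>T. \<theta> c T) \<longlongrightarrow> 1) at_top"
proof (rule tendsto_sandwich)
  have "((\<lambda>T. exp (- (c * \<epsilon> T))) \<longlongrightarrow> exp (- (c * 0))) at_top" by (intro tendsto_intros \<epsilon>0)
  then show "((\<lambda>T. exp (- (c * \<epsilon> T))) \<longlongrightarrow> 1) at_top" by simp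
  show "((\<lambda>T::real. 1::real) \<longlongrightarrow> 1) at_top" by simp
  show "\<forall>\<^sub>F T in at_top. exp (- (c * \<epsilon> T)) \<le> \<theta> c T"
    using U eventually_gt_at_top[of 0]
  proof eventually_elim
    case (elim T)
    have "exp (- (c / T) * (\<epsilon> T * T)) * U (\<epsilon> T * T) \<le> c / T * laplace (\<lambda>s. U (min s (\<epsilon> T * T))) (c / T)"
      using elim \<epsilon>(1)[of T] c by (intro U_min_laplace_bounds) auto
    then show ?case using elim by (simp add: \<theta>_def field_simps)
  qed
  show "\<forall>\<^sub>F T in at_top. \<theta> c T \<le> 1"
    using U eventually_gt_at_top[of 0]
  proof eventually_elim
    case (elim T)
    have "c / T * laplace (\<lambda>s. U (min s (\<epsilon> T * T))) (c / T) \<le> U (\<epsilon> T * T)"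
      using elim \<epsilon>(1)[of T] c by (intro U_min_laplace_bounds) auto
    then show ?case using elim by (simp add: \<theta>_def field_simps)
  qed
qed

lemma scaled_survival_ok:
  "\<forall>\<^sub>F T in at_top. (\<forall>x\<ge>0. 0 \<le> scaled_survival T x) \<and> (\<forall>c>0. laplace_integrable (scaled_survival T) c)"
  "\<forall>\<^sub>F T in at_top. antimono_on {0..} (scaled_survival T)"
proof -
  have d: "0 \<le> U (\<epsilon> T * T) * ell T * T powr (- \<alpha>)" if "0 < T" for T
    using ell_pos[OF that] by (intro mult_nonneg_nonneg U_nonneg) auto
  show "\<forall>\<^sub>F T in at_top. (\<forall>x\<ge>0. 0 \<le> scaled_survival T x) \<and> (\<forall>c>0. laplace_integrable (scaled_survival T) c)"
    by (rule eventually_mono[OF eventually_gt_at_top[of 0]], intro conjI allI impI scaled_survival_laplace(1))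
       (auto simp: scaled_survival_def H_bounds intro!: divide_nonneg_nonneg d)
  show "\<forall>\<^sub>F T in at_top. antimono_on {0..} (scaled_survival T)"
    by (rule eventually_mono[OF eventually_gt_at_top[of 0]])
       (auto simp: scaled_survival_def monotone_on_def \<epsilon>(1) less_imp_le intro!: divide_right_mono d diff_left_mono H_mono mult_left_mono)
qed

text \<open>The unit of time is now the length \<open>w = \<epsilon> T * T\<close> of the final window, which starts at
  \<open>(1 - \<epsilon> T) * T\<close>, so that \<open>x = 1\<close> is time \<open>T\<close>. In the denominator, \<open>T powr (\<alpha> - 1) / ell T\<close> is
  the order of the slope of \<open>U\<close> near \<open>T\<close>, and \<open>w powr (1 - \<alpha>) * ell w\<close> that of \<open>w / R (1 / w)\<close>.\<close>
definition scaled_passage :: "real \<Rightarrow> real \<Rightarrow> real" where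
  "scaled_passage T x = H ((1 - \<epsilon> T) * T) ((1 - \<epsilon> T) * T + \<epsilon> T * T * x) /
    (T powr (\<alpha> - 1) / ell T * (\<epsilon> T * T) powr (1 - \<alpha>) * ell (\<epsilon> T * T))"

text \<open>A function \<open>s \<mapsto> S * s\<close> has transform \<open>S / l\<^sup>2\<close>; so this is an average slope of \<open>U\<close> to the
  right of \<open>(1 - \<epsilon> T) * T\<close>, in units of its expected order.\<close>
definition \<theta>' :: "real \<Rightarrow> real \<Rightarrow> real" where
  "\<theta>' c T = (c / (\<epsilon> T * T))\<^sup>2 * laplace (\<lambda>s. U ((1 - \<epsilon> T) * T + s) - U ((1 - \<epsilon> T) * T)) (c / (\<epsilon> T * T)) /
    (T powr (\<alpha> - 1) / ell T)"

lemma scaled_passage_laplace: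
  assumes T: "0 < T" and c: "0 < c"
  shows "laplace_integrable (scaled_passage T) c" "laplace (scaled_passage T) c = \<theta>' c T / (A c (\<epsilon> T * T) * c\<^sup>2)"
proof -
  let ?w = "\<epsilon> T * T" and ?v = "(1 - \<epsilon> T) * T"
  let ?S = "T powr (\<alpha> - 1) / ell T"
  let ?n = "1 / (?S * ?w powr (1 - \<alpha>) * ell ?w)"
  have w: "0 < ?w" using \<epsilon>(1)[OF T] T by simp
  have v: "0 \<le> ?v" using \<epsilon>(2)[OF T] T by simp
  have S: "0 < ?S" using T ell_pos[OF T] by simp
  have cw: "0 < c / ?w" using w c by simp
  have f: "scaled_passage T = (\<lambda>x. ?n * (\<lambda>s. H ?v (?v + s)) (?w * x))" by (rule ext) (simp add: scaled_passage_def)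
  show "laplace_integrable (scaled_passage T) c"
    unfolding f by (intro laplace_integrable_cmult laplace_scale(1)[OF w] increment_laplace(1)[OF v cw])
  have s: "laplace (\<lambda>s. H ?v (?v + s)) (c / ?w) = laplace (\<lambda>s. U (?v + s) - U ?v) (c / ?w) / R (c / ?w)"
    using increment_laplace(3)[OF v cw] R_pos[OF cw] by (simp add: field_simps)
  have "laplace (scaled_passage T) c = ?n * (laplace (\<lambda>s. H ?v (?v + s)) (c / ?w) / ?w)"
    unfolding f laplace_cmult laplace_scale(2)[OF w, where f = "\<lambda>s. H ?v (?v + s)"] ..
  also have "\<dots> = \<theta>' c T / (A c ?w * c\<^sup>2)"
  proof -
    have p: "?w powr (1 - \<alpha>) = ?w * ?w powr (- \<alpha>)" using w by (simp add: powr_diff powr_minus field_simps)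
    define J where "J = laplace (\<lambda>s. U (?v + s) - U ?v) (c / ?w)"
    define S where "S = ?S"
    define w where "w = ?w"
    have pos: "0 < S" "0 < w" "0 < R (c / w)" "0 < ell w" "0 < w powr (- \<alpha>)"
      using \<open>0 < ?S\<close> \<open>0 < ?w\<close> R_pos[OF cw] ell_pos[OF \<open>0 < ?w\<close>] by (simp_all add: S_def w_def) (use w in auto)
    have "1 / (S * (w * w powr (- \<alpha>)) * ell w) * (J / R (c / w) / w) =
      (c / w)\<^sup>2 * J / S / (R (c / w) * ell w * w powr (- \<alpha>) * c\<^sup>2)"
      using pos c by (simp add: field_simps power2_eq_square)
    then show ?thesis unfolding s p \<theta>'_def A_def J_def S_def w_def .
  qed
  finally show "laplace (scaled_passage T) c = \<theta>' c T / (A c ?w * c\<^sup>2)" .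
qed

lemma scaled_passage_ok:
  "\<forall>\<^sub>F T in at_top. (\<forall>x\<ge>0. 0 \<le> scaled_passage T x) \<and> (\<forall>c>0. laplace_integrable (scaled_passage T) c)"
  "\<forall>\<^sub>F T in at_top. mono_on {0..} (scaled_passage T)"
proof -
  have d: "0 \<le> T powr (\<alpha> - 1) / ell T * (\<epsilon> T * T) powr (1 - \<alpha>) * ell (\<epsilon> T * T)" if "0 < T" for T
    using ell_pos[OF that] ell_pos[of "\<epsilon> T * T"] \<epsilon>(1)[OF that] that by simp
  show "\<forall>\<^sub>F T in at_top. (\<forall>x\<ge>0. 0 \<le> scaled_passage T x) \<and> (\<forall>c>0. laplace_integrable (scaled_passage T) c)"
  proof (rule eventually_mono[OF eventually_gt_at_top[of 0]], intro conjI allI impI scaled_passage_laplace(1))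
    show "0 \<le> scaled_passage T x" if "0 < T" for T x
      unfolding scaled_passage_def by (intro divide_nonneg_nonneg H_bounds d that)
  qed
  show "\<forall>\<^sub>F T in at_top. mono_on {0..} (scaled_passage T)"
  proof (rule eventually_mono[OF eventually_gt_at_top[of 0]], rule monotone_onI)
    fix T x y :: real assume T: "0 < T" and xy: "x \<le> y"
    show "scaled_passage T x \<le> scaled_passage T y"
      unfolding scaled_passage_def using T xy \<epsilon>[OF T]
      by (intro divide_right_mono d H_mono add_left_mono mult_left_mono mult_nonneg_nonneg) auto
  qed
qed

end

section \<open>A last visit in the distant past\<close>

lemma powr_minus_one_add: "0 < c \<Longrightarrow> c powr (- (1 + a)) = c powr (- a) / c" for a c :: real
proof -
  assume "0 < c"
  moreover have "- (1 + a) = - a - 1" by simp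
  ultimately show ?thesis by (simp only: powr_diff powr_one)
qed

lemma Gamma_reflection_real:
  "Gamma x * Gamma (1 - x) = pi / sin (pi * x)" for x :: real
proof -
  have "complex_of_real (Gamma x * Gamma (1 - x)) = Gamma (complex_of_real x) * Gamma (1 - complex_of_real x)"
    using Gamma_complex_of_real[of x] Gamma_complex_of_real[of "1 - x"] by simp
  also have "\<dots> = complex_of_real (pi / sin (pi * x))"
    unfolding Gamma_reflection_complex by (simp add: sin_of_real[symmetric])
  finally show ?thesis by (simp only: of_real_eq_iff)
qed

text \<open>The two Tauberian limits contribute \<open>Gamma (1 - \<alpha>)\<close> and \<open>Gamma (1 + \<alpha>)\<close>; this is the
  constant in the theorem.\<close>
lemma Gamma_sin:
  fixes x :: real assumes "0 < x"
  shows "1 / (Gamma (1 - x) * Gamma (1 + x)) = sin (pi * x) / (pi * x)"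
proof -
  have "x \<notin> \<int>\<^sub>\<le>\<^sub>0" using assms nonpos_Ints_nonpos[of x] by auto
  then have "Gamma (1 + x) = x * Gamma x" using Gamma_plus1[of x] by (simp add: add.commute)
  then have "Gamma (1 - x) * Gamma (1 + x) = x * (Gamma x * Gamma (1 - x))" by simp
  then show ?thesis unfolding Gamma_reflection_real by simp
qed

context regular_passage
begin

lemma scaled_U_1: "scaled_U T 1 = Y T"
  by (simp add: scaled_U_def Y_def)

lemma scaled_survival_1: "scaled_survival T 1 = (1 - H (\<epsilon> T * T) T) / (U (\<epsilon> T * T) * ell T * T powr (- \<alpha>))"
  by (simp add: scaled_survival_def)

text \<open>Splits the probability into two factors that converge by Tauberian arguments and the
  function in the theorem.\<close>
lemma early_probability:
  assumes T: "0 < T" and U: "0 < U (\<epsilon> T * T)"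
  shows "1 - H (\<epsilon> T * T) T = scaled_survival T 1 * Y (\<epsilon> T * T) * (ell T / ell (\<epsilon> T * T) * \<epsilon> T powr \<alpha>)"
proof -
  have w: "0 < \<epsilon> T * T" using \<epsilon>(1)[OF T] T by simp
  have p: "(\<epsilon> T * T) powr (- \<alpha>) * \<epsilon> T powr \<alpha> = T powr (- \<alpha>)"
    using T \<epsilon>(1)[OF T] by (simp add: powr_mult powr_minus field_simps)
  have "scaled_survival T 1 * (U (\<epsilon> T * T) * ell T * T powr (- \<alpha>)) = 1 - H (\<epsilon> T * T) T"
    unfolding scaled_survival_1 using T U ell_pos[OF T] by simp
  moreover have "Y (\<epsilon> T * T) * (ell T / ell (\<epsilon> T * T) * \<epsilon> T powr \<alpha>) = U (\<epsilon> T * T) * ell T * T powr (- \<alpha>)"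
    unfolding Y_def p[symmetric] using ell_pos[OF w] by simp
  ultimately show ?thesis by (simp only: mult.assoc)
qed

lemma late_probability:
  assumes T: "0 < T"
  shows "H ((1 - \<epsilon> T) * T) T = scaled_passage T 1 * (ell (\<epsilon> T * T) / ell T * \<epsilon> T powr (1 - \<alpha>))"
proof -
  have e: "0 < \<epsilon> T" using \<epsilon>(1)[OF T] .
  have "(\<epsilon> T * T) powr (1 - \<alpha>) * T powr (\<alpha> - 1) = \<epsilon> T powr (1 - \<alpha>) * (T powr (1 - \<alpha>) * T powr (\<alpha> - 1))"
    using T e by (simp add: powr_mult)
  also have "T powr (1 - \<alpha>) * T powr (\<alpha> - 1) = 1" using T by (simp add: powr_add[symmetric])
  finally have p: "T powr (\<alpha> - 1) / ell T * (\<epsilon> T * T) powr (1 - \<alpha>) * ell (\<epsilon> T * T) =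
     ell (\<epsilon> T * T) / ell T * \<epsilon> T powr (1 - \<alpha>)" by (simp add: field_simps)
  have "(1 - \<epsilon> T) * T + \<epsilon> T * T * 1 = T" by (simp add: algebra_simps)
  then have "scaled_passage T 1 = H ((1 - \<epsilon> T) * T) T / (ell (\<epsilon> T * T) / ell T * \<epsilon> T powr (1 - \<alpha>))"
    unfolding scaled_passage_def p by simp
  moreover have E: "ell (\<epsilon> T * T) / ell T * \<epsilon> T powr (1 - \<alpha>) \<noteq> 0"
    using ell_pos[OF T] ell_pos[of "\<epsilon> T * T"] T e by simp
  ultimately show ?thesis using iffD1[OF nonzero_eq_divide_eq[OF E]] by metis
qed

lemma scale_at_top: "filterlim (\<lambda>T. q * T) at_top at_top" if "0 < q" for q :: real
  using that by (intro filterlim_tendsto_pos_mult_at_top[OF tendsto_const]) (auto simp: filterlim_ident)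

lemma ell_ratio: "0 < q \<Longrightarrow> ((\<lambda>T. ell T / ell (q * T)) \<longlongrightarrow> 1) at_top"
  using tendsto_inverse[OF ell_slow[of q]] by (simp add: inverse_eq_divide)

text \<open>Slow variation extends the asymptotics of \<open>Y\<close> to all multiples of \<open>T\<close>, and so to increments
  of \<open>U\<close> over intervals proportional to \<open>T\<close>.\<close>
lemma scaled_U_eq_Y: "0 < T \<Longrightarrow> 0 < q \<Longrightarrow> scaled_U T q = Y (q * T) * q powr \<alpha> * (ell T / ell (q * T))"
  by (simp add: scaled_U_def Y_def powr_mult powr_minus field_simps ell_pos less_imp_neq[symmetric])

context
  assumes A_lim: "\<And>c. 0 < c \<Longrightarrow> (A c \<longlongrightarrow> c powr (- \<alpha>)) at_top"
begin

lemma Y_limit: "(Y \<longlongrightarrow> 1 / Gamma (1 + \<alpha>)) at_top"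
proof -
  have "((\<lambda>T. scaled_U T 1) \<longlongrightarrow> 1 / Gamma (1 + \<alpha>)) at_top"
  proof (rule monotone_tauberian)
    show "0 < 1 + \<alpha>" using \<alpha> by simp
    show "\<forall>\<^sub>F T in at_top. (\<forall>x\<ge>0. 0 \<le> scaled_U T x) \<and> (\<forall>c>0. laplace_integrable (scaled_U T) c)" by (rule scaled_U_ok)
    show "(\<forall>\<^sub>F T in at_top. mono_on {0..} (scaled_U T)) \<or> (\<forall>\<^sub>F T in at_top. antimono_on {0..} (scaled_U T))" using scaled_U_ok by blast
    fix c :: real assume c: "0 < c"
    have "((\<lambda>T. A c T / c) \<longlongrightarrow> c powr (- \<alpha>) / c) at_top" using c by (intro tendsto_divide A_lim tendsto_const) auto
    also have "c powr (- \<alpha>) / c = 1 * c powr (- (1 + \<alpha>))" using powr_minus_one_add[OF c] by simp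
    finally show "((\<lambda>T. laplace (scaled_U T) c) \<longlongrightarrow> 1 * c powr (- (1 + \<alpha>))) at_top"
      by (rule Lim_transform_eventually) (rule eventually_mono[OF eventually_gt_at_top[of 0]], simp only: scaled_U_laplace(2)[OF _ c])
  qed simp
  then show ?thesis by (simp only: scaled_U_1)
qed

lemma Y_pos: "\<forall>\<^sub>F T in at_top. 0 < Y T"
  using \<alpha> by (intro order_tendstoD(1)[OF Y_limit]) (simp add: Gamma_real_pos)

lemma U_eps_pos: "\<forall>\<^sub>F T in at_top. 0 < U (\<epsilon> T * T)"
  using eventually_compose_filterlim[OF Y_pos \<epsilon>_inf] eventually_compose_filterlim[OF eventually_gt_at_top[of 0] \<epsilon>_inf]
proof eventually_elim
  case (elim T)
  then show ?case using U_nonneg[of "\<epsilon> T * T"] by (cases "U (\<epsilon> T * T) = 0") (auto simp: Y_def)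
qed

lemma scaled_survival_limit: "((\<lambda>T. scaled_survival T 1) \<longlongrightarrow> 1 / Gamma (1 - \<alpha>)) at_top"
proof (rule monotone_tauberian)
  show "0 < 1 - \<alpha>" using \<alpha> by simp
  show "\<forall>\<^sub>F T in at_top. (\<forall>x\<ge>0. 0 \<le> scaled_survival T x) \<and> (\<forall>c>0. laplace_integrable (scaled_survival T) c)" by (rule scaled_survival_ok)
  show "(\<forall>\<^sub>F T in at_top. mono_on {0..} (scaled_survival T)) \<or> (\<forall>\<^sub>F T in at_top. antimono_on {0..} (scaled_survival T))" using scaled_survival_ok by blast
  fix c :: real assume c: "0 < c"
  have "((\<lambda>T. \<theta> c T / (A c T * c)) \<longlongrightarrow> 1 / (c powr (- \<alpha>) * c)) at_top"
    using c by (intro tendsto_divide tendsto_mult A_lim tendsto_const \<theta>_limit U_eps_pos) auto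
  also have "1 / (c powr (- \<alpha>) * c) = 1 * c powr (- (1 - \<alpha>))" using c by (simp add: powr_diff powr_minus field_simps)
  finally show "((\<lambda>T. laplace (scaled_survival T) c) \<longlongrightarrow> 1 * c powr (- (1 - \<alpha>))) at_top"
  proof (rule Lim_transform_eventually)
    show "\<forall>\<^sub>F T in at_top. \<theta> c T / (A c T * c) = laplace (scaled_survival T) c"
      using U_eps_pos eventually_gt_at_top[of 0] by eventually_elim (simp only: scaled_survival_laplace(2)[OF _ c])
  qed
qed simp

theorem early_limit:
  "((\<lambda>T. (1 - H (\<epsilon> T * T) T) / (sin (pi * \<alpha>) / (pi * \<alpha>) * (ell T / ell (\<epsilon> T * T)) * \<epsilon> T powr \<alpha>)) \<longlongrightarrow> 1) at_top"
proof -
  let ?C = "sin (pi * \<alpha>) / (pi * \<alpha>)"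
  have "((\<lambda>T. Y (\<epsilon> T * T)) \<longlongrightarrow> 1 / Gamma (1 + \<alpha>)) at_top" by (rule filterlim_compose[OF Y_limit \<epsilon>_inf])
  then have "((\<lambda>T. scaled_survival T 1 * Y (\<epsilon> T * T)) \<longlongrightarrow> 1 / Gamma (1 - \<alpha>) * (1 / Gamma (1 + \<alpha>))) at_top"
    by (intro tendsto_mult scaled_survival_limit)
  also have "1 / Gamma (1 - \<alpha>) * (1 / Gamma (1 + \<alpha>)) = ?C" unfolding Gamma_sin[OF \<alpha>(1), symmetric] by simp
  finally have l: "((\<lambda>T. scaled_survival T 1 * Y (\<epsilon> T * T)) \<longlongrightarrow> ?C) at_top" .
  have C: "?C > 0" unfolding Gamma_sin[OF \<alpha>(1), symmetric] using \<alpha> by (simp add: Gamma_real_pos)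
  have "((\<lambda>T. scaled_survival T 1 * Y (\<epsilon> T * T) / ?C) \<longlongrightarrow> ?C / ?C) at_top" using C by (intro tendsto_divide l tendsto_const) auto
  also have "?C / ?C = 1" using C by (intro divide_self) auto
  finally have "((\<lambda>T. scaled_survival T 1 * Y (\<epsilon> T * T) / ?C) \<longlongrightarrow> 1) at_top" .
  then show ?thesis
  proof (rule Lim_transform_eventually)
    show "\<forall>\<^sub>F T in at_top. scaled_survival T 1 * Y (\<epsilon> T * T) / ?C =
      (1 - H (\<epsilon> T * T) T) / (?C * (ell T / ell (\<epsilon> T * T)) * \<epsilon> T powr \<alpha>)"
      using U_eps_pos eventually_gt_at_top[of 0]
    proof eventually_elim
      case (elim T)
      have "ell T / ell (\<epsilon> T * T) * \<epsilon> T powr \<alpha> \<noteq> 0"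
        using elim ell_pos[of T] ell_pos[of "\<epsilon> T * T"] \<epsilon>(1)[of T] by simp
      then show ?case unfolding early_probability[OF elim(2,1)] mult.assoc[of ?C]
        by (rule mult_divide_mult_cancel_right[symmetric])
    qed
  qed
qed

lemma scaled_U_limit: "0 < q \<Longrightarrow> ((\<lambda>T. scaled_U T q) \<longlongrightarrow> q powr \<alpha> / Gamma (1 + \<alpha>)) at_top"
proof -
  assume q: "0 < q"
  have "((\<lambda>T. Y (q * T) * q powr \<alpha> * (ell T / ell (q * T))) \<longlongrightarrow> 1 / Gamma (1 + \<alpha>) * q powr \<alpha> * 1) at_top"
    by (intro tendsto_mult tendsto_const ell_ratio q filterlim_compose[OF Y_limit scale_at_top])
  then have "((\<lambda>T. Y (q * T) * q powr \<alpha> * (ell T / ell (q * T))) \<longlongrightarrow> q powr \<alpha> / Gamma (1 + \<alpha>)) at_top" by simp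
  then show ?thesis
    by (rule Lim_transform_eventually) (rule eventually_mono[OF eventually_gt_at_top[of 0]], simp only: scaled_U_eq_Y q)
qed

end

context
  fixes k K :: real
  assumes kK: "0 < k" "0 < K"
    and A_bounds: "\<And>c. 0 < c \<Longrightarrow> \<forall>\<^sub>F T in at_top. k * c powr (- \<alpha>) \<le> A c T \<and> A c T \<le> K * c powr (- \<alpha>)"
begin

lemma Y_bounds: "\<exists>k'>0. \<exists>K'>0. \<forall>\<^sub>F T in at_top. k' \<le> Y T \<and> Y T \<le> K'"
proof -
  have "\<exists>k'>0. \<exists>K'>0. \<forall>\<^sub>F T in at_top. k' \<le> scaled_U T 1 \<and> scaled_U T 1 \<le> K'"
  proof (rule monotone_tauberian_bounds[OF _ kK])
    show "0 < 1 + \<alpha>" using \<alpha> by simp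
    show "\<forall>\<^sub>F T in at_top. (\<forall>x\<ge>0. 0 \<le> scaled_U T x) \<and> (\<forall>c>0. laplace_integrable (scaled_U T) c)" by (rule scaled_U_ok)
    show "(\<forall>\<^sub>F T in at_top. mono_on {0..} (scaled_U T)) \<or> (\<forall>\<^sub>F T in at_top. antimono_on {0..} (scaled_U T))" using scaled_U_ok by blast
    fix c :: real assume c: "0 < c"
    have p: "z * c powr (- (1 + \<alpha>)) = z * c powr (- \<alpha>) / c" for z using powr_minus_one_add[OF c] by simp
    show "\<forall>\<^sub>F T in at_top. k * c powr (- (1 + \<alpha>)) \<le> laplace (scaled_U T) c \<and> laplace (scaled_U T) c \<le> K * c powr (- (1 + \<alpha>))"
      using A_bounds[OF c] eventually_gt_at_top[of 0]
      by eventually_elim (use c in \<open>simp only: scaled_U_laplace(2) p\<close>, auto intro: divide_right_mono)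
  qed
  then show ?thesis by (simp only: scaled_U_1)
qed

lemma U_eps_pos': "\<forall>\<^sub>F T in at_top. 0 < U (\<epsilon> T * T)"
proof -
  obtain k' K' where k': "0 < k'" "\<forall>\<^sub>F T in at_top. k' \<le> Y T \<and> Y T \<le> K'" using Y_bounds by blast
  show ?thesis
    using eventually_compose_filterlim[OF k'(2) \<epsilon>_inf]
  proof eventually_elim
    case (elim T)
    then show ?case using U_nonneg[of "\<epsilon> T * T"] k'(1) by (cases "U (\<epsilon> T * T) = 0") (auto simp: Y_def)
  qed
qed

lemma scaled_survival_bounds: "\<exists>k'>0. \<exists>K'>0. \<forall>\<^sub>F T in at_top. k' \<le> scaled_survival T 1 \<and> scaled_survival T 1 \<le> K'"
proof (rule monotone_tauberian_bounds)
  show "0 < 1 - \<alpha>" "0 < 1 / (2 * K)" "0 < 2 / k" using \<alpha> kK by auto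
  show "\<forall>\<^sub>F T in at_top. (\<forall>x\<ge>0. 0 \<le> scaled_survival T x) \<and> (\<forall>c>0. laplace_integrable (scaled_survival T) c)" by (rule scaled_survival_ok)
  show "(\<forall>\<^sub>F T in at_top. mono_on {0..} (scaled_survival T)) \<or> (\<forall>\<^sub>F T in at_top. antimono_on {0..} (scaled_survival T))" using scaled_survival_ok by blast
  fix c :: real assume c: "0 < c"
  have \<theta>: "\<forall>\<^sub>F T in at_top. 1 / 2 < \<theta> c T" "\<forall>\<^sub>F T in at_top. \<theta> c T < 2"
    by (intro order_tendstoD[OF \<theta>_limit[OF U_eps_pos' c]]; simp)+
  show "\<forall>\<^sub>F T in at_top. 1 / (2 * K) * c powr (- (1 - \<alpha>)) \<le> laplace (scaled_survival T) c \<and> laplace (scaled_survival T) c \<le> 2 / k * c powr (- (1 - \<alpha>))"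
    using A_bounds[OF c] \<theta> U_eps_pos' eventually_gt_at_top[of 0]
  proof eventually_elim
    case (elim T)
    define P where "P = c powr (- \<alpha>)"
    have P: "0 < P" "c powr (- (1 - \<alpha>)) = 1 / (P * c)" using c by (auto simp: P_def powr_diff powr_minus field_simps)
    have A: "k * P \<le> A c T" "A c T \<le> K * P" using elim by (auto simp: P_def)
    have Ap: "0 < A c T" using elim c by (intro A_pos)
    have "1 / 2 / (K * P * c) \<le> \<theta> c T / (A c T * c)"
      using elim A Ap c P kK by (intro frac_le mult_right_mono mult_pos_pos) auto
    moreover have "\<theta> c T / (A c T * c) \<le> 2 / (k * P * c)"
      using elim A Ap c P kK by (intro frac_le mult_right_mono mult_pos_pos) auto
    ultimately show ?case
      unfolding scaled_survival_laplace(2)[OF elim(5) c elim(4)] P(2) by (simp add: mult.assoc)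
  qed
qed

theorem early_bounds:
  "\<exists>k'>0. \<exists>K'>0. \<forall>\<^sub>F T in at_top.
    k' * (ell T / ell (\<epsilon> T * T) * \<epsilon> T powr \<alpha>) \<le> 1 - H (\<epsilon> T * T) T \<and>
    1 - H (\<epsilon> T * T) T \<le> K' * (ell T / ell (\<epsilon> T * T) * \<epsilon> T powr \<alpha>)"
proof -
  obtain k1 K1 where 1: "0 < k1" "0 < K1" "\<forall>\<^sub>F T in at_top. k1 \<le> Y T \<and> Y T \<le> K1" using Y_bounds by blast
  obtain k2 K2 where 2: "0 < k2" "0 < K2" "\<forall>\<^sub>F T in at_top. k2 \<le> scaled_survival T 1 \<and> scaled_survival T 1 \<le> K2" using scaled_survival_bounds by blast
  have "\<forall>\<^sub>F T in at_top.
    k2 * k1 * (ell T / ell (\<epsilon> T * T) * \<epsilon> T powr \<alpha>) \<le> 1 - H (\<epsilon> T * T) T \<and>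
    1 - H (\<epsilon> T * T) T \<le> K2 * K1 * (ell T / ell (\<epsilon> T * T) * \<epsilon> T powr \<alpha>)"
    using eventually_compose_filterlim[OF 1(3) \<epsilon>_inf] 2(3) U_eps_pos' eventually_gt_at_top[of 0]
  proof eventually_elim
    case (elim T)
    have g: "ell T / ell (\<epsilon> T * T) * \<epsilon> T powr \<alpha> \<ge> 0" using elim ell_pos[of T] ell_pos[of "\<epsilon> T * T"] \<epsilon>(1)[of T] by simp
    have b: "k2 * k1 \<le> scaled_survival T 1 * Y (\<epsilon> T * T)" "scaled_survival T 1 * Y (\<epsilon> T * T) \<le> K2 * K1"
      using elim 1(1,2) 2(1,2) by (auto intro!: mult_mono)
    then show ?case unfolding early_probability[OF elim(4,3)] by (intro conjI mult_right_mono g b)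
  qed
  then show ?thesis using 1 2 by (intro exI[of _ "k2 * k1"] exI[of _ "K2 * K1"] conjI) auto
qed

end

end

section \<open>A last visit in the recent past\<close>

lemma laplace_power:
  assumes l: "0 < l"
  shows "laplace_integrable (\<lambda>x. x ^ n) l" "laplace (\<lambda>x. x ^ n) l = fact n / l ^ Suc n"
proof -
  have e: "x powr (real (Suc n) - 1) = x ^ n" if "x \<in> {0<..}" for x :: real
    using that by (simp add: powr_realpow)
  have ae: "AE x in lborel. indicat_real {0..} x *\<^sub>R (exp (- l * x) * x powr (real (Suc n) - 1)) =
    indicat_real {0..} x *\<^sub>R (exp (- l * x) * x ^ n)"
    using AE_lborel_singleton[of "0::real"]
  proof eventually_elim
    case (elim x)
    show ?case
    proof (cases "0 < x")
      case True then show ?thesis using e[of x] by (simp only: greaterThan_iff)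
    next
      case False then show ?thesis using elim by simp
    qed
  qed
  have p: "l powr (- real (Suc n)) = 1 / l ^ Suc n"
    using l by (simp only: powr_minus powr_realpow inverse_eq_divide)
  have G: "Gamma (real (Suc n)) = fact n" using Gamma_fact[of n, where 'a = real] by (simp add: add.commute)
  have pos: "0 < real (Suc n)" by simp
  show "laplace_integrable (\<lambda>x. x ^ n) l"
    using laplace_powr(1)[OF pos l] integrable_cong_AE[OF _ _ ae] unfolding set_integrable_def by simp
  have "laplace (\<lambda>x. x ^ n) l = laplace (\<lambda>x. x powr (real (Suc n) - 1)) l"
    unfolding set_lebesgue_integral_def by (rule integral_cong_AE[symmetric, OF _ _ ae]) auto
  then show "laplace (\<lambda>x. x ^ n) l = fact n / l ^ Suc n"
    unfolding laplace_powr(2)[OF pos l] G p by simp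
qed

lemma laplace_linear:
  assumes l: "0 < l"
  shows "laplace_integrable (\<lambda>x. x) l" "laplace (\<lambda>x. x) l = 1 / l\<^sup>2"
    "laplace_integrable (\<lambda>x. x\<^sup>2) l" "laplace (\<lambda>x. x\<^sup>2) l = 2 / l ^ 3"
  using laplace_power[OF l, of 1] laplace_power[OF l, of 2] by (simp_all add: numeral_eq_Suc)

lemma square_le_divide: "0 < l \<Longrightarrow> x \<le> s / l\<^sup>2 \<Longrightarrow> l\<^sup>2 * x \<le> s" for l x s :: real
  by (simp add: pos_le_divide_eq mult.commute)

lemma divide_le_square: "0 < l \<Longrightarrow> s / l\<^sup>2 \<le> x \<Longrightarrow> s \<le> l\<^sup>2 * x" for l x s :: real
  by (simp add: pos_divide_le_eq mult.commute)

lemma cube_split: "S / m * (2 / l ^ 3) = S / l\<^sup>2 * (2 / l / m)" for S m l :: real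
  by (simp add: power2_eq_square power3_eq_cube)

text \<open>Regular variation of \<open>U\<close> determines its increments over intervals proportional to \<open>T\<close> only.
  Decreasing slopes carry this information over to the short window before \<open>T\<close>: the slope there
  lies between slopes over long intervals to its right and to its left.\<close>
locale concave_passage = regular_passage U H \<alpha> ell \<epsilon>
  for U :: "real \<Rightarrow> real" and H :: "real \<Rightarrow> real \<Rightarrow> real" and \<alpha> :: real and ell \<epsilon> :: "real \<Rightarrow> real" +
  assumes concave: "0 < a \<Longrightarrow> a < b \<Longrightarrow> b \<le> c \<Longrightarrow> c < d \<Longrightarrow> (U d - U c) / (d - c) \<le> (U b - U a) / (b - a)"
begin

definition slope :: "real \<Rightarrow> real \<Rightarrow> real \<Rightarrow> real" where
  "slope p q T = (U (q * T) - U (p * T)) / (q * T - p * T)"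

lemma slope_fU:
  assumes "0 < T"
  shows "slope p q T / (T powr (\<alpha> - 1) / ell T) = (scaled_U T q - scaled_U T p) / (q - p)"
proof -
  have p: "T powr (\<alpha> - 1) = 1 / (T * T powr (- \<alpha>))" using assms by (simp add: powr_diff powr_minus field_simps)
  have "q * T - p * T = (q - p) * T" by (simp add: algebra_simps)
  then have "slope p q T = (U (q * T) - U (p * T)) / ((q - p) * T)" by (simp add: slope_def)
  moreover have "scaled_U T q - scaled_U T p = ell T * T powr (- \<alpha>) * (U (q * T) - U (p * T))"
    by (simp add: scaled_U_def mult.commute right_diff_distrib)
  ultimately show ?thesis
    unfolding p using assms ell_pos[OF assms] by (cases "q = p") (simp_all add: divide_simps mult_ac)
qed

text \<open>The slope of \<open>U\<close> over \<open>{p * T..q * T}\<close> bounds every slope further to the right.\<close>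
lemma \<theta>'_upper:
  assumes T: "0 < T" and c: "0 < c" and pq: "0 < p" "p < q" "q \<le> 1 - \<epsilon> T"
  shows "\<theta>' c T \<le> (scaled_U T q - scaled_U T p) / (q - p)"
proof -
  let ?v = "(1 - \<epsilon> T) * T" and ?l = "c / (\<epsilon> T * T)"
  have l: "0 < ?l" using c T \<epsilon>(1)[OF T] by simp
  have v: "0 \<le> ?v" using T \<epsilon>(2)[OF T] by simp
  have "laplace (\<lambda>s. U (?v + s) - U ?v) ?l \<le> laplace (\<lambda>s. slope p q T * s) ?l"
  proof (rule laplace_mono[OF increment_laplace(2)[OF v l] laplace_integrable_cmult[OF laplace_linear(1)[OF l]]])
    fix s :: real assume s: "0 \<le> s"
    show "U (?v + s) - U ?v \<le> slope p q T * s"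
    proof (cases "s = 0")
      case False
      then have "(U (?v + s) - U ?v) / (?v + s - ?v) \<le> slope p q T"
        unfolding slope_def using s T pq by (intro concave mult_strict_right_mono mult_right_mono) auto
      then show ?thesis using s False by (simp add: field_simps)
    qed simp
  qed
  also have "\<dots> = slope p q T / ?l\<^sup>2" unfolding laplace_cmult laplace_linear(2)[OF l] by simp
  finally have "?l\<^sup>2 * laplace (\<lambda>s. U (?v + s) - U ?v) ?l \<le> slope p q T"
    by (rule square_le_divide[OF l])
  then have "\<theta>' c T \<le> slope p q T / (T powr (\<alpha> - 1) / ell T)"
    unfolding \<theta>'_def using T ell_pos[OF T] by (intro divide_right_mono) auto
  then show ?thesis unfolding slope_fU[OF T] .
qed

text \<open>The slope over \<open>{p * T..q * T}\<close> is a lower bound for slopes from \<open>(1 - \<epsilon> T) * T\<close> up to any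
  point before \<open>p * T\<close>, but not beyond. The quadratic term in the minorant \<open>S * s - S * s\<^sup>2 / m\<close>
  makes it negative beyond \<open>s = m\<close>, hence valid for all \<open>s\<close>; its transform is off by the relative
  error \<open>2 / (l * m)\<close> only.\<close>
lemma \<theta>'_lower:
  assumes T: "0 < T" and c: "0 < c" and pq: "1 < p" "p < q"
  shows "(scaled_U T q - scaled_U T p) / (q - p) * (1 - 2 * \<epsilon> T / (c * (p - 1))) \<le> \<theta>' c T"
proof -
  let ?v = "(1 - \<epsilon> T) * T" and ?l = "c / (\<epsilon> T * T)" and ?m = "(p - 1) * T"
  have l: "0 < ?l" using c T \<epsilon>(1)[OF T] by simp
  have v: "0 < ?v" using T \<epsilon>(2)[OF T] by simp
  have vT: "?v \<le> T" using T \<epsilon>(1)[OF T] by (simp add: algebra_simps)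
  have m: "0 < ?m" using pq T by simp
  have sl: "0 \<le> slope p q T"
    unfolding slope_def using T pq by (intro divide_nonneg_nonneg) (auto intro!: U_mono mult_right_mono)
  note i1 = laplace_integrable_cmult[OF laplace_linear(1)[OF l], of "slope p q T"]
  note i2 = laplace_integrable_cmult[OF laplace_linear(3)[OF l], of "slope p q T / ?m"]
  have "laplace (\<lambda>s. slope p q T * s - slope p q T / ?m * s\<^sup>2) ?l \<le> laplace (\<lambda>s. U (?v + s) - U ?v) ?l"
  proof (rule laplace_mono[OF laplace_integrable_diff[OF i1 i2] increment_laplace(2)[OF less_imp_le[OF v] l]])
    fix s :: real assume s: "0 \<le> s"
    have eq: "slope p q T * s - slope p q T / ?m * s\<^sup>2 = slope p q T * s * (1 - s / ?m)"
      by (simp add: power2_eq_square algebra_simps)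
    show "slope p q T * s - slope p q T / ?m * s\<^sup>2 \<le> U (?v + s) - U ?v"
    proof (cases "s \<le> ?m \<and> s \<noteq> 0")
      case True
      have "slope p q T \<le> (U (?v + s) - U ?v) / (?v + s - ?v)"
        unfolding slope_def using s T pq True v vT
        by (intro concave mult_strict_right_mono) (auto simp: algebra_simps)
      then have "slope p q T * s \<le> U (?v + s) - U ?v" using s True by (simp add: field_simps)
      moreover have "slope p q T * s * (1 - s / ?m) \<le> slope p q T * s * 1"
        using sl s m by (intro mult_left_mono) auto
      ultimately show ?thesis unfolding eq by simp
    next
      case False
      then consider "s = 0" | "?m < s" by fastforce
      then have "slope p q T * s * (1 - s / ?m) \<le> 0"
      proof cases
        case 2
        then have "1 - s / ?m \<le> 0" using m by simp
        then show ?thesis using sl s by (intro mult_nonneg_nonpos) auto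
      qed simp
      also have "0 \<le> U (?v + s) - U ?v" using s by (simp add: U_mono)
      finally show ?thesis unfolding eq .
    qed
  qed
  moreover have "laplace (\<lambda>s. slope p q T * s - slope p q T / ?m * s\<^sup>2) ?l =
    slope p q T / ?l\<^sup>2 * (1 - 2 * \<epsilon> T / (c * (p - 1)))"
  proof -
    have "2 / ?l / ?m = 2 * \<epsilon> T / (c * (p - 1))" using T pq c by (simp add: field_simps)
    then have "slope p q T / ?m * (2 / ?l ^ 3) = slope p q T / ?l\<^sup>2 * (2 * \<epsilon> T / (c * (p - 1)))"
      using cube_split[of "slope p q T" ?m ?l] by simp
    then show ?thesis
      unfolding laplace_diff[OF i1 i2] laplace_cmult laplace_linear(2)[OF l] laplace_linear(4)[OF l]
      by (simp only: right_diff_distrib mult_1_right times_divide_eq_right)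
  qed
  ultimately have "slope p q T * (1 - 2 * \<epsilon> T / (c * (p - 1))) / ?l\<^sup>2 \<le> laplace (\<lambda>s. U (?v + s) - U ?v) ?l"
    by (simp only: times_divide_eq_left)
  then have "slope p q T * (1 - 2 * \<epsilon> T / (c * (p - 1))) \<le> ?l\<^sup>2 * laplace (\<lambda>s. U (?v + s) - U ?v) ?l"
    by (rule divide_le_square[OF l])
  then have "slope p q T * (1 - 2 * \<epsilon> T / (c * (p - 1))) / (T powr (\<alpha> - 1) / ell T) \<le> \<theta>' c T"
    unfolding \<theta>'_def using T ell_pos[OF T] by (intro divide_right_mono) auto
  then show ?thesis unfolding slope_fU[OF T, symmetric] by (simp only: times_divide_eq_left)
qed

lemma eps_less: "0 < e \<Longrightarrow> \<forall>\<^sub>F T in at_top. \<epsilon> T < e"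
  by (rule order_tendstoD(2)[OF \<epsilon>0])

lemma A_eps: "filterlim (A c) G at_top \<Longrightarrow> filterlim (\<lambda>T. A c (\<epsilon> T * T)) G at_top"
  by (rule filterlim_compose[OF _ \<epsilon>_inf])

context
  assumes A_lim: "\<And>c. 0 < c \<Longrightarrow> (A c \<longlongrightarrow> c powr (- \<alpha>)) at_top"
begin

text \<open>The bounds of \<open>\<theta>'_upper\<close> and \<open>\<theta>'_lower\<close> converge to difference quotients of
  \<open>x powr \<alpha> / Gamma (1 + \<alpha>)\<close> over intervals next to 1, which are as close as desired to the
  derivative at 1.\<close>
lemma \<theta>'_limit: 
  assumes c: "0 < c" shows "((\<lambda>T. \<theta>' c T) \<longlongrightarrow> \<alpha> / Gamma (1 + \<alpha>)) at_top"
proof (rule order_tendstoI)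
  have G: "0 < Gamma (1 + \<alpha>)" using \<alpha> by (simp add: Gamma_real_pos)
  note scaled_U_lim = scaled_U_limit[OF A_lim]
  have d: "((\<lambda>T. (scaled_U T q - scaled_U T p) / (q - p)) \<longlongrightarrow> (q powr \<alpha> - p powr \<alpha>) / (q - p) / Gamma (1 + \<alpha>)) at_top"
    if "0 < p" "p < q" for p q
  proof -
    have "((\<lambda>T. (scaled_U T q - scaled_U T p) / (q - p)) \<longlongrightarrow> (q powr \<alpha> / Gamma (1 + \<alpha>) - p powr \<alpha> / Gamma (1 + \<alpha>)) / (q - p)) at_top"
      using that by (intro tendsto_divide tendsto_diff scaled_U_lim tendsto_const) auto
    then show ?thesis by (simp add: diff_divide_distrib mult.commute)
  qed
  fix y assume y: "y < \<alpha> / Gamma (1 + \<alpha>)"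
  have "((\<lambda>h::real. ((1 + 2 * h) powr \<alpha> - (1 + h) powr \<alpha>) / h / Gamma (1 + \<alpha>)) \<longlongrightarrow> \<alpha> / Gamma (1 + \<alpha>)) (at_right 0)"
    by (intro tendsto_divide tendsto_const) (real_asymp, use G in simp)
  then have "\<forall>\<^sub>F h in at_right 0. y < ((1 + 2 * h) powr \<alpha> - (1 + h) powr \<alpha>) / h / Gamma (1 + \<alpha>)"
    using y by (rule order_tendstoD)
  moreover have "\<forall>\<^sub>F h in at_right (0::real). 0 < h" by (simp add: eventually_at_filter)
  ultimately have "\<forall>\<^sub>F h in at_right 0. 0 < h \<and> y < ((1 + 2 * h) powr \<alpha> - (1 + h) powr \<alpha>) / h / Gamma (1 + \<alpha>)"
    by eventually_elim simp
  then obtain h where h: "0 < h" "y < ((1 + 2 * h) powr \<alpha> - (1 + h) powr \<alpha>) / h / Gamma (1 + \<alpha>)"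
    using eventually_happens'[OF trivial_limit_at_right_real] by blast
  have "((\<lambda>T. (scaled_U T (1 + 2 * h) - scaled_U T (1 + h)) / (1 + 2 * h - (1 + h)) * (1 - 2 * \<epsilon> T / (c * (1 + h - 1)))) \<longlongrightarrow>
    ((1 + 2 * h) powr \<alpha> - (1 + h) powr \<alpha>) / (1 + 2 * h - (1 + h)) / Gamma (1 + \<alpha>) * (1 - 2 * 0 / (c * (1 + h - 1)))) at_top"
    using h c by (intro tendsto_mult d tendsto_diff tendsto_divide tendsto_const \<epsilon>0) auto
  then have "\<forall>\<^sub>F T in at_top. y < (scaled_U T (1 + 2 * h) - scaled_U T (1 + h)) / (1 + 2 * h - (1 + h)) * (1 - 2 * \<epsilon> T / (c * (1 + h - 1)))"
    using h by (intro order_tendstoD(1)) auto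
  then show "\<forall>\<^sub>F T in at_top. y < \<theta>' c T"
    using eventually_gt_at_top[of 0]
  proof eventually_elim
    case (elim T)
    show ?case using h by (intro less_le_trans[OF elim(1) \<theta>'_lower[OF elim(2) c]]) auto
  qed
next
  have G: "0 < Gamma (1 + \<alpha>)" using \<alpha> by (simp add: Gamma_real_pos)
  note scaled_U_lim = scaled_U_limit[OF A_lim]
  fix y assume y: "\<alpha> / Gamma (1 + \<alpha>) < y"
  have "((\<lambda>h::real. ((1 - h) powr \<alpha> - (1 - 2 * h) powr \<alpha>) / h / Gamma (1 + \<alpha>)) \<longlongrightarrow> \<alpha> / Gamma (1 + \<alpha>)) (at_right 0)"
    by (intro tendsto_divide tendsto_const) (real_asymp, use G in simp)
  then have "\<forall>\<^sub>F h in at_right 0. ((1 - h) powr \<alpha> - (1 - 2 * h) powr \<alpha>) / h / Gamma (1 + \<alpha>) < y"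
    using y by (rule order_tendstoD)
  moreover have "\<forall>\<^sub>F h in at_right (0::real). 0 < h \<and> h < 1 / 2"
    by (auto simp: eventually_at_right_field intro!: exI[of _ "1 / 2"])
  ultimately have "\<forall>\<^sub>F h in at_right 0. (0 < h \<and> h < 1 / 2) \<and> ((1 - h) powr \<alpha> - (1 - 2 * h) powr \<alpha>) / h / Gamma (1 + \<alpha>) < y"
    by eventually_elim simp
  then obtain h where h: "0 < h" "h < 1 / 2" "((1 - h) powr \<alpha> - (1 - 2 * h) powr \<alpha>) / h / Gamma (1 + \<alpha>) < y"
    using eventually_happens'[OF trivial_limit_at_right_real] by blast
  have "((\<lambda>T. (scaled_U T (1 - h) - scaled_U T (1 - 2 * h)) / (1 - h - (1 - 2 * h))) \<longlongrightarrow>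
    ((1 - h) powr \<alpha> / Gamma (1 + \<alpha>) - (1 - 2 * h) powr \<alpha> / Gamma (1 + \<alpha>)) / (1 - h - (1 - 2 * h))) at_top"
    using h by (intro tendsto_divide tendsto_diff scaled_U_lim tendsto_const) auto
  moreover have "((1 - h) powr \<alpha> / Gamma (1 + \<alpha>) - (1 - 2 * h) powr \<alpha> / Gamma (1 + \<alpha>)) / (1 - h - (1 - 2 * h)) < y"
    using h by (simp add: diff_divide_distrib mult.commute)
  ultimately have "\<forall>\<^sub>F T in at_top. (scaled_U T (1 - h) - scaled_U T (1 - 2 * h)) / (1 - h - (1 - 2 * h)) < y"
    by (rule order_tendstoD(2))
  then show "\<forall>\<^sub>F T in at_top. \<theta>' c T < y"
    using eventually_gt_at_top[of 0] eps_less[OF h(1)]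
  proof eventually_elim
    case (elim T)
    show ?case using h elim(3) by (intro le_less_trans[OF \<theta>'_upper[OF elim(2) c] elim(1)]) auto
  qed
qed

lemma scaled_passage_limit: "((\<lambda>T. scaled_passage T 1) \<longlongrightarrow> \<alpha> / Gamma (1 + \<alpha>) / Gamma (2 - \<alpha>)) at_top"
proof (rule monotone_tauberian)
  show "0 < 2 - \<alpha>" using \<alpha> by simp
  show "0 \<le> \<alpha> / Gamma (1 + \<alpha>)" using \<alpha> by (simp add: Gamma_real_pos less_imp_le)
  show "\<forall>\<^sub>F T in at_top. (\<forall>x\<ge>0. 0 \<le> scaled_passage T x) \<and> (\<forall>c>0. laplace_integrable (scaled_passage T) c)" by (rule scaled_passage_ok)
  show "(\<forall>\<^sub>F T in at_top. mono_on {0..} (scaled_passage T)) \<or> (\<forall>\<^sub>F T in at_top. antimono_on {0..} (scaled_passage T))" using scaled_passage_ok by blast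
  fix c :: real assume c: "0 < c"
  have "((\<lambda>T. \<theta>' c T / (A c (\<epsilon> T * T) * c\<^sup>2)) \<longlongrightarrow> \<alpha> / Gamma (1 + \<alpha>) / (c powr (- \<alpha>) * c\<^sup>2)) at_top"
    using c by (intro tendsto_divide tendsto_mult A_eps A_lim tendsto_const \<theta>'_limit) auto
  also have "c powr (- \<alpha>) * c\<^sup>2 = 1 / c powr (- (2 - \<alpha>))"
    using c by (simp add: powr_diff powr_minus field_simps powr_numeral)
  also have "\<alpha> / Gamma (1 + \<alpha>) / (1 / c powr (- (2 - \<alpha>))) = \<alpha> / Gamma (1 + \<alpha>) * c powr (- (2 - \<alpha>))" by simp
  finally show "((\<lambda>T. laplace (scaled_passage T) c) \<longlongrightarrow> \<alpha> / Gamma (1 + \<alpha>) * c powr (- (2 - \<alpha>))) at_top"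
    by (rule Lim_transform_eventually) (rule eventually_mono[OF eventually_gt_at_top[of 0]], simp only: scaled_passage_laplace(2)[OF _ c])
qed

theorem late_limit:
  "((\<lambda>T. H ((1 - \<epsilon> T) * T) T / (sin (pi * (1 - \<alpha>)) / (pi * (1 - \<alpha>)) * (ell (\<epsilon> T * T) / ell T) * \<epsilon> T powr (1 - \<alpha>))) \<longlongrightarrow> 1) at_top"
proof -
  let ?C = "sin (pi * (1 - \<alpha>)) / (pi * (1 - \<alpha>))"
  have 1: "1 / (Gamma \<alpha> * Gamma (2 - \<alpha>)) = ?C" using Gamma_sin[of "1 - \<alpha>"] \<alpha> by simp
  have "\<alpha> \<notin> \<int>\<^sub>\<le>\<^sub>0" using \<alpha> nonpos_Ints_nonpos[of \<alpha>] by auto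
  then have "Gamma (1 + \<alpha>) = \<alpha> * Gamma \<alpha>" using Gamma_plus1[of \<alpha>] by (simp add: add.commute)
  then have 2: "\<alpha> / Gamma (1 + \<alpha>) / Gamma (2 - \<alpha>) = ?C" unfolding 1[symmetric] using \<alpha> by simp
  have C: "?C > 0" unfolding 1[symmetric] using \<alpha> by (simp add: Gamma_real_pos)
  have "((\<lambda>T. scaled_passage T 1 / ?C) \<longlongrightarrow> ?C / ?C) at_top"
    using C by (intro tendsto_divide scaled_passage_limit[unfolded 2] tendsto_const) auto
  also have "?C / ?C = 1" using C by (intro divide_self) auto
  finally show ?thesis
  proof (rule Lim_transform_eventually)
    show "\<forall>\<^sub>F T in at_top. scaled_passage T 1 / ?C = H ((1 - \<epsilon> T) * T) T / (?C * (ell (\<epsilon> T * T) / ell T) * \<epsilon> T powr (1 - \<alpha>))"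
      using eventually_gt_at_top[of 0]
    proof eventually_elim
      case (elim T)
      have "ell (\<epsilon> T * T) / ell T * \<epsilon> T powr (1 - \<alpha>) \<noteq> 0"
        using elim ell_pos[of T] ell_pos[of "\<epsilon> T * T"] \<epsilon>(1)[of T] by simp
      then show ?case unfolding late_probability[OF elim] mult.assoc[of ?C]
        by (rule mult_divide_mult_cancel_right[symmetric])
    qed
  qed
qed

end

context
  fixes k K :: real
  assumes kK: "0 < k" "0 < K"
    and A_bounds: "\<And>c. 0 < c \<Longrightarrow> \<forall>\<^sub>F T in at_top. k * c powr (- \<alpha>) \<le> A c T \<and> A c T \<le> K * c powr (- \<alpha>)"
begin

lemma scaled_U_bounds: "\<exists>k'>0. \<exists>K'>0. \<forall>q>0. \<forall>\<^sub>F T in at_top. k' * q powr \<alpha> \<le> scaled_U T q \<and> scaled_U T q \<le> K' * q powr \<alpha>"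
proof -
  obtain k1 K1 where 1: "0 < k1" "0 < K1" "\<forall>\<^sub>F T in at_top. k1 \<le> Y T \<and> Y T \<le> K1"
    using Y_bounds[OF kK A_bounds] by blast
  have "\<forall>\<^sub>F T in at_top. k1 / 2 * q powr \<alpha> \<le> scaled_U T q \<and> scaled_U T q \<le> 2 * K1 * q powr \<alpha>" if q: "0 < q" for q
  proof -
    have "\<forall>\<^sub>F T in at_top. 1 / 2 < ell T / ell (q * T)" "\<forall>\<^sub>F T in at_top. ell T / ell (q * T) < 2"
      by (intro order_tendstoD[OF ell_ratio[OF q]]; simp)+
    then show ?thesis
      using eventually_compose_filterlim[OF 1(3) scale_at_top[OF q]] eventually_gt_at_top[of 0]
    proof eventually_elim
      case (elim T)
      have r0: "0 \<le> ell T / ell (q * T)" using ell_pos[of T] ell_pos[of "q * T"] elim q by simp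
      have "k1 * q powr \<alpha> * (1 / 2) \<le> Y (q * T) * q powr \<alpha> * (ell T / ell (q * T))"
        using elim 1 q by (intro mult_mono) auto
      moreover have "Y (q * T) * q powr \<alpha> * (ell T / ell (q * T)) \<le> K1 * q powr \<alpha> * 2"
        using elim 1 q r0 by (intro mult_mono) auto
      ultimately show ?case unfolding scaled_U_eq_Y[OF elim(4) q] by (simp add: mult_ac)
    qed
  qed
  then show ?thesis using 1 by (intro exI[of _ "k1 / 2"] exI[of _ "2 * K1"] conjI allI impI) auto
qed

lemma \<theta>'_bounds: "\<exists>k'>0. \<exists>K'>0. \<forall>c>0. \<forall>\<^sub>F T in at_top. k' \<le> \<theta>' c T \<and> \<theta>' c T \<le> K'"
proof -
  obtain k1 K1 where 1: "0 < k1" "0 < K1"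
    "\<And>q. 0 < q \<Longrightarrow> \<forall>\<^sub>F T in at_top. k1 * q powr \<alpha> \<le> scaled_U T q \<and> scaled_U T q \<le> K1 * q powr \<alpha>" using scaled_U_bounds by blast
  \<comment> \<open>The upper and the lower bound on \<open>scaled_U\<close> have different constants; a large \<open>q\<close> forces
    \<open>scaled_U T q - scaled_U T 2\<close> above 1 nevertheless.\<close>
  have "filterlim (\<lambda>q::real. k1 * q powr \<alpha>) at_top at_top" using \<alpha> 1 by real_asymp
  then have "\<forall>\<^sub>F q in at_top. 2 < q \<and> K1 * 2 powr \<alpha> + 1 \<le> k1 * q powr \<alpha>"
    using eventually_gt_at_top[of "2::real"] by (auto simp: filterlim_at_top intro: eventually_conj)
  then obtain q where q: "2 < q" "K1 * 2 powr \<alpha> + 1 \<le> k1 * q powr \<alpha>"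
    using eventually_happens'[OF trivial_limit_at_top_linorder] by blast
  have "\<forall>\<^sub>F T in at_top. 1 / (q - 2) / 2 \<le> \<theta>' c T \<and> \<theta>' c T \<le> K1 * (1 / 2) powr \<alpha> * 4" if c: "0 < c" for c
  proof -
    have half: "\<forall>\<^sub>F T in at_top. k1 * (1 / 2) powr \<alpha> \<le> scaled_U T (1 / 2) \<and> scaled_U T (1 / 2) \<le> K1 * (1 / 2) powr \<alpha>" by (rule 1(3)) simp
    have two: "\<forall>\<^sub>F T in at_top. k1 * 2 powr \<alpha> \<le> scaled_U T 2 \<and> scaled_U T 2 \<le> K1 * 2 powr \<alpha>" by (rule 1(3)) simp
    have qq: "\<forall>\<^sub>F T in at_top. k1 * q powr \<alpha> \<le> scaled_U T q \<and> scaled_U T q \<le> K1 * q powr \<alpha>" by (rule 1(3)) (use q in simp)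
    have e1: "\<forall>\<^sub>F T in at_top. \<epsilon> T < 1 / 2" by (rule eps_less) simp
    have e2: "\<forall>\<^sub>F T in at_top. \<epsilon> T < c / 4" by (rule eps_less) (use c in simp)
    show ?thesis
      using half two qq e1 e2 eventually_gt_at_top[of 0]
    proof eventually_elim
      case (elim T)
      have "1 / (q - 2) * (1 / 2) \<le> (scaled_U T q - scaled_U T 2) / (q - 2) * (1 - 2 * \<epsilon> T / (c * (2 - 1)))"
        using elim q c by (intro mult_mono divide_right_mono) (auto simp: field_simps)
      also have "\<dots> \<le> \<theta>' c T" using q by (intro \<theta>'_lower[OF elim(6) c]) auto
      finally have lower: "1 / (q - 2) / 2 \<le> \<theta>' c T" by simp
      have "\<theta>' c T \<le> (scaled_U T (1 / 2) - scaled_U T (1 / 4)) / (1 / 2 - 1 / 4)"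
        using elim by (intro \<theta>'_upper[OF elim(6) c]) auto
      also have "\<dots> = (scaled_U T (1 / 2) - scaled_U T (1 / 4)) * 4" by simp
      also have "\<dots> \<le> K1 * (1 / 2) powr \<alpha> * 4"
        using elim U_nonneg[of "T * (1 / 4)"] ell_pos[of T]
        by (intro mult_right_mono) (auto simp: scaled_U_def intro: order_trans[rotated])
      finally show ?case using lower by simp
    qed
  qed
  then show ?thesis using 1 q by (intro exI[of _ "1 / (q - 2) / 2"] exI[of _ "K1 * (1 / 2) powr \<alpha> * 4"] conjI allI impI) auto
qed

lemma scaled_passage_bounds: "\<exists>k'>0. \<exists>K'>0. \<forall>\<^sub>F T in at_top. k' \<le> scaled_passage T 1 \<and> scaled_passage T 1 \<le> K'"
proof -
  obtain k1 K1 where 1: "0 < k1" "0 < K1" "\<And>c. 0 < c \<Longrightarrow> \<forall>\<^sub>F T in at_top. k1 \<le> \<theta>' c T \<and> \<theta>' c T \<le> K1"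
    using \<theta>'_bounds by blast
  show ?thesis
  proof (rule monotone_tauberian_bounds)
    show "0 < 2 - \<alpha>" "0 < k1 / K" "0 < K1 / k" using \<alpha> kK 1 by auto
    show "\<forall>\<^sub>F T in at_top. (\<forall>x\<ge>0. 0 \<le> scaled_passage T x) \<and> (\<forall>c>0. laplace_integrable (scaled_passage T) c)" by (rule scaled_passage_ok)
    show "(\<forall>\<^sub>F T in at_top. mono_on {0..} (scaled_passage T)) \<or> (\<forall>\<^sub>F T in at_top. antimono_on {0..} (scaled_passage T))" using scaled_passage_ok by blast
    fix c :: real assume c: "0 < c"
    show "\<forall>\<^sub>F T in at_top. k1 / K * c powr (- (2 - \<alpha>)) \<le> laplace (scaled_passage T) c \<and> laplace (scaled_passage T) c \<le> K1 / k * c powr (- (2 - \<alpha>))"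
      using eventually_compose_filterlim[OF A_bounds[OF c] \<epsilon>_inf] 1(3)[OF c] eventually_gt_at_top[of 0]
    proof eventually_elim
      case (elim T)
      define P where "P = c powr (- \<alpha>)"
      have P: "0 < P" "c powr (- (2 - \<alpha>)) = 1 / (P * c\<^sup>2)"
        using c by (auto simp: P_def powr_diff powr_minus field_simps powr_numeral)
      have Ap: "k * P \<le> A c (\<epsilon> T * T)" "A c (\<epsilon> T * T) \<le> K * P" using elim by (auto simp: P_def)
      have A0: "0 < A c (\<epsilon> T * T)" using elim c \<epsilon>(1)[of T] by (intro A_pos) auto
      have "k1 / (K * P * c\<^sup>2) \<le> \<theta>' c T / (A c (\<epsilon> T * T) * c\<^sup>2)"
        using elim Ap A0 c P kK 1 by (intro frac_le mult_right_mono mult_pos_pos) auto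
      moreover have "\<theta>' c T / (A c (\<epsilon> T * T) * c\<^sup>2) \<le> K1 / (k * P * c\<^sup>2)"
        using elim Ap A0 c P kK 1 by (intro frac_le mult_right_mono mult_pos_pos) auto
      ultimately show ?case
        unfolding scaled_passage_laplace(2)[OF elim(3) c] P(2) by (simp add: mult.assoc)
    qed
  qed
qed

theorem late_bounds:
  "\<exists>k'>0. \<exists>K'>0. \<forall>\<^sub>F T in at_top.
    k' * (ell (\<epsilon> T * T) / ell T * \<epsilon> T powr (1 - \<alpha>)) \<le> H ((1 - \<epsilon> T) * T) T \<and>
    H ((1 - \<epsilon> T) * T) T \<le> K' * (ell (\<epsilon> T * T) / ell T * \<epsilon> T powr (1 - \<alpha>))"
proof -
  obtain k1 K1 where 1: "0 < k1" "0 < K1" "\<forall>\<^sub>F T in at_top. k1 \<le> scaled_passage T 1 \<and> scaled_passage T 1 \<le> K1" using scaled_passage_bounds by blast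
  have "\<forall>\<^sub>F T in at_top.
    k1 * (ell (\<epsilon> T * T) / ell T * \<epsilon> T powr (1 - \<alpha>)) \<le> H ((1 - \<epsilon> T) * T) T \<and>
    H ((1 - \<epsilon> T) * T) T \<le> K1 * (ell (\<epsilon> T * T) / ell T * \<epsilon> T powr (1 - \<alpha>))"
    using 1(3) eventually_gt_at_top[of 0]
  proof eventually_elim
    case (elim T)
    have g: "ell (\<epsilon> T * T) / ell T * \<epsilon> T powr (1 - \<alpha>) \<ge> 0" using elim ell_pos[of T] ell_pos[of "\<epsilon> T * T"] \<epsilon>(1)[of T] by simp
    have b: "k1 \<le> scaled_passage T 1" "scaled_passage T 1 \<le> K1" using elim by auto
    show ?case unfolding late_probability[OF elim(2)] by (intro conjI mult_right_mono g b)
  qed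
  then show ?thesis using 1 by blast
qed

end

end

section \<open>Special subordinators have concave potentials\<close>

text \<open>Dominates the difference quotients when a Laplace transform is differentiated under the
  integral.\<close>
lemma exp_difference_bound:
  fixes h x b :: real
  assumes "\<bar>h\<bar> \<le> b" "0 \<le> x" "h \<noteq> 0"
  shows "\<bar>(exp (- h * x) - 1) / h\<bar> \<le> x * exp (b * x)"
proof -
  have "\<bar>exp y - 1\<bar> \<le> \<bar>y\<bar> * exp \<bar>y\<bar>" for y :: real
  proof (cases "0 \<le> y")
    case True
    have "exp y - 1 = exp y * (1 - exp (- y))" by (simp add: right_diff_distrib exp_minus)
    also have "\<dots> \<le> exp y * y" using exp_ge_add_one_self[of "- y"] by (intro mult_left_mono) auto
    finally show ?thesis using True by (simp add: mult.commute)
  next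
    case False
    then have "\<bar>exp y - 1\<bar> = 1 - exp y" by simp
    also have "\<dots> \<le> - y" using exp_ge_add_one_self[of y] by linarith
    also have "\<dots> \<le> \<bar>y\<bar> * exp \<bar>y\<bar>" using False mult_left_mono[of 1 "exp \<bar>y\<bar>" "\<bar>y\<bar>"] by simp
    finally show ?thesis .
  qed
  from this[of "- h * x"] have "\<bar>exp (- h * x) - 1\<bar> \<le> \<bar>h\<bar> * (x * exp (\<bar>h\<bar> * x))"
    using assms(2) by (simp add: abs_mult mult.assoc)
  also have "\<dots> \<le> \<bar>h\<bar> * (x * exp (b * x))" using assms by (intro mult_left_mono) (auto intro!: mult_right_mono)
  finally show ?thesis using assms(3) by (simp add: abs_divide field_simps)
qed

lemma laplace_derivative:
  fixes f :: "real \<Rightarrow> real" and l :: real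
  assumes l: "0 < l" and f [measurable]: "f \<in> borel_measurable borel"
    and i: "\<And>c. 0 < c \<Longrightarrow> laplace_integrable (\<lambda>x. \<bar>f x\<bar>) c"
    and xi: "\<And>c. 0 < c \<Longrightarrow> laplace_integrable (\<lambda>x. x * \<bar>f x\<bar>) c"
  shows "((\<lambda>c. laplace f c) has_field_derivative - laplace (\<lambda>x. x * f x) l) (at l)"
  unfolding has_field_derivative_iff tendsto_at_iff_sequentially
proof (intro allI impI)
  fix X :: "nat \<Rightarrow> real" assume X: "\<forall>i. X i \<in> UNIV - {l}" "X \<longlonglongrightarrow> l"
  have "eventually (\<lambda>n. dist (X n) l < l / 2) sequentially" using X(2) l by (intro tendstoD) auto
  then obtain N where N: "\<And>n. n \<ge> N \<Longrightarrow> \<bar>X n - l\<bar> < l / 2" by (auto simp: eventually_sequentially dist_real_def)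
  define Z where "Z n = X (n + N)" for n
  have Z: "\<bar>Z n - l\<bar> \<le> l / 2" "Z n \<noteq> l" "0 < Z n" for n
  proof -
    show "\<bar>Z n - l\<bar> \<le> l / 2" using N[of "n + N"] by (simp add: Z_def less_imp_le)
    show "Z n \<noteq> l" using X(1) by (simp add: Z_def)
    show "0 < Z n" using N[of "n + N"] l unfolding Z_def by linarith
  qed
  have Zlim: "Z \<longlonglongrightarrow> l" unfolding Z_def by (rule LIMSEQ_ignore_initial_segment[OF X(2)])
  have fi: "laplace_integrable f c" if "0 < c" for c
    by (rule laplace_integrable_bound[OF i[OF that] f]) simp
  let ?g = "\<lambda>n x. indicat_real {0..} x *\<^sub>R (exp (- l * x) * ((exp (- (Z n - l) * x) - 1) / (Z n - l) * f x))"
  have q: "(laplace f (Z n) - laplace f l) / (Z n - l) = (\<integral>x. ?g n x \<partial>lborel)" for n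
  proof -
    have "laplace f (Z n) - laplace f l = (LBINT x:{0..}. exp (- Z n * x) * f x - exp (- l * x) * f x)"
      by (rule set_integral_diff(2)[symmetric, OF fi[OF Z(3)] fi[OF l]])
    then have "(laplace f (Z n) - laplace f l) / (Z n - l) =
      (LBINT x:{0..}. (exp (- Z n * x) * f x - exp (- l * x) * f x) / (Z n - l))" by simp
    also have "\<dots> = (\<integral>x. ?g n x \<partial>lborel)"
      unfolding set_lebesgue_integral_def
    proof (rule Bochner_Integration.integral_cong[OF refl])
      fix x
      have "exp (- Z n * x) = exp (- l * x) * exp (- (Z n - l) * x)" by (simp add: exp_add[symmetric] algebra_simps)
      then show "indicat_real {0..} x *\<^sub>R ((exp (- Z n * x) * f x - exp (- l * x) * f x) / (Z n - l)) = ?g n x"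
        by (simp add: algebra_simps diff_divide_distrib)
    qed
    finally show ?thesis .
  qed
  have "(\<lambda>n. \<integral>x. ?g n x \<partial>lborel) \<longlonglongrightarrow> (\<integral>x. indicat_real {0..} x *\<^sub>R (exp (- l * x) * (- x * f x)) \<partial>lborel)"
  proof (rule integral_dominated_convergence)
    show "integrable lborel (\<lambda>x. indicat_real {0..} x *\<^sub>R (exp (- (l / 2) * x) * (x * \<bar>f x\<bar>)))"
      using xi[of "l / 2"] l unfolding set_integrable_def by simp
    show "AE x in lborel. (\<lambda>n. ?g n x) \<longlonglongrightarrow> indicat_real {0..} x *\<^sub>R (exp (- l * x) * (- x * f x))"
    proof (intro AE_I2 tendsto_intros)
      fix x :: real
      have "((\<lambda>h. exp (- h * x)) has_field_derivative (- x * exp (- 0 * x))) (at 0)"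
        by (auto intro!: derivative_eq_intros)
      then have "((\<lambda>h. (exp (- h * x) - 1) / h) \<longlongrightarrow> - x) (at 0)"
        unfolding has_field_derivative_iff by simp
      moreover have "filterlim (\<lambda>n. Z n - l) (at 0) sequentially"
        unfolding filterlim_at using Z(2) tendsto_diff[OF Zlim tendsto_const[of l]] by simp
      ultimately show "(\<lambda>n. (exp (- (Z n - l) * x) - 1) / (Z n - l)) \<longlonglongrightarrow> - x" by (rule filterlim_compose)
    qed
    show "AE x in lborel. norm (?g n x) \<le> indicat_real {0..} x *\<^sub>R (exp (- (l / 2) * x) * (x * \<bar>f x\<bar>))" for n
    proof (rule AE_I2)
      fix x :: real
      show "norm (?g n x) \<le> indicat_real {0..} x *\<^sub>R (exp (- (l / 2) * x) * (x * \<bar>f x\<bar>))"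
      proof (cases "0 \<le> x")
        case True
        have "\<bar>(exp (- (Z n - l) * x) - 1) / (Z n - l)\<bar> \<le> x * exp (l / 2 * x)"
          using Z[of n] True by (intro exp_difference_bound) auto
        then have "exp (- l * x) * (\<bar>(exp (- (Z n - l) * x) - 1) / (Z n - l)\<bar> * \<bar>f x\<bar>) \<le>
          exp (- l * x) * (x * exp (l / 2 * x) * \<bar>f x\<bar>)"
          by (intro mult_left_mono mult_right_mono) auto
        also have "\<dots> = (exp (- l * x) * exp (l / 2 * x)) * (x * \<bar>f x\<bar>)" by simp
        also have "exp (- l * x) * exp (l / 2 * x) = exp (- (l / 2) * x)" by (simp add: exp_add[symmetric] algebra_simps)
        finally show ?thesis using True by (simp add: abs_mult)
      qed simp
    qed
  qed measurable
  also have "(\<integral>x. indicat_real {0..} x *\<^sub>R (exp (- l * x) * (- x * f x)) \<partial>lborel) = laplace (\<lambda>x. (- 1) * (x * f x)) l"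
    by (simp add: set_lebesgue_integral_def)
  also have "\<dots> = - laplace (\<lambda>x. x * f x) l" unfolding laplace_cmult by simp
  finally have "(\<lambda>n. (laplace f (Z n) - laplace f l) / (Z n - l)) \<longlonglongrightarrow> - laplace (\<lambda>x. x * f x) l"
    by (simp only: q)
  then show "((\<lambda>y. (laplace f y - laplace f l) / (y - l)) \<circ> X) \<longlonglongrightarrow> - laplace (\<lambda>x. x * f x) l"
    unfolding Z_def comp_def by (rule LIMSEQ_offset[where f = "\<lambda>n. (laplace f (X n) - laplace f l) / (X n - l)"])
qed

lemma power_le_exp: "0 \<le> x \<Longrightarrow> x ^ n \<le> fact n * exp x" for x :: real
proof -
  assume x: "0 \<le> x"
  have "(\<Sum>k\<in>{n}. x ^ k /\<^sub>R fact k) \<le> (\<Sum>k. x ^ k /\<^sub>R fact k)"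
    using x by (intro sum_le_suminf summable_exp_generic) auto
  then have "x ^ n / fact n \<le> exp x" by (simp add: exp_def divide_inverse mult.commute)
  then show ?thesis by (simp add: field_simps)
qed

text \<open>Here \<open>\<Psi> l\<close> is \<open>l / \<Phi> l\<close> for the Laplace exponent \<open>\<Phi>\<close> of the inverse local time. If \<open>U\<close> were
  smooth, the derivatives of order \<open>n \<ge> 2\<close> of \<open>\<Psi>\<close> would be, up to sign, the transforms of \<open>s ^ n\<close>
  times the second derivative of \<open>U\<close>, so that their sign suggests that \<open>U\<close> is concave. The
  Post-Widder inversion formula makes this rigorous without smoothness.\<close>
locale special_potential =
  fixes U :: "real \<Rightarrow> real" and \<Psi> :: "real \<Rightarrow> real"
  assumes U_mono: "s \<le> t \<Longrightarrow> U s \<le> U t" and U_nonpos: "t \<le> 0 \<Longrightarrow> U t = 0" and U_cont: "isCont U t"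
    and U_laplace: "0 < l \<Longrightarrow> laplace_integrable U l"
    and \<Psi>: "0 < l \<Longrightarrow> \<Psi> l = l\<^sup>2 * laplace U l"
    and \<Psi>_deriv: "1 \<le> n \<Longrightarrow> 0 < l \<Longrightarrow> (- 1) ^ n * (deriv ^^ n) \<Psi> l \<le> 0"
begin

lemma U_nonneg: "0 \<le> U t"
  using U_mono[of "min t 0" t] U_nonpos[of "min t 0"] by simp

lemma U_measurable [measurable]: "U \<in> borel_measurable borel"
  by (intro borel_measurable_mono) (simp add: mono_def U_mono)

lemma moment_integrable:
  assumes l: "0 < l" shows "laplace_integrable (\<lambda>x. x ^ n * U x) l"
proof -
  have "laplace_integrable (\<lambda>x. (fact n * (2 / l) ^ n) * (exp (- (- (l / 2)) * x) * U x)) l"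
    by (rule laplace_integrable_cmult, unfold laplace_exp_mult) (use U_laplace[of "l / 2"] l in simp)
  then show ?thesis
  proof (rule laplace_integrable_bound)
    fix x :: real assume x: "0 \<le> x"
    have "x ^ n = (2 / l) ^ n * (l / 2 * x) ^ n" using l by (simp add: power_mult_distrib[symmetric])
    also have "\<dots> \<le> (2 / l) ^ n * (fact n * exp (l / 2 * x))" using x l by (intro mult_left_mono power_le_exp) auto
    finally have "x ^ n * U x \<le> (2 / l) ^ n * (fact n * exp (l / 2 * x)) * U x" using U_nonneg by (rule mult_right_mono)
    then show "\<bar>x ^ n * U x\<bar> \<le> fact n * (2 / l) ^ n * (exp (- (- (l / 2)) * x) * U x)"
      using x U_nonneg by (simp add: abs_mult mult_ac)
  qed measurable
qed

text \<open>Up to sign, the derivatives of \<open>laplace U\<close>.\<close>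
definition N :: "nat \<Rightarrow> real \<Rightarrow> real" where "N n l = laplace (\<lambda>x. x ^ n * U x) l"

lemma N_deriv: 
  assumes "0 < l" shows "(N n has_field_derivative - N (Suc n) l) (at l)"
proof -
  have a: "laplace_integrable (\<lambda>x. \<bar>x ^ m * U x\<bar>) c" if "0 < c" for c m
    by (rule laplace_integrable_bound[OF moment_integrable[OF that, of m]]) (auto simp: abs_mult U_nonneg)
  have b: "laplace_integrable (\<lambda>x. x * \<bar>x ^ n * U x\<bar>) c" if "0 < c" for c
    by (rule laplace_integrable_bound[OF moment_integrable[OF that, of "Suc n"]]) (auto simp: abs_mult U_nonneg mult_ac)
  have "((\<lambda>c. laplace (\<lambda>x. x ^ n * U x) c) has_field_derivative - laplace (\<lambda>x. x * (x ^ n * U x)) l) (at l)"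
    by (rule laplace_derivative[OF assms _ a b]) measurable
  then show ?thesis unfolding N_def[abs_def] by (simp add: mult.assoc)
qed

text \<open>By the Leibniz rule, \<open>(- 1) ^ n * E n l\<close> is the \<open>n\<close>-th derivative of \<open>l\<^sup>2 * laplace U l\<close>.
  Where the subtractions in the indices truncate, the coefficient is zero.\<close>
definition E :: "nat \<Rightarrow> real \<Rightarrow> real" where
  "E n l = l\<^sup>2 * N n l - 2 * real n * l * N (n - 1) l + real n * (real n - 1) * N (n - 2) l"

lemma E_deriv:
  assumes l: "0 < l" shows "(E n has_field_derivative - E (Suc n) l) (at l)"
proof -
  have 1: "((\<lambda>l. real n * N (n - 1) l) has_field_derivative - (real n * N n l)) (at l)"
    using DERIV_cmult[OF N_deriv[OF l, of "n - 1"], of "real n"] by (cases n) auto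
  have 2: "((\<lambda>l. real n * (real n - 1) * N (n - 2) l) has_field_derivative - (real n * (real n - 1) * N (n - 1) l)) (at l)"
  proof (cases "n \<le> 1")
    case True
    then have "n = 0 \<or> n = 1" by auto
    then show ?thesis by auto
  next
    case False
    then have "Suc (n - 2) = n - 1" by simp
    then show ?thesis using DERIV_cmult[OF N_deriv[OF l, of "n - 2"], of "real n * (real n - 1)"] by simp
  qed
  have "((\<lambda>l. l\<^sup>2 * N n l - 2 * l * (real n * N (n - 1) l) + real n * (real n - 1) * N (n - 2) l) has_field_derivative
    (l\<^sup>2 * - N (Suc n) l + 2 * l * N n l) - (2 * l * - (real n * N n l) + 2 * (real n * N (n - 1) l)) +
    - (real n * (real n - 1) * N (n - 1) l)) (at l)"
  proof -
    have sq: "((\<lambda>l::real. l\<^sup>2) has_field_derivative 2 * l) (at l)" "((\<lambda>l::real. 2 * l) has_field_derivative 2) (at l)"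
      by (auto intro!: derivative_eq_intros)
    show ?thesis
      by (rule DERIV_add[OF DERIV_diff[OF DERIV_mult'[OF sq(1) N_deriv[OF l]] DERIV_mult'[OF sq(2) 1]] 2])
  qed
  moreover have "(l\<^sup>2 * - N (Suc n) l + 2 * l * N n l) - (2 * l * - (real n * N n l) + 2 * (real n * N (n - 1) l)) +
    - (real n * (real n - 1) * N (n - 1) l) = - E (Suc n) l"
    by (simp add: E_def algebra_simps)
  moreover have "E n = (\<lambda>l. l\<^sup>2 * N n l - 2 * l * (real n * N (n - 1) l) + real n * (real n - 1) * N (n - 2) l)"
    by (rule ext) (simp add: E_def algebra_simps)
  ultimately show ?thesis by simp
qed

lemma \<Psi>_higher_deriv: "0 < l \<Longrightarrow> (deriv ^^ n) \<Psi> l = (- 1) ^ n * E n l"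
proof (induction n arbitrary: l)
  case 0 then show ?case by (simp add: \<Psi> E_def N_def)
next
  case (Suc n)
  have "((\<lambda>l. (- 1) ^ n * E n l) has_field_derivative (- 1) ^ n * - E (Suc n) l) (at l)"
    by (rule DERIV_cmult[OF E_deriv[OF Suc.prems]])
  then have "((deriv ^^ n) \<Psi> has_field_derivative (- 1) ^ n * - E (Suc n) l) (at l)"
    by (rule has_field_derivative_transform_within_open[of _ _ _ "{0<..}"]) (use Suc in auto)
  then show ?case by (simp add: DERIV_imp_deriv)
qed

lemma E_nonpos: "1 \<le> n \<Longrightarrow> 0 < l \<Longrightarrow> E n l \<le> 0"
  using \<Psi>_deriv[of n l] \<Psi>_higher_deriv[of l n] by (simp add: mult.assoc[symmetric] power_mult_distrib[symmetric])

text \<open>Up to the factor \<open>C n\<close> below, this is the Post-Widder approximant of \<open>U\<close> at \<open>t\<close>. The form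
  with \<open>inverse\<close> is stable under differentiation in \<open>t\<close>.\<close>
definition W :: "nat \<Rightarrow> real \<Rightarrow> real" where
  "W n t = inverse t ^ Suc n * N n (real n * inverse t)"

definition W' :: "nat \<Rightarrow> real \<Rightarrow> real" where
  "W' n t = inverse t ^ (n + 2) * (real n * inverse t * N (Suc n) (real n * inverse t) - real (Suc n) * N n (real n * inverse t))"

lemma N_inverse_deriv:
  assumes "0 < t" "1 \<le> n"
  shows "((\<lambda>t. N m (real n * inverse t)) has_field_derivative
    N (Suc m) (real n * inverse t) * (real n * inverse t ^ 2)) (at t)"
proof -
  have "((\<lambda>t. real n * inverse t) has_field_derivative - (real n * inverse t ^ 2)) (at t)"
    using assms by (auto intro!: derivative_eq_intros simp: power2_eq_square)
  from DERIV_chain2[OF N_deriv this, of m] show ?thesis using assms by simp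
qed

lemma inverse_power_deriv:
  fixes t :: real assumes "0 < t"
  shows "((\<lambda>t. inverse t ^ m) has_field_derivative - (real m * inverse t ^ Suc m)) (at t)"
proof -
  have "((\<lambda>t. inverse t ^ m) has_field_derivative real m * (- (inverse t * 1 * inverse t)) * inverse t ^ (m - 1)) (at t)"
    using assms by (auto intro!: derivative_eq_intros)
  moreover have "real m * (- (inverse t * 1 * inverse t)) * inverse t ^ (m - 1) = - (real m * inverse t ^ Suc m)"
    by (cases m) auto
  ultimately show ?thesis by (simp only:)
qed

lemma W_deriv:
  assumes t: "0 < t" "1 \<le> n" shows "(W n has_field_derivative W' n t) (at t)"
proof -
  have "((\<lambda>t. inverse t ^ Suc n * N n (real n * inverse t)) has_field_derivative
    inverse t ^ Suc n * (N (Suc n) (real n * inverse t) * (real n * inverse t ^ 2)) +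
    - (real (Suc n) * inverse t ^ Suc (Suc n)) * N n (real n * inverse t)) (at t)"
    by (rule DERIV_mult'[OF inverse_power_deriv[OF t(1)] N_inverse_deriv[OF t]])
  moreover have "inverse t ^ Suc n * (N (Suc n) (real n * inverse t) * (real n * inverse t ^ 2)) +
    - (real (Suc n) * inverse t ^ Suc (Suc n)) * N n (real n * inverse t) = W' n t"
    by (simp add: W'_def algebra_simps power2_eq_square)
  ultimately show ?thesis unfolding W_def[abs_def] by simp
qed

text \<open>The second derivative of the approximant is a positive multiple of \<open>E (n + 2)\<close>, hence
  nonpositive: this is why the Post-Widder approximants of \<open>U\<close> inherit concavity from the
  Bernstein property.\<close>
lemma W'_deriv:
  assumes t: "0 < t" "1 \<le> n"
  shows "(W' n has_field_derivative inverse t ^ (n + 3) * E (n + 2) (real n * inverse t)) (at t)"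
proof -
  let ?l = "real n * inverse t"
  have inv: "((\<lambda>t. real n * inverse t) has_field_derivative - (real n * inverse t ^ 2)) (at t)"
    using t by (auto intro!: derivative_eq_intros simp: power2_eq_square)
  have "((\<lambda>t. inverse t ^ (n + 2) * (real n * inverse t * N (Suc n) (real n * inverse t) - real (Suc n) * N n (real n * inverse t)))
    has_field_derivative
    inverse t ^ (n + 2) * ((?l * (N (Suc (Suc n)) ?l * (real n * inverse t ^ 2)) + - (real n * inverse t ^ 2) * N (Suc n) ?l) -
       real (Suc n) * (N (Suc n) ?l * (real n * inverse t ^ 2))) +
    - (real (n + 2) * inverse t ^ Suc (n + 2)) * (?l * N (Suc n) ?l - real (Suc n) * N n ?l)) (at t)"
    by (rule DERIV_mult'[OF inverse_power_deriv[OF t(1)] DERIV_diff[OF DERIV_mult'[OF inv N_inverse_deriv[OF t]] DERIV_cmult[OF N_inverse_deriv[OF t]]]])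
  moreover have "inverse t ^ (n + 2) * ((?l * (N (Suc (Suc n)) ?l * (real n * inverse t ^ 2)) + - (real n * inverse t ^ 2) * N (Suc n) ?l) -
       real (Suc n) * (N (Suc n) ?l * (real n * inverse t ^ 2))) +
    - (real (n + 2) * inverse t ^ Suc (n + 2)) * (?l * N (Suc n) ?l - real (Suc n) * N n ?l) =
    inverse t ^ (n + 3) * E (n + 2) ?l"
  proof -
    define i where "i = inverse t"
    have p: "i ^ (n + 2) = i ^ n * i\<^sup>2" "i ^ Suc (n + 2) = i ^ n * i\<^sup>2 * i" "i ^ (n + 3) = i ^ n * i\<^sup>2 * i"
      by (simp_all add: power_add power2_eq_square power3_eq_cube)
    show ?thesis unfolding E_def i_def[symmetric] p by (simp add: algebra_simps power2_eq_square)
  qed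
  ultimately show ?thesis unfolding W'_def[abs_def] by simp
qed

lemma W_slopes:
  assumes n: "1 \<le> n" and abcd: "0 < a" "a < b" "b \<le> c" "c < d"
  shows "(W n d - W n c) / (d - c) \<le> (W n b - W n a) / (b - a)"
proof -
  obtain x where x: "a < x" "x < b" "W n b - W n a = (b - a) * W' n x"
    using MVT2[of a b "W n" "W' n"] W_deriv n abcd by auto
  obtain y where y: "c < y" "y < d" "W n d - W n c = (d - c) * W' n y"
    using MVT2[of c d "W n" "W' n"] W_deriv n abcd by auto
  have "W' n y \<le> W' n x"
  proof (rule DERIV_nonpos_imp_nonincreasing[where f = "W' n" and a = x and b = y])
    show "x \<le> y" using x y abcd by simp
    fix t assume "x \<le> t" "t \<le> y"
    then have t: "0 < t" using x abcd by simp
    show "\<exists>z. (W' n has_field_derivative z) (at t) \<and> z \<le> 0"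
    proof (intro exI conjI)
      show "(W' n has_field_derivative inverse t ^ (n + 3) * E (n + 2) (real n * inverse t)) (at t)"
        by (rule W'_deriv[OF t n])
      show "inverse t ^ (n + 3) * E (n + 2) (real n * inverse t) \<le> 0"
        using t n by (intro mult_nonneg_nonpos E_nonpos) auto
    qed
  qed
  then show ?thesis unfolding x(3) y(3) using abcd by simp
qed

lemma U_growth:
  assumes l: "0 < l" and x: "0 \<le> x"
  shows "U x \<le> l * laplace U l * exp (l * x)"
proof -
  let ?f = "\<lambda>s. if s < x then 0 else U x"
  have c: "laplace_integrable (\<lambda>s. U x * 1) l" by (rule laplace_integrable_cmult[OF laplace_one(1)[OF l]])
  have fi: "laplace_integrable ?f l" by (rule laplace_integrable_bound[OF c]) (auto simp: U_nonneg)
  have "laplace ?f l = exp (- l * x) * laplace (\<lambda>s. ?f (x + s)) l"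
    by (rule laplace_shift(2)[OF x]) simp
  also have "laplace (\<lambda>s. ?f (x + s)) l = laplace (\<lambda>s. U x * 1) l"
    by (intro set_lebesgue_integral_cong) auto
  also have "\<dots> = U x / l" unfolding laplace_cmult laplace_one(2)[OF l] by simp
  finally have "exp (- l * x) * (U x / l) = laplace ?f l" ..
  also have "\<dots> \<le> laplace U l"
    by (rule laplace_mono[OF fi U_laplace[OF l]]) (auto simp: U_nonneg U_mono)
  finally have "exp (- l * x) * (U x / l) \<le> laplace U l" .
  then have "exp (l * x) * (exp (- l * x) * (U x / l)) \<le> exp (l * x) * laplace U l" by (intro mult_left_mono) auto
  moreover have "exp (l * x) * (exp (- l * x) * (U x / l)) = U x / l" by (simp add: exp_minus)
  ultimately have "U x / l \<le> exp (l * x) * laplace U l" by (simp only:)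
  then have "U x \<le> exp (l * x) * laplace U l * l" using l by (simp only: pos_divide_le_eq)
  then show ?thesis by (simp only: mult_ac)
qed

text \<open>Makes \<open>C n * exp (- n * s) * s ^ n\<close> a probability density in \<open>s\<close>, concentrated near 1 for
  large \<open>n\<close>; \<open>C n * W n t\<close> is the average of \<open>U (t * s)\<close> under it.\<close>
definition C :: "nat \<Rightarrow> real" where "C n = real n ^ Suc n / fact n"

lemma W_eq_average:
  assumes t: "0 < t" and n: "1 \<le> n"
  shows "C n * W n t = C n * laplace (\<lambda>s. s ^ n * U (t * s)) (real n)"
    and "laplace_integrable (\<lambda>s. s ^ n * U (t * s)) (real n)"
proof -
  have nt: "0 < real n / t" using t n by simp
  have eq: "s ^ n * U (t * s) = inverse t ^ n * ((t * s) ^ n * U (t * s))" for s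
    using t by (simp add: power_mult_distrib power_inverse)
  have i: "laplace_integrable (\<lambda>s. (t * s) ^ n * U (t * s)) (real n)"
    by (rule laplace_scale(1)[OF t moment_integrable[OF nt]])
  show "laplace_integrable (\<lambda>s. s ^ n * U (t * s)) (real n)"
    unfolding eq by (rule laplace_integrable_cmult[OF i])
  have "laplace (\<lambda>s. s ^ n * U (t * s)) (real n) = inverse t ^ n * (N n (real n / t) / t)"
    unfolding eq laplace_cmult N_def laplace_scale(2)[OF t, where f = "\<lambda>x. x ^ n * U x"] ..
  also have "\<dots> = W n t" by (simp add: W_def divide_inverse)
  finally show "C n * W n t = C n * laplace (\<lambda>s. s ^ n * U (t * s)) (real n)" by simp
qed

lemma C_normalises: "1 \<le> n \<Longrightarrow> C n * laplace (\<lambda>s. s ^ n) (real n) = 1"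
  unfolding C_def by (subst laplace_power) auto

text \<open>A bound on the spread of the density around 1. The weight \<open>exp s\<close> is there because \<open>U\<close> may
  grow exponentially; it changes the rate from \<open>n\<close> to \<open>n - 1\<close>.\<close>
lemma second_moment:
  assumes n: "2 \<le> n"
  defines "g \<equiv> \<lambda>s::real. s ^ n * (exp s * (s - 1)\<^sup>2)"
  shows "laplace_integrable g (real n)"
    and "C n * laplace g (real n) = (real n / (real n - 1)) ^ Suc n * ((real n + 5) / (real n - 1)\<^sup>2)"
proof -
  let ?b = "real n - 1"
  have b: "0 < ?b" using n by simp
  have g: "g = (\<lambda>s. exp (- (- 1) * s) * (s ^ (n + 2) + (- 2) * s ^ Suc n + s ^ n))"
    unfolding g_def by (rule ext) (simp add: power2_eq_square algebra_simps)
  note i0 = laplace_power(1)[OF b, of n]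
  note i1 = laplace_integrable_cmult[OF laplace_power(1)[OF b, of "Suc n"], of "- 2"]
  note i2 = laplace_power(1)[OF b, of "n + 2"]
  note i21 = laplace_integrable_add[OF i2 i1]
  have s: "real n + - 1 = ?b" by simp
  show "laplace_integrable g (real n)"
    unfolding g laplace_exp_mult s by (rule laplace_integrable_add[OF i21 i0])
  have "laplace g (real n) = fact (n + 2) / ?b ^ Suc (n + 2) + (- 2) * (fact (Suc n) / ?b ^ Suc (Suc n)) + fact n / ?b ^ Suc n"
    unfolding g laplace_exp_mult s laplace_add[OF i21 i0] laplace_add[OF i2 i1] laplace_cmult laplace_power(2)[OF b] ..
  also have "\<dots> = fact n / ?b ^ Suc n * ((real n + 5) / ?b\<^sup>2)"
  proof -
    define d where "d = ?b"
    have d: "0 < d" "real n = d + 1" using b by (auto simp: d_def)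
    have f: "fact (n + 2) = (d + 3) * ((d + 2) * fact n)" "fact (Suc n) = (d + 2) * fact n"
      using d(2) by (simp_all add: algebra_simps)
    have p: "d ^ Suc (n + 2) = d ^ Suc n * d\<^sup>2" "d ^ Suc (Suc n) = d ^ Suc n * d"
      by (simp_all add: power2_eq_square)
    have "0 < d ^ Suc n" using d(1) by simp
    then show ?thesis unfolding d_def[symmetric] f p d(2) using d(1)
      by (simp add: field_simps power2_eq_square)
  qed
  finally show "C n * laplace g (real n) = (real n / ?b) ^ Suc n * ((real n + 5) / ?b\<^sup>2)"
    unfolding C_def by (simp add: power_divide)
qed

lemma second_moment_limit:
  "(\<lambda>n. (real n / (real n - 1)) ^ Suc n * ((real n + 5) / (real n - 1)\<^sup>2)) \<longlonglongrightarrow> 0"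
proof -
  have "(\<lambda>n. (real n / (real n - 1)) powr (real n + 1) * ((real n + 5) / (real n - 1)\<^sup>2)) \<longlonglongrightarrow> 0"
    by real_asymp
  then show ?thesis
  proof (rule Lim_transform_eventually)
    show "\<forall>\<^sub>F n in sequentially. (real n / (real n - 1)) powr (real n + 1) * ((real n + 5) / (real n - 1)\<^sup>2) =
      (real n / (real n - 1)) ^ Suc n * ((real n + 5) / (real n - 1)\<^sup>2)"
      using eventually_ge_at_top[of 2]
    proof eventually_elim
      case (elim n)
      then have "0 < real n / (real n - 1)" by simp
      from powr_realpow[OF this, of "Suc n"] show ?case by (simp add: add.commute)
    qed
  qed
qed

text \<open>Chebyshev's argument: near 1 the difference of \<open>U (t * s)\<close> and \<open>U t\<close> is small by continuity,
  and elsewhere it is at most a multiple of \<open>exp s * (s - 1)\<^sup>2\<close>, whose average tends to 0.\<close>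
theorem W_limit:
  assumes t: "0 < t" shows "(\<lambda>n. C n * W n t) \<longlonglongrightarrow> U t"
proof (rule tendstoI)
  fix e :: real assume e: "0 < e"
  obtain d where d: "0 < d" "\<And>x. \<bar>x - t\<bar> < d \<Longrightarrow> \<bar>U x - U t\<bar> < e / 2"
    using U_cont[of t, unfolded continuous_at_eps_delta, rule_format, of "e / 2"] e by (auto simp: dist_real_def)
  define \<delta> where "\<delta> = d / (2 * t)"
  have \<delta>: "0 < \<delta>" using d t by (simp add: \<delta>_def)
  define B where "B = inverse t * laplace U (inverse t) * exp 1"
  have L0: "0 \<le> inverse t * laplace U (inverse t)"
    using t laplace_nonneg[of U "inverse t"] U_nonneg by (intro mult_nonneg_nonneg) auto
  have growth: "U (t * s) \<le> B * exp s" if "0 \<le> s" for s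
  proof -
    have "U (t * s) \<le> inverse t * laplace U (inverse t) * exp (inverse t * (t * s))" using t that by (intro U_growth) auto
    also have "inverse t * (t * s) = s" using t by simp
    also have "inverse t * laplace U (inverse t) * exp s \<le> B * exp s"
      unfolding B_def using mult_left_mono[OF _ L0, of 1 "exp 1"] by (intro mult_right_mono) auto
    finally show ?thesis .
  qed
  have B0: "0 \<le> B" unfolding B_def by (rule mult_nonneg_nonneg[OF L0]) simp
  define K where "K = 2 * B / \<delta>\<^sup>2"
  have K0: "0 \<le> K" using B0 by (simp add: K_def)
  have bound: "\<bar>U (t * s) - U t\<bar> \<le> e / 2 + K * (exp s * (s - 1)\<^sup>2)" if s: "0 \<le> s" for s
  proof (cases "\<bar>s - 1\<bar> \<le> \<delta>")
    case True
    have "t * s - t = t * (s - 1)" by (simp add: algebra_simps)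
    then have "\<bar>t * s - t\<bar> = t * \<bar>s - 1\<bar>" using t by (simp add: abs_mult)
    also have "\<dots> \<le> t * \<delta>" using True t by simp
    also have "\<dots> < d" using d t by (simp add: \<delta>_def)
    finally show ?thesis using d(2)[of "t * s"] K0 by (simp add: add_increasing2 less_imp_le)
  next
    case False
    have "U t \<le> inverse t * laplace U (inverse t) * exp (inverse t * t)" using t by (intro U_growth) auto
    also have "\<dots> = B" using t by (simp add: B_def)
    also have "B \<le> B * exp s" using B0 s by (simp add: mult_le_cancel_left1)
    finally have "\<bar>U (t * s) - U t\<bar> \<le> 2 * B * exp s * 1" using growth[OF s] U_nonneg[of t] U_nonneg[of "t * s"] by linarith
    also have "\<dots> \<le> 2 * B * exp s * ((s - 1)\<^sup>2 / \<delta>\<^sup>2)"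
    proof (intro mult_left_mono)
      have "\<delta>\<^sup>2 \<le> \<bar>s - 1\<bar>\<^sup>2" using False \<delta> by (intro power_mono) auto
      then show "1 \<le> (s - 1)\<^sup>2 / \<delta>\<^sup>2" using \<delta> by simp
    qed (use B0 in auto)
    also have "\<dots> = K * (exp s * (s - 1)\<^sup>2)" by (simp add: K_def)
    finally show ?thesis using e by simp
  qed
  have "(\<lambda>n. K * ((real n / (real n - 1)) ^ Suc n * ((real n + 5) / (real n - 1)\<^sup>2))) \<longlonglongrightarrow> K * 0"
    by (intro tendsto_mult tendsto_const second_moment_limit)
  then have "\<forall>\<^sub>F n in sequentially. K * ((real n / (real n - 1)) ^ Suc n * ((real n + 5) / (real n - 1)\<^sup>2)) < e / 2"
    using e by (intro order_tendstoD) auto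
  then show "\<forall>\<^sub>F n in sequentially. dist (C n * W n t) (U t) < e"
    using eventually_ge_at_top[of 2]
  proof eventually_elim
    case (elim n)
    have n1: "1 \<le> n" "0 < real n" using elim by auto
    have C0: "0 \<le> C n" by (simp add: C_def)
    have linear_diff: "z * (x - u * y) = z * x - u * (z * y)"
      and linear_sum: "z * (u * x + v * y) = u * (z * x) + v * (z * y)" for u v x y z :: real
      by (simp_all add: algebra_simps)
    let ?g = "\<lambda>s::real. s ^ n * (exp s * (s - 1)\<^sup>2)"
    note iU = W_eq_average(2)[OF t n1(1)]
    note ip = laplace_power(1)[OF n1(2), of n]
    note ig = second_moment(1)[OF elim(2)]
    note ic = laplace_integrable_cmult[OF ip, of "U t"]
    note ih = laplace_integrable_add[OF laplace_integrable_cmult[OF ip, of "e / 2"] laplace_integrable_cmult[OF ig, of K]]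
    let ?h = "\<lambda>s. e / 2 * s ^ n + K * ?g s"
    have le: "\<bar>s ^ n * U (t * s) - U t * s ^ n\<bar> \<le> ?h s" if "0 \<le> s" for s
    proof -
      have "s ^ n * U (t * s) - U t * s ^ n = s ^ n * (U (t * s) - U t)" by (simp add: algebra_simps)
      then have "\<bar>s ^ n * U (t * s) - U t * s ^ n\<bar> = s ^ n * \<bar>U (t * s) - U t\<bar>"
        using that by (simp add: abs_mult)
      also have "\<dots> \<le> s ^ n * (e / 2 + K * (exp s * (s - 1)\<^sup>2))" using bound[OF that] that by (intro mult_left_mono) auto
      finally show ?thesis by (simp add: algebra_simps)
    qed
    have d: "laplace (\<lambda>s. s ^ n * U (t * s) - U t * s ^ n) (real n) =
      laplace (\<lambda>s. s ^ n * U (t * s)) (real n) - U t * laplace (\<lambda>s. s ^ n) (real n)"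
      unfolding laplace_diff[OF iU ic] laplace_cmult ..
    have h: "laplace ?h (real n) = e / 2 * laplace (\<lambda>s. s ^ n) (real n) + K * laplace ?g (real n)"
      unfolding laplace_add[OF laplace_integrable_cmult[OF ip, of "e / 2"] laplace_integrable_cmult[OF ig, of K]] laplace_cmult ..
    have up: "laplace (\<lambda>s. s ^ n * U (t * s) - U t * s ^ n) (real n) \<le> laplace ?h (real n)"
      by (rule laplace_mono[OF laplace_integrable_diff[OF iU ic] ih]) (use le in \<open>fastforce simp: abs_le_iff\<close>)
    have lo: "laplace (\<lambda>s. (- 1) * ?h s) (real n) \<le> laplace (\<lambda>s. s ^ n * U (t * s) - U t * s ^ n) (real n)"
      by (rule laplace_mono[OF laplace_integrable_cmult[OF ih] laplace_integrable_diff[OF iU ic]])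
         (use le in \<open>fastforce simp: abs_le_iff\<close>)
    have "\<bar>laplace (\<lambda>s. s ^ n * U (t * s) - U t * s ^ n) (real n)\<bar> \<le> laplace ?h (real n)"
      using up lo unfolding laplace_cmult by (intro abs_leI) linarith+
    then have "C n * \<bar>laplace (\<lambda>s. s ^ n * U (t * s) - U t * s ^ n) (real n)\<bar> \<le> C n * laplace ?h (real n)"
      using C0 by (rule mult_left_mono)
    also have "C n * \<bar>laplace (\<lambda>s. s ^ n * U (t * s) - U t * s ^ n) (real n)\<bar> = \<bar>C n * W n t - U t\<bar>"
    proof -
      have "C n * laplace (\<lambda>s. s ^ n * U (t * s) - U t * s ^ n) (real n) = C n * W n t - U t * (C n * laplace (\<lambda>s. s ^ n) (real n))"
        unfolding d W_eq_average(1)[OF t n1(1)] by (rule linear_diff)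
      then have "C n * laplace (\<lambda>s. s ^ n * U (t * s) - U t * s ^ n) (real n) = C n * W n t - U t"
        unfolding C_normalises[OF n1(1)] by (simp only: mult_1_right)
      then have e: "C n * W n t - U t = C n * laplace (\<lambda>s. s ^ n * U (t * s) - U t * s ^ n) (real n)" ..
      show ?thesis unfolding e abs_mult by (simp only: abs_of_nonneg[OF C0])
    qed
    also have "C n * laplace ?h (real n) = e / 2 * (C n * laplace (\<lambda>s. s ^ n) (real n)) + K * (C n * laplace ?g (real n))"
      unfolding h by (rule linear_sum)
    also have "\<dots> = e / 2 + K * ((real n / (real n - 1)) ^ Suc n * ((real n + 5) / (real n - 1)\<^sup>2))"
      unfolding C_normalises[OF n1(1)] second_moment(2)[OF elim(2)] by simp
    also have "\<dots> < e / 2 + e / 2" using elim(1) by (rule add_strict_left_mono)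
    also have "e / 2 + e / 2 = e" by simp
    finally show ?case by (simp add: dist_real_def)
  qed
qed

theorem U_slopes:
  assumes abcd: "0 < a" "a < b" "b \<le> c" "c < d"
  shows "(U d - U c) / (d - c) \<le> (U b - U a) / (b - a)"
proof (rule tendsto_le[OF sequentially_bot])
  show "(\<lambda>n. (C n * W n d - C n * W n c) / (d - c)) \<longlonglongrightarrow> (U d - U c) / (d - c)"
    "(\<lambda>n. (C n * W n b - C n * W n a) / (b - a)) \<longlonglongrightarrow> (U b - U a) / (b - a)"
    using abcd by (intro tendsto_divide tendsto_diff W_limit tendsto_const; simp)+
  show "\<forall>\<^sub>F n in sequentially. (C n * W n d - C n * W n c) / (d - c) \<le> (C n * W n b - C n * W n a) / (b - a)"
    using eventually_ge_at_top[of 1]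
  proof eventually_elim
    case (elim n)
    have "C n * ((W n d - W n c) / (d - c)) \<le> C n * ((W n b - W n a) / (b - a))"
      by (intro mult_left_mono W_slopes[OF elim abcd]) (simp add: C_def)
    then show ?case by (simp add: right_diff_distrib)
  qed
qed

end

section \<open>Measurability along Hunt paths\<close>

lemma space_ext_borel [simp]: "space ext_borel = UNIV"
  by (simp add: ext_borel_def space_measure_of_conv)

lemma sets_ext_borel: "sets ext_borel = sigma_sets UNIV {U. openin ext_top U}"
  by (simp add: ext_borel_def)

lemma Some_image_in_ext_borel: "open V \<Longrightarrow> Some ` V \<in> sets ext_borel"
  by (auto simp: sets_ext_borel intro!: sigma_sets.Basic)

lemma None_in_ext_borel: "{None} \<in> sets (ext_borel :: 's::metric_space option measure)"
proof -
  have "space ext_borel - Some ` (UNIV :: 's set) \<in> sets ext_borel"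
    by (intro sets.compl_sets Some_image_in_ext_borel) simp
  also have "space ext_borel - Some ` (UNIV :: 's set) = {None}"
    by (auto simp: UNIV_option_conv)
  finally show ?thesis .
qed

lemma singleton_in_ext_borel: "{x} \<in> sets (ext_borel :: 's::metric_space option measure)"
proof (cases x)
  case None then show ?thesis by (simp add: None_in_ext_borel)
next
  case (Some y)
  have "Some ` UNIV - Some ` (- {y}) \<in> sets (ext_borel :: 's option measure)"
    by (intro sets.Diff Some_image_in_ext_borel) auto
  also have "Some ` UNIV - Some ` (- {y}) = {x}" using Some by auto
  finally show ?thesis .
qed

text \<open>A neighbourhood of the cemetery is the complement of a closed subset of the state space, so
  open subsets of the state space suffice.\<close>
lemma measurable_ext_borelI:
  fixes f :: "'a \<Rightarrow> 's::metric_space option"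
  assumes "\<And>V. open V \<Longrightarrow> f -` Some ` V \<inter> space M \<in> sets M"
  shows "f \<in> measurable M ext_borel"
  unfolding ext_borel_def
proof (rule measurable_measure_of)
  fix U :: "'s option set" assume "U \<in> {U. openin ext_top U}"
  then consider (fin) V where "open V" "U = Some ` V"
    | (inf) C where "closed C" "U = insert None (Some ` (UNIV - C))"
    by (auto simp: openin_Alexandroff_compactification)
  then show "f -` U \<inter> space M \<in> sets M"
  proof cases
    case fin then show ?thesis using assms by simp
  next
    case inf
    have "space M - ((f -` Some ` UNIV \<inter> space M) - (f -` Some ` (- C) \<inter> space M)) \<in> sets M"
      using inf by (intro sets.compl_sets sets.Diff assms) auto
    also have "space M - ((f -` Some ` UNIV \<inter> space M) - (f -` Some ` (- C) \<inter> space M)) = f -` U \<inter> space M"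
      unfolding inf by (auto simp: image_iff)
    finally show ?thesis .
  qed
qed auto

lemma ex_countable_compact_base:
  assumes lc: "locally_compact_space (euclidean :: 's::{metric_space, second_countable_topology} topology)"
  obtains B :: "'s::{metric_space, second_countable_topology} set set" where "countable B" "\<And>V. V \<in> B \<Longrightarrow> open V"
    "\<And>x U. open U \<Longrightarrow> x \<in> U \<Longrightarrow> \<exists>V\<in>B. x \<in> V \<and> compact (closure V) \<and> closure V \<subseteq> U"
proof -
  obtain B :: "'s set set" where B: "countable B" "topological_basis B"
    using ex_countable_basis by blast
  show thesis
  proof
    show "countable B" by fact
    show "V \<in> B \<Longrightarrow> open V" for V using B topological_basis_open by blast
    fix x and U :: "'s set" assume U: "open U" "x \<in> U"
    obtain W K where W: "open W" "compact K" "x \<in> W" "W \<subseteq> K"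
      using lc by (simp add: locally_compact_space_def) metis
    obtain e where e: "e > 0" "cball x e \<subseteq> U \<inter> W"
      using open_contains_cball[of "U \<inter> W"] U W by blast
    obtain V where V: "V \<in> B" "x \<in> V" "V \<subseteq> ball x e"
      using topological_basisE[OF B(2), of "ball x e" x] e by auto
    have cl: "closure V \<subseteq> cball x e"
      using V(3) by (meson ball_subset_cball closed_cball closure_minimal order_trans)
    have "compact (K \<inter> closure V)" using W(2) by (intro compact_Int_closed) auto
    moreover have "K \<inter> closure V = closure V" using cl e W by blast
    ultimately show "\<exists>V\<in>B. x \<in> V \<and> compact (closure V) \<and> closure V \<subseteq> U"
      using V cl e by (intro bexI[of _ V]) auto
  qed
qed

text \<open>The limit lies in an open \<open>U\<close> iff the sequence is eventually in the closure of one of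
  countably many base sets with compact closure inside \<open>U\<close>. Local compactness enters here: these
  closures remain closed in the extended state space.\<close>
lemma measurable_ext_limit:
  fixes f :: "nat \<Rightarrow> 'a \<Rightarrow> 's::{metric_space, second_countable_topology} option"
  assumes lc: "locally_compact_space (euclidean :: 's topology)"
    and f: "\<And>n. f n \<in> measurable M ext_borel"
    and lim: "\<And>\<omega>. \<omega> \<in> space M \<Longrightarrow> limitin ext_top (\<lambda>n. f n \<omega>) (g \<omega>) sequentially"
  shows "g \<in> measurable M ext_borel"
proof (rule measurable_ext_borelI)
  fix U :: "'s set" assume U: "open U"
  obtain B :: "'s set set" where B: "countable B" "\<And>V. V \<in> B \<Longrightarrow> open V"
    "\<And>x U. open U \<Longrightarrow> x \<in> U \<Longrightarrow> \<exists>V\<in>B. x \<in> V \<and> compact (closure V) \<and> closure V \<subseteq> U"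
    using ex_countable_compact_base[OF lc] by blast
  define BU where "BU = {V\<in>B. compact (closure V) \<and> closure V \<subseteq> U}"
  have cBU: "countable BU" unfolding BU_def using B(1) by (rule countable_Collect)
  have clm: "Some ` closure V \<in> sets ext_borel" if "V \<in> BU" for V
  proof -
    have "Some ` UNIV - Some ` (- closure V) \<in> sets (ext_borel :: 's option measure)"
      by (intro sets.Diff Some_image_in_ext_borel) auto
    also have "Some ` UNIV - Some ` (- closure V) = Some ` closure V" by auto
    finally show ?thesis .
  qed
  have "g -` Some ` U \<inter> space M =
    {\<omega>\<in>space M. \<exists>V\<in>BU. \<exists>N. \<forall>n\<in>{N..}. f n \<omega> \<in> Some ` closure V}" (is "_ = ?R")
  proof (intro set_eqI iffI)
    fix \<omega> assume "\<omega> \<in> g -` Some ` U \<inter> space M"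
    then obtain x where x: "x \<in> U" "g \<omega> = Some x" "\<omega> \<in> space M" by auto
    obtain V where V: "V \<in> B" "x \<in> V" "compact (closure V)" "closure V \<subseteq> U"
      using B(3)[OF U x(1)] by blast
    have "eventually (\<lambda>n. f n \<omega> \<in> Some ` V) sequentially"
    proof -
      have "openin ext_top (Some ` V)" using B(2)[OF V(1)] by simp
      moreover have "g \<omega> \<in> Some ` V" using V(2) x(2) by simp
      ultimately show ?thesis using lim[OF x(3)] unfolding limitin_def by blast
    qed
    then obtain N where "\<And>n. n \<ge> N \<Longrightarrow> f n \<omega> \<in> Some ` V" by (auto simp: eventually_sequentially)
    then have "\<forall>n\<in>{N..}. f n \<omega> \<in> Some ` closure V" using closure_subset[of V] by blast
    moreover have "V \<in> BU" using V by (simp add: BU_def)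
    ultimately show "\<omega> \<in> ?R" using x(3) by blast
  next
    fix \<omega> assume "\<omega> \<in> ?R"
    then obtain V N where V: "V \<in> BU" and om: "\<omega> \<in> space M"
      and N: "\<And>n. n \<ge> N \<Longrightarrow> f n \<omega> \<in> Some ` closure V" by blast
    have "closedin ext_top (Some ` closure V)"
      using V by (simp add: BU_def)
    moreover have "eventually (\<lambda>n. f n \<omega> \<in> Some ` closure V) sequentially"
      using N unfolding eventually_sequentially by blast
    ultimately have "g \<omega> \<in> Some ` closure V"
      using limitin_closedin[OF lim[OF om]] trivial_limit_sequentially by blast
    then show "\<omega> \<in> g -` Some ` U \<inter> space M" using V om unfolding BU_def by blast
  qed
  also have "\<dots> \<in> sets M"
  proof -
    have 1: "{\<omega>\<in>space M. f n \<omega> \<in> Some ` closure V} \<in> sets M" if "V \<in> BU" for V n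
      using measurable_sets_Collect[OF f, of "\<lambda>y. y \<in> Some ` closure V"] clm[OF that] by simp
    show ?thesis
      by (intro sets.sets_Collect_countable_Ex'[OF _ cBU] sets.sets_Collect_countable_Ex
          sets.sets_Collect_countable_Ball 1)
  qed
  finally show "g -` Some ` U \<inter> space M \<in> sets M" .
qed

locale hunt =
  fixes X :: "('w, 's::{metric_space, second_countable_topology}) process"
  assumes locally_compact: "locally_compact_space (euclidean :: 's topology)"
    and hunt: "hunt_process X"
begin

abbreviation "PA \<equiv> space (prob_algebra (ext_borel :: 's option measure))"

lemma return_in_PA: "return ext_borel x \<in> PA"
  by (simp add: space_prob_algebra prob_space_return)

lemma space_raw [simp]: "space (raw_filtration X t) = Omega X"
  by (simp add: raw_filtration_def space_measure_of_conv)

lemma sets_raw: "sets (raw_filtration X t) =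
    sigma_sets (Omega X) {coord X s -` E \<inter> Omega X | s E. s \<le> t \<and> E \<in> sets ext_borel}"
  unfolding raw_filtration_def by (rule sets_measure_of) auto

lemma raw_mono: "s \<le> t \<Longrightarrow> sets (raw_filtration X s) \<subseteq> sets (raw_filtration X t)"
  unfolding sets_raw by (rule sigma_sets_mono') (auto intro: order_trans)

lemma measurable_coord_raw: "s \<le> t \<Longrightarrow> coord X s \<in> measurable (raw_filtration X t) ext_borel"
  by (intro measurableI) (auto simp: sets_raw intro!: sigma_sets.Basic)

lemma space_init_law [simp]: "space (init_law X \<mu>) = Omega X"
  by (simp add: init_law_def space_measure_of_conv)

lemma raw_subset_init_law: "sets (raw_filtration X t) \<subseteq> sets (init_law X \<mu>)"
proof -
  have "sets (raw_filtration X t) \<subseteq> sets (raw_filtration X \<infinity>)" by (rule raw_mono) simp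
  also have "\<dots> = sets (measure_of (Omega X) (sets (raw_filtration X \<infinity>))
     (\<lambda>A. \<integral>\<^sup>+ x. emeasure (law X x) A \<partial>\<mu>))"
    using sets.sets_measure_of_eq[of "raw_filtration X \<infinity>"] by simp
  also have "\<dots> \<subseteq> sets (init_law X \<mu>)"
    unfolding init_law_def by auto
  finally show ?thesis .
qed

lemma null_sets_init_law_subset: "null_sets (init_law X \<mu>) \<subseteq> Pow (Omega X)"
  using sets.space_closed[of "init_law X \<mu>"] by auto

lemma raw_subset_Pow: "sets (raw_filtration X t) \<subseteq> Pow (Omega X)"
  using sets.space_closed[of "raw_filtration X t"] by auto

lemma space_aug [simp]: "space (aug_filtration X t) = Omega X"
  by (simp add: aug_filtration_def space_measure_of_conv)

text \<open>An intersection of sigma-algebras needs no further closure.\<close>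
lemma sets_aug: "sets (aug_filtration X t) =
    (\<Inter>\<mu>\<in>PA. sigma_sets (Omega X) (sets (raw_filtration X t) \<union> null_sets (init_law X \<mu>)))"
    (is "_ = ?S")
proof -
  have gen: "sets (raw_filtration X t) \<union> null_sets (init_law X \<mu>) \<subseteq> Pow (Omega X)" for \<mu>
    using raw_subset_Pow null_sets_init_law_subset by blast
  have PowS: "?S \<subseteq> Pow (Omega X)"
  proof -
    have "?S \<subseteq> sigma_sets (Omega X) (sets (raw_filtration X t) \<union> null_sets (init_law X (return ext_borel None)))"
      using return_in_PA[of None] by (rule INT_lower)
    also have "\<dots> \<subseteq> Pow (Omega X)"
      using sigma_sets_into_sp[OF gen] by blast
    finally show ?thesis .
  qed
  have "sigma_sets (Omega X) ?S \<subseteq> ?S"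
  proof (intro INT_greatest)
    fix \<mu> assume "\<mu> \<in> PA"
    then have "sigma_sets (Omega X) ?S \<subseteq> sigma_sets (Omega X)
       (sigma_sets (Omega X) (sets (raw_filtration X t) \<union> null_sets (init_law X \<mu>)))"
      by (intro sigma_sets_mono') auto
    then show "sigma_sets (Omega X) ?S \<subseteq>
       sigma_sets (Omega X) (sets (raw_filtration X t) \<union> null_sets (init_law X \<mu>))"
      using sigma_sets_sigma_sets_eq[OF gen] by simp
  qed
  moreover have "sets (aug_filtration X t) = sigma_sets (Omega X) ?S"
    unfolding aug_filtration_def using PowS by (rule sets_measure_of)
  ultimately show ?thesis by auto
qed

lemma raw_subset_aug: "sets (raw_filtration X t) \<subseteq> sets (aug_filtration X t)"
  unfolding sets_aug by auto

lemma aug_subset_init_law: "\<mu> \<in> PA \<Longrightarrow> sets (aug_filtration X t) \<subseteq> sets (init_law X \<mu>)"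
proof -
  assume "\<mu> \<in> PA"
  then have "sets (aug_filtration X t) \<subseteq> sigma_sets (Omega X) (sets (raw_filtration X t) \<union> null_sets (init_law X \<mu>))"
    unfolding sets_aug by auto
  also have "\<dots> \<subseteq> sets (init_law X \<mu>)"
    using sets.sigma_sets_subset[of "sets (raw_filtration X t) \<union> null_sets (init_law X \<mu>)" "init_law X \<mu>"]
      raw_subset_init_law[of t \<mu>] by auto
  finally show ?thesis .
qed

lemma aug_mono: "s \<le> t \<Longrightarrow> sets (aug_filtration X s) \<subseteq> sets (aug_filtration X t)"
proof -
  assume st: "s \<le> t"
  have step: "sigma_sets (Omega X) (sets (raw_filtration X s) \<union> null_sets (init_law X \<mu>))
     \<subseteq> sigma_sets (Omega X) (sets (raw_filtration X t) \<union> null_sets (init_law X \<mu>))" for \<mu>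
    using raw_mono[OF st] by (intro sigma_sets_mono') auto
  show ?thesis unfolding sets_aug
    by (rule INT_greatest, rule order_trans, rule INT_lower, assumption, rule step)
qed

sublocale filtration "Omega X" "aug_filtration X"
  by unfold_locales (auto dest: aug_mono)

lemma measurable_aug_mono:
  "s \<le> t \<Longrightarrow> f \<in> measurable (aug_filtration X s) N \<Longrightarrow> f \<in> measurable (aug_filtration X t) N"
  using aug_mono[of s t] by (auto simp: measurable_def)

lemma measurable_coord_aug: "s \<le> t \<Longrightarrow> coord X s \<in> measurable (aug_filtration X t) ext_borel"
  using measurable_coord_raw[of s t] raw_subset_aug[of t] by (auto simp: measurable_def)

lemma aug_right_continuous:
  assumes "t < \<infinity>" and "\<And>s. t < s \<Longrightarrow> A \<in> sets (aug_filtration X s)"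
  shows "A \<in> sets (aug_filtration X t)"
  using hunt assms unfolding hunt_process_def by auto

lemma path_properties:
  assumes "\<omega> \<in> Omega X"
  shows coord_infinity: "coord X \<infinity> \<omega> = None"
    and coord_after_lifetime: "lifetime X \<omega> \<le> t \<Longrightarrow> coord X t \<omega> = None"
    and shift_in_Omega: "t < \<infinity> \<Longrightarrow> shift X t \<omega> \<in> Omega X"
    and coord_shift: "t < \<infinity> \<Longrightarrow> coord X s (shift X t \<omega>) = coord X (s + t) \<omega>"
    and coord_right_limit: "t < \<infinity> \<Longrightarrow> limitin ext_top (\<lambda>s. coord X s \<omega>) (coord X t \<omega>) (at_right t)"
proof -
  have *: "coord X \<infinity> \<omega> = None \<and>
        (\<forall>t\<ge>lifetime X \<omega>. coord X t \<omega> = None) \<and>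
        (\<forall>t<\<infinity>. shift X t \<omega> \<in> Omega X \<and> (\<forall>s. coord X s (shift X t \<omega>) = coord X (s + t) \<omega>)) \<and>
        (\<forall>t<\<infinity>. limitin ext_top (\<lambda>s. coord X s \<omega>) (coord X t \<omega>) (at_right t)) \<and>
        (\<forall>t. 0 < t \<and> t < \<infinity> \<longrightarrow> (\<exists>y. limitin ext_top (\<lambda>s. coord X s \<omega>) y (at_left t)))"
    using hunt assms unfolding hunt_process_def by (elim conjE) (erule bspec)
  show "coord X \<infinity> \<omega> = None"
    using * by (elim conjE)
  show "lifetime X \<omega> \<le> t \<Longrightarrow> coord X t \<omega> = None"
    using * by (elim conjE) simp
  show "t < \<infinity> \<Longrightarrow> shift X t \<omega> \<in> Omega X"
    using * by (elim conjE) simp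
  show "t < \<infinity> \<Longrightarrow> coord X s (shift X t \<omega>) = coord X (s + t) \<omega>"
    using * by (elim conjE) simp
  show "t < \<infinity> \<Longrightarrow> limitin ext_top (\<lambda>s. coord X s \<omega>) (coord X t \<omega>) (at_right t)"
    using * by (elim conjE) blast
qed

lemma coord_limit_from_right:
  assumes "\<omega> \<in> Omega X" "t < \<infinity>" "x \<longlonglongrightarrow> t" "\<And>n. t \<le> x n"
  shows "limitin ext_top (\<lambda>n. coord X (x n) \<omega>) (coord X t \<omega>) sequentially"
  unfolding limitin_def
proof (intro conjI allI impI)
  show "coord X t \<omega> \<in> topspace ext_top" by (simp add: UNIV_option_conv[symmetric])
  fix U assume U: "openin ext_top U \<and> coord X t \<omega> \<in> U"
  then have "eventually (\<lambda>s. coord X s \<omega> \<in> U) (at_right t)"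
    using coord_right_limit[OF assms(1,2)] unfolding limitin_def by blast
  then obtain S where S: "open S" "t \<in> S" "\<And>s. s \<in> S \<Longrightarrow> t < s \<Longrightarrow> coord X s \<omega> \<in> U"
    unfolding eventually_at_topological by auto
  have "eventually (\<lambda>n. x n \<in> S) sequentially"
    using assms(3) S(1,2) by (rule topological_tendstoD)
  then show "eventually (\<lambda>n. coord X (x n) \<omega> \<in> U) sequentially"
  proof (eventually_elim)
    case (elim n) then show ?case
      using S(3)[of "x n"] U assms(4)[of n] by (cases "x n = t") auto
  qed
qed

text \<open>Right continuity of the paths allows to approximate the stopping time from the right by
  dyadic times. They are capped at \<open>t\<close>, so that the approximations only use coordinates up to time
  \<open>t\<close>.\<close>
lemma measurable_coord_stopping_restrict:
  assumes \<sigma>: "stopping_time (aug_filtration X) \<sigma>"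
  shows "(\<lambda>\<omega>. coord X (\<sigma> \<omega>) \<omega>) \<in>
    measurable (restrict_space (aug_filtration X t) {\<omega>\<in>Omega X. \<sigma> \<omega> \<le> t \<and> \<sigma> \<omega> < \<infinity>}) ext_borel"
    (is "_ \<in> measurable ?M _")
proof -
  define k where "k n \<omega> = nat \<lfloor>2 ^ n * enn2real (min (\<sigma> \<omega>) t)\<rfloor>" for n :: nat and \<omega>
  define e where "e n j = min t (ennreal ((real j + 1) / 2 ^ n))" for n j :: nat
  have [measurable]: "(\<lambda>\<omega>. min (\<sigma> \<omega>) t) \<in> borel_measurable (aug_filtration X t)"
  proof (rule borel_measurableI_le)
    fix c
    show "{\<omega> \<in> space (aug_filtration X t). min (\<sigma> \<omega>) t \<le> c} \<in> sets (aug_filtration X t)"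
    proof (cases "t \<le> c")
      case True then show ?thesis
        using sets.top[of "aug_filtration X t"] by (simp add: min_le_iff_disj)
    next
      case False
      then show ?thesis using stopping_time_le_const[OF \<sigma>, of c t]
        by (simp add: min_le_iff_disj pred_def)
    qed
  qed
  have km: "k n \<in> measurable (aug_filtration X t) (count_space UNIV)" for n
    unfolding k_def by measurable
  have sp: "space ?M = {\<omega>\<in>Omega X. \<sigma> \<omega> \<le> t \<and> \<sigma> \<omega> < \<infinity>}"
    by (auto simp: space_restrict_space)
  show ?thesis
  proof (rule measurable_ext_limit[OF locally_compact])
    fix n
    show "(\<lambda>\<omega>. coord X (e n (k n \<omega>)) \<omega>) \<in> measurable ?M ext_borel"
    proof (rule measurable_restrict_space1)
      show "(\<lambda>\<omega>. coord X (e n (k n \<omega>)) \<omega>) \<in> measurable (aug_filtration X t) ext_borel"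
        by (rule measurable_compose_countable[OF _ km])
           (auto intro!: measurable_coord_aug simp: e_def)
    qed
  next
    fix \<omega> assume "\<omega> \<in> space ?M"
    then have \<omega>: "\<omega> \<in> Omega X" "\<sigma> \<omega> \<le> t" "\<sigma> \<omega> < \<infinity>" unfolding sp by auto
    define s where "s = enn2real (\<sigma> \<omega>)"
    have s: "\<sigma> \<omega> = ennreal s" "s \<ge> 0" using \<omega>(3) by (auto simp: s_def)
    define y where "y n = (real (k n \<omega>) + 1) / 2 ^ n" for n
    have kn: "real (k n \<omega>) = of_int \<lfloor>2 ^ n * s\<rfloor>" for n
    proof -
      have "k n \<omega> = nat \<lfloor>2 ^ n * s\<rfloor>"
        unfolding k_def using \<omega>(2) s by (simp add: min_absorb1)
      moreover have "\<lfloor>2 ^ n * s\<rfloor> \<ge> 0" using s(2) by simp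
      ultimately show ?thesis by simp
    qed
    have y1: "s \<le> y n" for n
    proof -
      have "2 ^ n * s \<le> real (k n \<omega>) + 1" unfolding kn by linarith
      then show ?thesis by (simp add: y_def field_simps)
    qed
    have y2: "y n \<le> s + 1 / 2 ^ n" for n
    proof -
      have "real (k n \<omega>) + 1 \<le> 2 ^ n * s + 1" unfolding kn by simp
      then show ?thesis by (simp add: y_def field_simps)
    qed
    have "(\<lambda>n. s + 1 / 2 ^ n) \<longlonglongrightarrow> s + 0"
      by (intro tendsto_add tendsto_const LIMSEQ_divide_realpow_zero) auto
    then have "y \<longlonglongrightarrow> s"
      by (intro tendsto_sandwich[of "\<lambda>n. s" y sequentially "\<lambda>n. s + 1 / 2 ^ n"])
         (auto simp: y1 y2)
    then have "(\<lambda>n. ennreal (y n)) \<longlonglongrightarrow> \<sigma> \<omega>" unfolding s by (rule tendsto_ennrealI)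
    then have "(\<lambda>n. min t (ennreal (y n))) \<longlonglongrightarrow> min t (\<sigma> \<omega>)"
      by (intro tendsto_min tendsto_const)
    then have lim: "(\<lambda>n. e n (k n \<omega>)) \<longlonglongrightarrow> \<sigma> \<omega>"
      using \<omega>(2) by (simp add: e_def y_def min_absorb2)
    show "limitin ext_top (\<lambda>n. coord X (e n (k n \<omega>)) \<omega>) (coord X (\<sigma> \<omega>) \<omega>) sequentially"
    proof (rule coord_limit_from_right[OF \<omega>(1,3) lim])
      fix n show "\<sigma> \<omega> \<le> e n (k n \<omega>)"
        using \<omega>(2) y1[of n] unfolding e_def y_def s by (simp add: ennreal_leI)
    qed
  qed
qed

text \<open>What remains is the event that the stopping time is infinite, on which the process sits in
  the cemetery.\<close>
lemma measurable_coord_stopping: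
  assumes \<sigma>: "stopping_time (aug_filtration X) \<sigma>"
  shows "(\<lambda>\<omega>. coord X (\<sigma> \<omega>) \<omega>) \<in> measurable (pre_sigma \<sigma>) ext_borel"
proof (rule measurableI)
  fix E assume E: "E \<in> sets (ext_borel :: 's option measure)"
  show "(\<lambda>\<omega>. coord X (\<sigma> \<omega>) \<omega>) -` E \<inter> space (pre_sigma \<sigma>) \<in> sets (pre_sigma \<sigma>)"
  proof (rule sets_pre_sigmaI[OF \<sigma>])
    fix t
    have fin: "{\<omega>\<in>Omega X. \<sigma> \<omega> \<le> t \<and> \<sigma> \<omega> < \<infinity>} \<in> sets (aug_filtration X t)"
    proof (cases "t = \<infinity>")
      case True
      then show ?thesis using stopping_time_less_const[OF \<sigma>, of \<infinity>] by (simp add: pred_def)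
    next
      case False
      then have "{\<omega>\<in>Omega X. \<sigma> \<omega> \<le> t \<and> \<sigma> \<omega> < \<infinity>} = {\<omega>\<in>Omega X. \<sigma> \<omega> \<le> t}"
        by (auto simp: less_top[symmetric] top_unique)
      then show ?thesis using stopping_timeD[OF \<sigma>, of t] by (simp add: pred_def)
    qed
    have inf: "{\<omega>\<in>Omega X. \<sigma> \<omega> \<le> t \<and> \<sigma> \<omega> = \<infinity>} \<in> sets (aug_filtration X t)"
    proof -
      have "{\<omega>\<in>Omega X. \<sigma> \<omega> \<le> t \<and> \<sigma> \<omega> = \<infinity>} =
        {\<omega>\<in>Omega X. \<sigma> \<omega> \<le> t} - {\<omega>\<in>Omega X. \<sigma> \<omega> \<le> t \<and> \<sigma> \<omega> < \<infinity>}"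
        by (auto simp: less_top[symmetric])
      then show ?thesis using stopping_timeD[OF \<sigma>, of t] fin by (auto simp: pred_def)
    qed
    let ?A = "(\<lambda>\<omega>. coord X (\<sigma> \<omega>) \<omega>) -` E \<inter> {\<omega>\<in>Omega X. \<sigma> \<omega> \<le> t \<and> \<sigma> \<omega> < \<infinity>}"
    have "?A \<in> sets (aug_filtration X t)"
      using measurable_sets[OF measurable_coord_stopping_restrict[OF \<sigma>, of t] E] fin
      by (subst (asm) sets_restrict_space_iff)
         (auto simp: space_restrict_space Int_absorb2 Int_commute Collect_conj_eq[symmetric] conj_ac
           intro: back_subst[where P="\<lambda>A. A \<in> sets (aug_filtration X t)"])
    moreover have "(if None \<in> E then {\<omega>\<in>Omega X. \<sigma> \<omega> \<le> t \<and> \<sigma> \<omega> = \<infinity>} else {}) \<in> sets (aug_filtration X t)"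
      using inf by simp
    ultimately have "?A \<union> (if None \<in> E then {\<omega>\<in>Omega X. \<sigma> \<omega> \<le> t \<and> \<sigma> \<omega> = \<infinity>} else {}) \<in> sets (aug_filtration X t)"
      by (rule sets.Un)
    also have "?A \<union> (if None \<in> E then {\<omega>\<in>Omega X. \<sigma> \<omega> \<le> t \<and> \<sigma> \<omega> = \<infinity>} else {}) =
      {\<omega> \<in> (\<lambda>\<omega>. coord X (\<sigma> \<omega>) \<omega>) -` E \<inter> space (pre_sigma \<sigma>). \<sigma> \<omega> \<le> t}"
      using coord_infinity by (auto simp: space_pre_sigma less_top[symmetric])
    finally show "{\<omega> \<in> (\<lambda>\<omega>. coord X (\<sigma> \<omega>) \<omega>) -` E \<inter> space (pre_sigma \<sigma>). \<sigma> \<omega> \<le> t} \<in> sets (aug_filtration X t)" .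
  qed
qed auto

lemma stopping_time_add_const:
  assumes \<sigma>: "stopping_time (aug_filtration X) \<sigma>"
  shows "stopping_time (aug_filtration X) (\<lambda>\<omega>. \<sigma> \<omega> + s)"
proof (rule stopping_timeI)
  fix t :: ennreal
  show "Measurable.pred (aug_filtration X t) (\<lambda>\<omega>. \<sigma> \<omega> + s \<le> t)"
  proof (cases "s \<le> t \<and> s < \<infinity>")
    case True
    then have "\<sigma> \<omega> + s \<le> t \<longleftrightarrow> \<sigma> \<omega> \<le> t - s" for \<omega>
      using ennreal_le_minus_iff[of "\<sigma> \<omega>" t s] by auto
    then show ?thesis using stopping_time_le_const[OF \<sigma>, of "t - s" t] by (simp add: diff_le_self_ennreal)
  next
    case False
    then have "(\<sigma> \<omega> + s \<le> t) = (t = \<infinity>)" for \<omega>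
    proof -
      have "s \<le> t \<Longrightarrow> t = \<infinity>" using False by (auto simp: less_top[symmetric] top_unique)
      moreover have "\<sigma> \<omega> + s \<le> t \<Longrightarrow> s \<le> t" by (metis add.commute add_increasing2 dual_order.trans order_refl zero_le)
      ultimately show ?thesis by auto
    qed
    then show ?thesis by simp
  qed
qed

end

section \<open>The strong Markov property for path functionals\<close>

lemma nn_integral_return_singleton:
  assumes "{x} \<in> sets M" "x \<in> space M"
  shows "(\<integral>\<^sup>+ y. h y \<partial>return M x) = h x"
proof -
  have "AE y in return M x. y = x"
    using assms by (intro AE_I'[of "space M - {x}"]) (auto simp: null_sets_def emeasure_return)
  then have "(\<integral>\<^sup>+ y. h y \<partial>return M x) = (\<integral>\<^sup>+ y. h x \<partial>return M x)"
    by (intro nn_integral_cong_AE) auto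
  also have "\<dots> = h x" using assms by (simp add: emeasure_return)
  finally show ?thesis .
qed

context hunt
begin

lemma hunt_law:
  shows prob_space_law: "prob_space (law X x)"
    and sets_law: "sets (law X x) = sets (sample X)"
    and measurable_coord_sample: "coord X t \<in> measurable (sample X) ext_borel"
    and law_coord_measurable: "E \<in> sets ext_borel \<Longrightarrow>
        (\<lambda>x. emeasure (law X x) {\<omega> \<in> Omega X. coord X t \<omega> \<in> E}) \<in> borel_measurable ext_borel"
    and law_start: "AE \<omega> in law X x. coord X 0 \<omega> = x"
    and law_dead: "AE \<omega> in law X None. coord X t \<omega> = None"
  using hunt unfolding hunt_process_def by (elim conjE; simp)+

lemma space_law [simp]: "space (law X x) = Omega X"
  using sets_law by (rule sets_eq_imp_space_eq)

lemma measurable_coord_law: "coord X t \<in> measurable (law X x) ext_borel"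
  using measurable_coord_sample sets_law by (simp cong: measurable_cong_sets)

lemma raw_subset_law: "sets (raw_filtration X t) \<subseteq> sets (law X x)"
proof -
  have "{coord X s -` E \<inter> Omega X | s E. s \<le> t \<and> E \<in> sets ext_borel} \<subseteq> sets (law X x)"
    using measurable_sets[OF measurable_coord_law[of _ x]] by auto
  then show ?thesis
    unfolding sets_raw using sets.sigma_sets_subset[of _ "law X x"] by simp
qed

lemma subalgebra_raw_law: "subalgebra (law X x) (raw_filtration X t)"
  using raw_subset_law by (auto simp: subalgebra_def)

text \<open>The laws on the sigma-algebra generated by the coordinates, whose mixtures are completed in
  \<open>init_law\<close>.\<close>
definition rlaw :: "'s option \<Rightarrow> 'w measure" where
  "rlaw x = restr_to_subalg (law X x) (raw_filtration X \<infinity>)"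

lemma sets_rlaw [simp, measurable_cong]: "sets (rlaw x) = sets (raw_filtration X \<infinity>)"
  unfolding rlaw_def by (rule sets_restr_to_subalg[OF subalgebra_raw_law])

lemma space_rlaw [simp]: "space (rlaw x) = Omega X"
  unfolding rlaw_def by (simp add: space_restr_to_subalg)

lemma emeasure_rlaw: "A \<in> sets (raw_filtration X \<infinity>) \<Longrightarrow> emeasure (rlaw x) A = emeasure (law X x) A"
  unfolding rlaw_def by (rule emeasure_restr_to_subalg[OF subalgebra_raw_law])

lemma prob_space_rlaw: "prob_space (rlaw x)"
  unfolding rlaw_def using subalgebra_raw_law prob_space_law by (rule prob_space_restr_to_subalg)

lemma nn_integral_rlaw:
  "f \<in> borel_measurable (raw_filtration X \<infinity>) \<Longrightarrow> (\<integral>\<^sup>+ \<omega>. f \<omega> \<partial>rlaw x) = (\<integral>\<^sup>+ \<omega>. f \<omega> \<partial>law X x)"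
  unfolding rlaw_def by (rule nn_integral_subalgebra2[OF subalgebra_raw_law])

lemma init_law_return: "init_law X (return ext_borel x) = completion (rlaw x)"
proof -
  have "measure_of (Omega X) (sets (raw_filtration X \<infinity>))
     (\<lambda>A. \<integral>\<^sup>+ y. emeasure (law X y) A \<partial>return ext_borel x) = rlaw x"
    unfolding rlaw_def restr_to_subalg_def
    by (simp add: nn_integral_return_singleton singleton_in_ext_borel)
  then show ?thesis unfolding init_law_def by simp
qed

lemma pt_law_eq: "pt_law X x = completion (rlaw (Some x))"
  unfolding pt_law_def by (rule init_law_return)

lemma prob_space_completion: "prob_space M \<Longrightarrow> prob_space (completion M)"
  by (rule prob_spaceI) (simp add: prob_space.emeasure_space_1)

lemma prob_space_init_return: "prob_space (init_law X (return ext_borel x))"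
  unfolding init_law_return by (intro prob_space_completion prob_space_rlaw)

lemma pre_sigma_subset_init_law:
  assumes "stopping_time (aug_filtration X) \<sigma>" "\<mu> \<in> PA"
  shows "sets (pre_sigma \<sigma>) \<subseteq> sets (init_law X \<mu>)"
proof
  fix A assume "A \<in> sets (pre_sigma \<sigma>)"
  then have "{\<omega>\<in>A. \<sigma> \<omega> \<le> \<infinity>} \<in> sets (aug_filtration X \<infinity>)"
    by (rule sets_pre_sigmaD[OF assms(1)])
  then show "A \<in> sets (init_law X \<mu>)" using aug_subset_init_law[OF assms(2), of \<infinity>] by auto
qed

lemma subalgebra_pre_sigma:
  assumes "stopping_time (aug_filtration X) \<sigma>" "\<mu> \<in> PA"
  shows "subalgebra (init_law X \<mu>) (pre_sigma \<sigma>)"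
  using pre_sigma_subset_init_law[OF assms] by (auto simp: subalgebra_def space_pre_sigma)

text \<open>\<open>strong_markov\<close> is a statement on conditional probabilities. Integrated against a weight
  that is known at the stopping time it becomes an identity that can be iterated.\<close>
lemma markov_set:
  assumes \<mu>: "\<mu> \<in> PA" and prob: "prob_space (init_law X \<mu>)"
    and \<sigma>: "stopping_time (aug_filtration X) \<sigma>"
    and Z: "Z \<in> borel_measurable (pre_sigma \<sigma>)" and E: "E \<in> sets ext_borel"
  shows "(\<integral>\<^sup>+ \<omega>. Z \<omega> * indicator E (coord X (\<sigma> \<omega> + s) \<omega>) \<partial>init_law X \<mu>) =
    (\<integral>\<^sup>+ \<omega>. Z \<omega> * emeasure (law X (coord X (\<sigma> \<omega>) \<omega>)) {\<omega>' \<in> Omega X. coord X s \<omega>' \<in> E} \<partial>init_law X \<mu>)"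
proof -
  let ?M = "init_law X \<mu>" and ?F = "pre_sigma \<sigma>"
  interpret prob_space ?M by fact
  note sub = subalgebra_pre_sigma[OF \<sigma> \<mu>]
  interpret finite_measure_subalgebra ?M ?F by unfold_locales (rule sub)
  let ?B = "{\<omega>' \<in> Omega X. coord X (\<sigma> \<omega>' + s) \<omega>' \<in> E}"
  have B [measurable]: "?B \<in> sets ?M"
  proof -
    note \<sigma>s = stopping_time_add_const[OF \<sigma>, of s]
    have "(\<lambda>\<omega>. coord X (\<sigma> \<omega> + s) \<omega>) -` E \<inter> space (pre_sigma (\<lambda>\<omega>. \<sigma> \<omega> + s)) \<in> sets (pre_sigma (\<lambda>\<omega>. \<sigma> \<omega> + s))"
      using measurable_coord_stopping[OF \<sigma>s] E by (rule measurable_sets)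
    then show ?thesis
      using pre_sigma_subset_init_law[OF \<sigma>s \<mu>] by (auto simp: space_pre_sigma vimage_def Int_def conj_commute)
  qed
  let ?c = "nn_cond_exp ?M ?F (indicator ?B)"
  have zero: "AE \<omega> in ?M. 0 = nn_cond_exp ?M ?F (\<lambda>_. 0) \<omega>"
    by (rule nn_cond_exp_F_meas) simp
  have one: "AE \<omega> in ?M. 1 = nn_cond_exp ?M ?F (\<lambda>_. 1) \<omega>"
    by (rule nn_cond_exp_F_meas) simp
  have mono: "AE \<omega> in ?M. ?c \<omega> \<le> nn_cond_exp ?M ?F (\<lambda>_. 1) \<omega>"
    by (rule nn_cond_exp_mono) (auto simp: indicator_def)
  have "AE \<omega> in ?M. real_cond_exp ?M ?F (indicator ?B) \<omega> =
       measure (law X (coord X (\<sigma> \<omega>) \<omega>)) {\<omega>' \<in> Omega X. coord X s \<omega>' \<in> E}"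
    using hunt \<mu> \<sigma> E unfolding hunt_process_def strong_markov_def by blast
  then have c: "AE \<omega> in ?M. ?c \<omega> = emeasure (law X (coord X (\<sigma> \<omega>) \<omega>)) {\<omega>' \<in> Omega X. coord X s \<omega>' \<in> E}"
    using zero one mono
  proof eventually_elim
    case (elim \<omega>)
    have *: "(\<lambda>x. ennreal (indicator ?B x)) = indicator ?B" "(\<lambda>x. ennreal (- indicator ?B x)) = (\<lambda>_. 0)"
      by (auto simp: indicator_def fun_eq_iff ennreal_neg)
    have "?c \<omega> \<le> 1" using elim by simp
    then have "?c \<omega> < \<infinity>" using order_le_less_trans[OF _ ennreal_one_less_top] by simp
    then have "?c \<omega> = ennreal (enn2real (?c \<omega>))" by simp
    also have "enn2real (?c \<omega>) = measure (law X (coord X (\<sigma> \<omega>) \<omega>)) {\<omega>' \<in> Omega X. coord X s \<omega>' \<in> E}"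
      using elim(1) elim(2)[symmetric] unfolding real_cond_exp_def * by simp
    finally show ?case
      by (simp add: finite_measure.emeasure_eq_measure[OF prob_space.finite_measure[OF prob_space_law]])
  qed
  have "(\<integral>\<^sup>+ \<omega>. Z \<omega> * indicator E (coord X (\<sigma> \<omega> + s) \<omega>) \<partial>?M) = (\<integral>\<^sup>+ \<omega>. Z \<omega> * indicator ?B \<omega> \<partial>?M)"
    by (intro nn_integral_cong) (auto simp: indicator_def)
  also have "\<dots> = (\<integral>\<^sup>+ \<omega>. Z \<omega> * ?c \<omega> \<partial>?M)"
    by (rule nn_cond_exp_intg[symmetric, OF Z]) simp
  also have "\<dots> = (\<integral>\<^sup>+ \<omega>. Z \<omega> * emeasure (law X (coord X (\<sigma> \<omega>) \<omega>)) {\<omega>' \<in> Omega X. coord X s \<omega>' \<in> E} \<partial>?M)"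
    using c by (intro nn_integral_cong_AE) auto
  finally show ?thesis .
qed

definition kernel :: "ennreal \<Rightarrow> ('s option \<Rightarrow> ennreal) \<Rightarrow> 's option \<Rightarrow> ennreal" where
  "kernel s g x = (\<integral>\<^sup>+ \<omega>. g (coord X s \<omega>) \<partial>law X x)"

lemma kernel_measurable:
  assumes "g \<in> borel_measurable ext_borel"
  shows "kernel s g \<in> borel_measurable ext_borel"
proof -
  let ?k = "\<lambda>x. distr (law X x) ext_borel (coord X s)"
  have k: "?k \<in> measurable ext_borel (subprob_algebra ext_borel)"
  proof (rule measurable_subprob_algebra)
    show "subprob_space (?k x)" for x
      using prob_space.prob_space_distr[OF prob_space_law measurable_coord_law]
      by (rule prob_space_imp_subprob_space)
    show "(\<lambda>x. emeasure (?k x) E) \<in> borel_measurable ext_borel" if "E \<in> sets ext_borel" for E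
      using law_coord_measurable[OF that, of s] that
      by (subst emeasure_distr[OF measurable_coord_law]) (auto simp: vimage_def Int_def conj_commute)
  qed simp
  have "kernel s g = (\<lambda>x. \<integral>\<^sup>+ y. g y \<partial>?k x)"
    unfolding kernel_def using assms by (simp add: nn_integral_distr[OF measurable_coord_law])
  also have "\<dots> \<in> borel_measurable ext_borel"
    using measurable_compose[OF k nn_integral_measurable_subprob_algebra[OF assms]] .
  finally show ?thesis .
qed

lemma markov_fun:
  assumes \<mu>: "\<mu> \<in> PA" and prob: "prob_space (init_law X \<mu>)"
    and \<sigma>: "stopping_time (aug_filtration X) \<sigma>"
    and Z: "Z \<in> borel_measurable (pre_sigma \<sigma>)" and g: "g \<in> borel_measurable ext_borel"
  shows "(\<integral>\<^sup>+ \<omega>. Z \<omega> * g (coord X (\<sigma> \<omega> + s) \<omega>) \<partial>init_law X \<mu>) =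
    (\<integral>\<^sup>+ \<omega>. Z \<omega> * kernel s g (coord X (\<sigma> \<omega>) \<omega>) \<partial>init_law X \<mu>)"
proof -
  let ?M = "init_law X \<mu>"
  note \<sigma>s = stopping_time_add_const[OF \<sigma>, of s]
  have Z' [measurable]: "Z \<in> borel_measurable ?M"
    using subalgebra_pre_sigma[OF \<sigma> \<mu>] Z by (rule measurable_from_subalg)
  have Xs [measurable]: "(\<lambda>\<omega>. coord X (\<sigma> \<omega> + s) \<omega>) \<in> measurable ?M ext_borel"
    using subalgebra_pre_sigma[OF \<sigma>s \<mu>] measurable_coord_stopping[OF \<sigma>s] by (rule measurable_from_subalg)
  have X0 [measurable]: "(\<lambda>\<omega>. coord X (\<sigma> \<omega>) \<omega>) \<in> measurable ?M ext_borel"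
    using subalgebra_pre_sigma[OF \<sigma> \<mu>] measurable_coord_stopping[OF \<sigma>] by (rule measurable_from_subalg)
  note [measurable] = kernel_measurable
  have cm: "(\<lambda>\<omega>. u (coord X s \<omega>)) \<in> borel_measurable (law X x)"
    if "u \<in> borel_measurable ext_borel" for u :: "'s option \<Rightarrow> ennreal" and x
    using measurable_coord_law that by (rule measurable_compose)
  show ?thesis using g
  proof (induction rule: borel_measurable_induct)
    case (cong f g)
    then have "f = g" by (intro ext) auto
    then show ?case using cong by simp
  next
    case (set E)
    have "kernel s (indicator E) x = emeasure (law X x) {\<omega>' \<in> Omega X. coord X s \<omega>' \<in> E}" for x
    proof -
      have "kernel s (indicator E) x = (\<integral>\<^sup>+ \<omega>. indicator {\<omega>' \<in> Omega X. coord X s \<omega>' \<in> E} \<omega> \<partial>law X x)"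
        unfolding kernel_def by (intro nn_integral_cong) (auto simp: indicator_def)
      also have "\<dots> = emeasure (law X x) {\<omega>' \<in> Omega X. coord X s \<omega>' \<in> E}"
        using measurable_sets_Collect[OF measurable_coord_law[of s x], of "\<lambda>y. y \<in> E"] set
        by (intro nn_integral_indicator) simp
      finally show ?thesis .
    qed
    then show ?case using markov_set[OF \<mu> prob \<sigma> Z set] by simp
  next
    case (mult u c)
    have "kernel s (\<lambda>x. c * u x) = (\<lambda>x. c * kernel s u x)"
      unfolding kernel_def using mult by (intro ext nn_integral_cmult cm)
    then show ?case
      using mult by (simp add: mult.left_commute nn_integral_cmult)
  next
    case (add u v)
    have "kernel s (\<lambda>x. v x + u x) = (\<lambda>x. kernel s v x + kernel s u x)"
      unfolding kernel_def using add by (intro ext nn_integral_add cm)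
    then show ?case using add by (simp add: distrib_left nn_integral_add)
  next
    case (seq U)
    have inc: "incseq (\<lambda>i. U i x)" for x using seq(3) by (auto simp: incseq_def le_fun_def)
    have k: "kernel s (\<lambda>x. SUP i. U i x) = (\<lambda>x. SUP i. kernel s (U i) x)"
      unfolding kernel_def using seq inc
      by (intro ext nn_integral_monotone_convergence_SUP cm) (auto simp: incseq_def le_fun_def)
    have kinc: "incseq (\<lambda>i. kernel s (U i) x)" for x
      unfolding kernel_def using inc by (intro incseq_SucI nn_integral_mono) (auto simp: incseq_Suc_iff)
    have "(\<integral>\<^sup>+ \<omega>. Z \<omega> * (SUP i. U i (coord X (\<sigma> \<omega> + s) \<omega>)) \<partial>?M) =
      (SUP i. \<integral>\<^sup>+ \<omega>. Z \<omega> * U i (coord X (\<sigma> \<omega> + s) \<omega>) \<partial>?M)"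
      unfolding SUP_mult_left_ennreal using seq inc
      by (intro nn_integral_monotone_convergence_SUP) (auto simp: incseq_def le_fun_def intro!: mult_left_mono)
    also have "\<dots> = (SUP i. \<integral>\<^sup>+ \<omega>. Z \<omega> * kernel s (U i) (coord X (\<sigma> \<omega>) \<omega>) \<partial>?M)"
      using seq by simp
    also have "\<dots> = (\<integral>\<^sup>+ \<omega>. Z \<omega> * (SUP i. kernel s (U i) (coord X (\<sigma> \<omega>) \<omega>)) \<partial>?M)"
      unfolding SUP_mult_left_ennreal using seq kinc
      by (intro nn_integral_monotone_convergence_SUP[symmetric])
         (auto simp: incseq_def le_fun_def intro!: mult_left_mono)
    finally show ?case unfolding SUP_apply image_comp k by (simp add: image_comp)
  qed
qed

text \<open>The probability to be in given sets at successive times, as an iterated integral. The list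
  contains the waiting times between the visits, so that each application of the Markov property
  removes one entry.\<close>
fun iterate :: "(ennreal \<times> 's option set) list \<Rightarrow> 's option \<Rightarrow> ennreal" where
  "iterate [] x = 1"
| "iterate ((d, E) # l) x = kernel d (\<lambda>y. indicator E y * iterate l y) x"

fun visits :: "(ennreal \<times> 's option set) list \<Rightarrow> ennreal \<Rightarrow> 'w \<Rightarrow> ennreal" where
  "visits [] c \<omega> = 1"
| "visits ((d, E) # l) c \<omega> = indicator E (coord X (c + d) \<omega>) * visits l (c + d) \<omega>"

lemma iterate_measurable:
  "\<forall>(d, E)\<in>set l. E \<in> sets ext_borel \<Longrightarrow> iterate l \<in> borel_measurable ext_borel"
proof (induction l)
  case Nil
  have "iterate [] = (\<lambda>_. 1)" by (rule ext) simp
  then show ?case by simp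
next
  case (Cons p l)
  obtain d E where p: "p = (d, E)" by (cases p)
  have [measurable]: "E \<in> sets ext_borel" "iterate l \<in> borel_measurable ext_borel" using Cons by (auto simp: p)
  have "iterate (p # l) = kernel d (\<lambda>y. indicator E y * iterate l y)" by (rule ext) (simp add: p)
  also have "\<dots> \<in> borel_measurable ext_borel" by (rule kernel_measurable) measurable
  finally show ?case .
qed

text \<open>In the induction step the stopping time moves on by \<open>d\<close>, and the first indicator becomes
  part of the weight \<open>Z\<close>.\<close>
lemma markov_iterate:
  assumes \<mu>: "\<mu> \<in> PA" and prob: "prob_space (init_law X \<mu>)"
  shows "stopping_time (aug_filtration X) \<sigma> \<Longrightarrow> Z \<in> borel_measurable (pre_sigma \<sigma>) \<Longrightarrow>
    \<forall>(d, E)\<in>set l. E \<in> sets ext_borel \<Longrightarrow>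
    (\<integral>\<^sup>+ \<omega>. Z \<omega> * visits l (\<sigma> \<omega>) \<omega> \<partial>init_law X \<mu>) =
    (\<integral>\<^sup>+ \<omega>. Z \<omega> * iterate l (coord X (\<sigma> \<omega>) \<omega>) \<partial>init_law X \<mu>)"
proof (induction l arbitrary: \<sigma> Z)
  case Nil then show ?case by simp
next
  case (Cons p l)
  obtain d E where p: "p = (d, E)" by (cases p)
  note \<sigma> = Cons.prems(1) and Z = Cons.prems(2)
  note \<sigma>d = stopping_time_add_const[OF \<sigma>, of d]
  have E [measurable]: "E \<in> sets ext_borel" and l: "\<forall>(d, E)\<in>set l. E \<in> sets ext_borel"
    using Cons.prems(3) by (auto simp: p)
  have "subalgebra (pre_sigma (\<lambda>\<omega>. \<sigma> \<omega> + d)) (pre_sigma \<sigma>)"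
    unfolding subalgebra_def using mono_pre_sigma[OF \<sigma> \<sigma>d] by (simp add: space_pre_sigma)
  then have [measurable]: "Z \<in> borel_measurable (pre_sigma (\<lambda>\<omega>. \<sigma> \<omega> + d))"
    using Z by (rule measurable_from_subalg)
  note [measurable] = measurable_coord_stopping[OF \<sigma>d] iterate_measurable[OF l]
  have "(\<integral>\<^sup>+ \<omega>. Z \<omega> * visits (p # l) (\<sigma> \<omega>) \<omega> \<partial>init_law X \<mu>) =
    (\<integral>\<^sup>+ \<omega>. (Z \<omega> * indicator E (coord X (\<sigma> \<omega> + d) \<omega>)) * visits l (\<sigma> \<omega> + d) \<omega> \<partial>init_law X \<mu>)"
    by (simp add: p mult.assoc)
  also have "\<dots> = (\<integral>\<^sup>+ \<omega>. (Z \<omega> * indicator E (coord X (\<sigma> \<omega> + d) \<omega>)) *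
      iterate l (coord X (\<sigma> \<omega> + d) \<omega>) \<partial>init_law X \<mu>)"
    by (rule Cons.IH[OF \<sigma>d _ l]) measurable
  also have "\<dots> = (\<integral>\<^sup>+ \<omega>. Z \<omega> * (indicator E (coord X (\<sigma> \<omega> + d) \<omega>) *
      iterate l (coord X (\<sigma> \<omega> + d) \<omega>)) \<partial>init_law X \<mu>)"
    by (simp add: mult.assoc)
  also have "\<dots> = (\<integral>\<^sup>+ \<omega>. Z \<omega> * iterate (p # l) (coord X (\<sigma> \<omega>) \<omega>) \<partial>init_law X \<mu>)"
    unfolding p iterate.simps by (rule markov_fun[OF \<mu> prob \<sigma> Z]) measurable
  finally show ?case .
qed

lemma visits_measurable:
  "\<forall>(d, E)\<in>set l. E \<in> sets ext_borel \<Longrightarrow> visits l c \<in> borel_measurable (raw_filtration X \<infinity>)"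
proof (induction l arbitrary: c)
  case Nil
  have "visits [] c = (\<lambda>_. 1)" by (rule ext) simp
  then show ?case by simp
next
  case (Cons p l)
  obtain d E where p: "p = (d, E)" by (cases p)
  have [measurable]: "E \<in> sets ext_borel" "visits l (c + d) \<in> borel_measurable (raw_filtration X \<infinity>)"
    using Cons by (auto simp: p)
  have [measurable]: "coord X (c + d) \<in> measurable (raw_filtration X \<infinity>) ext_borel"
    by (rule measurable_coord_raw) simp
  have "visits (p # l) c = (\<lambda>\<omega>. indicator E (coord X (c + d) \<omega>) * visits l (c + d) \<omega>)"
    by (rule ext) (simp add: p)
  also have "\<dots> \<in> borel_measurable (raw_filtration X \<infinity>)" by measurable
  finally show ?case .
qed

lemma nn_integral_init_return:
  assumes f: "f \<in> borel_measurable (raw_filtration X \<infinity>)"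
  shows "(\<integral>\<^sup>+ \<omega>. f \<omega> \<partial>init_law X (return ext_borel x)) = (\<integral>\<^sup>+ \<omega>. f \<omega> \<partial>law X x)"
  using f unfolding init_law_return
  by (subst nn_integral_completion) (simp add: nn_integral_rlaw)

lemma AE_init_return:
  assumes "AE \<omega> in rlaw x. P \<omega>"
  shows "AE \<omega> in init_law X (return ext_borel x). P \<omega>"
  using assms unfolding init_law_return by (rule AE_completion)

lemma rlaw_start: "AE \<omega> in rlaw x. coord X 0 \<omega> = x"
  unfolding rlaw_def
proof (rule AE_restr_to_subalg2[OF subalgebra_raw_law])
  show "AE \<omega> in law X x. coord X 0 \<omega> = x" by (rule law_start)
  have "coord X 0 -` {x} \<inter> space (raw_filtration X \<infinity>) \<in> sets (raw_filtration X \<infinity>)"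
    by (rule measurable_sets[OF measurable_coord_raw singleton_in_ext_borel]) simp
  then show "Measurable.pred (raw_filtration X \<infinity>) (\<lambda>\<omega>. coord X 0 \<omega> = x)"
    by (simp add: pred_def vimage_def Int_def conj_commute)
qed

lemma iterate_eq_law:
  assumes l: "\<forall>(d, E)\<in>set l. E \<in> sets ext_borel"
  shows "iterate l x = (\<integral>\<^sup>+ \<omega>. visits l 0 \<omega> \<partial>law X x)"
proof -
  let ?M = "init_law X (return ext_borel x)"
  have "(\<integral>\<^sup>+ \<omega>. visits l 0 \<omega> \<partial>law X x) = (\<integral>\<^sup>+ \<omega>. visits l 0 \<omega> \<partial>?M)"
    by (rule nn_integral_init_return[symmetric, OF visits_measurable[OF l]])
  also have "\<dots> = (\<integral>\<^sup>+ \<omega>. iterate l (coord X 0 \<omega>) \<partial>?M)"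
    using markov_iterate[OF return_in_PA prob_space_init_return stopping_time_const, of "\<lambda>_. 1" 0 l] l
    by simp
  also have "\<dots> = (\<integral>\<^sup>+ \<omega>. iterate l x \<partial>?M)"
  proof (rule nn_integral_cong_AE)
    show "AE \<omega> in ?M. iterate l (coord X 0 \<omega>) = iterate l x"
      using AE_init_return[OF rlaw_start] by eventually_elim simp
  qed
  also have "\<dots> = iterate l x"
    using prob_space.emeasure_space_1[OF prob_space_init_return[of x]] by simp
  finally show ?thesis ..
qed

definition cylinder :: "(ennreal \<times> 's option set) list \<Rightarrow> 'w set" where
  "cylinder l = {\<omega>\<in>Omega X. \<forall>(s, E)\<in>set l. coord X s \<omega> \<in> E}"

text \<open>Waiting times, from a list of increasing absolute times.\<close>
fun increments :: "ennreal \<Rightarrow> (ennreal \<times> 's option set) list \<Rightarrow> (ennreal \<times> 's option set) list" where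
  "increments c [] = []"
| "increments c ((s, E) # l) = (s - c, E) # increments s l"

lemma increments_sets: "\<forall>(d, E)\<in>set l. E \<in> sets ext_borel \<Longrightarrow> \<forall>(d, E)\<in>set (increments c l). E \<in> sets ext_borel"
  by (induction c l rule: increments.induct) auto

lemma visits_increments:
  "sorted (c # map fst l) \<Longrightarrow>
    visits (increments c l) (b + c) \<omega> = (if \<forall>(s, E)\<in>set l. coord X (b + s) \<omega> \<in> E then 1 else 0)"
proof (induction c l rule: increments.induct)
  case (2 c s E l)
  have eq: "b + c + (s - c) = b + s"
    using 2(2) by (simp add: add.assoc add_diff_inverse_ennreal)
  show ?case
    unfolding increments.simps visits.simps eq using 2 by (auto simp: indicator_def)
qed simp

text \<open>After sorting by time, a cylinder is a list of visits. Its probability is thus an iterated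
  kernel; this also makes it measurable in the starting point, which \<open>hunt_process\<close> asserts for a
  single time only.\<close>
lemma law_cylinder_strong_markov:
  assumes l: "\<forall>(s, E)\<in>set l. E \<in> sets ext_borel"
  shows cylinder_raw: "cylinder l \<in> sets (raw_filtration X \<infinity>)"
    and law_cylinder_measurable: "(\<lambda>x. emeasure (law X x) (cylinder l)) \<in> borel_measurable ext_borel"
    and strong_markov_cylinder: "\<lbrakk>\<mu> \<in> PA; prob_space (init_law X \<mu>); stopping_time (aug_filtration X) \<sigma>;
      Z \<in> borel_measurable (pre_sigma \<sigma>)\<rbrakk> \<Longrightarrow>
      (\<integral>\<^sup>+ \<omega>. Z \<omega> * (if \<forall>(s, E)\<in>set l. coord X (\<sigma> \<omega> + s) \<omega> \<in> E then 1 else 0) \<partial>init_law X \<mu>) =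
      (\<integral>\<^sup>+ \<omega>. Z \<omega> * emeasure (law X (coord X (\<sigma> \<omega>) \<omega>)) (cylinder l) \<partial>init_law X \<mu>)"
proof -
  define l' where "l' = increments 0 (sort_key fst l)"
  have sl: "\<forall>(s, E)\<in>set (sort_key fst l). E \<in> sets ext_borel" using l by simp
  have l': "\<forall>(s, E)\<in>set l'. E \<in> sets ext_borel" unfolding l'_def by (rule increments_sets[OF sl])
  have v: "visits l' b \<omega> = (if \<forall>(s, E)\<in>set l. coord X (b + s) \<omega> \<in> E then 1 else 0)" for b \<omega>
    using visits_increments[of 0 "sort_key fst l" b \<omega>] by (simp add: l'_def)
  have ind: "visits l' 0 \<omega> = indicator (cylinder l) \<omega>" if "\<omega> \<in> Omega X" for \<omega>
    using that by (simp add: v cylinder_def)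
  have "visits l' 0 -` {1} \<inter> space (raw_filtration X \<infinity>) \<in> sets (raw_filtration X \<infinity>)"
    by (rule measurable_sets[OF visits_measurable[OF l']]) simp
  also have "visits l' 0 -` {1} \<inter> space (raw_filtration X \<infinity>) = cylinder l"
    by (auto simp: v cylinder_def split: if_splits)
  finally show raw: "cylinder l \<in> sets (raw_filtration X \<infinity>)" .
  have eq: "iterate l' x = emeasure (law X x) (cylinder l)" for x
  proof -
    have "iterate l' x = (\<integral>\<^sup>+ \<omega>. indicator (cylinder l) \<omega> \<partial>law X x)"
      unfolding iterate_eq_law[OF l'] by (intro nn_integral_cong) (simp add: ind)
    also have "\<dots> = emeasure (law X x) (cylinder l)"
      using raw raw_subset_law[of \<infinity> x] by (intro nn_integral_indicator) auto
    finally show ?thesis .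
  qed
  show "(\<lambda>x. emeasure (law X x) (cylinder l)) \<in> borel_measurable ext_borel"
    using iterate_measurable[OF l'] by (simp add: eq[abs_def])
  show "(\<integral>\<^sup>+ \<omega>. Z \<omega> * (if \<forall>(s, E)\<in>set l. coord X (\<sigma> \<omega> + s) \<omega> \<in> E then 1 else 0) \<partial>init_law X \<mu>) =
      (\<integral>\<^sup>+ \<omega>. Z \<omega> * emeasure (law X (coord X (\<sigma> \<omega>) \<omega>)) (cylinder l) \<partial>init_law X \<mu>)"
    if "\<mu> \<in> PA" "prob_space (init_law X \<mu>)" "stopping_time (aug_filtration X) \<sigma>"
      "Z \<in> borel_measurable (pre_sigma \<sigma>)"
    using markov_iterate[OF that l'] by (simp only: v eq)
qed

abbreviation "Cylinders \<equiv> {cylinder l | l. \<forall>(s, E)\<in>set l. E \<in> sets ext_borel}"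

lemma Int_stable_Cylinders: "Int_stable Cylinders"
proof (rule Int_stableI)
  fix A B assume "A \<in> Cylinders" "B \<in> Cylinders"
  then obtain l l' where "A = cylinder l" "B = cylinder l'"
    "\<forall>(s, E)\<in>set l. E \<in> sets ext_borel" "\<forall>(s, E)\<in>set l'. E \<in> sets ext_borel" by auto
  moreover then have "A \<inter> B = cylinder (l @ l')" by (auto simp: cylinder_def)
  ultimately show "A \<inter> B \<in> Cylinders" by (intro CollectI exI[of _ "l @ l'"]) auto
qed

lemma Cylinders_subset: "Cylinders \<subseteq> Pow (Omega X)"
  by (auto simp: cylinder_def)

lemma sets_raw_cylinder: "sets (raw_filtration X \<infinity>) = sigma_sets (Omega X) Cylinders"
proof
  show "sets (raw_filtration X \<infinity>) \<subseteq> sigma_sets (Omega X) Cylinders"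
    unfolding sets_raw
  proof (rule sigma_sets_mono', safe)
    fix s :: ennreal and E :: "'s option set" assume "E \<in> sets ext_borel"
    moreover have "coord X s -` E \<inter> Omega X = cylinder [(s, E)]" by (auto simp: cylinder_def)
    ultimately show "\<exists>l. coord X s -` E \<inter> Omega X = cylinder l \<and> (\<forall>(s, E)\<in>set l. E \<in> sets ext_borel)"
      by (intro exI[of _ "[(s, E)]"]) simp
  qed
  show "sigma_sets (Omega X) Cylinders \<subseteq> sets (raw_filtration X \<infinity>)"
    using sets.sigma_sets_subset[of Cylinders "raw_filtration X \<infinity>"] cylinder_raw by auto
qed

lemma law_measurable:
  assumes "A \<in> sets (raw_filtration X \<infinity>)"
  shows "(\<lambda>x. emeasure (law X x) A) \<in> borel_measurable ext_borel"
  using Int_stable_Cylinders Cylinders_subset assms[unfolded sets_raw_cylinder]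
proof (induction rule: sigma_sets_induct_disjoint)
  case (basic A) then show ?case using law_cylinder_measurable by auto
next
  case empty then show ?case by simp
next
  case (compl A)
  have "emeasure (law X x) (Omega X - A) = 1 - emeasure (law X x) A" for x
  proof -
    interpret prob_space "law X x" by (rule prob_space_law)
    have "A \<in> sets (law X x)"
      using compl(1) raw_subset_law[of \<infinity> x] unfolding sets_raw_cylinder by auto
    then show ?thesis using emeasure_compl[of A "law X x"] emeasure_space_1 by simp
  qed
  then show ?case using compl by simp
next
  case (union A)
  have "A i \<in> sets (law X x)" for i x
    using union(2) raw_subset_law[of \<infinity> x] unfolding sets_raw_cylinder by auto
  then have "emeasure (law X x) (\<Union>i. A i) = (\<Sum>i. emeasure (law X x) (A i))" for x
    using union(1) by (intro suminf_emeasure[symmetric]) auto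
  then show ?case using union by simp
qed

lemma rlaw_measurable: "rlaw \<in> measurable ext_borel (subprob_algebra (raw_filtration X \<infinity>))"
proof (rule measurable_subprob_algebra)
  show "subprob_space (rlaw x)" for x using prob_space_rlaw by (rule prob_space_imp_subprob_space)
  show "(\<lambda>x. emeasure (rlaw x) A) \<in> borel_measurable ext_borel" if "A \<in> sets (raw_filtration X \<infinity>)" for A
    using law_measurable[OF that] by (simp add: emeasure_rlaw[OF that])
qed simp

lemma rlaw_measurable': "\<mu> \<in> PA \<Longrightarrow> rlaw \<in> measurable \<mu> (subprob_algebra (raw_filtration X \<infinity>))"
  using rlaw_measurable by (simp add: space_prob_algebra cong: measurable_cong_sets)

lemma space_PA: "\<mu> \<in> PA \<Longrightarrow> space \<mu> = UNIV"
  using sets_eq_imp_space_eq[of \<mu> ext_borel] by (simp add: space_prob_algebra)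

lemma sets_bind_rlaw: "\<mu> \<in> PA \<Longrightarrow> sets (\<mu> \<bind> rlaw) = sets (raw_filtration X \<infinity>)"
  by (rule sets_bind) (auto simp: space_PA)

lemma emeasure_bind_rlaw:
  "\<mu> \<in> PA \<Longrightarrow> A \<in> sets (raw_filtration X \<infinity>) \<Longrightarrow> emeasure (\<mu> \<bind> rlaw) A = (\<integral>\<^sup>+ x. emeasure (law X x) A \<partial>\<mu>)"
  by (subst emeasure_bind[OF _ rlaw_measurable']) (auto simp: space_PA emeasure_rlaw)

text \<open>Now that the laws form a kernel, the set function in \<open>init_law\<close> is a mixture in the sense of
  the Giry monad, and therefore a measure.\<close>
lemma init_law_eq: 
  assumes "\<mu> \<in> PA" shows "init_law X \<mu> = completion (\<mu> \<bind> rlaw)"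
proof -
  have sp: "space (\<mu> \<bind> rlaw) = Omega X"
    using sets_eq_imp_space_eq[OF sets_bind_rlaw[OF assms]] by simp
  have "measure_of (Omega X) (sets (raw_filtration X \<infinity>)) (\<lambda>A. \<integral>\<^sup>+ x. emeasure (law X x) A \<partial>\<mu>) =
    measure_of (Omega X) (sets (raw_filtration X \<infinity>)) (emeasure (\<mu> \<bind> rlaw))"
  proof (rule measure_of_eq)
    show "sets (raw_filtration X \<infinity>) \<subseteq> Pow (Omega X)" by (rule raw_subset_Pow)
    fix A assume "A \<in> sigma_sets (Omega X) (sets (raw_filtration X \<infinity>))"
    then have "A \<in> sets (raw_filtration X \<infinity>)"
      using sets.sigma_sets_eq[of "raw_filtration X \<infinity>"] by simp
    then show "(\<integral>\<^sup>+ x. emeasure (law X x) A \<partial>\<mu>) = emeasure (\<mu> \<bind> rlaw) A"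
      by (rule emeasure_bind_rlaw[OF assms, symmetric])
  qed
  also have "\<dots> = \<mu> \<bind> rlaw"
    using measure_of_of_measure[of "\<mu> \<bind> rlaw"] by (simp add: sp sets_bind_rlaw[OF assms])
  finally show ?thesis unfolding init_law_def by simp
qed

lemma prob_space_init_law: "\<mu> \<in> PA \<Longrightarrow> prob_space (init_law X \<mu>)"
proof -
  assume \<mu>: "\<mu> \<in> PA"
  have "emeasure (\<mu> \<bind> rlaw) (Omega X) = (\<integral>\<^sup>+ x. 1 \<partial>\<mu>)"
    using \<mu> sets.top[of "raw_filtration X \<infinity>"] prob_space.emeasure_space_1[OF prob_space_law]
    by (subst emeasure_bind_rlaw) auto
  also have "\<dots> = 1"
    using \<mu> prob_space.emeasure_space_1[of \<mu>] by (simp add: space_prob_algebra)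
  finally have "prob_space (\<mu> \<bind> rlaw)"
    using sets_eq_imp_space_eq[OF sets_bind_rlaw[OF \<mu>]] by (intro prob_spaceI) simp
  then show ?thesis unfolding init_law_eq[OF \<mu>] by (rule prob_space_completion)
qed

text \<open>There is no shift by an infinite time; leaving the path unchanged keeps the function
  measurable.\<close>
definition shifted :: "('w \<Rightarrow> ennreal) \<Rightarrow> 'w \<Rightarrow> 'w" where
  "shifted \<sigma> \<omega> = (if \<sigma> \<omega> < \<infinity> then shift X (\<sigma> \<omega>) \<omega> else \<omega>)"

lemma coord_stopping_init:
  assumes "\<mu> \<in> PA" "stopping_time (aug_filtration X) \<sigma>"
  shows "(\<lambda>\<omega>. coord X (\<sigma> \<omega>) \<omega>) \<in> measurable (init_law X \<mu>) ext_borel"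
  using subalgebra_pre_sigma[OF assms(2,1)] measurable_coord_stopping[OF assms(2)] by (rule measurable_from_subalg)

lemma stopping_init:
  assumes "\<mu> \<in> PA" "stopping_time (aug_filtration X) \<sigma>"
  shows "\<sigma> \<in> borel_measurable (init_law X \<mu>)"
  using subalgebra_pre_sigma[OF assms(2,1)] measurable_stopping_time_pre_sigma[OF assms(2)] by (rule measurable_from_subalg)

lemma shifted_measurable:
  assumes \<mu>: "\<mu> \<in> PA" and \<sigma>: "stopping_time (aug_filtration X) \<sigma>"
  shows "shifted \<sigma> \<in> measurable (init_law X \<mu>) (raw_filtration X \<infinity>)"
proof (rule measurable_sigma_sets[OF sets_raw])
  show "shifted \<sigma> \<in> space (init_law X \<mu>) \<rightarrow> Omega X"
    using shift_in_Omega by (auto simp: shifted_def)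
  note [measurable] = stopping_init[OF \<mu> \<sigma>]
  fix A assume "A \<in> {coord X s -` E \<inter> Omega X |s E. s \<le> \<infinity> \<and> E \<in> sets ext_borel}"
  then obtain s E where A: "A = coord X s -` E \<inter> Omega X" and E [measurable]: "E \<in> sets ext_borel" by auto
  have [measurable]: "coord X s \<in> measurable (init_law X \<mu>) ext_borel"
    using measurable_coord_raw[of s \<infinity>] raw_subset_init_law[of \<infinity> \<mu>] by (auto simp: measurable_def)
  have [measurable]: "(\<lambda>\<omega>. coord X (\<sigma> \<omega> + s) \<omega>) \<in> measurable (init_law X \<mu>) ext_borel"
    by (rule coord_stopping_init[OF \<mu> stopping_time_add_const[OF \<sigma>]])
  have "shifted \<sigma> -` A \<inter> space (init_law X \<mu>) =
    {\<omega>\<in>space (init_law X \<mu>). if \<sigma> \<omega> < \<infinity> then coord X (\<sigma> \<omega> + s) \<omega> \<in> E else coord X s \<omega> \<in> E}"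
    using shift_in_Omega coord_shift by (auto simp: shifted_def A add.commute split: if_splits)
  also have "\<dots> \<in> sets (init_law X \<mu>)" by measurable
  finally show "shifted \<sigma> -` A \<inter> space (init_law X \<mu>) \<in> sets (init_law X \<mu>)" .
qed (use raw_subset_Pow in auto)

text \<open>Both sides are finite measures in \<open>A\<close> which agree on cylinders. The weight vanishes where
  the stopping time is infinite, which is where \<open>shifted\<close> is not a shift.\<close>
theorem strong_markov_shift:
  assumes \<mu>: "\<mu> \<in> PA" and \<sigma>: "stopping_time (aug_filtration X) \<sigma>"
    and Z: "Z \<in> borel_measurable (pre_sigma \<sigma>)" and Z1: "\<And>\<omega>. Z \<omega> \<le> 1"
    and Z0: "\<And>\<omega>. \<sigma> \<omega> = \<infinity> \<Longrightarrow> Z \<omega> = 0"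
    and A: "A \<in> sets (raw_filtration X \<infinity>)"
  shows "(\<integral>\<^sup>+ \<omega>. Z \<omega> * indicator A (shifted \<sigma> \<omega>) \<partial>init_law X \<mu>) =
    (\<integral>\<^sup>+ \<omega>. Z \<omega> * emeasure (law X (coord X (\<sigma> \<omega>) \<omega>)) A \<partial>init_law X \<mu>)"
proof -
  let ?M = "init_law X \<mu>"
  note prob = prob_space_init_law[OF \<mu>]
  interpret prob_space ?M by fact
  have Z' [measurable]: "Z \<in> borel_measurable ?M"
    using subalgebra_pre_sigma[OF \<sigma> \<mu>] Z by (rule measurable_from_subalg)
  note [measurable] = coord_stopping_init[OF \<mu> \<sigma>] shifted_measurable[OF \<mu> \<sigma>]
  have int_le: "(\<integral>\<^sup>+ \<omega>. Z \<omega> * g \<omega> \<partial>?M) \<noteq> \<infinity>" if "\<And>\<omega>. g \<omega> \<le> 1" for g :: "'w \<Rightarrow> ennreal"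
  proof -
    have "(\<integral>\<^sup>+ \<omega>. Z \<omega> * g \<omega> \<partial>?M) \<le> (\<integral>\<^sup>+ \<omega>. 1 * 1 \<partial>?M)"
      by (intro nn_integral_mono mult_mono Z1 that) auto
    then show ?thesis by (auto simp: emeasure_space_1 top_unique)
  qed
  show ?thesis
    using Int_stable_Cylinders Cylinders_subset A[unfolded sets_raw_cylinder]
  proof (induction rule: sigma_sets_induct_disjoint)
    case (basic A)
    then obtain l where l: "A = cylinder l" "\<forall>(s, E)\<in>set l. E \<in> sets ext_borel" by auto
    have "(\<integral>\<^sup>+ \<omega>. Z \<omega> * indicator A (shifted \<sigma> \<omega>) \<partial>?M) =
      (\<integral>\<^sup>+ \<omega>. Z \<omega> * (if \<forall>(s, E)\<in>set l. coord X (\<sigma> \<omega> + s) \<omega> \<in> E then 1 else 0) \<partial>?M)"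
    proof (rule nn_integral_cong)
      fix \<omega> assume "\<omega> \<in> space ?M"
      then have \<omega>: "\<omega> \<in> Omega X" by simp
      show "Z \<omega> * indicator A (shifted \<sigma> \<omega>) =
        Z \<omega> * (if \<forall>(s, E)\<in>set l. coord X (\<sigma> \<omega> + s) \<omega> \<in> E then 1 else 0)"
      proof (cases "\<sigma> \<omega> < \<infinity>")
        case True
        then have "shifted \<sigma> \<omega> \<in> A \<longleftrightarrow> (\<forall>(s, E)\<in>set l. coord X (\<sigma> \<omega> + s) \<omega> \<in> E)"
          using shift_in_Omega[OF \<omega> True] coord_shift[OF \<omega> True]
          by (simp add: l(1) cylinder_def shifted_def add.commute)
        then show ?thesis by (simp add: indicator_def)
      next
        case False then show ?thesis using Z0[of \<omega>] by (simp add: less_top[symmetric])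
      qed
    qed
    also have "\<dots> = (\<integral>\<^sup>+ \<omega>. Z \<omega> * emeasure (law X (coord X (\<sigma> \<omega>) \<omega>)) (cylinder l) \<partial>?M)"
      using l(2) \<mu> prob \<sigma> Z by (rule strong_markov_cylinder)
    finally show ?case by (simp add: l)
  next
    case empty then show ?case by simp
  next
    case (compl A)
    have Araw [measurable]: "A \<in> sets (raw_filtration X \<infinity>)" using compl(1) unfolding sets_raw_cylinder .
    note [measurable] = law_measurable[OF Araw]
    have le1: "emeasure (law X x) A \<le> 1" for x
      using prob_space.emeasure_le_1[OF prob_space_law] .
    have eq: "emeasure (law X x) (Omega X - A) = 1 - emeasure (law X x) A" for x
    proof -
      interpret L: prob_space "law X x" by (rule prob_space_law)
      show ?thesis using emeasure_compl[of A "law X x"] L.emeasure_space_1 raw_subset_law[of \<infinity> x] Araw by auto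
    qed
    have *: "Z \<omega> * (1 - c) = Z \<omega> - Z \<omega> * c" for \<omega> c
      using order_le_less_trans[OF Z1[of \<omega>] ennreal_one_less_top]
      by (subst ennreal_right_diff_distrib) auto
    have Zf: "Z \<omega> < top" for \<omega>
      using order_le_less_trans[OF Z1[of \<omega>] ennreal_one_less_top] .
    have "(\<integral>\<^sup>+ \<omega>. Z \<omega> * indicator (Omega X - A) (shifted \<sigma> \<omega>) \<partial>?M) =
      (\<integral>\<^sup>+ \<omega>. Z \<omega> - Z \<omega> * indicator A (shifted \<sigma> \<omega>) \<partial>?M)"
      using measurable_space[OF shifted_measurable[OF \<mu> \<sigma>]]
      using Zf by (intro nn_integral_cong) (auto simp: indicator_def diff_eq_0_iff_ennreal)
    also have "\<dots> = (\<integral>\<^sup>+ \<omega>. Z \<omega> \<partial>?M) - (\<integral>\<^sup>+ \<omega>. Z \<omega> * indicator A (shifted \<sigma> \<omega>) \<partial>?M)"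
      using int_le[of "\<lambda>\<omega>. indicator A (shifted \<sigma> \<omega>)"]
      by (intro nn_integral_diff) (auto simp: indicator_def)
    also have "\<dots> = (\<integral>\<^sup>+ \<omega>. Z \<omega> \<partial>?M) - (\<integral>\<^sup>+ \<omega>. Z \<omega> * emeasure (law X (coord X (\<sigma> \<omega>) \<omega>)) A \<partial>?M)"
      using compl by simp
    also have "\<dots> = (\<integral>\<^sup>+ \<omega>. Z \<omega> - Z \<omega> * emeasure (law X (coord X (\<sigma> \<omega>) \<omega>)) A \<partial>?M)"
      using int_le[of "\<lambda>\<omega>. emeasure (law X (coord X (\<sigma> \<omega>) \<omega>)) A", OF le1] le1 mult_left_mono[OF le1 zero_le]
      by (intro nn_integral_diff[symmetric]) auto
    finally show ?case by (simp add: eq *)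
  next
    case (union A)
    have Araw [measurable]: "A i \<in> sets (raw_filtration X \<infinity>)" for i using union(2) unfolding sets_raw_cylinder by auto
    note [measurable] = law_measurable[OF Araw]
    have "(\<integral>\<^sup>+ \<omega>. Z \<omega> * indicator (\<Union>i. A i) (shifted \<sigma> \<omega>) \<partial>?M) =
      (\<integral>\<^sup>+ \<omega>. (\<Sum>i. Z \<omega> * indicator (A i) (shifted \<sigma> \<omega>)) \<partial>?M)"
      by (simp add: suminf_indicator[OF union(1), symmetric])
    also have "\<dots> = (\<Sum>i. \<integral>\<^sup>+ \<omega>. Z \<omega> * indicator (A i) (shifted \<sigma> \<omega>) \<partial>?M)"
      by (rule nn_integral_suminf) measurable
    also have "\<dots> = (\<Sum>i. \<integral>\<^sup>+ \<omega>. Z \<omega> * emeasure (law X (coord X (\<sigma> \<omega>) \<omega>)) (A i) \<partial>?M)"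
      using union by simp
    also have "\<dots> = (\<integral>\<^sup>+ \<omega>. (\<Sum>i. Z \<omega> * emeasure (law X (coord X (\<sigma> \<omega>) \<omega>)) (A i)) \<partial>?M)"
      by (rule nn_integral_suminf[symmetric]) measurable
    also have "\<dots> = (\<integral>\<^sup>+ \<omega>. Z \<omega> * emeasure (law X (coord X (\<sigma> \<omega>) \<omega>)) (\<Union>i. A i) \<partial>?M)"
    proof -
      have "A i \<in> sets (law X x)" for i x using Araw raw_subset_law[of \<infinity> x] by blast
      then have "emeasure (law X x) (\<Union>i. A i) = (\<Sum>i. emeasure (law X x) (A i))" for x
        using union(1) by (intro suminf_emeasure[symmetric]) auto
      then show ?thesis by simp
    qed
    finally show ?case .
  qed
qed

text \<open>By the strong Markov property, an almost sure property of the shifted path holds almost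
  surely for the process started at the landing point. As \<open>A\<close> belongs to the completed
  sigma-algebra only, it is first enclosed between two sets of the raw one, up to null sets for
  the law started from the distribution of the landing point.\<close>
lemma shifted_landing:
  assumes \<mu>: "\<mu> \<in> PA" and \<sigma>: "stopping_time (aug_filtration X) \<sigma>"
    and A: "A \<in> sets (aug_filtration X \<infinity>)"
    and sh: "AE \<omega> in init_law X \<mu>. \<sigma> \<omega> < \<infinity> \<longrightarrow> shifted \<sigma> \<omega> \<in> A"
  shows "AE \<omega> in init_law X \<mu>. \<sigma> \<omega> < \<infinity> \<longrightarrow>
    (AE \<omega>' in init_law X (return ext_borel (coord X (\<sigma> \<omega>) \<omega>)). \<omega>' \<in> A)"
proof -
  let ?M = "init_law X \<mu>" and ?\<nu> = "distr (init_law X \<mu>) ext_borel (\<lambda>\<omega>. coord X (\<sigma> \<omega>) \<omega>)"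
  interpret prob_space ?M by (rule prob_space_init_law[OF \<mu>])
  note Xs [measurable] = coord_stopping_init[OF \<mu> \<sigma>]
  have \<nu>: "?\<nu> \<in> PA" using prob_space_distr[OF Xs] by (simp add: space_prob_algebra)
  have "A \<in> sets (completion (?\<nu> \<bind> rlaw))"
    using A aug_subset_init_law[OF \<nu>, of \<infinity>] unfolding init_law_eq[OF \<nu>] by auto
  then obtain S N N' where SN: "A = S \<union> N" "N \<subseteq> N'" "N' \<in> null_sets (?\<nu> \<bind> rlaw)" "S \<in> sets (?\<nu> \<bind> rlaw)"
    by (rule sets_completionE) blast
  have S: "S \<in> sets (raw_filtration X \<infinity>)" and N': "N' \<in> sets (raw_filtration X \<infinity>)"
    using SN(3,4) by (auto simp: sets_bind_rlaw[OF \<nu>] null_sets_def)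
  note [measurable] = law_measurable[OF N'] S N' stopping_init[OF \<mu> \<sigma>]
  have "(\<integral>\<^sup>+ x. emeasure (law X x) N' \<partial>?\<nu>) = 0"
    using SN(3) emeasure_bind_rlaw[OF \<nu> N'] by (auto simp: null_sets_def)
  then have "(\<integral>\<^sup>+ \<omega>. emeasure (law X (coord X (\<sigma> \<omega>) \<omega>)) N' \<partial>?M) = 0"
    by (simp add: nn_integral_distr)
  then have n1: "AE \<omega> in ?M. emeasure (law X (coord X (\<sigma> \<omega>) \<omega>)) N' = 0"
    by (subst (asm) nn_integral_0_iff_AE) auto
  define B where "B = Omega X - (S \<union> N')"
  have B [measurable]: "B \<in> sets (raw_filtration X \<infinity>)"
    unfolding B_def using S N' sets.compl_sets[of "S \<union> N'" "raw_filtration X \<infinity>"] by auto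
  note [measurable] = law_measurable[OF B]
  define Z :: "'w \<Rightarrow> ennreal" where "Z \<omega> = (if \<sigma> \<omega> < \<infinity> then 1 else 0)" for \<omega>
  have Z: "Z \<in> borel_measurable (pre_sigma \<sigma>)"
    unfolding Z_def using measurable_stopping_time_pre_sigma[OF \<sigma>] by measurable
  have Z' [measurable]: "Z \<in> borel_measurable ?M"
    using subalgebra_pre_sigma[OF \<sigma> \<mu>] Z by (rule measurable_from_subalg)
  have "(\<integral>\<^sup>+ \<omega>. Z \<omega> * emeasure (law X (coord X (\<sigma> \<omega>) \<omega>)) B \<partial>?M) =
    (\<integral>\<^sup>+ \<omega>. Z \<omega> * indicator B (shifted \<sigma> \<omega>) \<partial>?M)"
    by (rule strong_markov_shift[symmetric, OF \<mu> \<sigma> Z _ _ B]) (auto simp: Z_def)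
  also have "\<dots> = (\<integral>\<^sup>+ \<omega>. 0 \<partial>?M)"
  proof (rule nn_integral_cong_AE)
    show "AE \<omega> in ?M. Z \<omega> * indicator B (shifted \<sigma> \<omega>) = 0"
      using sh by eventually_elim (use SN in \<open>auto simp: Z_def B_def indicator_def\<close>)
  qed
  finally have "(\<integral>\<^sup>+ \<omega>. Z \<omega> * emeasure (law X (coord X (\<sigma> \<omega>) \<omega>)) B \<partial>?M) = 0" by simp
  then have "AE \<omega> in ?M. Z \<omega> * emeasure (law X (coord X (\<sigma> \<omega>) \<omega>)) B = 0"
    by (subst (asm) nn_integral_0_iff_AE) auto
  with n1 show ?thesis
  proof eventually_elim
    case (elim \<omega>)
    show ?case
    proof
      assume fin: "\<sigma> \<omega> < \<infinity>"
      let ?x = "coord X (\<sigma> \<omega>) \<omega>"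
      have "emeasure (law X ?x) N' = 0" "emeasure (law X ?x) B = 0"
        using elim fin by (auto simp: Z_def)
      then have "N' \<union> B \<in> null_sets (rlaw ?x)"
        using N' B by (intro null_sets.Un) (auto simp: null_sets_def emeasure_rlaw)
      then have "AE \<omega>' in rlaw ?x. \<omega>' \<in> A"
        by (rule AE_I') (use SN in \<open>auto simp: B_def\<close>)
      then show "AE \<omega>' in init_law X (return ext_borel ?x). \<omega>' \<in> A"
        by (rule AE_init_return)
    qed
  qed
qed

text \<open>If the landing point is always \<open>a\<close>, then under every weight \<open>Z\<close> that is known at the
  stopping time the law of the shifted path is a multiple of \<open>P\<^sub>a\<close>, so this path is independent of
  the past.\<close>
lemma regeneration:
  assumes \<mu>: "\<mu> \<in> PA" and \<sigma>: "stopping_time (aug_filtration X) \<sigma>"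
    and land: "AE \<omega> in init_law X \<mu>. \<sigma> \<omega> < \<infinity> \<longrightarrow> coord X (\<sigma> \<omega>) \<omega> = Some a"
    and Z: "Z \<in> borel_measurable (pre_sigma \<sigma>)" and Z1: "\<And>\<omega>. Z \<omega> \<le> 1"
    and Z0: "\<And>\<omega>. \<sigma> \<omega> = \<infinity> \<Longrightarrow> Z \<omega> = 0"
    and G: "G \<in> borel_measurable (pt_law X a)"
  shows "(\<integral>\<^sup>+ \<omega>. Z \<omega> * G (shifted \<sigma> \<omega>) \<partial>init_law X \<mu>) =
    (\<integral>\<^sup>+ \<omega>. Z \<omega> \<partial>init_law X \<mu>) * (\<integral>\<^sup>+ \<omega>. G \<omega> \<partial>pt_law X a)"
proof -
  let ?M = "init_law X \<mu>" and ?R = "raw_filtration X \<infinity>" and ?c = "\<integral>\<^sup>+ \<omega>. Z \<omega> \<partial>init_law X \<mu>"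
  interpret prob_space ?M by (rule prob_space_init_law[OF \<mu>])
  have Z' [measurable]: "Z \<in> borel_measurable ?M"
    using subalgebra_pre_sigma[OF \<sigma> \<mu>] Z by (rule measurable_from_subalg)
  note sm [measurable] = shifted_measurable[OF \<mu> \<sigma>]
  let ?N = "distr (density ?M Z) ?R (shifted \<sigma>)"
  have N: "?N = scale_measure ?c (rlaw (Some a))"
  proof (rule measure_eqI)
    fix A assume "A \<in> sets ?N"
    then have A [measurable]: "A \<in> sets ?R" by simp
    have "shifted \<sigma> -` A \<inter> space ?M \<in> sets ?M" using sm A by (rule measurable_sets)
    then have "emeasure ?N A = (\<integral>\<^sup>+ \<omega>. Z \<omega> * indicator A (shifted \<sigma> \<omega>) \<partial>?M)"
      by (subst emeasure_distr, measurable, subst emeasure_density)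
         (auto intro!: nn_integral_cong simp: indicator_def)
    also have "\<dots> = (\<integral>\<^sup>+ \<omega>. Z \<omega> * emeasure (law X (coord X (\<sigma> \<omega>) \<omega>)) A \<partial>?M)"
      by (rule strong_markov_shift[OF \<mu> \<sigma> Z Z1 Z0 A])
    also have "\<dots> = (\<integral>\<^sup>+ \<omega>. Z \<omega> * emeasure (law X (Some a)) A \<partial>?M)"
    proof (rule nn_integral_cong_AE)
      show "AE \<omega> in ?M. Z \<omega> * emeasure (law X (coord X (\<sigma> \<omega>) \<omega>)) A = Z \<omega> * emeasure (law X (Some a)) A"
        using land by eventually_elim (use Z0 in \<open>force simp: less_top[symmetric]\<close>)
    qed
    also have "\<dots> = emeasure (scale_measure ?c (rlaw (Some a))) A"
      using emeasure_rlaw[OF A, of "Some a"] by (simp add: nn_integral_multc)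
    finally show "emeasure ?N A = emeasure (scale_measure ?c (rlaw (Some a))) A" .
  qed simp
  obtain G' where G' [measurable]: "G' \<in> borel_measurable (rlaw (Some a))" and GG': "AE \<omega> in rlaw (Some a). G \<omega> = G' \<omega>"
    using completion_ex_borel_measurable[OF G[unfolded pt_law_eq]] by blast
  have G'' [measurable]: "G' \<in> borel_measurable ?R" using G' by (simp cong: measurable_cong_sets)
  have "AE \<omega> in ?N. G \<omega> = G' \<omega>"
  proof -
    obtain B where "{\<omega>\<in>space (rlaw (Some a)). \<not> G \<omega> = G' \<omega>} \<subseteq> B"
      "emeasure (rlaw (Some a)) B = 0" "B \<in> sets (rlaw (Some a))"
      using GG' by (rule AE_E)
    then show ?thesis unfolding N
      by (intro AE_I'[of B]) (auto simp: null_sets_def space_scale_measure)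
  qed
  then have "AE \<omega> in density ?M Z. G (shifted \<sigma> \<omega>) = G' (shifted \<sigma> \<omega>)"
    by (rule AE_distrD[rotated]) (use sm in simp)
  then have "AE \<omega> in ?M. 0 < Z \<omega> \<longrightarrow> G (shifted \<sigma> \<omega>) = G' (shifted \<sigma> \<omega>)"
    by (simp add: AE_density)
  then have "(\<integral>\<^sup>+ \<omega>. Z \<omega> * G (shifted \<sigma> \<omega>) \<partial>?M) = (\<integral>\<^sup>+ \<omega>. Z \<omega> * G' (shifted \<sigma> \<omega>) \<partial>?M)"
    by (intro nn_integral_cong_AE, eventually_elim) (metis mult_zero_left not_gr_zero)
  also have "\<dots> = (\<integral>\<^sup>+ \<omega>. G' \<omega> \<partial>?N)"
    by (subst nn_integral_distr, measurable, subst nn_integral_density) auto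
  also have "\<dots> = ?c * (\<integral>\<^sup>+ \<omega>. G' \<omega> \<partial>rlaw (Some a))"
    unfolding N by (rule nn_integral_scale_measure) simp
  also have "(\<integral>\<^sup>+ \<omega>. G' \<omega> \<partial>rlaw (Some a)) = (\<integral>\<^sup>+ \<omega>. G \<omega> \<partial>pt_law X a)"
  proof -
    have "AE \<omega> in completion (rlaw (Some a)). G' \<omega> = G \<omega>"
      by (rule AE_completion, use GG' in eventually_elim) simp
    then have "(\<integral>\<^sup>+ \<omega>. G' \<omega> \<partial>completion (rlaw (Some a))) = (\<integral>\<^sup>+ \<omega>. G \<omega> \<partial>completion (rlaw (Some a)))"
      by (rule nn_integral_cong_AE)
    then show ?thesis unfolding pt_law_eq by (simp add: nn_integral_completion)
  qed
  finally show ?thesis .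
qed

end

section \<open>The first increase of the local time after a given time\<close>

locale local_time_at = hunt X
  for X :: "('w, 's::{metric_space, second_countable_topology}) process" +
  fixes r :: "real \<Rightarrow> 's \<Rightarrow> 's \<Rightarrow> ennreal" and a :: 's and L :: "real \<Rightarrow> 'w \<Rightarrow> real"
  assumes local_time: "local_time X r a L"
begin

abbreviation "P \<equiv> pt_law X a"

lemma L_measurable: "t \<ge> 0 \<Longrightarrow> L t \<in> borel_measurable (aug_filtration X (ennreal t))"
  using local_time unfolding local_time_def perfect_pcaf_def by blast

text \<open>One fixed choice of the set on which the additive functional is well behaved.\<close>
definition regular :: "'w set" where
  "regular = (SOME \<Lambda>. \<Lambda> \<in> sets (aug_filtration X \<infinity>) \<and> (\<forall>x. emeasure (pt_law X x) \<Lambda> = 1) \<and>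
       (\<forall>\<omega>\<in>\<Lambda>. L 0 \<omega> = 0 \<and> mono_on {0..} (\<lambda>t. L t \<omega>) \<and> continuous_on {0..} (\<lambda>t. L t \<omega>) \<and>
         (\<forall>s t. lifetime X \<omega> \<le> ennreal s \<and> 0 \<le> s \<and> s \<le> t \<longrightarrow> L t \<omega> = L s \<omega>) \<and>
         (\<forall>s\<ge>0. \<forall>t\<ge>0. L (t + s) \<omega> = L t \<omega> + L s (shift X (ennreal t) \<omega>))))"

lemma regular: "regular \<in> sets (aug_filtration X \<infinity>) \<and> (\<forall>x. emeasure (pt_law X x) regular = 1) \<and>
       (\<forall>\<omega>\<in>regular. L 0 \<omega> = 0 \<and> mono_on {0..} (\<lambda>t. L t \<omega>) \<and> continuous_on {0..} (\<lambda>t. L t \<omega>) \<and>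
         (\<forall>s t. lifetime X \<omega> \<le> ennreal s \<and> 0 \<le> s \<and> s \<le> t \<longrightarrow> L t \<omega> = L s \<omega>) \<and>
         (\<forall>s\<ge>0. \<forall>t\<ge>0. L (t + s) \<omega> = L t \<omega> + L s (shift X (ennreal t) \<omega>)))"
  unfolding regular_def
  by (rule someI_ex) (use local_time in \<open>unfold local_time_def perfect_pcaf_def Bex_def, elim conjE\<close>)

lemma regular_sets: "regular \<in> sets (aug_filtration X \<infinity>)"
  and regular_full: "emeasure (pt_law X x) regular = 1"
  using regular by (elim conjE; simp)+

lemma regular_path:
  assumes "\<omega> \<in> regular"
  shows "L 0 \<omega> = 0" "mono_on {0..} (\<lambda>t. L t \<omega>)" "continuous_on {0..} (\<lambda>t. L t \<omega>)"
    "lifetime X \<omega> \<le> ennreal s \<Longrightarrow> 0 \<le> s \<Longrightarrow> s \<le> t \<Longrightarrow> L t \<omega> = L s \<omega>"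
    "0 \<le> s \<Longrightarrow> 0 \<le> t \<Longrightarrow> L (t + s) \<omega> = L t \<omega> + L s (shift X (ennreal t) \<omega>)"
  using conjunct2[OF conjunct2[OF regular]] assms by blast+

text \<open>Unlike \<open>regular\<close>, this set belongs to the augmented filtration at every time, including 0:
  it differs from the event that the path starts in the state space by a set that is null for
  every initial law.\<close>
definition alive :: "'w set" where "alive = {\<omega>\<in>regular. coord X 0 \<omega> \<noteq> None}"

lemma alive_subset: "alive \<subseteq> Omega X"
  using sets.sets_into_space[OF regular_sets] by (auto simp: alive_def)

lemma coord0_sets: "{\<omega>\<in>Omega X. coord X 0 \<omega> \<noteq> None} \<in> sets (raw_filtration X t)"
proof -
  have "coord X 0 -` (- {None}) \<inter> space (raw_filtration X t) \<in> sets (raw_filtration X t)"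
    using sets.compl_sets[OF None_in_ext_borel]
    by (intro measurable_sets[OF measurable_coord_raw]) (auto simp: Compl_eq_Diff_UNIV)
  then show ?thesis by (simp add: vimage_def Int_def conj_commute)
qed

lemma emeasure_pt_law: "S \<in> sets (raw_filtration X \<infinity>) \<Longrightarrow> emeasure (pt_law X x) S = emeasure (law X (Some x)) S"
  unfolding pt_law_eq by (simp add: emeasure_rlaw)

lemma prob_space_pt_law: "prob_space (pt_law X x)"
  unfolding pt_law_def by (rule prob_space_init_return)

lemma aug_subset_pt_law: "sets (aug_filtration X t) \<subseteq> sets (pt_law X x)"
  unfolding pt_law_def by (rule aug_subset_init_law[OF return_in_PA])

lemma space_pt_law [simp]: "space (pt_law X x) = Omega X"
  unfolding pt_law_def by simp

lemma alive_sets: "alive \<in> sets (aug_filtration X t)"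
proof -
  define B where "B = {\<omega>\<in>Omega X. coord X 0 \<omega> \<noteq> None} - regular"
  have Baug: "B \<in> sets (aug_filtration X \<infinity>)"
    unfolding B_def using coord0_sets raw_subset_aug regular_sets by (intro sets.Diff) auto
  have null: "B \<in> null_sets (init_law X \<mu>)" if \<mu>: "\<mu> \<in> PA" for \<mu>
  proof -
    have "B \<in> sets (completion (\<mu> \<bind> rlaw))"
      using Baug aug_subset_init_law[OF \<mu>, of \<infinity>] unfolding init_law_eq[OF \<mu>] by auto
    then obtain S N N' where SN: "B = S \<union> N" "N \<subseteq> N'" "N' \<in> null_sets (\<mu> \<bind> rlaw)" "S \<in> sets (\<mu> \<bind> rlaw)"
      by (rule sets_completionE) blast
    have S: "S \<in> sets (raw_filtration X \<infinity>)" using SN(4) by (simp add: sets_bind_rlaw[OF \<mu>])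
    have "emeasure (law X x) S = 0" for x
    proof (cases x)
      case None
      have "emeasure (law X None) {\<omega>\<in>space (law X None). coord X 0 \<omega> \<noteq> None} = 0"
        using law_start[of None] by (intro emeasure_eq_0_AE) simp
      moreover have "S \<subseteq> {\<omega>\<in>space (law X None). coord X 0 \<omega> \<noteq> None}" using SN(1) by (auto simp: B_def)
      moreover have "{\<omega>\<in>space (law X None). coord X 0 \<omega> \<noteq> None} \<in> sets (law X None)"
        using coord0_sets raw_subset_law by auto
      ultimately have "emeasure (law X None) S \<le> 0" using emeasure_mono by fastforce
      then show ?thesis unfolding None by simp
    next
      case (Some y)
      interpret prob_space "pt_law X y" by (rule prob_space_pt_law)
      have "regular \<in> sets (pt_law X y)" using regular_sets aug_subset_pt_law by auto
      then have "emeasure (pt_law X y) (Omega X - regular) = 0"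
        using emeasure_compl[of regular "pt_law X y"] regular_full emeasure_space_1 by simp
      moreover have "S \<subseteq> Omega X - regular" using SN(1) by (auto simp: B_def)
      moreover have "Omega X - regular \<in> sets (pt_law X y)"
        using sets.compl_sets[OF \<open>regular \<in> sets (pt_law X y)\<close>] by simp
      ultimately have "emeasure (pt_law X y) S \<le> 0" using emeasure_mono by fastforce
      then show ?thesis using emeasure_pt_law[OF S] Some by simp
    qed
    then have "S \<in> null_sets (\<mu> \<bind> rlaw)"
      using S by (simp add: null_sets_def emeasure_bind_rlaw[OF \<mu> S] sets_bind_rlaw[OF \<mu>])
    then have "S \<union> N' \<in> null_sets (\<mu> \<bind> rlaw)" using SN(3) by (rule null_sets.Un)
    then have "AE \<omega> in \<mu> \<bind> rlaw. \<omega> \<notin> B" by (rule AE_I') (use SN in auto)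
    then have "AE \<omega> in init_law X \<mu>. \<omega> \<notin> B" unfolding init_law_eq[OF \<mu>] by (rule AE_completion)
    moreover have "B \<in> sets (init_law X \<mu>)" using Baug aug_subset_init_law[OF \<mu>] by auto
    ultimately show ?thesis by (simp add: AE_iff_null_sets)
  qed
  have "B \<in> sets (aug_filtration X t)"
    unfolding sets_aug using null by (intro INT_I sigma_sets.Basic) simp
  then have "{\<omega>\<in>Omega X. coord X 0 \<omega> \<noteq> None} - B \<in> sets (aug_filtration X t)"
    using coord0_sets raw_subset_aug by (intro sets.Diff) auto
  also have "{\<omega>\<in>Omega X. coord X 0 \<omega> \<noteq> None} - B = alive"
    using sets.sets_into_space[OF regular_sets] by (auto simp: alive_def B_def)
  finally show ?thesis .
qed

lemma AE_alive: "AE \<omega> in P. \<omega> \<in> alive"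
proof -
  interpret prob_space P by (rule prob_space_pt_law)
  have "AE \<omega> in P. \<omega> \<in> regular"
    using regular_full[of a] regular_sets aug_subset_pt_law by (intro AE_prob_1) (auto simp: measure_def)
  moreover have "AE \<omega> in P. coord X 0 \<omega> = Some a"
    unfolding pt_law_def by (rule AE_init_return[OF rlaw_start])
  ultimately show ?thesis by eventually_elim (simp add: alive_def)
qed

text \<open>The local time, made continuous and increasing along every path and extended by 0 to
  negative times.\<close>
definition K :: "real \<Rightarrow> 'w \<Rightarrow> real" where
  "K t \<omega> = (if \<omega> \<in> alive then L (max 0 t) \<omega> else 0)"

lemma K_measurable_aug: "t \<le> s \<Longrightarrow> 0 \<le> s \<Longrightarrow> K t \<in> borel_measurable (aug_filtration X (ennreal s))"
proof -
  assume "t \<le> s" "0 \<le> s"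
  then have [measurable]: "L (max 0 t) \<in> borel_measurable (aug_filtration X (ennreal s))"
    by (intro measurable_aug_mono[OF _ L_measurable] ennreal_leI) auto
  show ?thesis unfolding K_def[abs_def] using alive_sets alive_subset
    by (intro measurable_If_set) (auto simp: Int_absorb2)
qed

lemma K_measurable [measurable]: "K t \<in> borel_measurable P"
  using K_measurable_aug[of t "max 0 t"] aug_subset_pt_law[of _ a] by (auto simp: measurable_def)

lemma K_mono: "s \<le> t \<Longrightarrow> K s \<omega> \<le> K t \<omega>"
  using regular_path(2)[of \<omega>] by (auto simp: K_def alive_def mono_on_def)

lemma K_nonpos [simp]: "t \<le> 0 \<Longrightarrow> K t \<omega> = 0"
  using regular_path(1)[of \<omega>] by (auto simp: K_def alive_def max_absorb1)

lemma K_nonneg: "0 \<le> K t \<omega>"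
  using K_mono[of "min t 0" t \<omega>] by simp

lemma K_continuous: "continuous_on UNIV (\<lambda>t. K t \<omega>)"
proof (cases "\<omega> \<in> alive")
  case True
  have "continuous_on UNIV (\<lambda>t. L (max 0 t) \<omega>)"
    by (rule continuous_on_compose2[OF regular_path(3)])
       (use True in \<open>auto simp: alive_def intro!: continuous_intros\<close>)
  then show ?thesis using True by (simp add: K_def)
qed (simp add: K_def)

lemma K_pair_measurable [measurable]: "(\<lambda>(t, \<omega>). K t \<omega>) \<in> borel_measurable (borel \<Otimes>\<^sub>M P)"
proof (rule borel_measurable_LIMSEQ_real)
  fix n :: nat
  let ?g = "\<lambda>p :: real \<times> 'w. \<lfloor>real (Suc n) * fst p\<rfloor>"
  have "?g \<in> measurable (borel \<Otimes>\<^sub>M P) (count_space UNIV)" by measurable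
  moreover have "(\<lambda>p. K (real_of_int i / real (Suc n)) (snd p)) \<in> borel_measurable (borel \<Otimes>\<^sub>M P)" for i by measurable
  ultimately show "(\<lambda>p. K (real_of_int (?g p) / real (Suc n)) (snd p)) \<in> borel_measurable (borel \<Otimes>\<^sub>M P)"
    by (rule measurable_compose_countable[rotated])
next
  fix p :: "real \<times> 'w"
  obtain t \<omega> where p: "p = (t, \<omega>)" by (cases p)
  have "(\<lambda>n. real_of_int \<lfloor>real (Suc n) * t\<rfloor> / real (Suc n)) \<longlonglongrightarrow> t"
  proof (rule tendsto_sandwich)
    show "(\<lambda>n. t - 1 / real (Suc n)) \<longlonglongrightarrow> t"
      using tendsto_diff[OF tendsto_const LIMSEQ_inverse_real_of_nat, of t] by (simp add: inverse_eq_divide)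
    show "(\<lambda>n. t) \<longlonglongrightarrow> t" by simp
    show "eventually (\<lambda>n. t - 1 / real (Suc n) \<le> real_of_int \<lfloor>real (Suc n) * t\<rfloor> / real (Suc n)) sequentially"
    proof (intro always_eventually allI)
      fix n :: nat
      have "real (Suc n) * t - 1 \<le> real_of_int \<lfloor>real (Suc n) * t\<rfloor>" by linarith
      then have "(real (Suc n) * t - 1) / real (Suc n) \<le> real_of_int \<lfloor>real (Suc n) * t\<rfloor> / real (Suc n)"
        by (rule divide_right_mono) simp
      then show "t - 1 / real (Suc n) \<le> real_of_int \<lfloor>real (Suc n) * t\<rfloor> / real (Suc n)"
        by (simp add: diff_divide_distrib)
    qed
    show "eventually (\<lambda>n. real_of_int \<lfloor>real (Suc n) * t\<rfloor> / real (Suc n) \<le> t) sequentially"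
    proof (intro always_eventually allI)
      fix n :: nat
      have "real_of_int \<lfloor>real (Suc n) * t\<rfloor> / real (Suc n) \<le> (real (Suc n) * t) / real (Suc n)"
        by (rule divide_right_mono) auto
      then show "real_of_int \<lfloor>real (Suc n) * t\<rfloor> / real (Suc n) \<le> t" by simp
    qed
  qed
  moreover have "isCont (\<lambda>t. K t \<omega>) t" using K_continuous[of \<omega>] by (simp add: continuous_on_eq_continuous_at)
  ultimately show "(\<lambda>n. K (real_of_int \<lfloor>real (Suc n) * fst p\<rfloor> / real (Suc n)) (snd p)) \<longlonglongrightarrow> (case p of (t, \<omega>) \<Rightarrow> K t \<omega>)"
    unfolding p using isCont_tendsto_compose[of t "\<lambda>t. K t \<omega>"] by simp
qed

text \<open>The first time after \<open>u\<close> at which the local time increases.\<close>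
definition D :: "real \<Rightarrow> 'w \<Rightarrow> ennreal" where
  "D u \<omega> = Inf (ennreal ` {t. 0 < t \<and> K u \<omega> < K t \<omega>})"

lemma D_ge: "ennreal u \<le> D u \<omega>"
  unfolding D_def
proof (rule Inf_greatest, safe)
  fix t assume "0 < t" "K u \<omega> < K t \<omega>"
  then have "u < t" using K_mono[of t u \<omega>] by (cases "u < t") auto
  then show "ennreal u \<le> ennreal t" by (simp add: ennreal_leI)
qed

lemma D_le: "0 < t \<Longrightarrow> K u \<omega> < K t \<omega> \<Longrightarrow> D u \<omega> \<le> ennreal t"
  unfolding D_def by (rule Inf_lower) auto

lemma D_less_iff: "D u \<omega> < ennreal t \<longleftrightarrow> (\<exists>s. 0 < s \<and> s < t \<and> K u \<omega> < K s \<omega>)"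
  unfolding D_def Inf_less_iff by (auto simp: ennreal_less_iff)

lemma D_less_imp: "D u \<omega> < ennreal t \<Longrightarrow> K u \<omega> < K t \<omega>"
  unfolding D_less_iff using K_mono[of _ t \<omega>] by (auto intro: less_le_trans)

lemma D_le_iff:
  assumes "0 \<le> t"
  shows "D u \<omega> \<le> ennreal t \<longleftrightarrow> (\<forall>n. K u \<omega> < K (t + 1 / real (Suc n)) \<omega>)"
proof
  assume "D u \<omega> \<le> ennreal t"
  then have "D u \<omega> < ennreal (t + 1 / real (Suc n))" for n
    using assms by (auto elim!: le_less_trans simp: ennreal_less_iff)
  then show "\<forall>n. K u \<omega> < K (t + 1 / real (Suc n)) \<omega>" using D_less_imp by blast
next
  assume K: "\<forall>n. K u \<omega> < K (t + 1 / real (Suc n)) \<omega>"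
  have "D u \<omega> \<le> ennreal (t + 1 / real (Suc n))" for n
    using assms K by (intro D_le) (auto intro: add_nonneg_pos)
  moreover have "(\<lambda>n. ennreal (t + 1 / real (Suc n))) \<longlonglongrightarrow> ennreal (t + 0)"
    using LIMSEQ_inverse_real_of_nat by (intro tendsto_ennrealI tendsto_add tendsto_const) (simp add: inverse_eq_divide)
  ultimately show "D u \<omega> \<le> ennreal t" by (intro LIMSEQ_le_const) auto
qed

lemma sets_aug_Collect_Ball:
  fixes f :: "nat \<Rightarrow> 'w \<Rightarrow> real"
  assumes f: "\<And>n. n \<in> I \<Longrightarrow> f n \<in> borel_measurable (aug_filtration X t)"
    and g: "g \<in> borel_measurable (aug_filtration X t)"
  shows "{\<omega>\<in>Omega X. \<forall>n\<in>I. g \<omega> < f n \<omega>} \<in> sets (aug_filtration X t)"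
proof -
  have "{\<omega>\<in>space (aug_filtration X t). g \<omega> < f n \<omega>} \<in> sets (aug_filtration X t)" if "n \<in> I" for n
    using g f[OF that] by (rule borel_measurable_less)
  then show ?thesis
    using sets.sets_Collect_countable_All'[of I "aug_filtration X t" "\<lambda>n \<omega>. g \<omega> < f n \<omega>"] by simp
qed

text \<open>Whether \<open>D u \<le> t\<close> is decided immediately after \<open>t\<close>, and the filtration is right continuous.\<close>
lemma D_stopping_time:
  assumes "0 \<le> u" shows "stopping_time (aug_filtration X) (D u)"
proof (rule stopping_timeI)
  fix t :: ennreal
  show "Measurable.pred (aug_filtration X t) (\<lambda>\<omega>. D u \<omega> \<le> t)"
  proof (cases t)
    case top then show ?thesis by simp
  next
    case (real x)
    show ?thesis
    proof (cases "u \<le> x")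
      case False
      then have "\<not> D u \<omega> \<le> t" for \<omega>
      proof -
        have "t < ennreal u" using False real by (simp add: ennreal_less_iff)
        also have "\<dots> \<le> D u \<omega>" by (rule D_ge)
        finally show ?thesis by (simp add: not_le)
      qed
      then show ?thesis by simp
    next
      case True
      let ?A = "{\<omega>\<in>Omega X. D u \<omega> \<le> t}"
      have rc: "?A \<in> sets (aug_filtration X s)" if ts: "t < s" for s
      proof -
        obtain y where y: "x < y" "ennreal y \<le> s"
        proof (cases s)
          case (real z) then show ?thesis using ts \<open>t = ennreal x\<close> \<open>0 \<le> x\<close> by (intro that[of z]) (auto simp: ennreal_less_iff)
        next
          case top then show ?thesis by (intro that[of "x + 1"]) auto
        qed
        obtain N where N: "1 / real (Suc N) < y - x" using y(1) nat_approx_posE[of "y - x"] by auto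
        have "?A = {\<omega>\<in>Omega X. \<forall>n\<in>{N..}. K u \<omega> < K (x + 1 / real (Suc n)) \<omega>}"
        proof -
          have "D u \<omega> \<le> t \<longleftrightarrow> (\<forall>n\<in>{N..}. K u \<omega> < K (x + 1 / real (Suc n)) \<omega>)" for \<omega>
          proof -
            have "K u \<omega> < K (x + 1 / real (Suc n)) \<omega>" if *: "\<forall>n\<in>{N..}. K u \<omega> < K (x + 1 / real (Suc n)) \<omega>" for n
            proof -
              have "K u \<omega> < K (x + 1 / real (Suc (max n N))) \<omega>" using * by auto
              also have "\<dots> \<le> K (x + 1 / real (Suc n)) \<omega>" by (intro K_mono) (auto simp: field_simps)
              finally show ?thesis .
            qed
            then show ?thesis unfolding real(2) D_le_iff[OF real(1)] by auto
          qed
          then show ?thesis by simp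
        qed
        also have "\<dots> \<in> sets (aug_filtration X (ennreal y))"
        proof (rule sets_aug_Collect_Ball)
          fix n assume "n \<in> {N..}"
          then have "1 / real (Suc n) \<le> 1 / real (Suc N)" by (simp add: field_simps)
          then have "x + 1 / real (Suc n) \<le> y" using N by simp
          then show "K (x + 1 / real (Suc n)) \<in> borel_measurable (aug_filtration X (ennreal y))"
            using real y by (intro K_measurable_aug) auto
        next
          show "K u \<in> borel_measurable (aug_filtration X (ennreal y))"
            using real y True by (intro K_measurable_aug) auto
        qed
        also have "sets (aug_filtration X (ennreal y)) \<subseteq> sets (aug_filtration X s)"
          using y(2) by (rule aug_mono)
        finally show ?thesis .
      qed
      have "t < \<infinity>" using real by simp
      then have "?A \<in> sets (aug_filtration X t)" using rc by (rule aug_right_continuous)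
      then show ?thesis by (simp add: pred_def)
    qed
  qed
qed

lemma K_continuous_at: "isCont (\<lambda>t. K t \<omega>) t"
  using K_continuous[of \<omega>] by (simp add: continuous_on_eq_continuous_at)

lemma K_gt_left:
  assumes "c < K t \<omega>" "0 \<le> c"
  shows "\<exists>s. 0 < s \<and> s < t \<and> c < K s \<omega>"
proof -
  have t: "0 < t" using assms K_nonpos[of t \<omega>] by (cases "t \<le> 0") auto
  have "eventually (\<lambda>s. c < K s \<omega>) (at t)"
    using K_continuous_at[of t \<omega>] assms(1) by (simp add: isCont_def order_tendstoD)
  then obtain d where d: "d > 0" "\<And>s. s \<noteq> t \<Longrightarrow> dist s t < d \<Longrightarrow> c < K s \<omega>"
    unfolding eventually_at by auto
  define s where "s = max (t - d / 2) (t / 2)"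
  have "s < t" "0 < s" "dist s t < d" using d(1) t by (auto simp: s_def dist_real_def)
  then show ?thesis using d(2)[of s] by auto
qed

lemma K_at_D:
  assumes "0 \<le> u" "D u \<omega> < \<infinity>"
  shows "K (enn2real (D u \<omega>)) \<omega> = K u \<omega>"
proof (rule antisym)
  let ?d = "enn2real (D u \<omega>)"
  have d: "ennreal ?d = D u \<omega>" using assms(2) by simp
  show "K ?d \<omega> \<le> K u \<omega>"
  proof (rule ccontr)
    assume "\<not> K ?d \<omega> \<le> K u \<omega>"
    then obtain s where "0 < s" "s < ?d" "K u \<omega> < K s \<omega>"
      using K_gt_left[of "K u \<omega>" ?d \<omega>] K_nonneg by auto
    then have "D u \<omega> < ennreal ?d" unfolding D_less_iff by blast
    then show False using d by simp
  qed
  have "u \<le> ?d" using D_ge[of u \<omega>] assms enn2real_mono[of "ennreal u" "D u \<omega>"] by simp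
  then show "K u \<omega> \<le> K ?d \<omega>" by (rule K_mono)
qed

lemma D_ge_real: "0 \<le> u \<Longrightarrow> D u \<omega> < \<infinity> \<Longrightarrow> u \<le> enn2real (D u \<omega>)"
  using D_ge[of u \<omega>] enn2real_mono[of "ennreal u" "D u \<omega>"] by simp

lemma K_after_D:
  assumes "0 \<le> u" "\<omega> \<in> alive" "D u \<omega> < \<infinity>" "0 \<le> s"
  shows "K (enn2real (D u \<omega>) + s) \<omega> = K u \<omega> + L s (shift X (D u \<omega>) \<omega>)"
proof -
  let ?d = "enn2real (D u \<omega>)"
  have d: "ennreal ?d = D u \<omega>" "0 \<le> ?d" using assms(3) by simp_all
  have "L (?d + s) \<omega> = L ?d \<omega> + L s (shift X (ennreal ?d) \<omega>)"
    using assms(2,4) d(2) by (intro regular_path(5)) (auto simp: alive_def)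
  moreover have "K ?d \<omega> = L ?d \<omega>" "K (?d + s) \<omega> = L (?d + s) \<omega>"
    using assms(2,4) d(2) by (auto simp: K_def)
  ultimately show ?thesis using K_at_D[OF assms(1,3)] d(1) by simp
qed

text \<open>The local time is constant between \<open>u\<close> and \<open>D u\<close>; from then on, additivity makes it the
  local time of the shifted path.\<close>
lemma path_split:
  assumes u: "0 \<le> u" and \<omega>: "\<omega> \<in> alive" and fin: "D u \<omega> < \<infinity>"
    and \<theta>: "shift X (D u \<omega>) \<omega> \<in> alive"
  shows "K s \<omega> - K (min s u) \<omega> = K (s - enn2real (D u \<omega>)) (shift X (D u \<omega>) \<omega>)"
proof -
  let ?d = "enn2real (D u \<omega>)"
  note ud = D_ge_real[OF u fin]
  consider "s \<le> u" | "u < s" "s \<le> ?d" | "?d < s" by linarith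
  then show ?thesis
  proof cases
    case 1 then show ?thesis using ud by simp
  next
    case 2
    then have "K s \<omega> = K u \<omega>" using K_mono[of u s \<omega>] K_mono[of s ?d \<omega>] K_at_D[OF u fin] by simp
    then show ?thesis using 2 by simp
  next
    case 3
    then have "K s \<omega> = K u \<omega> + L (s - ?d) (shift X (D u \<omega>) \<omega>)"
      using K_after_D[OF u \<omega> fin, of "s - ?d"] by simp
    then show ?thesis using 3 ud \<theta> by (simp add: K_def)
  qed
qed

text \<open>The local time of the path shifted by \<open>D u\<close> increases at once, so by the strong Markov
  property the landing point belongs to the support of the local time, which is \<open>{a}\<close>. The path is
  not in the cemetery, as the local time no longer increases after the lifetime.\<close>
lemma landing:
  assumes u: "0 \<le> u"
  shows "AE \<omega> in P. D u \<omega> < \<infinity> \<longrightarrow> coord X (D u \<omega>) \<omega> = Some a"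
proof -
  let ?A = "{\<omega>\<in>Omega X. \<forall>n\<in>UNIV. 0 < L (1 / real (Suc n)) \<omega>}"
  have A: "?A \<in> sets (aug_filtration X \<infinity>)"
  proof (rule sets_aug_Collect_Ball)
    show "L (1 / real (Suc n)) \<in> borel_measurable (aug_filtration X \<infinity>)" for n
      by (rule measurable_aug_mono[OF _ L_measurable]) auto
  qed simp
  have sh: "AE \<omega> in P. D u \<omega> < \<infinity> \<longrightarrow> shifted (D u) \<omega> \<in> ?A"
    using AE_alive
  proof eventually_elim
    case (elim \<omega>)
    show ?case
    proof
      assume fin: "D u \<omega> < \<infinity>"
      have "0 < L (1 / real (Suc n)) (shift X (D u \<omega>) \<omega>)" for n
      proof -
        have "K u \<omega> < K (enn2real (D u \<omega>) + 1 / real (Suc n)) \<omega>"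
          using D_le_iff[of "enn2real (D u \<omega>)" u \<omega>] fin by simp
        then show ?thesis using K_after_D[OF u elim fin, of "1 / real (Suc n)"] by simp
      qed
      moreover have "shift X (D u \<omega>) \<omega> \<in> Omega X"
        using shift_in_Omega fin elim alive_subset by blast
      ultimately show "shifted (D u) \<omega> \<in> ?A" using fin by (simp add: shifted_def)
    qed
  qed
  have "AE \<omega> in P. D u \<omega> < \<infinity> \<longrightarrow>
    (AE \<omega>' in init_law X (return ext_borel (coord X (D u \<omega>) \<omega>)). \<omega>' \<in> ?A)"
    using shifted_landing[OF return_in_PA D_stopping_time[OF u] A sh[unfolded pt_law_def]]
    unfolding pt_law_def .
  then show ?thesis using AE_alive
  proof eventually_elim
    case (elim \<omega>)
    show ?case
    proof
      assume fin: "D u \<omega> < \<infinity>"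
      let ?d = "enn2real (D u \<omega>)"
      have d: "ennreal ?d = D u \<omega>" using fin by simp
      show "coord X (D u \<omega>) \<omega> = Some a"
      proof (cases "coord X (D u \<omega>) \<omega>")
        case None
        then have "lifetime X \<omega> \<le> ennreal ?d" unfolding lifetime_def d by (intro Inf_lower) simp
        then have "L (?d + 1) \<omega> = L ?d \<omega>"
          using elim(2) by (intro regular_path(4)) (auto simp: alive_def)
        then have "K (?d + 1) \<omega> = K ?d \<omega>" using elim(2) by (simp add: K_def)
        moreover have "K u \<omega> < K (?d + 1 / real (Suc 0)) \<omega>"
          using D_le_iff[of ?d u \<omega>] d by (auto dest: spec[of _ 0])
        ultimately show ?thesis using K_at_D[OF u fin] by simp
      next
        case (Some x)
        have "AE \<omega>' in pt_law X x. \<omega>' \<in> ?A"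
          using elim(1) fin unfolding Some pt_law_def by blast
        then have "AE \<omega>' in pt_law X x. Inf (ennreal ` {t. 0 \<le> t \<and> L t \<omega>' > 0}) = 0"
        proof eventually_elim
          case (elim \<omega>')
          have "Inf (ennreal ` {t. 0 \<le> t \<and> L t \<omega>' > 0}) \<le> ennreal (1 / real (Suc n))" for n
            using elim by (intro Inf_lower) auto
          moreover have "(\<lambda>n. ennreal (1 / real (Suc n))) \<longlonglongrightarrow> ennreal 0"
            using LIMSEQ_inverse_real_of_nat by (intro tendsto_ennrealI) (simp add: inverse_eq_divide)
          ultimately have "Inf (ennreal ` {t. 0 \<le> t \<and> L t \<omega>' > 0}) \<le> ennreal 0"
            by (intro LIMSEQ_le_const) auto
          then show ?case by simp
        qed
        then have "x \<in> af_support X L" by (simp add: af_support_def)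
        then show ?thesis using local_time Some by (simp add: local_time_def)
      qed
    qed
  qed
qed

lemma regeneration_at_D:
  assumes "0 \<le> u" "Z \<in> borel_measurable (pre_sigma (D u))" "\<And>\<omega>. Z \<omega> \<le> 1" "\<And>\<omega>. D u \<omega> = \<infinity> \<Longrightarrow> Z \<omega> = 0"
    "G \<in> borel_measurable P"
  shows "(\<integral>\<^sup>+ \<omega>. Z \<omega> * G (shifted (D u) \<omega>) \<partial>P) = (\<integral>\<^sup>+ \<omega>. Z \<omega> \<partial>P) * (\<integral>\<^sup>+ \<omega>. G \<omega> \<partial>P)"
  using regeneration[OF return_in_PA D_stopping_time landing[unfolded pt_law_def], of u Z G] assms
  unfolding pt_law_def by blast

lemma D_measurable [measurable]: "0 \<le> u \<Longrightarrow> D u \<in> borel_measurable P"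
  unfolding pt_law_def by (rule stopping_init[OF return_in_PA D_stopping_time])

lemma shifted_measurable_P: "0 \<le> u \<Longrightarrow> shifted (D u) \<in> measurable P (raw_filtration X \<infinity>)"
  unfolding pt_law_def by (rule shifted_measurable[OF return_in_PA D_stopping_time])

text \<open>\<open>alive\<close> belongs to the completed sigma-algebra only, so the regeneration property is applied
  to a raw null set that contains its complement.\<close>
lemma AE_shifted_alive:
  assumes u: "0 \<le> u"
  shows "AE \<omega> in P. D u \<omega> < \<infinity> \<longrightarrow> shifted (D u) \<omega> \<in> alive"
proof -
  have "AE \<omega> in rlaw (Some a). \<omega> \<in> alive"
    using AE_alive unfolding pt_law_eq by (simp add: AE_completion_iff)
  then obtain B where B: "{\<omega>\<in>space (rlaw (Some a)). \<not> \<omega> \<in> alive} \<subseteq> B"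
      "emeasure (rlaw (Some a)) B = 0" "B \<in> sets (rlaw (Some a))"
    by (rule AE_E)
  have Braw [measurable]: "B \<in> sets (raw_filtration X \<infinity>)" using B(3) by simp
  then have BP [measurable]: "B \<in> sets P" unfolding pt_law_def using raw_subset_init_law by blast
  note [measurable] = shifted_measurable_P[OF u] D_measurable[OF u]
  define Z :: "'w \<Rightarrow> ennreal" where "Z \<omega> = (if D u \<omega> < \<infinity> then 1 else 0)" for \<omega>
  have Z: "Z \<in> borel_measurable (pre_sigma (D u))"
    unfolding Z_def using measurable_stopping_time_pre_sigma[OF D_stopping_time[OF u]] by measurable
  have [measurable]: "Z \<in> borel_measurable P" unfolding Z_def by measurable
  have "emeasure P B = 0" using B(2) Braw emeasure_rlaw[OF Braw] by (simp add: emeasure_pt_law)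
  then have "(\<integral>\<^sup>+ \<omega>. Z \<omega> * indicator B (shifted (D u) \<omega>) \<partial>P) = 0"
    by (subst regeneration_at_D[OF u Z]) (auto simp: Z_def)
  then have "AE \<omega> in P. Z \<omega> * indicator B (shifted (D u) \<omega>) = 0"
    by (subst (asm) nn_integral_0_iff_AE) auto
  moreover have "AE \<omega> in P. shifted (D u) \<omega> \<in> Omega X"
    using measurable_space[OF shifted_measurable_P[OF u]] by (intro AE_I2) simp
  ultimately show ?thesis
    by eventually_elim (use B(1) in \<open>auto simp: Z_def indicator_def split: if_splits\<close>)
qed

definition V :: "real \<Rightarrow> 'w \<Rightarrow> ennreal" where
  "V l \<omega> = (\<integral>\<^sup>+ s. ennreal (exp (- l * s) * K s \<omega>) \<partial>lborel)"

lemma V_measurable [measurable]: "V l \<in> borel_measurable P"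
  unfolding V_def[abs_def] by measurable

definition discount :: "real \<Rightarrow> real \<Rightarrow> 'w \<Rightarrow> ennreal" where
  "discount l u \<omega> = (if D u \<omega> < \<infinity> then ennreal (exp (- l * enn2real (D u \<omega>))) else 0)"

text \<open>The substitution \<open>s = D u + s'\<close> in \<open>path_split\<close> splits off the factor \<open>exp (- l * D u)\<close>,
  which is known at time \<open>D u\<close> and hence independent of the path after it.\<close>
lemma first_passage:
  assumes u: "0 \<le> u" and l: "0 < l"
  shows "(\<integral>\<^sup>+ \<omega>. (\<integral>\<^sup>+ s. ennreal (exp (- l * s) * (K s \<omega> - K (min s u) \<omega>)) \<partial>lborel) \<partial>P) =
    (\<integral>\<^sup>+ \<omega>. discount l u \<omega> \<partial>P) * (\<integral>\<^sup>+ \<omega>. V l \<omega> \<partial>P)"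
proof -
  note [measurable] = measurable_stopping_time_pre_sigma[OF D_stopping_time[OF u]]
  have "(\<integral>\<^sup>+ \<omega>. (\<integral>\<^sup>+ s. ennreal (exp (- l * s) * (K s \<omega> - K (min s u) \<omega>)) \<partial>lborel) \<partial>P) =
    (\<integral>\<^sup>+ \<omega>. discount l u \<omega> * V l (shifted (D u) \<omega>) \<partial>P)"
  proof (rule nn_integral_cong_AE)
    show "AE \<omega> in P. (\<integral>\<^sup>+ s. ennreal (exp (- l * s) * (K s \<omega> - K (min s u) \<omega>)) \<partial>lborel) =
      discount l u \<omega> * V l (shifted (D u) \<omega>)"
      using AE_alive AE_shifted_alive[OF u]
    proof eventually_elim
      case (elim \<omega>)
      show ?case
      proof (cases "D u \<omega> < \<infinity>")
        case True
        let ?d = "enn2real (D u \<omega>)" and ?\<theta> = "shift X (D u \<omega>) \<omega>"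
        have \<theta>: "?\<theta> \<in> alive" using elim True by (simp add: shifted_def)
        have cont: "continuous_on UNIV (\<lambda>s. K (s - ?d) ?\<theta>)"
          by (rule continuous_on_compose2[OF K_continuous[of ?\<theta>]]) (auto intro!: continuous_intros)
        have [measurable]: "(\<lambda>s. K (s - ?d) ?\<theta>) \<in> borel_measurable borel"
          using cont by (rule borel_measurable_continuous_onI)
        have [measurable]: "(\<lambda>s. K s ?\<theta>) \<in> borel_measurable borel"
          using K_continuous by (rule borel_measurable_continuous_onI)
        have "(\<integral>\<^sup>+ s. ennreal (exp (- l * s) * (K s \<omega> - K (min s u) \<omega>)) \<partial>lborel) =
          (\<integral>\<^sup>+ s. ennreal (exp (- l * s) * K (s - ?d) ?\<theta>) \<partial>lborel)"
          by (simp only: path_split[OF u elim(1) True \<theta>])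
        also have "\<dots> = ennreal \<bar>1\<bar> * (\<integral>\<^sup>+ s. ennreal (exp (- l * (?d + 1 * s)) * K (?d + 1 * s - ?d) ?\<theta>) \<partial>lborel)"
          by (rule nn_integral_real_affine) auto
        also have "\<dots> = (\<integral>\<^sup>+ s. ennreal (exp (- l * ?d)) * ennreal (exp (- l * s) * K s ?\<theta>) \<partial>lborel)"
        proof -
          have e: "exp (- l * (?d + 1 * s)) * K (?d + 1 * s - ?d) ?\<theta> = exp (- l * ?d) * (exp (- l * s) * K s ?\<theta>)" for s
            by (simp add: mult.assoc[symmetric] exp_add[symmetric] algebra_simps)
          have e': "ennreal (exp (- l * (?d + 1 * s)) * K (?d + 1 * s - ?d) ?\<theta>) =
            ennreal (exp (- l * ?d)) * ennreal (exp (- l * s) * K s ?\<theta>)" for s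
            unfolding e by (rule ennreal_mult') simp
          show ?thesis unfolding e' by simp
        qed
        also have "\<dots> = ennreal (exp (- l * ?d)) * V l ?\<theta>"
          unfolding V_def by (rule nn_integral_cmult) measurable
        finally show ?thesis using True by (simp add: discount_def shifted_def)
      next
        case False
        have "K s \<omega> = K (min s u) \<omega>" for s
        proof (cases "s \<le> u")
          case nle: False
          then have "\<not> K u \<omega> < K s \<omega>" using False u D_le[of s u \<omega>] by (auto simp: top_unique less_top[symmetric])
          then show ?thesis using nle K_mono[of u s \<omega>] by simp
        qed simp
        then show ?thesis using False by (simp add: discount_def)
      qed
    qed
  qed
  also have "\<dots> = (\<integral>\<^sup>+ \<omega>. discount l u \<omega> \<partial>P) * (\<integral>\<^sup>+ \<omega>. V l \<omega> \<partial>P)"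
  proof (rule regeneration_at_D[OF u])
    show "discount l u \<in> borel_measurable (pre_sigma (D u))"
      unfolding discount_def[abs_def] by measurable
    show "discount l u \<omega> \<le> 1" for \<omega> using l by (simp add: discount_def)
  qed (auto simp: discount_def)
  finally show ?thesis .
qed

text \<open>Integration by parts for the Stieltjes integral, in the form of Fubini's theorem applied to
  \<open>exp_tail\<close>.\<close>
lemma laplace_local_time:
  assumes \<omega>: "\<omega> \<in> alive" and l: "0 < l"
  shows "(\<integral>\<^sup>+ t\<in>{0..}. ennreal (exp (- l * t)) \<partial>interval_measure (\<lambda>t. L (max 0 t) \<omega>)) = ennreal l * V l \<omega>"
proof -
  let ?I = "interval_measure (\<lambda>t. K t \<omega>)"
  have KL: "(\<lambda>t. L (max 0 t) \<omega>) = (\<lambda>t. K t \<omega>)" using \<omega> by (simp add: K_def)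
  interpret I: sigma_finite_measure ?I
    using K_continuous[of \<omega>] K_mono[of _ _ \<omega>]
    by (intro sigma_finite_interval_measure) (auto simp: continuous_on_eq_continuous_within intro: continuous_within_subset)
  interpret pair_sigma_finite ?I lborel ..
  have [measurable]: "(\<lambda>s. K s \<omega>) \<in> borel_measurable borel"
    using K_continuous by (rule borel_measurable_continuous_onI)
  have "(\<integral>\<^sup>+ t\<in>{0..}. ennreal (exp (- l * t)) \<partial>?I) =
    (\<integral>\<^sup>+ t. (\<integral>\<^sup>+ s. ennreal (l * exp (- l * s)) * (if 0 \<le> t \<and> t \<le> s then 1 else 0) \<partial>lborel) \<partial>?I)"
  proof (rule nn_integral_cong)
    fix t
    have "ennreal (exp (- l * t)) * indicator {0..} t =
      (\<integral>\<^sup>+ s. ennreal (l * exp (- l * s)) * indicator {t..} s \<partial>lborel) * indicator {0..} t"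
      by (simp only: exp_tail[OF l])
    also have "\<dots> = (\<integral>\<^sup>+ s. ennreal (l * exp (- l * s)) * indicator {t..} s * indicator {0..} t \<partial>lborel)"
      by (rule nn_integral_multc[symmetric]) measurable
    also have "\<dots> = (\<integral>\<^sup>+ s. ennreal (l * exp (- l * s)) * (if 0 \<le> t \<and> t \<le> s then 1 else 0) \<partial>lborel)"
      by (intro nn_integral_cong) (auto simp: indicator_def)
    finally show "ennreal (exp (- l * t)) * indicator {0..} t = \<dots>" .
  qed
  also have "\<dots> = (\<integral>\<^sup>+ s. (\<integral>\<^sup>+ t. ennreal (l * exp (- l * s)) * (if 0 \<le> t \<and> t \<le> s then 1 else 0) \<partial>?I) \<partial>lborel)"
    by (rule Fubini'[symmetric]) measurable
  also have "\<dots> = (\<integral>\<^sup>+ s. ennreal l * ennreal (exp (- l * s) * K s \<omega>) \<partial>lborel)"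
  proof (rule nn_integral_cong)
    fix s
    have "(\<integral>\<^sup>+ t. ennreal (l * exp (- l * s)) * (if 0 \<le> t \<and> t \<le> s then 1 else 0) \<partial>?I) =
      (\<integral>\<^sup>+ t. ennreal (l * exp (- l * s)) * indicator {0..s} t \<partial>?I)"
      by (intro nn_integral_cong) (auto simp: indicator_def)
    also have "\<dots> = ennreal (l * exp (- l * s)) * emeasure ?I {0..s}" by (rule nn_integral_cmult_indicator) simp
    also have "emeasure ?I {0..s} = ennreal (K s \<omega>)"
    proof (cases "0 \<le> s")
      case True
      then have "emeasure ?I {0..s} = ennreal (K s \<omega> - K 0 \<omega>)"
        by (intro emeasure_interval_measure_Icc K_mono K_continuous)
      then show ?thesis by simp
    qed simp
    also have "ennreal (l * exp (- l * s)) * ennreal (K s \<omega>) = ennreal l * ennreal (exp (- l * s) * K s \<omega>)"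
      using l by (simp add: ennreal_mult'[symmetric] K_nonneg mult.assoc)
    finally show "(\<integral>\<^sup>+ t. ennreal (l * exp (- l * s)) * (if 0 \<le> t \<and> t \<le> s then 1 else 0) \<partial>?I) = \<dots>" .
  qed
  also have "\<dots> = ennreal l * V l \<omega>" unfolding V_def by (rule nn_integral_cmult) measurable
  finally show ?thesis unfolding KL .
qed

lemma V_expectation:
  assumes l: "0 < l" shows "ennreal l * (\<integral>\<^sup>+ \<omega>. V l \<omega> \<partial>P) = r l a a"
proof -
  have "r l a a = (\<integral>\<^sup>+ \<omega>. (\<integral>\<^sup>+ t\<in>{0..}. ennreal (exp (- l * t))
                     \<partial>interval_measure (\<lambda>t. L (max 0 t) \<omega>)) \<partial>P)"
    using local_time l unfolding local_time_def by simp
  also have "\<dots> = (\<integral>\<^sup>+ \<omega>. ennreal l * V l \<omega> \<partial>P)"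
    using AE_alive by (intro nn_integral_cong_AE, eventually_elim) (rule laplace_local_time[OF _ l])
  also have "\<dots> = ennreal l * (\<integral>\<^sup>+ \<omega>. V l \<omega> \<partial>P)" by (rule nn_integral_cmult) measurable
  finally show ?thesis ..
qed

end

section \<open>Expected local time and the last visit\<close>

locale finite_local_time = local_time_at X r a L
  for X :: "('w, 's::{metric_space, second_countable_topology}) process" and r a L +
  assumes resolvent_pos: "0 < l \<Longrightarrow> 0 < r l a a" and resolvent_finite: "0 < l \<Longrightarrow> r l a a < \<infinity>"
begin

sublocale prob_space P by (rule prob_space_pt_law)

lemma V_finite: "0 < l \<Longrightarrow> (\<integral>\<^sup>+ \<omega>. V l \<omega> \<partial>P) < \<infinity>"
  using V_expectation[of l] resolvent_finite[of l] by (auto simp: less_top[symmetric] ennreal_mult_top)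

lemma K_integrable [simp]: "integrable P (K t)"
proof (rule integrableI_nonneg)
  show "AE \<omega> in P. 0 \<le> K t \<omega>" by (simp add: K_nonneg)
  have le: "ennreal (exp (- (\<bar>t\<bar> + 1))) * ennreal (K t \<omega>) \<le> V 1 \<omega>" for \<omega>
  proof -
    have "ennreal (exp (- (\<bar>t\<bar> + 1))) * ennreal (K t \<omega>) =
      (\<integral>\<^sup>+ s. ennreal (exp (- (\<bar>t\<bar> + 1)) * K t \<omega>) * indicator {t..t + 1} s \<partial>lborel)"
      by (simp add: nn_integral_cmult_indicator ennreal_mult' )
    also have "\<dots> \<le> V 1 \<omega>"
      unfolding V_def
      by (intro nn_integral_mono) (auto simp: indicator_def intro!: ennreal_leI mult_mono K_mono K_nonneg)
    finally show ?thesis .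
  qed
  have "ennreal (exp (- (\<bar>t\<bar> + 1))) * (\<integral>\<^sup>+ \<omega>. ennreal (K t \<omega>) \<partial>P) \<le> (\<integral>\<^sup>+ \<omega>. V 1 \<omega> \<partial>P)"
    by (subst nn_integral_cmult[symmetric], measurable, rule nn_integral_mono, rule le)
  also have "\<dots> < \<infinity>" by (rule V_finite) simp
  finally show "(\<integral>\<^sup>+ \<omega>. ennreal (K t \<omega>) \<partial>P) < \<infinity>"
    by (auto simp: less_top[symmetric] ennreal_mult_top ennreal_mult_eq_top_iff)
qed measurable

definition U :: "real \<Rightarrow> real" where "U t = (\<integral>\<omega>. K t \<omega> \<partial>P)"

lemma U_mono: "s \<le> t \<Longrightarrow> U s \<le> U t"
  unfolding U_def by (intro integral_mono K_mono) auto

lemma U_nonpos [simp]: "t \<le> 0 \<Longrightarrow> U t = 0"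
proof -
  assume "t \<le> 0"
  then have "K t = (\<lambda>_. 0)" by (intro ext K_nonpos)
  then show ?thesis by (simp add: U_def)
qed

lemma U_nonneg: "0 \<le> U t"
  unfolding U_def by (intro integral_nonneg_AE) (simp add: K_nonneg)

lemma U_continuous: "isCont U t"
  unfolding continuous_at_sequentially
proof (intro allI impI)
  fix x :: "nat \<Rightarrow> real" assume x: "x \<longlonglongrightarrow> t"
  then obtain B where B: "\<And>n. norm (x n) \<le> B" using convergent_imp_Bseq[of x] by (auto simp: Bseq_def convergent_def)
  have "(\<lambda>n. \<integral>\<omega>. K (x n) \<omega> \<partial>P) \<longlonglongrightarrow> (\<integral>\<omega>. K t \<omega> \<partial>P)"
  proof (rule integral_dominated_convergence[where w = "K B"])
    show "AE \<omega> in P. (\<lambda>n. K (x n) \<omega>) \<longlonglongrightarrow> K t \<omega>"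
      using isCont_tendsto_compose[OF K_continuous_at x] by simp
    show "AE \<omega> in P. norm (K (x n) \<omega>) \<le> K B \<omega>" for n
      using B[of n] K_mono[of "x n" B] by (simp add: K_nonneg abs_le_iff)
  qed auto
  then show "(U \<circ> x) \<longlonglongrightarrow> U t" by (simp add: U_def comp_def)
qed

lemma U_measurable [measurable]: "U \<in> borel_measurable borel"
  by (intro borel_measurable_mono) (simp add: mono_def U_mono)

lemma nn_integral_K: "(\<integral>\<^sup>+ \<omega>. ennreal (K t \<omega>) \<partial>P) = ennreal (U t)"
  unfolding U_def by (rule nn_integral_eq_integral) (auto simp: K_nonneg)

lemma sets_P_AE:
  assumes "AE \<omega> in P. \<omega> \<in> A \<longleftrightarrow> \<omega> \<in> B" "A \<in> sets P" "B \<subseteq> Omega X"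
  shows "B \<in> sets P"
  using completion.in_sets_AE[where M = "rlaw (Some a)" and A = A and B = B] assms unfolding pt_law_eq by simp

interpretation pair_sigma_finite P lborel ..

lemma U_laplace_V: "(\<integral>\<^sup>+ s. ennreal (exp (- l * s) * U s) \<partial>lborel) = (\<integral>\<^sup>+ \<omega>. V l \<omega> \<partial>P)"
proof -
  have "(\<integral>\<^sup>+ \<omega>. V l \<omega> \<partial>P) = (\<integral>\<^sup>+ s. (\<integral>\<^sup>+ \<omega>. ennreal (exp (- l * s) * K s \<omega>) \<partial>P) \<partial>lborel)"
    unfolding V_def by (rule Fubini'[symmetric]) measurable
  also have "\<dots> = (\<integral>\<^sup>+ s. ennreal (exp (- l * s) * U s) \<partial>lborel)"
    by (simp add: ennreal_mult' nn_integral_cmult nn_integral_K)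
  finally show ?thesis ..
qed

lemma U_laplace:
  assumes "0 < l" shows "ennreal l * (\<integral>\<^sup>+ s. ennreal (exp (- l * s) * U s) \<partial>lborel) = r l a a"
  unfolding U_laplace_V by (rule V_expectation[OF assms])

lemma first_passage_laplace:
  assumes u: "0 \<le> u" and l: "0 < l"
  shows "(\<integral>\<^sup>+ s. ennreal (exp (- l * s) * (U s - U (min s u))) \<partial>lborel) =
    (\<integral>\<^sup>+ \<omega>. discount l u \<omega> \<partial>P) * (\<integral>\<^sup>+ s. ennreal (exp (- l * s) * U s) \<partial>lborel)"
proof -
  have "(\<integral>\<^sup>+ \<omega>. discount l u \<omega> \<partial>P) * (\<integral>\<^sup>+ s. ennreal (exp (- l * s) * U s) \<partial>lborel) =
     (\<integral>\<^sup>+ s. (\<integral>\<^sup>+ \<omega>. ennreal (exp (- l * s) * (K s \<omega> - K (min s u) \<omega>)) \<partial>P) \<partial>lborel)"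
    unfolding U_laplace_V first_passage[OF u l, symmetric] by (rule Fubini'[symmetric]) measurable
  also have "\<dots> = (\<integral>\<^sup>+ s. ennreal (exp (- l * s) * (U s - U (min s u))) \<partial>lborel)"
  proof (rule nn_integral_cong)
    fix s
    have "(\<integral>\<^sup>+ \<omega>. ennreal (exp (- l * s) * (K s \<omega> - K (min s u) \<omega>)) \<partial>P) =
      ennreal (\<integral>\<omega>. exp (- l * s) * (K s \<omega> - K (min s u) \<omega>) \<partial>P)"
      by (rule nn_integral_eq_integral) (auto simp: K_mono)
    then show "(\<integral>\<^sup>+ \<omega>. ennreal (exp (- l * s) * (K s \<omega> - K (min s u) \<omega>)) \<partial>P) =
      ennreal (exp (- l * s) * (U s - U (min s u)))"
      by (simp add: U_def)
  qed
  finally show ?thesis ..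
qed

definition H :: "real \<Rightarrow> real \<Rightarrow> real" where
  "H u t = prob {\<omega>\<in>Omega X. D u \<omega> \<le> ennreal t}"

lemma D_event [measurable]: "0 \<le> u \<Longrightarrow> {\<omega>\<in>Omega X. D u \<omega> \<le> t} \<in> sets P"
proof -
  assume "0 \<le> u"
  then have [measurable]: "D u \<in> borel_measurable P" by (rule D_measurable)
  have "{\<omega>\<in>space P. D u \<omega> \<le> t} \<in> sets P" by measurable
  then show ?thesis by simp
qed

lemma discount_laplace:
  assumes u: "0 \<le> u" and l: "0 < l"
  shows "(\<integral>\<^sup>+ \<omega>. discount l u \<omega> \<partial>P) =
    (\<integral>\<^sup>+ t. ennreal (l * exp (- l * t) * H u t) * indicator {0..} t \<partial>lborel)"
proof -
  note [measurable] = D_measurable[OF u]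
  have "(\<integral>\<^sup>+ \<omega>. discount l u \<omega> \<partial>P) =
    (\<integral>\<^sup>+ \<omega>. (\<integral>\<^sup>+ t. ennreal (l * exp (- l * t)) * (if 0 \<le> t \<and> D u \<omega> \<le> ennreal t then 1 else 0) \<partial>lborel) \<partial>P)"
  proof (rule nn_integral_cong)
    fix \<omega>
    show "discount l u \<omega> =
      (\<integral>\<^sup>+ t. ennreal (l * exp (- l * t)) * (if 0 \<le> t \<and> D u \<omega> \<le> ennreal t then 1 else 0) \<partial>lborel)"
    proof (cases "D u \<omega> < \<infinity>")
      case True
      then obtain d where d: "D u \<omega> = ennreal d" "0 \<le> d" by (cases "D u \<omega>") auto
      have "(\<integral>\<^sup>+ t. ennreal (l * exp (- l * t)) * (if 0 \<le> t \<and> D u \<omega> \<le> ennreal t then 1 else 0) \<partial>lborel) =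
        (\<integral>\<^sup>+ t. ennreal (l * exp (- l * t)) * indicator {d..} t \<partial>lborel)"
        using d by (intro nn_integral_cong) (auto simp: indicator_def)
      then show ?thesis using True d by (simp only: exp_tail[OF l]) (simp add: discount_def)
    next
      case False then show ?thesis by (auto simp: discount_def less_top[symmetric] top_unique)
    qed
  qed
  also have "\<dots> = (\<integral>\<^sup>+ t. (\<integral>\<^sup>+ \<omega>. ennreal (l * exp (- l * t)) * (if 0 \<le> t \<and> D u \<omega> \<le> ennreal t then 1 else 0) \<partial>P) \<partial>lborel)"
    by (rule Fubini'[symmetric]) measurable
  also have "\<dots> = (\<integral>\<^sup>+ t. ennreal (l * exp (- l * t) * H u t) * indicator {0..} t \<partial>lborel)"
  proof (rule nn_integral_cong)
    fix t
    have "(\<integral>\<^sup>+ \<omega>. ennreal (l * exp (- l * t)) * (if 0 \<le> t \<and> D u \<omega> \<le> ennreal t then 1 else 0) \<partial>P) =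
      (\<integral>\<^sup>+ \<omega>. (ennreal (l * exp (- l * t)) * indicator {0..} t) * indicator {\<omega>\<in>Omega X. D u \<omega> \<le> ennreal t} \<omega> \<partial>P)"
      by (intro nn_integral_cong) (auto simp: indicator_def)
    also have "\<dots> = (ennreal (l * exp (- l * t)) * indicator {0..} t) * emeasure P {\<omega>\<in>Omega X. D u \<omega> \<le> ennreal t}"
      by (rule nn_integral_cmult_indicator) (rule D_event[OF u])
    also have "\<dots> = ennreal (l * exp (- l * t) * H u t) * indicator {0..} t"
      using l by (simp add: emeasure_eq_measure H_def ennreal_mult' mult_ac)
    finally show "(\<integral>\<^sup>+ \<omega>. ennreal (l * exp (- l * t)) * (if 0 \<le> t \<and> D u \<omega> \<le> ennreal t then 1 else 0) \<partial>P) = \<dots>" .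
  qed
  finally show ?thesis .
qed

lemma H_bounds: "0 \<le> H u t" "H u t \<le> 1"
  by (auto simp: H_def)

lemma H_mono: "0 \<le> u \<Longrightarrow> s \<le> t \<Longrightarrow> H u s \<le> H u t"
  unfolding H_def by (intro finite_measure_mono) (auto intro: order_trans ennreal_leI)

lemma inv_local_time_alive:
  assumes "\<omega> \<in> alive"
  shows "inv_local_time L s \<omega> = Inf (ennreal ` {t. 0 < t \<and> s < K t \<omega>})"
proof -
  have "{t. 0 < t \<and> L t \<omega> > s} = {t. 0 < t \<and> s < K t \<omega>}"
    using assms by (auto simp: K_def max_absorb2)
  then show ?thesis by (simp add: inv_local_time_def)
qed

lemma inv_local_time_less_iff:
  assumes "\<omega> \<in> alive" "0 \<le> s"
  shows "inv_local_time L s \<omega> < ennreal t \<longleftrightarrow> s < K t \<omega>"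
proof
  assume "inv_local_time L s \<omega> < ennreal t"
  then obtain x where x: "0 < x" "s < K x \<omega>" "ennreal x < ennreal t"
    unfolding inv_local_time_alive[OF assms(1)] Inf_less_iff by auto
  then have "x \<le> t" by (simp add: ennreal_less_iff)
  then show "s < K t \<omega>" using K_mono[of x t \<omega>] x by simp
next
  assume "s < K t \<omega>"
  then obtain x where x: "0 < x" "x < t" "s < K x \<omega>" using K_gt_left[of s t \<omega>] assms(2) by auto
  then have "inv_local_time L s \<omega> \<le> ennreal x"
    unfolding inv_local_time_alive[OF assms(1)] by (intro Inf_lower) auto
  also have "ennreal x < ennreal t" using x by (simp add: ennreal_less_iff)
  finally show "inv_local_time L s \<omega> < ennreal t" .
qed

lemma inv_local_time_mono:
  assumes "\<omega> \<in> alive" "s \<le> s'"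
  shows "inv_local_time L s \<omega> \<le> inv_local_time L s' \<omega>"
  unfolding inv_local_time_alive[OF assms(1)] using assms(2) by (intro Inf_superset_mono) auto

text \<open>In terms of the inverse local time, \<open>D u\<close> is its value at \<open>K u\<close>. The last visit is at or
  before \<open>u\<close> iff the inverse local time has no value in the interval from \<open>u\<close> to \<open>t\<close>, that is, iff
  it jumps over this interval.\<close>
lemma last_visit_le_iff:
  assumes \<omega>: "\<omega> \<in> alive" and ut: "0 < u" "u < t"
  shows "last_visit L t \<omega> \<le> u \<longleftrightarrow> \<not> D u \<omega> \<le> ennreal t"
proof -
  let ?T = "\<lambda>s. inv_local_time L s \<omega>"
  let ?S = "Sup {?T s | s. 0 \<le> s \<and> ?T s \<le> ennreal t}"
  have D: "D u \<omega> = ?T (K u \<omega>)" unfolding inv_local_time_alive[OF \<omega>] D_def ..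
  have "?S \<le> ennreal t" by (intro Sup_least) auto
  then have fin: "?S < top" using ennreal_less_top le_less_trans by blast
  have "last_visit L t \<omega> \<le> u \<longleftrightarrow> ?S \<le> ennreal u"
    unfolding last_visit_def using fin ut(1) by (cases ?S) auto
  also have "\<dots> \<longleftrightarrow> (\<forall>s\<ge>0. ?T s \<le> ennreal t \<longrightarrow> ?T s \<le> ennreal u)"
    by (auto simp: Sup_le_iff)
  also have "\<dots> \<longleftrightarrow> \<not> D u \<omega> \<le> ennreal t"
  proof (intro iffI allI impI notI)
    fix s assume nD: "\<not> D u \<omega> \<le> ennreal t" and s: "0 \<le> s" "?T s \<le> ennreal t"
    have "s < K u \<omega>"
    proof (rule ccontr)
      assume "\<not> s < K u \<omega>"
      then have "D u \<omega> \<le> ?T s" unfolding D using inv_local_time_mono[OF \<omega>] by simp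
      then show False using nD s(2) by auto
    qed
    then show "?T s \<le> ennreal u" using inv_local_time_less_iff[OF \<omega> s(1), of u] by simp
  next
    assume *: "\<forall>s\<ge>0. ?T s \<le> ennreal t \<longrightarrow> ?T s \<le> ennreal u" and Dt: "D u \<omega> \<le> ennreal t"
    show False
    proof (cases "D u \<omega> = ennreal t")
      case True
      then have "ennreal t \<le> ennreal u" using * K_nonneg[of u \<omega>] unfolding D by auto
      then show False using ut by (simp add: ennreal_le_iff)
    next
      case False
      then have "K u \<omega> < K t \<omega>" using Dt D_less_imp by (simp add: order_less_le)
      \<comment> \<open>At a level strictly between \<open>K u\<close> and \<open>K t\<close> the inverse local time lies strictly after
        \<open>u\<close> and before \<open>t\<close>.\<close>
      define s where "s = (K u \<omega> + K t \<omega>) / 2"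
      have s: "K u \<omega> < s" "s < K t \<omega>" "0 \<le> s" using \<open>K u \<omega> < K t \<omega>\<close> K_nonneg[of u \<omega>] by (auto simp: s_def)
      then have "?T s \<le> ennreal u" using * inv_local_time_less_iff[OF \<omega> s(3), of t] by simp
      have "eventually (\<lambda>x. K x \<omega> < s) (at u)"
        using K_continuous_at[of u \<omega>] s(1) by (simp add: isCont_def order_tendstoD)
      then obtain d where d: "d > 0" "\<And>x. x \<noteq> u \<Longrightarrow> dist x u < d \<Longrightarrow> K x \<omega> < s"
        unfolding eventually_at by auto
      have "K (u + d / 2) \<omega> < s" using d by (intro d(2)) (auto simp: dist_real_def)
      then have "\<not> ?T s < ennreal (u + d / 2)" using inv_local_time_less_iff[OF \<omega> s(3)] by simp
      then have "ennreal (u + d / 2) \<le> ennreal u" using \<open>?T s \<le> ennreal u\<close> by simp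
      then show False using d(1) ut(1) by (simp add: ennreal_le_iff)
    qed
  qed
  finally show ?thesis .
qed

lemma prob_last_visit_le:
  assumes "0 < u" "u < t"
  shows "prob {\<omega>\<in>Omega X. last_visit L t \<omega> \<le> u} = 1 - H u t"
proof -
  let ?A = "{\<omega>\<in>Omega X. last_visit L t \<omega> \<le> u}" and ?B = "space P - {\<omega>\<in>Omega X. D u \<omega> \<le> ennreal t}"
  have m: "?B \<in> sets P" using assms by (intro sets.compl_sets D_event) simp
  have ae: "AE \<omega> in P. \<omega> \<in> ?A \<longleftrightarrow> \<omega> \<in> ?B"
    using AE_alive by eventually_elim (use last_visit_le_iff[OF _ assms] alive_subset in auto)
  have "?A \<in> sets P" using ae by (intro sets_P_AE[OF _ m]) auto
  then have "prob ?A = prob ?B" using ae m by (intro measure_eq_AE)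
  also have "\<dots> = 1 - H u t" unfolding H_def using assms by (intro prob_compl D_event) simp
  finally show ?thesis .
qed

lemma D_mono: "v \<le> u \<Longrightarrow> D v \<omega> \<le> D u \<omega>"
  unfolding D_def using K_mono[of v u \<omega>] by (intro Inf_superset_mono) auto

lemma discount_measurable [measurable]: "0 \<le> u \<Longrightarrow> discount l u \<in> borel_measurable P"
proof -
  assume "0 \<le> u"
  note [measurable] = D_measurable[OF this]
  show ?thesis unfolding discount_def[abs_def] by measurable
qed

text \<open>As a function of \<open>u\<close>, \<open>D\<close> has no jump at a fixed point: a jump over the interval from \<open>t\<close> to
  \<open>t + h\<close> would lower \<open>exp (- D u)\<close> by at least \<open>\<kappa>\<close>, while by \<open>first_passage_laplace\<close> the
  expectation of \<open>exp (- D u)\<close> changes continuously in \<open>u\<close> together with \<open>U\<close>.\<close>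
lemma AE_no_jump_of_D:
  assumes u: "0 < u" and h: "0 < h" and t: "0 \<le> t"
  shows "AE \<omega> in P. \<not> ((\<forall>n. D (u - u / real (n + 2)) \<omega> \<le> ennreal t) \<and> ennreal (t + h) \<le> D u \<omega>)"
proof -
  \<comment> \<open>With \<open>n + 2\<close> in place of \<open>n + 1\<close> all \<open>v n\<close> are positive; they increase to \<open>u\<close>.\<close>
  define v where "v n = u - u / real (n + 2)" for n
  have v: "0 \<le> v n" "v n \<le> u" for n
    using u by (auto simp: v_def field_simps)
  note [measurable] = D_measurable[OF v(1)] D_measurable[of u]
  have u0 [simp]: "0 \<le> u" using u by simp
  define B where "B n = {\<omega>\<in>space P. D (v n) \<omega> \<le> ennreal t \<and> ennreal (t + h) \<le> D u \<omega>}" for n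
  have B [measurable]: "B n \<in> sets P" for n unfolding B_def using u by measurable
  define \<kappa> where "\<kappa> = exp (- t) - exp (- (t + h))"
  have \<kappa>: "0 < \<kappa>" using h by (simp add: \<kappa>_def)
  define c where "c = (\<integral>\<^sup>+ s. ennreal (exp (- 1 * s) * U s) \<partial>lborel)"
  have c1: "c = r 1 a a" using U_laplace[of 1] by (simp add: c_def)
  have c: "0 < c" "c < \<infinity>" using c1 resolvent_pos[of 1] resolvent_finite[of 1] by auto
  have disc: "discount 1 u \<omega> + ennreal \<kappa> * indicator (B n) \<omega> \<le> discount 1 (v n) \<omega>" if "\<omega> \<in> space P" for \<omega> n
  proof -
    have mono: "discount 1 u \<omega> \<le> discount 1 (v n) \<omega>"
      using D_mono[OF v(2), of n \<omega>]
      by (auto simp: discount_def intro!: ennreal_leI enn2real_mono intro: le_less_trans)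
    show ?thesis
    proof (cases "\<omega> \<in> B n")
      case True
      then obtain d where d: "D (v n) \<omega> = ennreal d" "0 \<le> d" "d \<le> t"
        by (cases "D (v n) \<omega>") (auto simp: B_def t top_unique)
      have 1: "ennreal (exp (- t)) \<le> discount 1 (v n) \<omega>" using d by (simp add: discount_def ennreal_leI)
      have 2: "discount 1 u \<omega> \<le> ennreal (exp (- (t + h)))"
      proof (cases "D u \<omega>")
        case (real e)
        then have "t + h \<le> e" using True t h by (simp add: B_def ennreal_le_iff del: ennreal_plus)
        then show ?thesis using real by (simp add: discount_def ennreal_leI)
      qed (simp add: discount_def)
      have "discount 1 u \<omega> + ennreal \<kappa> \<le> ennreal (exp (- (t + h))) + ennreal \<kappa>" using 2 by (rule add_right_mono)
      also have "\<dots> = ennreal (exp (- t))" using \<kappa> by (simp add: \<kappa>_def ennreal_plus[symmetric] del: ennreal_plus)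
      finally show ?thesis using True 1 by simp
    qed (use mono in simp)
  qed
  have bound: "c * (ennreal \<kappa> * emeasure P (B n)) \<le> ennreal (U u - U (v n))" for n
  proof -
    have fin: "c * (\<integral>\<^sup>+ \<omega>. discount 1 u \<omega> \<partial>P) \<noteq> top"
    proof -
      have "(\<integral>\<^sup>+ \<omega>. discount 1 u \<omega> \<partial>P) \<le> (\<integral>\<^sup>+ \<omega>. 1 \<partial>P)"
        by (intro nn_integral_mono) (simp add: discount_def)
      then have "(\<integral>\<^sup>+ \<omega>. discount 1 u \<omega> \<partial>P) \<noteq> top" using emeasure_space_1 by (auto simp: top_unique)
      then show ?thesis using c by (simp add: ennreal_mult_eq_top_iff)
    qed
    have "c * (\<integral>\<^sup>+ \<omega>. discount 1 u \<omega> \<partial>P) + c * (ennreal \<kappa> * emeasure P (B n)) =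
      (\<integral>\<^sup>+ \<omega>. discount 1 u \<omega> + ennreal \<kappa> * indicator (B n) \<omega> \<partial>P) * c"
      by (simp add: nn_integral_add nn_integral_cmult_indicator distrib_left mult.commute)
    also have "\<dots> \<le> (\<integral>\<^sup>+ \<omega>. discount 1 (v n) \<omega> \<partial>P) * c"
      by (intro mult_right_mono nn_integral_mono disc) auto
    also have "\<dots> = (\<integral>\<^sup>+ s. ennreal (exp (- 1 * s) * (U s - U (min s (v n)))) \<partial>lborel)"
      unfolding c_def by (rule first_passage_laplace[symmetric, OF v(1)]) simp
    also have "\<dots> \<le> (\<integral>\<^sup>+ s. ennreal (exp (- 1 * s) * (U s - U (min s u))) +
        ennreal (U u - U (v n)) * (ennreal (1 * exp (- 1 * s)) * indicator {0..} s) \<partial>lborel)"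
    proof (rule nn_integral_mono)
      fix s
      show "ennreal (exp (- 1 * s) * (U s - U (min s (v n)))) \<le> ennreal (exp (- 1 * s) * (U s - U (min s u))) +
        ennreal (U u - U (v n)) * (ennreal (1 * exp (- 1 * s)) * indicator {0..} s)"
      proof (cases "0 \<le> s")
        case True
        have "U (min s u) - U (min s (v n)) \<le> U u - U (v n)"
          using U_mono[of "v n" u] U_mono[of "v n" s] U_mono[of s u] v(2)[of n]
          by (auto simp: min_def)
        then have "exp (- s) * (U s - U (min s (v n))) \<le> exp (- s) * ((U s - U (min s u)) + (U u - U (v n)))"
          by (intro mult_left_mono) auto
        then have "ennreal (exp (- s) * (U s - U (min s (v n)))) \<le>
          ennreal (exp (- s) * (U s - U (min s u)) + (U u - U (v n)) * exp (- s))"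
          by (intro ennreal_leI) (simp add: algebra_simps)
        also have "\<dots> = ennreal (exp (- s) * (U s - U (min s u))) + ennreal (U u - U (v n)) * ennreal (exp (- s))"
          using v(2) by (simp add: ennreal_mult' ennreal_plus U_mono)
        finally show ?thesis using True by simp
      qed simp
    qed
    also have "\<dots> = (\<integral>\<^sup>+ s. ennreal (exp (- 1 * s) * (U s - U (min s u))) \<partial>lborel) + ennreal (U u - U (v n))"
      by (subst nn_integral_add, measurable, subst nn_integral_cmult, measurable)
         (subst exp_tail, simp_all)
    also have "(\<integral>\<^sup>+ s. ennreal (exp (- 1 * s) * (U s - U (min s u))) \<partial>lborel) = c * (\<integral>\<^sup>+ \<omega>. discount 1 u \<omega> \<partial>P)"
      unfolding c_def by (subst first_passage_laplace) (auto simp: mult.commute)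
    finally show ?thesis using fin by (simp add: ennreal_add_left_cancel_le)
  qed
  define A where "A = (\<Inter>n. B n)"
  have A [measurable]: "A \<in> sets P" unfolding A_def by measurable
  have "c * (ennreal \<kappa> * emeasure P A) \<le> ennreal 0"
  proof (rule LIMSEQ_le_const)
    have "v \<longlonglongrightarrow> u - 0"
      unfolding v_def by (intro tendsto_diff tendsto_const) real_asymp
    then have "(\<lambda>n. U (v n)) \<longlonglongrightarrow> U u" using isCont_tendsto_compose[OF U_continuous, of v u] by simp
    then have "(\<lambda>n. U u - U (v n)) \<longlonglongrightarrow> U u - U u" by (intro tendsto_diff tendsto_const)
    then show "(\<lambda>n. ennreal (U u - U (v n))) \<longlonglongrightarrow> ennreal 0" by (intro tendsto_ennrealI) simp
    have "c * (ennreal \<kappa> * emeasure P A) \<le> ennreal (U u - U (v n))" for n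
    proof -
      have "c * (ennreal \<kappa> * emeasure P A) \<le> c * (ennreal \<kappa> * emeasure P (B n))"
        by (intro mult_left_mono emeasure_mono B) (auto simp: A_def)
      then show ?thesis using bound[of n] by (rule order_trans)
    qed
    then show "\<exists>N. \<forall>n\<ge>N. c * (ennreal \<kappa> * emeasure P A) \<le> ennreal (U u - U (v n))" by blast
  qed
  then have "A \<in> null_sets P" using c(1) \<kappa> by (auto simp: null_sets_def)
  then show ?thesis
    by (rule AE_I') (auto simp: A_def B_def v_def)
qed

text \<open>If the last visit is at or after \<open>u\<close>, then it is after every \<open>v < u\<close>, so \<open>D v \<le> t\<close> for these
  \<open>v\<close>; by continuity of \<open>D\<close> at \<open>u\<close> this passes to \<open>D u \<le> t\<close>.\<close>
lemma prob_last_visit_ge: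
  assumes ut: "0 < u" "u < t"
  shows "prob {\<omega>\<in>Omega X. u \<le> last_visit L t \<omega>} = H u t"
proof -
  let ?A = "{\<omega>\<in>Omega X. u \<le> last_visit L t \<omega>}" and ?B = "{\<omega>\<in>Omega X. D u \<omega> \<le> ennreal t}"
  have m: "?B \<in> sets P" using assms by (intro D_event) simp
  have "AE \<omega> in P. \<forall>k. \<not> ((\<forall>n. D (u - u / real (n + 2)) \<omega> \<le> ennreal t) \<and> ennreal (t + 1 / real (Suc k)) \<le> D u \<omega>)"
    unfolding AE_all_countable using assms by (intro allI AE_no_jump_of_D) auto
  then have ae: "AE \<omega> in P. \<omega> \<in> ?A \<longleftrightarrow> \<omega> \<in> ?B"
    using AE_alive
  proof eventually_elim
    case (elim \<omega>)
    have \<omega>: "\<omega> \<in> Omega X" using elim alive_subset by auto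
    have "D u \<omega> \<le> ennreal t" if ge: "u \<le> last_visit L t \<omega>"
    proof -
      have "D (u - u / real (n + 2)) \<omega> \<le> ennreal t" for n
      proof -
        have v: "0 < u - u / real (n + 2)" "u - u / real (n + 2) < u"
          using ut by (auto simp: field_simps intro: add_pos_nonneg)
        have "\<not> last_visit L t \<omega> \<le> u - u / real (n + 2)" using ge v(2) by linarith
        then show ?thesis using last_visit_le_iff[OF elim(2) v(1) less_trans[OF v(2) ut(2)]] by blast
      qed
      then have "D u \<omega> \<le> ennreal (t + 1 / real (Suc k))" for k using elim(1) by (meson linear)
      moreover have "(\<lambda>k. ennreal (t + 1 / real (Suc k))) \<longlonglongrightarrow> ennreal (t + 0)"
        using LIMSEQ_inverse_real_of_nat by (intro tendsto_ennrealI tendsto_add tendsto_const) (simp add: inverse_eq_divide)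
      ultimately show ?thesis by (intro LIMSEQ_le_const) auto
    qed
    moreover have "u \<le> last_visit L t \<omega>" if "D u \<omega> \<le> ennreal t"
      using last_visit_le_iff[OF elim(2) ut] that by auto
    ultimately show ?case using \<omega> by auto
  qed
  have "?A \<in> sets P" using ae by (intro sets_P_AE[OF _ m]) auto
  then have "prob ?A = prob ?B" using ae m by (intro measure_eq_AE)
  then show ?thesis by (simp add: H_def)
qed

text \<open>The inverse local time at \<open>s\<close> is before \<open>t\<close> iff \<open>s\<close> is less than the local time at \<open>t\<close>.
  Integrating \<open>exp (- l * t)\<close> over the set of such \<open>(s, t)\<close> in both orders gives \<open>1 / \<Phi> l\<close> on one
  side and the resolvent density on the other.\<close>
lemma laplace_exponent_resolvent:
  assumes \<Phi>: "laplace_exponent P (inv_local_time L) \<Phi>" and l: "0 < l"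
  shows "r l a a = ennreal (1 / \<Phi> l)" "0 < \<Phi> l"
proof -
  let ?e = "\<lambda>s \<omega>. if inv_local_time L s \<omega> = \<infinity> then 0 else exp (- l * enn2real (inv_local_time L s \<omega>))"
  let ?g = "\<lambda>s \<omega> t. ennreal (l * exp (- l * t)) * (if 0 \<le> s \<and> s < K t \<omega> then 1 else 0)"
  have e_eq: "ennreal (?e s \<omega>) = (\<integral>\<^sup>+ t. ?g s \<omega> t \<partial>lborel)" if \<omega>: "\<omega> \<in> alive" and s: "0 \<le> s" for s \<omega>
  proof (cases "inv_local_time L s \<omega>")
    case (real d)
    have "(\<integral>\<^sup>+ t. ?g s \<omega> t \<partial>lborel) = (\<integral>\<^sup>+ t. ennreal (l * exp (- l * t)) * indicator {d..} t \<partial>lborel)"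
    proof (rule nn_integral_cong_AE)
      have "AE t in lborel. t \<noteq> d" by (rule AE_lborel_singleton)
      then show "AE t in lborel. ?g s \<omega> t = ennreal (l * exp (- l * t)) * indicator {d..} t"
      proof eventually_elim
        case (elim t)
        have "s < K t \<omega> \<longleftrightarrow> d < t"
          using inv_local_time_less_iff[OF \<omega> s, of t] real by (auto simp: ennreal_less_iff)
        then show ?case using elim s by (auto simp: indicator_def)
      qed
    qed
    then show ?thesis using real by (simp only: exp_tail[OF l]) simp
  next
    case top
    then have "\<not> s < K t \<omega>" for t using inv_local_time_less_iff[OF \<omega> s, of t] by simp
    then show ?thesis using top by simp
  qed
  have K_int: "(\<integral>\<^sup>+ s. (if 0 \<le> s \<and> s < K t \<omega> then 1 else 0) \<partial>lborel) = ennreal (K t \<omega>)" for t \<omega>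
  proof -
    have "(\<integral>\<^sup>+ s. (if 0 \<le> s \<and> s < K t \<omega> then 1 else 0) \<partial>lborel) = (\<integral>\<^sup>+ s. indicator {0..<K t \<omega>} s \<partial>lborel)"
      by (intro nn_integral_cong) (auto simp: indicator_def)
    then show ?thesis by (simp add: K_nonneg)
  qed
  have E: "(\<integral>\<^sup>+ \<omega>. ennreal (?e s \<omega>) \<partial>P) = ennreal (exp (- \<Phi> l * s))" if s: "0 \<le> s" for s
  proof -
    have eq: "(\<integral>\<omega>. ?e s \<omega> \<partial>P) = exp (- \<Phi> l * s)" using \<Phi> l s unfolding laplace_exponent_def by blast
    then have "integrable P (?e s)" using not_integrable_integral_eq[of P "?e s"] by fastforce
    then have "(\<integral>\<^sup>+ \<omega>. ennreal (?e s \<omega>) \<partial>P) = ennreal (\<integral>\<omega>. ?e s \<omega> \<partial>P)"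
      by (rule nn_integral_eq_integral) auto
    then show ?thesis unfolding eq .
  qed
  have "(\<integral>\<^sup>+ s. ennreal (exp (- \<Phi> l * s)) * indicator {0..} s \<partial>lborel) =
    (\<integral>\<^sup>+ s. (\<integral>\<^sup>+ \<omega>. (\<integral>\<^sup>+ t. ?g s \<omega> t \<partial>lborel) \<partial>P) \<partial>lborel)"
  proof (rule nn_integral_cong)
    fix s :: real
    show "ennreal (exp (- \<Phi> l * s)) * indicator {0..} s = (\<integral>\<^sup>+ \<omega>. (\<integral>\<^sup>+ t. ?g s \<omega> t \<partial>lborel) \<partial>P)"
    proof (cases "0 \<le> s")
      case True
      have "(\<integral>\<^sup>+ \<omega>. ennreal (?e s \<omega>) \<partial>P) = (\<integral>\<^sup>+ \<omega>. (\<integral>\<^sup>+ t. ?g s \<omega> t \<partial>lborel) \<partial>P)"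
        by (intro nn_integral_cong_AE, use AE_alive in eventually_elim) (rule e_eq[OF _ True])
      then show ?thesis using E[OF True] True by simp
    qed simp
  qed
  also have "\<dots> = (\<integral>\<^sup>+ \<omega>. (\<integral>\<^sup>+ s. (\<integral>\<^sup>+ t. ?g s \<omega> t \<partial>lborel) \<partial>lborel) \<partial>P)"
    by (rule Fubini') measurable
  also have "\<dots> = (\<integral>\<^sup>+ \<omega>. (\<integral>\<^sup>+ t. (\<integral>\<^sup>+ s. ?g s \<omega> t \<partial>lborel) \<partial>lborel) \<partial>P)"
  proof (rule nn_integral_cong)
    fix \<omega>
    have [measurable]: "(\<lambda>s. K s \<omega>) \<in> borel_measurable borel"
      using K_continuous by (rule borel_measurable_continuous_onI)
    show "(\<integral>\<^sup>+ s. (\<integral>\<^sup>+ t. ?g s \<omega> t \<partial>lborel) \<partial>lborel) = (\<integral>\<^sup>+ t. (\<integral>\<^sup>+ s. ?g s \<omega> t \<partial>lborel) \<partial>lborel)"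
      by (rule lborel_pair.Fubini') measurable
  qed
  also have "\<dots> = (\<integral>\<^sup>+ \<omega>. ennreal l * V l \<omega> \<partial>P)"
  proof (rule nn_integral_cong)
    fix \<omega>
    have [measurable]: "(\<lambda>s. K s \<omega>) \<in> borel_measurable borel"
      using K_continuous by (rule borel_measurable_continuous_onI)
    have "(\<integral>\<^sup>+ s. ?g s \<omega> t \<partial>lborel) = ennreal l * ennreal (exp (- l * t) * K t \<omega>)" for t
      using l by (subst nn_integral_cmult, measurable, subst K_int)
        (simp add: ennreal_mult'[symmetric] K_nonneg mult.assoc)
    then show "(\<integral>\<^sup>+ t. (\<integral>\<^sup>+ s. ?g s \<omega> t \<partial>lborel) \<partial>lborel) = ennreal l * V l \<omega>"
      unfolding V_def by (simp only:) (rule nn_integral_cmult, measurable)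
  qed
  also have "\<dots> = r l a a"
    using V_expectation[OF l] by (simp add: nn_integral_cmult)
  finally have R: "(\<integral>\<^sup>+ s. ennreal (exp (- \<Phi> l * s)) * indicator {0..} s \<partial>lborel) = r l a a" .
  show pos: "0 < \<Phi> l"
  proof (rule ccontr)
    assume "\<not> 0 < \<Phi> l"
    have "(\<integral>\<^sup>+ s. indicator {0::real..} s \<partial>lborel) \<le> (\<integral>\<^sup>+ s. ennreal (exp (- \<Phi> l * s)) * indicator {0..} s \<partial>lborel)"
    proof (rule nn_integral_mono)
      fix s :: real
      have "1 \<le> exp (- \<Phi> l * s)" if "0 \<le> s"
        using \<open>\<not> 0 < \<Phi> l\<close> that by (simp add: mult_nonpos_nonneg)
      then show "indicator {0..} s \<le> ennreal (exp (- \<Phi> l * s)) * indicator {0..} s"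
        by (auto simp: indicator_def simp del: one_le_exp_iff)
    qed
    then have "emeasure lborel {0::real..} \<le> r l a a" unfolding R by simp
    also have "r l a a < top" using resolvent_finite[OF l] by simp
    finally obtain n where "emeasure lborel {0::real..} < of_nat n" using ennreal_Ex_less_of_nat by blast
    moreover have "of_nat n = emeasure lborel {0..real n}" by (simp add: ennreal_of_nat_eq_real_of_nat)
    moreover have "emeasure lborel {0..real n} \<le> emeasure lborel {0::real..}" by (intro emeasure_mono) auto
    ultimately show False by simp
  qed
  have "ennreal (\<Phi> l) * r l a a = (\<integral>\<^sup>+ s. ennreal (\<Phi> l * exp (- \<Phi> l * s)) * indicator {0..} s \<partial>lborel)"
    unfolding R[symmetric] using pos
    by (subst nn_integral_cmult[symmetric]) (auto simp: ennreal_mult' mult.assoc intro!: nn_integral_cong)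
  also have "\<dots> = 1" by (subst exp_tail[OF pos]) simp
  finally have *: "ennreal (\<Phi> l) * r l a a = 1" .
  obtain x where x: "r l a a = ennreal x" "0 \<le> x" using resolvent_finite[OF l] by (cases "r l a a") auto
  have "\<Phi> l * x = 1" using * x pos by (simp add: ennreal_mult'[symmetric])
  then have "x = 1 / \<Phi> l" using pos by (simp add: field_simps)
  then show "r l a a = ennreal (1 / \<Phi> l)" using x by simp
qed

end

section \<open>Probabilities of the last visit\<close>

lemma laplace_to_nn:
  assumes "laplace_integrable f c" "\<And>x. 0 \<le> x \<Longrightarrow> 0 \<le> f x"
  shows "(\<integral>\<^sup>+ x. ennreal (exp (- c * x) * f x) * indicator {0..} x \<partial>lborel) = ennreal (laplace f c)"
proof -
  have "(\<integral>\<^sup>+ x. ennreal (exp (- c * x) * f x) * indicator {0..} x \<partial>lborel) =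
    (\<integral>\<^sup>+ x. ennreal (indicat_real {0..} x *\<^sub>R (exp (- c * x) * f x)) \<partial>lborel)"
    by (intro nn_integral_cong) (auto simp: indicator_def)
  also have "\<dots> = ennreal (laplace f c)"
    unfolding set_lebesgue_integral_def using assms(1)
    by (intro nn_integral_eq_integral AE_I2) (auto simp: set_integrable_def indicator_def assms(2))
  finally show ?thesis .
qed

context local_time_at
begin

lemma V_antimono: "l \<le> l' \<Longrightarrow> V l' \<omega> \<le> V l \<omega>"
  unfolding V_def
proof (rule nn_integral_mono)
  fix s assume l: "l \<le> l'"
  show "ennreal (exp (- l' * s) * K s \<omega>) \<le> ennreal (exp (- l * s) * K s \<omega>)"
  proof (cases "0 \<le> s")
    case True
    then show ?thesis using l by (intro ennreal_leI mult_right_mono K_nonneg) (auto intro: mult_right_mono)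
  qed simp
qed

text \<open>Finiteness passes to larger \<open>l\<close> because the integrand decreases in \<open>l\<close>. The resolvent
  density vanishes only if the local time vanishes almost surely, which does not depend on \<open>l\<close>.\<close>
lemma resolvent_positive_finite:
  assumes l: "0 < l'" "l' \<le> l" and r: "0 < r l' a a" "r l' a a < \<infinity>"
  shows "0 < r l a a" "r l a a < \<infinity>"
proof -
  have "0 < l" using l by simp
  have "(\<integral>\<^sup>+ \<omega>. V l \<omega> \<partial>P) \<le> (\<integral>\<^sup>+ \<omega>. V l' \<omega> \<partial>P)" by (intro nn_integral_mono V_antimono l)
  also have "\<dots> < \<infinity>" using V_expectation[OF l(1)] r(2) l(1) by (auto simp: less_top[symmetric] ennreal_mult_top)
  finally show "r l a a < \<infinity>" unfolding V_expectation[OF \<open>0 < l\<close>, symmetric] by (simp add: ennreal_mult_less_top)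
  show "0 < r l a a"
  proof (rule ccontr)
    assume "\<not> 0 < r l a a"
    then have "(\<integral>\<^sup>+ \<omega>. V l \<omega> \<partial>P) = 0" using V_expectation[OF \<open>0 < l\<close>] \<open>0 < l\<close> by simp
    then have "AE \<omega> in P. V l \<omega> = 0" by (subst (asm) nn_integral_0_iff_AE) auto
    then have "AE \<omega> in P. V l' \<omega> = 0"
    proof eventually_elim
      case (elim \<omega>)
      have [measurable]: "(\<lambda>s. K s \<omega>) \<in> borel_measurable borel"
        using K_continuous by (rule borel_measurable_continuous_onI)
      have "AE s in lborel. ennreal (exp (- l * s) * K s \<omega>) = 0"
        using elim unfolding V_def by (subst (asm) nn_integral_0_iff_AE) auto
      then have "AE s in lborel. ennreal (exp (- l' * s) * K s \<omega>) = 0"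
        by eventually_elim (auto simp: ennreal_eq_0_iff mult_le_0_iff)
      then show ?case unfolding V_def by (subst nn_integral_0_iff_AE) auto
    qed
    then have "(\<integral>\<^sup>+ \<omega>. V l' \<omega> \<partial>P) = 0" by (subst nn_integral_0_iff_AE) auto
    then show False using V_expectation[OF l(1)] r(1) by simp
  qed
qed

lemma resolvent_eventually:
  assumes "\<forall>\<^sub>F l in at_right 0. enn2real (r l a a) \<noteq> 0" and l: "0 < l"
  shows "0 < r l a a" "r l a a < \<infinity>"
proof -
  have "\<forall>\<^sub>F l' in at_right (0::real). 0 < l' \<and> l' \<le> l"
    using l by (auto simp: eventually_at_right_field intro!: exI[of _ l])
  with assms(1) have "\<forall>\<^sub>F l' in at_right 0. enn2real (r l' a a) \<noteq> 0 \<and> 0 < l' \<and> l' \<le> l"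
    by eventually_elim simp
  then obtain l' where l': "enn2real (r l' a a) \<noteq> 0" "0 < l'" "l' \<le> l"
    using eventually_happens'[OF trivial_limit_at_right_real] by blast
  have "0 < r l' a a" "r l' a a < \<infinity>"
    using l'(1) by (auto simp: zero_less_iff_neq_zero less_top[symmetric])
  then show "0 < r l a a" "r l a a < \<infinity>" using resolvent_positive_finite l' by blast+
qed

end

context finite_local_time
begin

lemma laplace_U:
  assumes l: "0 < l"
  shows "laplace_integrable U l" "l * laplace U l = enn2real (r l a a)"
proof -
  obtain x where x: "r l a a = ennreal x" "0 \<le> x" using resolvent_finite[OF l] by (cases "r l a a") auto
  have "(\<integral>\<^sup>+ s. ennreal (exp (- l * s) * U s) * indicator {0..} s \<partial>lborel) = (\<integral>\<^sup>+ s. ennreal (exp (- l * s) * U s) \<partial>lborel)"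
    by (intro nn_integral_cong) (auto simp: indicator_def)
  also have "\<dots> = ennreal (1 / l) * (ennreal l * (\<integral>\<^sup>+ s. ennreal (exp (- l * s) * U s) \<partial>lborel))"
    using l by (simp add: mult.assoc[symmetric] ennreal_mult'[symmetric])
  also have "\<dots> = ennreal (x / l)" unfolding U_laplace[OF l] x using l by (simp add: ennreal_mult'[symmetric])
  finally have *: "(\<integral>\<^sup>+ s. ennreal (exp (- l * s) * U s) * indicator {0..} s \<partial>lborel) = ennreal (x / l)" .
  have xl: "0 \<le> x / l" using x l by simp
  show "laplace_integrable U l" by (rule laplace_nn(1)[OF U_measurable U_nonneg * xl])
  have "laplace U l = x / l" by (rule laplace_nn(2)[OF U_measurable U_nonneg * xl])
  then show "l * laplace U l = enn2real (r l a a)" using l x by (simp only: enn2real_ennreal) simp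
qed

sublocale passage_problem U H
proof
  show "s \<le> t \<Longrightarrow> U s \<le> U t" for s t by (rule U_mono)
  show "t \<le> 0 \<Longrightarrow> U t = 0" for t by (rule U_nonpos)
  show U: "laplace_integrable U l" if "0 < l" for l by (rule laplace_U(1)[OF that])
  show "0 < laplace U l" if l: "0 < l" for l
  proof -
    have "0 < enn2real (r l a a)" using resolvent_pos[OF l] resolvent_finite[OF l] by (simp add: enn2real_positive_iff)
    then have "0 < l * laplace U l" by (simp only: laplace_U(2)[OF l])
    then show ?thesis using l by (simp only: zero_less_mult_pos)
  qed
  show "0 \<le> H u t" "H u t \<le> 1" for u t by (rule H_bounds)+
  show "H u s \<le> H u t" if "0 \<le> u" "s \<le> t" for u s t by (rule H_mono[OF that])
  show "H u t = 0" if "0 \<le> t" "t < u" for u t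
  proof -
    have "\<not> D u \<omega> \<le> ennreal t" for \<omega>
      using that D_ge[of u \<omega>] order_less_le_trans[of "ennreal t" "ennreal u" "D u \<omega>"]
      by (auto simp: ennreal_less_iff not_le)
    then show ?thesis unfolding H_def by simp
  qed
  show "laplace (\<lambda>s. U s - U (min s u)) l = l * laplace (H u) l * laplace U l" if u: "0 \<le> u" and l: "0 < l" for u l
  proof -
    have Hi: "laplace_integrable (H u) l"
    proof (rule laplace_integrable_bound[OF laplace_one(1)[OF l]])
      show "H u \<in> borel_measurable borel" using u by (intro borel_measurable_mono) (simp add: mono_def H_mono)
    qed (auto simp: H_bounds)
    have H0: "0 \<le> laplace (H u) l" by (rule laplace_nonneg) (rule H_bounds)
    have "(\<integral>\<^sup>+ \<omega>. discount l u \<omega> \<partial>P) = (\<integral>\<^sup>+ t. ennreal l * (ennreal (exp (- l * t) * H u t) * indicator {0..} t) \<partial>lborel)"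
      unfolding discount_laplace[OF u l] using l
      by (intro nn_integral_cong) (simp add: mult.assoc ennreal_mult' H_bounds)
    also have "\<dots> = ennreal l * (\<integral>\<^sup>+ t. ennreal (exp (- l * t) * H u t) * indicator {0..} t \<partial>lborel)"
    proof (rule nn_integral_cmult)
      have [measurable]: "H u \<in> borel_measurable borel" using u by (intro borel_measurable_mono) (simp add: mono_def H_mono)
      show "(\<lambda>t. ennreal (exp (- l * t) * H u t) * indicator {0..} t) \<in> borel_measurable lborel" by measurable
    qed
    also have "\<dots> = ennreal (l * laplace (H u) l)"
      unfolding laplace_to_nn[OF Hi H_bounds(1)] using l by (simp only: ennreal_mult'[OF less_imp_le])
    finally have 1: "(\<integral>\<^sup>+ \<omega>. discount l u \<omega> \<partial>P) = ennreal (l * laplace (H u) l)" .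
    have 2: "(\<integral>\<^sup>+ s. ennreal (exp (- l * s) * U s) \<partial>lborel) = ennreal (laplace U l)"
      unfolding laplace_to_nn[OF laplace_U(1)[OF l] U_nonneg, symmetric]
      by (intro nn_integral_cong) (auto simp: indicator_def)
    have U0: "0 \<le> laplace U l" by (rule laplace_nonneg) (rule U_nonneg)
    have lH: "0 \<le> l * laplace (H u) l" using l H0 by (intro mult_nonneg_nonneg) auto
    have "(\<integral>\<^sup>+ s. ennreal (exp (- l * s) * (U s - U (min s u))) * indicator {0..} s \<partial>lborel) =
      (\<integral>\<^sup>+ s. ennreal (exp (- l * s) * (U s - U (min s u))) \<partial>lborel)"
      by (intro nn_integral_cong) (auto simp: indicator_def min_def)
    also have "\<dots> = ennreal (l * laplace (H u) l * laplace U l)"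
      unfolding first_passage_laplace[OF u l] 1 2 by (rule ennreal_mult[OF lH U0, symmetric])
    finally have 3: "(\<integral>\<^sup>+ s. ennreal (exp (- l * s) * (U s - U (min s u))) * indicator {0..} s \<partial>lborel) =
      ennreal (l * laplace (H u) l * laplace U l)" .
    have [measurable]: "U \<in> borel_measurable borel" by (intro borel_measurable_mono) (simp add: mono_def U_mono)
    have m: "(\<lambda>s. U s - U (min s u)) \<in> borel_measurable borel" by measurable
    have "0 \<le> U s - U (min s u)" for s by (simp add: U_mono)
    then show ?thesis by (rule laplace_nn(2)[OF m _ 3 mult_nonneg_nonneg[OF lH U0]])
  qed
qed

end

context regular_passage
begin

lemma A_ratio:
  assumes c: "0 < c" and T: "0 < T"
  shows "A c T = R (c / T) / ((c / T) powr (- \<alpha>) / ell (1 / (c / T))) * (c powr (- \<alpha>) * (ell T / ell (1 / c * T)))"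
proof -
  have e: "1 / (c / T) = 1 / c * T" by simp
  have p: "(c / T) powr (- \<alpha>) = c powr (- \<alpha>) / T powr (- \<alpha>)" using c T by (simp add: powr_divide)
  have "0 < ell (1 / c * T)" "0 < ell T" using c T by (auto intro!: ell_pos)
  then show ?thesis unfolding A_def e p using c T by (simp add: field_simps)
qed

lemma filterlim_small:
  assumes "0 < c"
  shows "filterlim (\<lambda>T. c / T) (at_right (0::real)) at_top"
  using assms by real_asymp

lemma A_limit:
  assumes lim: "((\<lambda>l. R l / (l powr (- \<alpha>) / ell (1 / l))) \<longlongrightarrow> 1) (at_right 0)" and c: "0 < c"
  shows "(A c \<longlongrightarrow> c powr (- \<alpha>)) at_top"
proof -
  have "((\<lambda>T. R (c / T) / ((c / T) powr (- \<alpha>) / ell (1 / (c / T))) * (c powr (- \<alpha>) * (ell T / ell (1 / c * T))))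
    \<longlongrightarrow> 1 * (c powr (- \<alpha>) * 1)) at_top"
    using c by (intro tendsto_mult tendsto_const ell_ratio filterlim_compose[OF lim filterlim_small]) auto
  then have "((\<lambda>T. R (c / T) / ((c / T) powr (- \<alpha>) / ell (1 / (c / T))) * (c powr (- \<alpha>) * (ell T / ell (1 / c * T))))
    \<longlongrightarrow> c powr (- \<alpha>)) at_top" by simp
  then show ?thesis
    by (rule Lim_transform_eventually) (rule eventually_mono[OF eventually_gt_at_top[of 0]], simp only: A_ratio[OF c])
qed

lemma A_bounds:
  assumes bnd: "\<forall>\<^sub>F l in at_right 0. k \<le> R l / (l powr (- \<alpha>) / ell (1 / l)) \<and> R l / (l powr (- \<alpha>) / ell (1 / l)) \<le> K"
    and k: "0 < k" "0 < K" and c: "0 < c"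
  shows "\<forall>\<^sub>F T in at_top. k / 2 * c powr (- \<alpha>) \<le> A c T \<and> A c T \<le> 2 * K * c powr (- \<alpha>)"
proof -
  have ic: "0 < 1 / c" using c by simp
  \<comment> \<open>The factors \<open>1 / 2\<close> and \<open>2\<close> absorb the quotient of slowly varying functions, which tends to
    1.\<close>
  have 1: "\<forall>\<^sub>F T in at_top. 1 / 2 < ell T / ell (1 / c * T)" "\<forall>\<^sub>F T in at_top. ell T / ell (1 / c * T) < 2"
    by (intro order_tendstoD[OF ell_ratio[OF ic]]; simp)+
  show ?thesis
    using eventually_compose_filterlim[OF bnd filterlim_small[OF c]] 1 eventually_gt_at_top[of 0]
  proof eventually_elim
    case (elim T)
    let ?q = "R (c / T) / ((c / T) powr (- \<alpha>) / ell (1 / (c / T)))" and ?e = "ell T / ell (1 / c * T)"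
    have e0: "0 \<le> ?e" using elim by linarith
    have q0: "0 \<le> ?q" using elim k by linarith
    have "k * (c powr (- \<alpha>) * (1 / 2)) \<le> ?q * (c powr (- \<alpha>) * ?e)"
      by (intro mult_mono mult_left_mono mult_nonneg_nonneg powr_ge_zero q0) (use elim in \<open>linarith\<close>)+
    moreover have "?q * (c powr (- \<alpha>) * ?e) \<le> K * (c powr (- \<alpha>) * 2)"
      by (intro mult_mono mult_left_mono mult_nonneg_nonneg powr_ge_zero e0) (use elim k in \<open>linarith\<close>)+
    moreover have "k / 2 * c powr (- \<alpha>) = k * (c powr (- \<alpha>) * (1 / 2))" "2 * K * c powr (- \<alpha>) = K * (c powr (- \<alpha>) * 2)"
      by simp_all
    ultimately show ?case by (simp only: A_ratio[OF c elim(4)])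
  qed
qed

end

lemma eventually_quotient_bounds:
  fixes f g :: "real \<Rightarrow> real"
  assumes fg: "f \<in> \<Theta>[F](g)" and f: "\<forall>\<^sub>F x in F. 0 \<le> f x" and g: "\<forall>\<^sub>F x in F. 0 < g x"
  obtains k K where "0 < k" "0 < K" "\<forall>\<^sub>F x in F. k \<le> f x / g x \<and> f x / g x \<le> K"
proof -
  have "f \<in> O[F](g)" "g \<in> O[F](f)" using fg by (auto simp: bigtheta_def bigomega_iff_bigo)
  then obtain K k where K: "0 < K" "\<forall>\<^sub>F x in F. norm (f x) \<le> K * norm (g x)"
    and k: "0 < k" "\<forall>\<^sub>F x in F. norm (g x) \<le> k * norm (f x)" by (elim landau_o.bigE) blast
  have "\<forall>\<^sub>F x in F. 1 / k \<le> f x / g x \<and> f x / g x \<le> K"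
    using K(2) k(2) f g by eventually_elim (use k(1) in \<open>auto simp: field_simps\<close>)
  then show ?thesis using K k that[of "1 / k" K] by simp
qed

lemma asymp_equiv_of_quotient:
  fixes f g h :: "real \<Rightarrow> real"
  assumes "((\<lambda>x. f x / g x) \<longlongrightarrow> 1) at_top" "\<forall>\<^sub>F x in at_top. f x = h x"
  shows "h \<sim>[at_top] g"
  by (rule asymp_equivI', rule Lim_transform_eventually[OF assms(1)]) (use assms(2) in eventually_elim, simp)

lemma bigtheta_of_bounds:
  fixes f g h :: "real \<Rightarrow> real"
  assumes "\<exists>k>0. \<exists>K>0. \<forall>\<^sub>F T in at_top. k * g T \<le> f T \<and> f T \<le> K * g T"
    "\<forall>\<^sub>F T in at_top. f T = h T" "\<forall>\<^sub>F T in at_top. 0 \<le> g T" "\<forall>\<^sub>F T in at_top. 0 \<le> f T"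
  shows "h \<in> \<Theta>[at_top](g)"
proof -
  obtain k K where k: "0 < k" "0 < K" "\<forall>\<^sub>F T in at_top. k * g T \<le> f T \<and> f T \<le> K * g T" using assms(1) by blast
  show ?thesis
  proof (rule bigthetaI'[OF k(1,2)])
    show "\<forall>\<^sub>F x in at_top. k * norm (g x) \<le> norm (h x) \<and> norm (h x) \<le> K * norm (g x)"
      using k(3) assms(2-4) by eventually_elim simp
  qed
qed

locale regular_local_time = finite_local_time X r a L
  for X :: "('w, 's::{metric_space, second_countable_topology}) process" and r a L +
  fixes \<alpha> :: real and ell \<epsilon> :: "real \<Rightarrow> real"
  assumes \<alpha>: "0 < \<alpha>" "\<alpha> < 1"
    and ell_slow: "slowly_varying ell"
    and \<epsilon>: "0 < t \<Longrightarrow> 0 < \<epsilon> t \<and> \<epsilon> t < 1" and \<epsilon>0: "(\<epsilon> \<longlongrightarrow> 0) at_top"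
    and \<epsilon>_inf: "filterlim (\<lambda>t. \<epsilon> t * t) at_top at_top"

sublocale regular_local_time \<subseteq> regular_passage U H \<alpha> ell \<epsilon>
  by unfold_locales (use \<alpha> ell_slow \<epsilon> \<epsilon>0 \<epsilon>_inf in \<open>auto simp: slowly_varying_def\<close>)

context regular_local_time
begin

lemma R_eq: "0 < l \<Longrightarrow> R l = enn2real (r l a a)"
  unfolding R_def by (rule laplace_U(2))

lemma prob_early:
  "\<forall>\<^sub>F t in at_top. 1 - H (\<epsilon> t * t) t = prob {\<omega> \<in> Omega X. last_visit L t \<omega> / t \<le> \<epsilon> t}"
  using eventually_gt_at_top[of 0]
proof eventually_elim
  case (elim t)
  have "{\<omega> \<in> Omega X. last_visit L t \<omega> / t \<le> \<epsilon> t} = {\<omega> \<in> Omega X. last_visit L t \<omega> \<le> \<epsilon> t * t}"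
    using elim by (simp add: pos_divide_le_eq)
  moreover have "0 < \<epsilon> t * t" "\<epsilon> t * t < t" using \<epsilon>[OF elim] elim by auto
  ultimately show ?case using prob_last_visit_le by simp
qed

lemma prob_late:
  "\<forall>\<^sub>F t in at_top. H ((1 - \<epsilon> t) * t) t = prob {\<omega> \<in> Omega X. last_visit L t \<omega> / t \<ge> 1 - \<epsilon> t}"
  using eventually_gt_at_top[of 0]
proof eventually_elim
  case (elim t)
  have "{\<omega> \<in> Omega X. last_visit L t \<omega> / t \<ge> 1 - \<epsilon> t} = {\<omega> \<in> Omega X. (1 - \<epsilon> t) * t \<le> last_visit L t \<omega>}"
    using elim by (simp add: pos_le_divide_eq)
  moreover have "0 < (1 - \<epsilon> t) * t" "(1 - \<epsilon> t) * t < t" using \<epsilon>[OF elim] elim by auto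
  ultimately show ?case using prob_last_visit_ge by simp
qed

text \<open>The conjugate function \<open>l / \<Phi> l\<close> is the \<open>\<Psi>\<close> of \<open>special_potential\<close>, since \<open>1 / \<Phi> l\<close> is the
  resolvent density.\<close>
lemma special_concave_passage:
  assumes "special_subordinator P (inv_local_time L)"
  shows "concave_passage U H \<alpha> ell \<epsilon>"
proof -
  obtain \<Phi> where \<Phi>: "laplace_exponent P (inv_local_time L) \<Phi>" "special_bernstein \<Phi>"
    using assms by (auto simp: special_subordinator_def)
  interpret special_potential U "\<lambda>l. l / \<Phi> l"
  proof
    show "s \<le> t \<Longrightarrow> U s \<le> U t" for s t by (rule U_mono)
    show "t \<le> 0 \<Longrightarrow> U t = 0" for t by (rule U_nonpos)
    show "isCont U t" for t by (rule U_continuous)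
    show "laplace_integrable U l" if "0 < l" for l by (rule laplace_U(1)[OF that])
    show "l / \<Phi> l = l\<^sup>2 * laplace U l" if l: "0 < l" for l
    proof -
      have "l * laplace U l = 1 / \<Phi> l"
        using laplace_U(2)[OF l] laplace_exponent_resolvent[OF \<Phi>(1) l] by simp
      then have "l * (l * laplace U l) = l * (1 / \<Phi> l)" by (simp only:)
      then show ?thesis by (simp only: power2_eq_square mult.assoc) simp
    qed
    show "(- 1) ^ n * (deriv ^^ n) (\<lambda>l. l / \<Phi> l) l \<le> 0" if "1 \<le> n" "0 < l" for n l
      using \<Phi>(2) that unfolding special_bernstein_def bernstein_def by blast
  qed
  show ?thesis by unfold_locales (rule U_slopes)
qed

end

theorem theorem6p4:
  fixes X :: "('w, 's::{metric_space, second_countable_topology}) process"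
    and Xh :: "('v, 's) process"
    and m :: "'s measure"
    and r :: "real \<Rightarrow> 's \<Rightarrow> 's \<Rightarrow> ennreal"
    and a :: 's
    and L :: "real \<Rightarrow> 'w \<Rightarrow> real"
    and \<alpha> \<alpha>h :: real
    and ell \<epsilon> :: "real \<Rightarrow> real"
  assumes "locally_compact_space (euclidean :: 's topology)"
    and "hunt_process X" and "hunt_process Xh"
    and "radon_measure m" and "dual_processes X Xh m"
    and "\<And>l. l > 0 \<Longrightarrow> resolvent_density X Xh m l (r l)"
    and "r 1 a a < \<infinity>" and "isCont (\<lambda>x. r 1 x a) a"
    and "local_time X r a L"
    and "0 < \<alpha>" and "\<alpha> < 1" and "\<alpha>h = 1 - \<alpha>"
    and "slowly_varying ell"
    and "\<And>t. t > 0 \<Longrightarrow> 0 < \<epsilon> t \<and> \<epsilon> t < 1"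
    and "(\<epsilon> \<longlongrightarrow> 0) at_top" and "filterlim (\<lambda>t. \<epsilon> t * t) at_top at_top"
  shows "((\<lambda>l. enn2real (r l a a)) \<sim>[at_right 0] (\<lambda>l. l powr (- \<alpha>) / ell (1 / l)) \<longrightarrow>
      ((\<lambda>t. measure (pt_law X a) {\<omega> \<in> Omega X. last_visit L t \<omega> / t \<le> \<epsilon> t}) \<sim>[at_top]
         (\<lambda>t. sin (pi * \<alpha>) / (pi * \<alpha>) * (ell t / ell (\<epsilon> t * t)) * \<epsilon> t powr \<alpha>)) \<and>
      (special_subordinator (pt_law X a) (inv_local_time L) \<longrightarrow>
       (\<lambda>t. measure (pt_law X a) {\<omega> \<in> Omega X. last_visit L t \<omega> / t \<ge> 1 - \<epsilon> t}) \<sim>[at_top]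
         (\<lambda>t. sin (pi * \<alpha>h) / (pi * \<alpha>h) * (ell (\<epsilon> t * t) / ell t) * \<epsilon> t powr \<alpha>h))) \<and>
     ((\<lambda>l. enn2real (r l a a)) \<in> \<Theta>[at_right 0](\<lambda>l. l powr (- \<alpha>) / ell (1 / l)) \<longrightarrow>
      ((\<lambda>t. measure (pt_law X a) {\<omega> \<in> Omega X. last_visit L t \<omega> / t \<le> \<epsilon> t})
         \<in> \<Theta>[at_top](\<lambda>t. (ell t / ell (\<epsilon> t * t)) * \<epsilon> t powr \<alpha>)) \<and>
      (special_subordinator (pt_law X a) (inv_local_time L) \<longrightarrow>
       (\<lambda>t. measure (pt_law X a) {\<omega> \<in> Omega X. last_visit L t \<omega> / t \<ge> 1 - \<epsilon> t})
         \<in> \<Theta>[at_top](\<lambda>t. (ell (\<epsilon> t * t) / ell t) * \<epsilon> t powr \<alpha>h)))"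
proof -
  interpret local_time_at X r a L
    by unfold_locales (use assms in auto)
  let ?g = "\<lambda>l. l powr (- \<alpha>) / ell (1 / l)" and ?r = "\<lambda>l. enn2real (r l a a)"
  have ell: "0 < ell x" if "0 < x" for x using assms(13) that by (simp add: slowly_varying_def)
  have small: "\<forall>\<^sub>F l in at_right 0. (0::real) < l" by (rule eventually_at_right_less)
  have g: "\<forall>\<^sub>F l in at_right 0. 0 < ?g l"
    using small by eventually_elim (simp add: ell)
  have large: "\<forall>\<^sub>F t in at_top. (0::real) < t" by (rule eventually_gt_at_top)
  \<comment> \<open>\<open>enn2real\<close> maps infinity to 0, so this condition excludes both extreme values of the
    resolvent density.\<close>
  have regular: "regular_local_time X r a L \<alpha> ell \<epsilon>" if "\<forall>\<^sub>F l in at_right 0. ?r l \<noteq> 0"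
    by unfold_locales (use resolvent_eventually[OF that] assms in auto)
  have ratio_pos: "\<forall>\<^sub>F t in at_top. 0 \<le> ell t / ell (\<epsilon> t * t) * \<epsilon> t powr \<alpha>"
    "\<forall>\<^sub>F t in at_top. 0 \<le> ell (\<epsilon> t * t) / ell t * \<epsilon> t powr \<alpha>h"
    using large by (eventually_elim, use assms(14) ell in \<open>simp add: less_imp_le\<close>)+
  show ?thesis
  proof (rule conjI; rule impI)
    assume h: "?r \<sim>[at_right 0] ?g"
    have q: "((\<lambda>l. ?r l / ?g l) \<longlongrightarrow> 1) (at_right 0)"
      by (rule asymp_equivD_strong[OF h]) (rule eventually_mono[OF g], rule disjI2, rule less_imp_neq[symmetric])
    have "\<forall>\<^sub>F l in at_right 0. 0 < ?r l / ?g l" by (rule order_tendstoD(1)[OF q]) simp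
    then have "\<forall>\<^sub>F l in at_right 0. ?r l \<noteq> 0" by eventually_elim auto
    then interpret regular_local_time X r a L \<alpha> ell \<epsilon> by (rule regular)
    have "((\<lambda>l. R l / ?g l) \<longlongrightarrow> 1) (at_right 0)"
      by (rule Lim_transform_eventually[OF q]) (use small in \<open>eventually_elim, simp add: R_eq\<close>)
    note A_lim = A_limit[OF this]
    have "(\<lambda>t. prob {\<omega> \<in> Omega X. last_visit L t \<omega> / t \<ge> 1 - \<epsilon> t}) \<sim>[at_top]
         (\<lambda>t. sin (pi * \<alpha>h) / (pi * \<alpha>h) * (ell (\<epsilon> t * t) / ell t) * \<epsilon> t powr \<alpha>h)"
      if "special_subordinator P (inv_local_time L)"
    proof -
      interpret concave_passage U H \<alpha> ell \<epsilon> by (rule special_concave_passage[OF that])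
      show ?thesis unfolding assms(12) by (rule asymp_equiv_of_quotient[OF late_limit[OF A_lim] prob_late])
    qed
    then show "((\<lambda>t. prob {\<omega> \<in> Omega X. last_visit L t \<omega> / t \<le> \<epsilon> t}) \<sim>[at_top]
         (\<lambda>t. sin (pi * \<alpha>) / (pi * \<alpha>) * (ell t / ell (\<epsilon> t * t)) * \<epsilon> t powr \<alpha>)) \<and>
      (special_subordinator P (inv_local_time L) \<longrightarrow>
       (\<lambda>t. prob {\<omega> \<in> Omega X. last_visit L t \<omega> / t \<ge> 1 - \<epsilon> t}) \<sim>[at_top]
         (\<lambda>t. sin (pi * \<alpha>h) / (pi * \<alpha>h) * (ell (\<epsilon> t * t) / ell t) * \<epsilon> t powr \<alpha>h))"
      using asymp_equiv_of_quotient[OF early_limit[OF A_lim] prob_early] by blast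
  next
    assume h: "?r \<in> \<Theta>[at_right 0](?g)"
    obtain k K where k: "0 < k" "0 < K" and q: "\<forall>\<^sub>F l in at_right 0. k \<le> ?r l / ?g l \<and> ?r l / ?g l \<le> K"
      by (rule eventually_quotient_bounds[OF h _ g]) auto
    have "\<forall>\<^sub>F l in at_right 0. ?r l \<noteq> 0" using q by eventually_elim (use k(1) in auto)
    then interpret regular_local_time X r a L \<alpha> ell \<epsilon> by (rule regular)
    have "\<forall>\<^sub>F l in at_right 0. k \<le> R l / ?g l \<and> R l / ?g l \<le> K"
      using q small by eventually_elim (simp add: R_eq)
    note A_bnd = A_bounds[OF this k]
    have k2: "0 < k / 2" "0 < 2 * K" using k by simp_all
    have "(\<lambda>t. prob {\<omega> \<in> Omega X. last_visit L t \<omega> / t \<ge> 1 - \<epsilon> t})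
         \<in> \<Theta>[at_top](\<lambda>t. (ell (\<epsilon> t * t) / ell t) * \<epsilon> t powr \<alpha>h)"
      if "special_subordinator P (inv_local_time L)"
    proof -
      interpret concave_passage U H \<alpha> ell \<epsilon> by (rule special_concave_passage[OF that])
      show ?thesis using ratio_pos(2) unfolding assms(12)
        by (intro bigtheta_of_bounds[OF late_bounds[OF k2 A_bnd] prob_late]) (auto simp: H_bounds)
    qed
    moreover have "(\<lambda>t. prob {\<omega> \<in> Omega X. last_visit L t \<omega> / t \<le> \<epsilon> t})
         \<in> \<Theta>[at_top](\<lambda>t. (ell t / ell (\<epsilon> t * t)) * \<epsilon> t powr \<alpha>)"
      using ratio_pos(1)
      by (intro bigtheta_of_bounds[OF early_bounds[OF k2 A_bnd] prob_early]) (auto simp: H_bounds)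
    ultimately show "((\<lambda>t. prob {\<omega> \<in> Omega X. last_visit L t \<omega> / t \<le> \<epsilon> t})
         \<in> \<Theta>[at_top](\<lambda>t. (ell t / ell (\<epsilon> t * t)) * \<epsilon> t powr \<alpha>)) \<and>
      (special_subordinator P (inv_local_time L) \<longrightarrow>
       (\<lambda>t. prob {\<omega> \<in> Omega X. last_visit L t \<omega> / t \<ge> 1 - \<epsilon> t})
         \<in> \<Theta>[at_top](\<lambda>t. (ell (\<epsilon> t * t) / ell t) * \<epsilon> t powr \<alpha>h))"
      by blast
  qed
qed

end
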